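(* Let $u_0\in H^3_m(S^1)$, $v_0\in H^2_m(S^1)$, $T,\mu,\gamma>0$ and $\phi$, $W$ as in the context be given. Let $(u,v)$ be the strong solution of the local model \[ u_t-v_x=0,\qquad v_t-W'(u)_x=\mu v_{xx}-\gamma u_{xxx}\quad\text{in }(0,T)\times S^1,\] and, for each $\varepsilon>0$, let $(u^\varepsilon,v^\varepsilon)$ be the strong solution of the non-local model \[ u^\varepsilon_t - v^\varepsilon_x=0,\qquad v^\varepsilon_t - W'(u^\varepsilon)_x = \mu v^\varepsilon_{xx} - L_\varepsilon[u^\varepsilon]_x\quad\text{in }(0,T)\times S^1,\] both with initial data $u(0,\cdot)=u^\varepsilon(0,\cdot)=u_0$, $v(0,\cdot)=v^\varepsilon(0,\cdot)=v_0$. Then, for $\varepsilon>0$ sufficiently small, \[\|u^\varepsilon-u\|^2_{L^\infty(0,T;L^2(S^1))}+\|v^\varepsilon-v\|^2_{L^\infty(0,T;L^2(S^1))}\le C\sqrt{\varepsilon},\] with a constant $C>0$ depending on $u_0,v_0,\mu,\gamma,T,\phi$ (but not on $\varepsilon$).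
   Context: $S^1$ is the flat unit circle (the unit interval with periodic boundary conditions). $H^k=W^{k,2}$; a subscript $m$ on a function space denotes the subspace of functions with vanishing mean over $S^1$. $W\in C^3(\mathbb{R},[0,\infty))$ and there exists $\bar W>0$ with $W''(u)>-\bar W$ for all $u$. The kernel $\phi\in C^\infty_0(\mathbb{R},[0,\infty))$ satisfies $\operatorname{supp}\phi\subset[-1,1]$, $\phi$ even, $\int\phi=1$, $\int\phi(x)x^2\,\mathrm{d}x=2\gamma$; $\phi_\varepsilon(x)=\varepsilon^{-1}\phi(x/\varepsilon)$; $(\phi_\varepsilon*w)(x)=\int_{S^1}\phi_\varepsilon(x-y)w(y)\,\mathrm{d}y$ where $x-y$ is understood periodically as $\operatorname{dist}(y,\{x,1+x,x-1\})$; $L_\varepsilon[w]=\varepsilon^{-2}(\phi_\varepsilon*w-w)$. The strong solution of the local model is the unique solution with $u\in C^0([0,T],H^3_m(S^1))\cap C^1((0,T),H^1_m(S^1))$, $v\in C^0([0,T],H^2_m(S^1))\cap C^1((0,T),L^2_m(S^1))$. The strong solution of the non-local model is the unique solution with $u^\varepsilon\in W^{1,\infty}(0,T;L^2_m(S^1))\cap H^1(0,T;H^1_m(S^1))$, $v^\varepsilon\in L^2(0,T;H^2_m(S^1))\cap L^\infty(0,T;H^1_m(S^1))\cap H^1(0,T;L^2_m(S^1))$. *)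

theory Defs
  imports "HOL-Analysis.Analysis"
begin

definition per1 :: "(real \<Rightarrow> real) \<Rightarrow> bool" where
  "per1 f \<longleftrightarrow> (\<forall>x. f (x + 1) = f x)"

definition L2S :: "(real \<Rightarrow> real) \<Rightarrow> bool" where
  "L2S f \<longleftrightarrow> f \<in> borel_measurable lborel \<and> per1 f \<and>
     set_integrable lborel {0..1} (\<lambda>x. (f x)\<^sup>2)"

definition nL2 :: "(real \<Rightarrow> real) \<Rightarrow> real" where
  "nL2 f = sqrt (set_lebesgue_integral lborel {0..1} (\<lambda>x. (f x)\<^sup>2))"

definition mean0 :: "(real \<Rightarrow> real) \<Rightarrow> bool" where
  "mean0 f \<longleftrightarrow> set_lebesgue_integral lborel {0..1} f = 0"

definition test_per :: "(real \<Rightarrow> real) \<Rightarrow> bool" where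
  "test_per \<psi> \<longleftrightarrow> (\<forall>x. \<psi> differentiable at x) \<and> continuous_on UNIV (deriv \<psi>) \<and> per1 \<psi>"

definition is_wderiv :: "(real \<Rightarrow> real) \<Rightarrow> (real \<Rightarrow> real) \<Rightarrow> bool" where
  "is_wderiv f g \<longleftrightarrow> L2S f \<and> L2S g \<and>
     (\<forall>\<psi>. test_per \<psi> \<longrightarrow>
        set_lebesgue_integral lborel {0..1} (\<lambda>x. f x * deriv \<psi> x)
        = - set_lebesgue_integral lborel {0..1} (\<lambda>x. g x * \<psi> x))"

text \<open>(A representative of) the weak derivative; unique up to null sets.\<close>
definition wd :: "(real \<Rightarrow> real) \<Rightarrow> (real \<Rightarrow> real)" where
  "wd f = (SOME g. is_wderiv f g)"

definition inHk :: "nat \<Rightarrow> (real \<Rightarrow> real) \<Rightarrow> bool" where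
  "inHk k f \<longleftrightarrow> L2S f \<and> (\<forall>j<k. is_wderiv ((wd ^^ j) f) ((wd ^^ Suc j) f))"

definition Hkm :: "nat \<Rightarrow> (real \<Rightarrow> real) \<Rightarrow> bool" where
  "Hkm k f \<longleftrightarrow> inHk k f \<and> mean0 f"

definition Hnorm :: "nat \<Rightarrow> (real \<Rightarrow> real) \<Rightarrow> real" where
  "Hnorm k f = sqrt (\<Sum>j\<le>k. (nL2 ((wd ^^ j) f))\<^sup>2)"

definition C0_Hkm :: "nat \<Rightarrow> real \<Rightarrow> (real \<Rightarrow> real \<Rightarrow> real) \<Rightarrow> bool" where
  "C0_Hkm k T u \<longleftrightarrow> (\<forall>t\<in>{0..T}. Hkm k (u t) \<and>
      ((\<lambda>s. Hnorm k (\<lambda>x. u s x - u t x)) \<longlongrightarrow> 0) (at t within {0..T}))"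

definition C1_Hkm :: "nat \<Rightarrow> real \<Rightarrow> (real \<Rightarrow> real \<Rightarrow> real) \<Rightarrow> (real \<Rightarrow> real \<Rightarrow> real) \<Rightarrow> bool" where
  "C1_Hkm k T u ut \<longleftrightarrow> (\<forall>t\<in>{0<..<T}. Hkm k (u t) \<and> Hkm k (ut t) \<and>
      ((\<lambda>s. Hnorm k (\<lambda>x. (u s x - u t x) / (s - t) - ut t x)) \<longlongrightarrow> 0) (at t) \<and>
      ((\<lambda>s. Hnorm k (\<lambda>x. ut s x - ut t x)) \<longlongrightarrow> 0) (at t))"

text \<open>Functions of (t,x) are identified with maps (0,T) -> functions on S^1.
  L^2(0,T;L^2(S^1)) = L^2((0,T) x S^1).\<close>
definition L2Q :: "real \<Rightarrow> (real \<Rightarrow> real \<Rightarrow> real) \<Rightarrow> bool" where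
  "L2Q T f \<longleftrightarrow> (\<lambda>(t, x). f t x) \<in> borel_measurable lborel \<and> (\<forall>t. per1 (f t)) \<and>
     set_integrable lborel ({0<..<T} \<times> {0..1}) (\<lambda>(t, x). (f t x)\<^sup>2)"

definition LinfL2 :: "real \<Rightarrow> (real \<Rightarrow> real \<Rightarrow> real) \<Rightarrow> bool" where
  "LinfL2 T f \<longleftrightarrow> (\<exists>M. AE t in lborel. t \<in> {0<..<T} \<longrightarrow>
      set_integrable lborel {0..1} (\<lambda>x. (f t x)\<^sup>2) \<and>
      set_lebesgue_integral lborel {0..1} (\<lambda>x. (f t x)\<^sup>2) \<le> M)"

definition st_test :: "real \<Rightarrow> (real \<times> real \<Rightarrow> real) \<Rightarrow> (real \<times> real \<Rightarrow> real) \<Rightarrow> (real \<times> real \<Rightarrow> real) \<Rightarrow> bool" where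
  "st_test T \<psi> pt px \<longleftrightarrow>
     (\<forall>p. (\<psi> has_derivative (\<lambda>h. pt p * fst h + px p * snd h)) (at p)) \<and>
     continuous_on UNIV pt \<and> continuous_on UNIV px \<and>
     (\<exists>a b. 0 < a \<and> a \<le> b \<and> b < T \<and> (\<forall>t x. t \<notin> {a..b} \<longrightarrow> \<psi> (t, x) = 0)) \<and>
     (\<forall>t x. \<psi> (t, x + 1) = \<psi> (t, x))"

definition dtw :: "real \<Rightarrow> (real \<Rightarrow> real \<Rightarrow> real) \<Rightarrow> (real \<Rightarrow> real \<Rightarrow> real) \<Rightarrow> bool" where
  "dtw T f g \<longleftrightarrow> (\<forall>\<psi> pt px. st_test T \<psi> pt px \<longrightarrow>
      set_lebesgue_integral lborel ({0<..<T} \<times> {0..1}) (\<lambda>(t, x). f t x * pt (t, x))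
      = - set_lebesgue_integral lborel ({0<..<T} \<times> {0..1}) (\<lambda>(t, x). g t x * \<psi> (t, x)))"

definition dxw :: "real \<Rightarrow> (real \<Rightarrow> real \<Rightarrow> real) \<Rightarrow> (real \<Rightarrow> real \<Rightarrow> real) \<Rightarrow> bool" where
  "dxw T f g \<longleftrightarrow> (\<forall>\<psi> pt px. st_test T \<psi> pt px \<longrightarrow>
      set_lebesgue_integral lborel ({0<..<T} \<times> {0..1}) (\<lambda>(t, x). f t x * px (t, x))
      = - set_lebesgue_integral lborel ({0<..<T} \<times> {0..1}) (\<lambda>(t, x). g t x * \<psi> (t, x)))"

definition phi_eps :: "(real \<Rightarrow> real) \<Rightarrow> real \<Rightarrow> real \<Rightarrow> real" where
  "phi_eps \<phi> \<epsilon> x = \<phi> (x / \<epsilon>) / \<epsilon>"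

text \<open>Periodic distance dist(y,{x,1+x,x-1}) for x in [0,1).\<close>
definition pdist :: "real \<Rightarrow> real \<Rightarrow> real" where
  "pdist x y = min \<bar>x - y\<bar> (min \<bar>1 + x - y\<bar> \<bar>x - 1 - y\<bar>)"

definition conv_eps :: "(real \<Rightarrow> real) \<Rightarrow> real \<Rightarrow> (real \<Rightarrow> real) \<Rightarrow> real \<Rightarrow> real" where
  "conv_eps \<phi> \<epsilon> w x = set_lebesgue_integral lborel {0..1} (\<lambda>y. phi_eps \<phi> \<epsilon> (pdist (frac x) y) * w y)"

definition Leps :: "(real \<Rightarrow> real) \<Rightarrow> real \<Rightarrow> (real \<Rightarrow> real) \<Rightarrow> real \<Rightarrow> real" where
  "Leps \<phi> \<epsilon> w x = (conv_eps \<phi> \<epsilon> w x - w x) / \<epsilon>\<^sup>2"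

definition smooth_fun :: "(real \<Rightarrow> real) \<Rightarrow> bool" where
  "smooth_fun f \<longleftrightarrow> (\<forall>n x. (deriv ^^ n) f differentiable at x)"

definition kernel_ok :: "(real \<Rightarrow> real) \<Rightarrow> real \<Rightarrow> bool" where
  "kernel_ok \<phi> \<gamma> \<longleftrightarrow> smooth_fun \<phi> \<and> (\<forall>x. 0 \<le> \<phi> x) \<and> (\<forall>x. \<bar>x\<bar> > 1 \<longrightarrow> \<phi> x = 0) \<and>
     (\<forall>x. \<phi> (- x) = \<phi> x) \<and> integral\<^sup>L lborel \<phi> = 1 \<and>
     integral\<^sup>L lborel (\<lambda>x. \<phi> x * x\<^sup>2) = 2 * \<gamma>"

definition potential_ok :: "(real \<Rightarrow> real) \<Rightarrow> bool" where
  "potential_ok W \<longleftrightarrow> (\<forall>j<3. \<forall>x. (deriv ^^ j) W differentiable at x) \<and>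
     continuous_on UNIV ((deriv ^^ 3) W) \<and> (\<forall>x. 0 \<le> W x) \<and>
     (\<exists>Wb>0. \<forall>x. (deriv ^^ 2) W x > - Wb)"

definition local_sol :: "(real \<Rightarrow> real) \<Rightarrow> real \<Rightarrow> real \<Rightarrow> real \<Rightarrow> (real \<Rightarrow> real) \<Rightarrow> (real \<Rightarrow> real)
     \<Rightarrow> (real \<Rightarrow> real \<Rightarrow> real) \<Rightarrow> (real \<Rightarrow> real \<Rightarrow> real) \<Rightarrow> bool" where
  "local_sol W \<mu> \<gamma> T u0 v0 u v \<longleftrightarrow>
     (\<exists>ut vt. C0_Hkm 3 T u \<and> C1_Hkm 1 T u ut \<and> C0_Hkm 2 T v \<and> C1_Hkm 0 T v vt \<and>
       (\<forall>t\<in>{0<..<T}. AE x in lborel.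
           ut t x = wd (v t) x \<and>
           vt t x = wd (\<lambda>y. deriv W (u t y)) x + \<mu> * (wd ^^ 2) (v t) x - \<gamma> * (wd ^^ 3) (u t) x) \<and>
       (AE x in lborel. u 0 x = u0 x) \<and> (AE x in lborel. v 0 x = v0 x))"

text \<open>Strong solution of the non-local model
  u_t - v_x = 0, v_t - W'(u)_x = mu v_xx - L_eps[u]_x, in the class
  u \<in> W^{1,\<infinity>}(0,T;L^2_m) \<inter> H^1(0,T;H^1_m),
  v \<in> L^2(0,T;H^2_m) \<inter> L^\<infinity>(0,T;H^1_m) \<inter> H^1(0,T;L^2_m).
  Initial data are attained in L^2 (the solution is continuous in time with values in L^2).\<close>
definition nonlocal_sol :: "(real \<Rightarrow> real) \<Rightarrow> (real \<Rightarrow> real) \<Rightarrow> real \<Rightarrow> real \<Rightarrow> real \<Rightarrow> (real \<Rightarrow> real) \<Rightarrow> (real \<Rightarrow> real)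
     \<Rightarrow> (real \<Rightarrow> real \<Rightarrow> real) \<Rightarrow> (real \<Rightarrow> real \<Rightarrow> real) \<Rightarrow> bool" where
  "nonlocal_sol W \<phi> \<mu> \<epsilon> T u0 v0 u v \<longleftrightarrow>
     (\<exists>ut ux uxt vt vx vxx.
       L2Q T u \<and> L2Q T ut \<and> L2Q T ux \<and> L2Q T uxt \<and>
       dtw T u ut \<and> dxw T u ux \<and> dtw T ux uxt \<and>
       LinfL2 T u \<and> LinfL2 T ut \<and>
       L2Q T v \<and> L2Q T vx \<and> L2Q T vxx \<and> L2Q T vt \<and>
       dxw T v vx \<and> dxw T vx vxx \<and> dtw T v vt \<and>
       LinfL2 T v \<and> LinfL2 T vx \<and>
       (AE t in lborel. t \<in> {0<..<T} \<longrightarrow> mean0 (u t) \<and> mean0 (v t)) \<and>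
       (AE t in lborel. t \<in> {0<..<T} \<longrightarrow> (AE x in lborel.
           ut t x = vx t x \<and>
           vt t x = wd (\<lambda>y. deriv W (u t y)) x + \<mu> * vxx t x - wd (Leps \<phi> \<epsilon> (u t)) x)) \<and>
       (\<forall>e>0. \<exists>\<delta>>0. AE t in lborel. t \<in> {0<..<\<delta>} \<longrightarrow>
           nL2 (\<lambda>x. u t x - u0 x) < e \<and> nL2 (\<lambda>x. v t x - v0 x) < e))"

definition esssupT :: "real \<Rightarrow> (real \<Rightarrow> real) \<Rightarrow> ereal" where
  "esssupT T g = Inf {M :: ereal. AE t in lborel. t \<in> {0<..<T} \<longrightarrow> ereal (g t) \<le> M}"

end

theory Submission imports Defs begin

text \<open>The differences \<open>p = u\<^sup>\<epsilon> - u\<close> and \<open>q = v\<^sup>\<epsilon> - v\<close> vanish at time \<open>0\<close> and satisfy \<open>p\<^sub>t = q\<^sub>x\<close> and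
  \<open>q\<^sub>t = (W'(u\<^sup>\<epsilon>) - W'(u) + \<mu> p\<^sub>t - L\<^sub>\<epsilon>[p] - R)\<^sub>x\<close> with \<open>R = L\<^sub>\<epsilon>[u] - \<gamma> u\<^sub>x\<^sub>x\<close>. As \<open>u\<close> is bounded in
  \<open>H\<^sup>3\<close> uniformly in time, \<open>R = O(\<epsilon>)\<close> in \<open>L\<^sup>2\<close>. Testing with \<open>p\<close> and \<open>q\<close>, the nonlocal term is the time
  derivative of a nonnegative energy, and Gronwall's inequality gives \<open>p, q = O(\<epsilon>)\<close> in \<open>L\<^sup>2\<close> as long as
  \<open>\<bar>p\<bar> \<le> 1\<close>, where \<open>W'\<close> is Lipschitz continuous with a constant independent of \<open>\<epsilon>\<close>.
  The condition \<open>\<bar>p\<bar> \<le> 1\<close> is maintained by a continuation argument: integrating the second equation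
  in \<open>x\<close> shows that \<open>p\<close> minus the spatial primitive of \<open>q / \<mu>\<close> solves, for almost every \<open>x\<close>, the
  damped equation \<open>y' = - y / (\<mu> \<epsilon>\<^sup>2) + \<dots>\<close>, so that \<open>L\<^sup>2\<close> errors of order \<open>\<epsilon>\<close> force
  \<open>\<bar>p\<bar> = O(\<epsilon>\<^sup>1\<^sup>/\<^sup>2)\<close>.\<close>

section \<open>Square-integrable functions and primitives\<close>

text \<open>What shapes the proof is that \<open>W'\<close> is only locally Lipschitz, while the
  energy estimate controls \<open>p\<close> in \<open>L^2\<close> alone. The damping that rescues it
  comes from viscosity: \<open>p_t = q_x\<close> makes \<open>\<mu> v_xx\<close> contribute
  \<open>\<mu> p_t\<close> to the flux, and \<open>- L_\<epsilon>[p]\<close> contains the local part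
  \<open>p / \<epsilon>^2\<close>. The rest of the nonlocal term is a convolution, whose sup norm is
  at most \<open>sqrt (Km / \<epsilon>)\<close> times the \<open>L^2\<close> norm of
  \<open>p\<close>; this is where half a power of \<epsilon> is lost. The energy estimate itself
  must lose nothing: the nonlocal energy carries the factor \<open>\<epsilon>^-2\<close>, but it
  starts from \<open>0\<close>, so its sign suffices. A continuation step may have a length
  depending on \<epsilon>, since each step closes with the same constants and finitely many reach
  \<open>T\<close>. Solutions are known only weakly and almost everywhere, so weak derivatives are
  converted into primitives (\<open>cum\<close>), and product and chain rules are proved for
  primitives. The squared error comes out of order \<open>\<epsilon>^2\<close>, with a constant
  built from \<open>M\<close>, \<Lambda>, \<mu> and \<open>T\<close>, where \<open>M\<close> bounds
  the local solution.\<close>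

definition lbon :: "'a::euclidean_space set \<Rightarrow> 'a measure" where
  "lbon A = density lborel (\<lambda>x. ennreal (indicator A x))"

lemma sets_lbon [simp, measurable_cong]: "sets (lbon A) = sets borel"
  by (simp add: lbon_def)

lemma space_lbon [simp]: "space (lbon A) = UNIV"
  by (simp add: lbon_def)

lemma AE_lbon:
  assumes [measurable]: "A \<in> sets borel"
  shows "(AE x in lbon A. P x) \<longleftrightarrow> (AE x in lborel. x \<in> A \<longrightarrow> P x)"
  unfolding lbon_def by (subst AE_density) (auto simp: indicator_def)

lemma integrable_lbon:
  fixes f :: "_ \<Rightarrow> real"
  assumes [measurable]: "A \<in> sets borel" "f \<in> borel_measurable borel"
  shows "integrable (lbon A) f \<longleftrightarrow> set_integrable lborel A f"
  unfolding lbon_def set_integrable_def by (subst integrable_density) auto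

lemma integral_lbon:
  fixes f :: "_ \<Rightarrow> real"
  assumes [measurable]: "A \<in> sets borel" "f \<in> borel_measurable borel"
  shows "integral\<^sup>L (lbon A) f = set_lebesgue_integral lborel A f"
  unfolding lbon_def set_lebesgue_integral_def by (subst integral_density) auto

lemma emeasure_lbon:
  assumes [measurable]: "A \<in> sets borel" "B \<in> sets borel"
  shows "emeasure (lbon A) B = emeasure lborel (A \<inter> B)"
proof -
  have "emeasure (lbon A) B = (\<integral>\<^sup>+x. indicator (A \<inter> B) x \<partial>lborel)"
    unfolding lbon_def by (subst emeasure_density) (auto intro!: nn_integral_cong simp: indicator_def simp del: nn_integral_indicator)
  then show ?thesis by simp
qed

lemma measure_lbon:
  assumes [measurable]: "A \<in> sets borel" "B \<in> sets borel"
  shows "measure (lbon A) B = measure lborel (A \<inter> B)"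
  by (simp add: measure_def emeasure_lbon)

lemma sigma_finite_lbon [simp]:
  assumes [measurable]: "A \<in> sets borel"
  shows "sigma_finite_measure (lbon A)"
  unfolding lbon_def by (subst sigma_finite_measure.sigma_finite_iff_density_finite[OF lborel.sigma_finite_measure_axioms]) auto

lemma finite_measure_lbon:
  assumes "A \<in> sets borel" "bounded A"
  shows "finite_measure (lbon A)"
proof
  show "emeasure (lbon A) (space (lbon A)) \<noteq> \<infinity>"
    using emeasure_bounded_finite[OF assms(2)] assms(1) by (simp add: emeasure_lbon)
qed

text \<open>This is the point of encoding restriction as a density of \<open>lborel\<close>: every
  \<open>lbon A\<close> keeps the Borel sigma-algebra and the full space, so measurability never
  refers to \<open>A\<close> and products of restrictions are restrictions again.\<close>

lemma pair_lbon:
  assumes [measurable]: "A \<in> sets borel" "B \<in> sets borel"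
  shows "lbon A \<Otimes>\<^sub>M lbon B = lbon (A \<times> B)"
proof -
  have "lbon A \<Otimes>\<^sub>M lbon B = density (lborel \<Otimes>\<^sub>M lborel) (\<lambda>(x,y). ennreal (indicator A x) * ennreal (indicator B y))"
    unfolding lbon_def
    by (rule pair_measure_density) (use sigma_finite_lbon[of B] in \<open>auto simp: lbon_def lborel.sigma_finite_measure_axioms\<close>)
  also have "(\<lambda>(x,y). ennreal (indicator A x) * ennreal (indicator B y)) = (\<lambda>p. ennreal (indicator (A \<times> B) p))"
    by (auto simp: indicator_def fun_eq_iff)
  finally show ?thesis by (simp add: lbon_def lborel_prod)
qed

text \<open>The measure is arbitrary because the notion is used on the circle, on the time interval,
  on their product, and with the kernel measure as a further factor.\<close>

definition sqi :: "'a measure \<Rightarrow> ('a \<Rightarrow> real) \<Rightarrow> bool" where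
  "sqi M f \<longleftrightarrow> f \<in> borel_measurable M \<and> integrable M (\<lambda>x. (f x)\<^sup>2)"

lemma sqi_measurable: "sqi M f \<Longrightarrow> f \<in> borel_measurable M"
  by (simp add: sqi_def)

lemma sqi_square: "sqi M f \<Longrightarrow> integrable M (\<lambda>x. (f x)\<^sup>2)"
  by (simp add: sqi_def)

lemma sqi_mult:
  assumes "sqi M f" "sqi M g"
  shows "integrable M (\<lambda>x. f x * g x)"
proof (rule Bochner_Integration.integrable_bound)
  show "integrable M (\<lambda>x. (f x)\<^sup>2 + (g x)\<^sup>2)" using assms by (auto simp: sqi_def)
  show "(\<lambda>x. f x * g x) \<in> borel_measurable M" using assms by (auto simp: sqi_def)
  have "\<bar>a * b\<bar> \<le> a\<^sup>2 + b\<^sup>2" for a b :: real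
  proof -
    have "2 * (\<bar>a\<bar> * \<bar>b\<bar>) \<le> a\<^sup>2 + b\<^sup>2"
      using sum_squares_bound[of "\<bar>a\<bar>" "\<bar>b\<bar>"] by (simp add: mult.assoc)
    moreover have "0 \<le> \<bar>a\<bar> * \<bar>b\<bar>" by simp
    ultimately show ?thesis unfolding abs_mult by linarith
  qed
  then show "AE x in M. norm (f x * g x) \<le> norm ((f x)\<^sup>2 + (g x)\<^sup>2)"
    by (auto simp: abs_le_iff intro: order_trans)
qed

lemma sqi_bound:
  assumes "sqi M f" "g \<in> borel_measurable M" "AE x in M. \<bar>g x\<bar> \<le> \<bar>f x\<bar>"
  shows "sqi M g"
  unfolding sqi_def
proof
  show "integrable M (\<lambda>x. (g x)\<^sup>2)"
  proof (rule Bochner_Integration.integrable_bound)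
    show "integrable M (\<lambda>x. (f x)\<^sup>2)" using assms by (simp add: sqi_def)
    show "(\<lambda>x. (g x)\<^sup>2) \<in> borel_measurable M" using assms(2) by measurable
    show "AE x in M. norm ((g x)\<^sup>2) \<le> norm ((f x)\<^sup>2)"
      using assms(3) by eventually_elim (simp add: abs_le_square_iff)
  qed
qed fact

lemma sqi_add:
  assumes "sqi M f" "sqi M g"
  shows "sqi M (\<lambda>x. f x + g x)"
  using assms sqi_mult[OF assms] by (auto simp: sqi_def power2_sum mult.assoc)

lemma sqi_cmult: "sqi M f \<Longrightarrow> sqi M (\<lambda>x. c * f x)"
  by (auto simp: sqi_def power_mult_distrib)

lemma sqi_diff:
  assumes "sqi M f" "sqi M g"
  shows "sqi M (\<lambda>x. f x - g x)"
  using sqi_add[OF assms(1) sqi_cmult[OF assms(2), of "-1"]] by simp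

lemma sqi_const: "finite_measure M \<Longrightarrow> sqi M (\<lambda>x. c)"
  by (auto simp: sqi_def finite_measure.integrable_const)

lemma sqi_imp_integrable:
  assumes "finite_measure M" "sqi M f"
  shows "integrable M f"
  using sqi_mult[OF assms(2) sqi_const[OF assms(1), of 1]] by simp

lemma sqi_bounded:
  assumes "finite_measure M" "f \<in> borel_measurable M" "AE x in M. \<bar>f x\<bar> \<le> B"
  shows "sqi M f"
  by (rule sqi_bound[OF sqi_const[OF assms(1), of B] assms(2)]) (use assms(3) in eventually_elim, auto)

lemma sqi_mult_bounded:
  assumes "sqi M f" "b \<in> borel_measurable M" "AE x in M. \<bar>b x\<bar> \<le> B"
  shows "sqi M (\<lambda>x. b x * f x)"
proof (rule sqi_bound[OF sqi_cmult[OF assms(1), of B]])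
  show "(\<lambda>x. b x * f x) \<in> borel_measurable M" using assms by (auto simp: sqi_def)
  show "AE x in M. \<bar>b x * f x\<bar> \<le> \<bar>B * f x\<bar>"
    using assms(3) by eventually_elim (auto simp: abs_mult intro!: mult_right_mono)
qed

lemma sqi_cong_AE:
  assumes "sqi M f" "g \<in> borel_measurable M" "AE x in M. f x = g x"
  shows "sqi M g"
  by (rule sqi_bound[OF assms(1,2)]) (use assms(3) in eventually_elim, auto)

text \<open>The integral of \<open>(s f - r g)^2\<close> is a nonnegative quadratic form in
  \<open>(s, r)\<close>; the inequality is its discriminant condition.\<close>

lemma sqi_Cauchy_Schwarz:
  assumes "sqi M f" "sqi M g"
  shows "(\<integral>x. f x * g x \<partial>M)\<^sup>2 \<le> (\<integral>x. (f x)\<^sup>2 \<partial>M) * (\<integral>x. (g x)\<^sup>2 \<partial>M)"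
proof -
  let ?a = "\<integral>x. (f x)\<^sup>2 \<partial>M" and ?b = "\<integral>x. f x * g x \<partial>M" and ?c = "\<integral>x. (g x)\<^sup>2 \<partial>M"
  have fg: "integrable M (\<lambda>x. f x * g x)" by (rule sqi_mult[OF assms])
  have f2: "integrable M (\<lambda>x. (f x)\<^sup>2)" and g2: "integrable M (\<lambda>x. (g x)\<^sup>2)"
    using assms by (auto simp: sqi_def)
  have q: "0 \<le> s\<^sup>2 * ?a - 2 * s * r * ?b + r\<^sup>2 * ?c" for s r :: real
  proof -
    have "0 \<le> (\<integral>x. (s * f x - r * g x)\<^sup>2 \<partial>M)" by (rule integral_nonneg_AE) auto
    also have "(\<lambda>x. (s * f x - r * g x)\<^sup>2) = (\<lambda>x. s\<^sup>2 * (f x)\<^sup>2 - 2 * s * r * (f x * g x) + r\<^sup>2 * (g x)\<^sup>2)"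
      by (auto simp: power2_eq_square algebra_simps)
    also have "(\<integral>x. s\<^sup>2 * (f x)\<^sup>2 - 2 * s * r * (f x * g x) + r\<^sup>2 * (g x)\<^sup>2 \<partial>M) = s\<^sup>2 * ?a - 2 * s * r * ?b + r\<^sup>2 * ?c"
      using fg f2 g2 by simp
    finally show ?thesis .
  qed
  have c0: "?c \<ge> 0" by (rule integral_nonneg_AE) auto
  show ?thesis
  proof (cases "?c = 0")
    case True
    have "?b = 0"
    proof (rule ccontr)
      assume b: "?b \<noteq> 0"
      \<comment> \<open>With \<open>?c = 0\<close> and \<open>s = 1\<close> the form is affine in
        \<open>r\<close>; this \<open>r\<close> makes it \<open>- ?a - 2\<close>, which is
        negative.\<close>
      have "0 \<le> 1 * ?a - 2 * 1 * ((?a + 1) / ?b) * ?b" using q[of 1 "(?a + 1) / ?b"] True by simp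
      then have "0 \<le> ?a - 2 * (?a + 1)" using b by simp
      moreover have "?a \<ge> 0" by (rule integral_nonneg_AE) auto
      ultimately show False by simp
    qed
    then show ?thesis using True by simp
  next
    case False
    \<comment> \<open>The minimiser of the form up to scaling: \<open>s = ?c\<close>,
      \<open>r = ?b\<close>.\<close>
    have "0 \<le> ?c\<^sup>2 * ?a - 2 * ?c * ?b * ?b + ?b\<^sup>2 * ?c" by (rule q)
    also have "\<dots> = ?c * (?a * ?c - ?b\<^sup>2)" by (simp add: power2_eq_square algebra_simps)
    finally show ?thesis using False c0 by (simp add: zero_le_mult_iff)
  qed
qed

definition n2 :: "'a measure \<Rightarrow> ('a \<Rightarrow> real) \<Rightarrow> real" where
  "n2 M f = sqrt (\<integral>x. (f x)\<^sup>2 \<partial>M)"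

lemma n2_nonneg [simp]: "0 \<le> n2 M f"
  by (auto simp: n2_def intro!: integral_nonneg_AE)

lemma n2_sq: "(n2 M f)\<^sup>2 = (\<integral>x. (f x)\<^sup>2 \<partial>M)"
  by (auto simp: n2_def intro!: integral_nonneg_AE real_sqrt_pow2)

lemma n2_Cauchy_Schwarz:
  assumes "sqi M f" "sqi M g"
  shows "\<bar>\<integral>x. f x * g x \<partial>M\<bar> \<le> n2 M f * n2 M g"
proof (rule power2_le_imp_le)
  show "\<bar>\<integral>x. f x * g x \<partial>M\<bar>\<^sup>2 \<le> (n2 M f * n2 M g)\<^sup>2"
    using sqi_Cauchy_Schwarz[OF assms] by (simp add: power_mult_distrib n2_sq)
qed simp

lemma n2_cong_AE:
  assumes "f \<in> borel_measurable M" "g \<in> borel_measurable M" "AE x in M. f x = g x"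
  shows "n2 M f = n2 M g"
  unfolding n2_def by (rule arg_cong[where f = sqrt], rule integral_cong_AE) (use assms in auto)

lemma n2_add:
  assumes "sqi M f" "sqi M g"
  shows "n2 M (\<lambda>x. f x + g x) \<le> n2 M f + n2 M g"
proof (rule power2_le_imp_le)
  have "(n2 M (\<lambda>x. f x + g x))\<^sup>2 = (n2 M f)\<^sup>2 + (n2 M g)\<^sup>2 + 2 * (\<integral>x. f x * g x \<partial>M)"
    using assms sqi_mult[OF assms] by (simp add: n2_sq power2_sum mult.assoc sqi_def)
  also have "\<dots> \<le> (n2 M f)\<^sup>2 + (n2 M g)\<^sup>2 + 2 * (n2 M f * n2 M g)"
    using n2_Cauchy_Schwarz[OF assms] by simp
  finally show "(n2 M (\<lambda>x. f x + g x))\<^sup>2 \<le> (n2 M f + n2 M g)\<^sup>2" by (simp add: power2_sum)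
qed simp

lemma n2_cmult: "n2 M (\<lambda>x. c * f x) = \<bar>c\<bar> * n2 M f"
  by (simp add: n2_def power_mult_distrib real_sqrt_mult)

lemma n2_diff:
  assumes "sqi M f" "sqi M g"
  shows "\<bar>n2 M f - n2 M g\<bar> \<le> n2 M (\<lambda>x. f x - g x)"
  using n2_add[OF sqi_diff[OF assms] assms(2)] n2_add[OF sqi_diff[OF assms(2,1)] assms(1)]
    n2_cmult[of M "-1" "\<lambda>x. f x - g x"] by simp

text \<open>The primitive of \<open>f\<close>, with the lower limit hidden in \<open>A\<close>. For
  \<open>A\<close> equal to \<open>{0..1}\<close> or \<open>{0<..<T}\<close> it vanishes at
  \<open>0\<close> and is constant beyond the right end. It stands in for absolutely continuous
  functions throughout.\<close>

definition cum :: "real set \<Rightarrow> (real \<Rightarrow> real) \<Rightarrow> real \<Rightarrow> real" where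
  "cum A f t = (\<integral>s. indicator {..t} s * f s \<partial>lbon A)"

lemma integrable_product_fun:
  fixes f g :: "_ \<Rightarrow> real"
  assumes "pair_sigma_finite M N" "integrable M f" "integrable N g"
  shows "integrable (M \<Otimes>\<^sub>M N) (\<lambda>(s, r). f s * g r)"
proof -
  interpret pair_sigma_finite M N by fact
  note [measurable] = borel_measurable_integrable[OF assms(2)] borel_measurable_integrable[OF assms(3)]
  show ?thesis
    by (rule Fubini_integrable) (use assms in \<open>auto simp: abs_mult split_beta'\<close>)
qed

lemma integrable_ind_mult:
  fixes f :: "_ \<Rightarrow> real"
  assumes "integrable M f" "A \<in> sets M"
  shows "integrable M (\<lambda>x. indicator A x * f x)"
  using integrable_mult_indicator[OF assms(2,1)] by simp

lemma cum_measurable2: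
  assumes [measurable]: "A \<in> sets borel"
    "case_prod f \<in> borel_measurable (borel \<Otimes>\<^sub>M N)"
  shows "(\<lambda>(t, x). cum A (\<lambda>s. f s x) t) \<in> borel_measurable (borel \<Otimes>\<^sub>M N)"
proof -
  interpret sigma_finite_measure "lbon A" by simp
  have [measurable]: "Measurable.pred ((borel \<Otimes>\<^sub>M N) \<Otimes>\<^sub>M lbon A) (\<lambda>y. snd y \<le> fst (fst y))"
    by measurable
  have "(\<lambda>p. \<integral>s. indicator {(p, s). s \<le> fst p} (p, s) * f s (snd p) \<partial>lbon A) \<in> borel_measurable (borel \<Otimes>\<^sub>M N)"
    by measurable
  then show ?thesis by (simp add: cum_def split_beta' indicator_def)
qed

lemma cum_measurable [measurable]:
  assumes [measurable]: "A \<in> sets borel" "f \<in> borel_measurable borel"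
  shows "cum A f \<in> borel_measurable borel"
proof -
  interpret sigma_finite_measure "lbon A" by simp
  have "(\<lambda>t. \<integral>s. indicator {(t, s). s \<le> t} (t, s) * f s \<partial>lbon A) \<in> borel_measurable borel"
    by measurable
  then show ?thesis by (simp add: cum_def[abs_def] indicator_def)
qed

lemma abs_cum_le:
  assumes [measurable]: "A \<in> sets borel" and "integrable (lbon A) f"
  shows "\<bar>cum A f t\<bar> \<le> (\<integral>s. \<bar>f s\<bar> \<partial>lbon A)"
proof -
  have "\<bar>cum A f t\<bar> \<le> (\<integral>s. \<bar>indicator {..t} s * f s\<bar> \<partial>lbon A)"
    unfolding cum_def by (rule integral_abs_bound)
  also have "\<dots> \<le> (\<integral>s. \<bar>f s\<bar> \<partial>lbon A)"
  proof (rule integral_mono)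
    show "integrable (lbon A) (\<lambda>s. \<bar>indicator {..t} s * f s\<bar>)"
      by (rule integrable_abs, rule integrable_ind_mult) (use assms in auto)
  qed (use assms in \<open>auto simp: indicator_def\<close>)
  finally show ?thesis .
qed

lemma integrable_bounded_mult:
  fixes f :: "_ \<Rightarrow> real"
  assumes "integrable M f" "b \<in> borel_measurable M" "AE x in M. \<bar>b x\<bar> \<le> B"
  shows "integrable M (\<lambda>x. f x * b x)"
proof (rule Bochner_Integration.integrable_bound)
  show "integrable M (\<lambda>x. B * f x)" using assms by simp
  show "(\<lambda>x. f x * b x) \<in> borel_measurable M" using assms by measurable
  show "AE x in M. norm (f x * b x) \<le> norm (B * f x)"
    using assms(3) by eventually_elim (simp add: abs_mult, subst mult.commute, rule mult_right_mono, auto)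
qed

lemma integrable_mult_cum:
  assumes [measurable]: "A \<in> sets borel" and "integrable (lbon A) f" "integrable (lbon A) g"
  shows "integrable (lbon A) (\<lambda>s. f s * cum A g s)"
  by (rule integrable_bounded_mult[OF assms(2)]) 
    (use borel_measurable_integrable[OF assms(3)] abs_cum_le[OF assms(1,3)] in \<open>auto simp: lbon_def\<close>)

lemma AE_lbon_singleton: "A \<in> sets borel \<Longrightarrow> AE s in lbon A. s \<noteq> c"
  by (subst AE_lbon) (use AE_lborel_singleton[of c] in auto)

text \<open>Product rule for primitives, by Fubini: the square \<open>s, r \<le> t\<close> splits
  into the triangles \<open>r \<le> s\<close> and \<open>s < r\<close>, and the inner integral over
  each triangle is again a primitive.\<close>

lemma cum_product:
  assumes A [measurable]: "A \<in> sets borel" and f: "integrable (lbon A) f" and g: "integrable (lbon A) g"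
  shows "cum A f t * cum A g t = cum A (\<lambda>s. f s * cum A g s + g s * cum A f s) t"
proof -
  interpret S: sigma_finite_measure "lbon A" by simp
  interpret P: pair_sigma_finite "lbon A" "lbon A" ..
  note [measurable] = borel_measurable_integrable[OF f, simplified] borel_measurable_integrable[OF g, simplified]
  have fg: "integrable (lbon A \<Otimes>\<^sub>M lbon A) (\<lambda>(s, r). f s * g r)"
    by (rule integrable_product_fun[OF P.pair_sigma_finite_axioms f g])
  have fg_ind: "integrable (lbon A \<Otimes>\<^sub>M lbon A) (\<lambda>z. indicator {z. P (fst z) (snd z)} z * (case z of (s, r) \<Rightarrow> f s * g r))"
    if "Measurable.pred (borel \<Otimes>\<^sub>M borel) (\<lambda>z. P (fst z) (snd z))" for P
    by (rule integrable_ind_mult[OF fg]) (use that[unfolded pred_def space_pair_measure space_borel, simplified] sets_pair_measure_cong[of "lbon A" borel "lbon A" borel] in simp)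
  let ?a = "\<lambda>s r. (if s \<le> t \<and> r \<le> s then f s * g r else 0)"
  let ?b = "\<lambda>s r. (if r \<le> t \<and> s < r then f s * g r else 0)"
  have a: "integrable (lbon A \<Otimes>\<^sub>M lbon A) (case_prod ?a)"
    by (rule Bochner_Integration.integrable_cong[THEN iffD1, OF refl _ fg_ind[of "\<lambda>s r. s \<le> t \<and> r \<le> s"]])
       (auto simp: indicator_def)
  have b: "integrable (lbon A \<Otimes>\<^sub>M lbon A) (case_prod ?b)"
    by (rule Bochner_Integration.integrable_cong[THEN iffD1, OF refl _ fg_ind[of "\<lambda>s r. r \<le> t \<and> s < r"]])
       (auto simp: indicator_def)
  have "cum A f t * cum A g t = (\<integral>z. (case z of (s, r) \<Rightarrow> (indicator {..t} s * f s) * (indicator {..t} r * g r)) \<partial>(lbon A \<Otimes>\<^sub>M lbon A))"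
    unfolding cum_def
    by (subst P.integral_fst'[symmetric]) (auto intro!: integrable_product_fun P.pair_sigma_finite_axioms integrable_ind_mult f g)
  also have "\<dots> = (\<integral>z. case_prod ?a z + case_prod ?b z \<partial>(lbon A \<Otimes>\<^sub>M lbon A))"
    by (rule Bochner_Integration.integral_cong) (auto simp: indicator_def)
  also have "\<dots> = (\<integral>z. case_prod ?a z \<partial>(lbon A \<Otimes>\<^sub>M lbon A)) + (\<integral>z. case_prod ?b z \<partial>(lbon A \<Otimes>\<^sub>M lbon A))"
    by (rule Bochner_Integration.integral_add[OF a b])
  also have "(\<integral>z. case_prod ?a z \<partial>(lbon A \<Otimes>\<^sub>M lbon A)) = (\<integral>s. \<integral>r. ?a s r \<partial>lbon A \<partial>lbon A)"
    using P.integral_fst'[OF a] by simp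
  also have "\<dots> = cum A (\<lambda>s. f s * cum A g s) t"
    unfolding cum_def
    by (rule Bochner_Integration.integral_cong, simp, subst integral_mult_right_zero[symmetric],
        subst integral_mult_right_zero[symmetric], rule Bochner_Integration.integral_cong) (auto simp: indicator_def)
  also have "(\<integral>z. case_prod ?b z \<partial>(lbon A \<Otimes>\<^sub>M lbon A)) = (\<integral>r. \<integral>s. ?b s r \<partial>lbon A \<partial>lbon A)"
    using P.integral_snd[OF b] by simp
  \<comment> \<open>The strict inequality \<open>s < r\<close> in \<open>?b\<close> turns into
    \<open>s \<le> r\<close> at the cost of the single point \<open>s = r\<close>.\<close>
  also have "\<dots> = (\<integral>r. \<integral>s. indicator {..t} r * (g r * (indicator {..r} s * f s)) \<partial>lbon A \<partial>lbon A)"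
  proof (rule Bochner_Integration.integral_cong[OF refl], rule integral_cong_AE)
    fix r
    show "AE s in lbon A. ?b s r = indicator {..t} r * (g r * (indicator {..r} s * f s))"
      using AE_lbon_singleton[OF A, of r] by eventually_elim (auto simp: indicator_def)
  qed measurable
  also have "\<dots> = cum A (\<lambda>s. g s * cum A f s) t"
    by (simp add: cum_def)
  also have "cum A (\<lambda>s. f s * cum A g s) t + cum A (\<lambda>s. g s * cum A f s) t = cum A (\<lambda>s. f s * cum A g s + g s * cum A f s) t"
    unfolding cum_def[of A _ t]
    by (subst Bochner_Integration.integral_add[symmetric])
       (auto intro!: integrable_ind_mult integrable_mult_cum f g simp: distrib_left)
  finally show ?thesis .
qed

section \<open>Test functions and the fundamental lemma of the calculus of variations on the
  cylinder\<close>

definition time_test :: "real \<Rightarrow> (real \<Rightarrow> real) \<Rightarrow> (real \<Rightarrow> real) \<Rightarrow> bool" where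
  "time_test T \<theta> \<theta>' \<longleftrightarrow> (\<forall>t. (\<theta> has_real_derivative \<theta>' t) (at t)) \<and> continuous_on UNIV \<theta>' \<and>
     (\<exists>a b. 0 < a \<and> b < T \<and> (\<forall>t. t \<notin> {a..b} \<longrightarrow> \<theta> t = 0))"

definition per_test :: "(real \<Rightarrow> real) \<Rightarrow> (real \<Rightarrow> real) \<Rightarrow> bool" where
  "per_test \<eta> \<eta>' \<longleftrightarrow> (\<forall>x. (\<eta> has_real_derivative \<eta>' x) (at x)) \<and> continuous_on UNIV \<eta>' \<and> per1 \<eta>"

text \<open>A C^1 function that vanishes for \<open>s \<le> 0\<close> and tends to \<open>1\<close>
  at infinity. Hence \<open>cutoff (n y - 1)\<close> approximates the indicator of
  \<open>y > 0\<close>, and the shift by \<open>1\<close> makes it vanish already for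
  \<open>y \<le> 1 / n\<close>, which yields compact support.\<close>

definition cutoff :: "real \<Rightarrow> real" where
  "cutoff s = (max 0 s)\<^sup>2 / (1 + (max 0 s)\<^sup>2)"

lemma one_plus_sq_pos: "0 < 1 + (x::real)\<^sup>2"
  by (simp add: add_pos_nonneg)

lemma one_plus_sq_nz: "1 + (x::real)\<^sup>2 \<noteq> 0"
  using one_plus_sq_pos[of x] by simp

lemma cutoff_bounds: "0 \<le> cutoff s" "cutoff s \<le> 1"
  using one_plus_sq_pos[of "max 0 s"] by (simp_all add: cutoff_def)

lemma cutoff_nonpos: "s \<le> 0 \<Longrightarrow> cutoff s = 0"
  by (simp add: cutoff_def)

lemma DERIV_max_sq: "((\<lambda>s. (max 0 s)\<^sup>2) has_real_derivative 2 * max 0 s) (at (s::real))"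
proof -
  consider "s < 0" | "s = 0" | "s > 0" by linarith
  then show ?thesis
  proof cases
    case 1
    show ?thesis
      by (rule has_field_derivative_transform_within_open[of "\<lambda>_. 0" _ _ "{..<0}"]) (use 1 in auto)
  next
    case 3
    have "((\<lambda>s. s\<^sup>2) has_real_derivative 2 * max 0 s) (at s)"
      using 3 by (auto intro!: derivative_eq_intros)
    then show ?thesis
      by (rule has_field_derivative_transform_within_open[of _ _ _ "{0<..}"]) (use 3 in auto)
  next
    case 2
    have "((\<lambda>y. (max 0 y)\<^sup>2 / y) \<longlongrightarrow> 0) (at (0::real))"
    proof (rule Lim_null_comparison)
      show "eventually (\<lambda>y. norm ((max 0 y)\<^sup>2 / y) \<le> \<bar>y\<bar>) (at (0::real))"
        by (auto simp: max_def power2_eq_square intro!: always_eventually)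
      show "((\<lambda>y. \<bar>y\<bar>) \<longlongrightarrow> 0) (at (0::real))" by (rule tendsto_rabs_zero) (rule tendsto_ident_at)
    qed
    then show ?thesis unfolding has_field_derivative_iff using 2 by simp
  qed
qed

lemma DERIV_cutoff:
  "(cutoff has_real_derivative 2 * max 0 s / (1 + (max 0 s)\<^sup>2)\<^sup>2) (at s)"
proof -
  have nz: "1 + (max 0 s)\<^sup>2 \<noteq> 0" by (rule one_plus_sq_nz)
  have eq: "2 * max 0 s * (1 + (max 0 s)\<^sup>2) - (max 0 s)\<^sup>2 * (2 * max 0 s) = 2 * max 0 s"
    by (simp add: algebra_simps)
  show ?thesis
    unfolding cutoff_def[abs_def]
    by (rule derivative_eq_intros DERIV_max_sq refl nz)+ (use eq in \<open>simp add: power2_eq_square\<close>)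
qed

lemma continuous_cutoff_deriv: "continuous_on UNIV (\<lambda>s. 2 * max 0 s / (1 + (max 0 s)\<^sup>2)\<^sup>2 :: real)"
proof -
  have "(1 + (max 0 s)\<^sup>2)\<^sup>2 \<noteq> 0" for s :: real
    using one_plus_sq_nz[of "max 0 s"] by simp
  then show ?thesis by (auto intro!: continuous_intros)
qed

lemma cutoff_tendsto: "(\<lambda>n. cutoff (real n * y - 1)) \<longlonglongrightarrow> (if y > 0 then 1 else 0)"
proof (cases "y > 0")
  case False
  then have "cutoff (real n * y - 1) = 0" for n
    by (intro cutoff_nonpos) (smt (verit) mult_nonneg_nonpos of_nat_0_le_iff)
  then show ?thesis using False by simp
next
  case True
  have lim: "filterlim (\<lambda>n. real n * y - 1) at_top sequentially"
    using filterlim_tendsto_pos_mult_at_top[OF tendsto_const True filterlim_real_sequentially]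
    by (simp add: mult.commute filterlim_tendsto_add_at_top[OF tendsto_const, of _ _ "-1", simplified])
  have "((\<lambda>s. 1 - inverse (1 + (max 0 s)\<^sup>2)) \<longlongrightarrow> 1 - 0) (at_top :: real filter)"
  proof (intro tendsto_diff tendsto_const tendsto_inverse_0_at_top)
    show "filterlim (\<lambda>s::real. 1 + (max 0 s)\<^sup>2) at_top at_top"
    proof (rule filterlim_at_top_mono)
      show "filterlim (\<lambda>s::real. 2 * s) at_top at_top"
        by (rule filterlim_tendsto_pos_mult_at_top[OF tendsto_const]) (auto simp: filterlim_ident)
      have "2 * s \<le> 1 + (max 0 s)\<^sup>2" for s :: real
      proof -
        have "2 * max 0 s \<le> 1 + (max 0 s)\<^sup>2" using sum_squares_bound[of 1 "max 0 s"] by simp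
        moreover have "2 * s \<le> 2 * max 0 s" by simp
        ultimately show ?thesis by linarith
      qed
      then show "eventually (\<lambda>s::real. 2 * s \<le> 1 + (max 0 s)\<^sup>2) at_top" by simp
    qed
  qed
  moreover have "1 - inverse (1 + (max 0 s)\<^sup>2) = cutoff s" for s :: real
  proof -
    have "1 + (max 0 s)\<^sup>2 \<noteq> 0" by (rule one_plus_sq_nz)
    then show ?thesis by (simp add: cutoff_def field_simps)
  qed
  ultimately have "(cutoff \<longlongrightarrow> 1) at_top" by simp
  from filterlim_compose[OF this lim] show ?thesis using True by simp
qed

lemma continuous_deriv_comp:
  assumes "\<And>x. (f has_real_derivative f' x) (at x)"
  shows "continuous_on UNIV f"
  by (meson assms DERIV_continuous_on has_field_derivative_at_within)

lemma time_test_cutoff: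
  assumes "0 \<le> a" "a < b" "b \<le> T"
  shows "time_test T (\<lambda>t. cutoff (real n * ((t - a) * (b - t)) - 1))
    (\<lambda>t. 2 * max 0 (real n * ((t - a) * (b - t)) - 1) / (1 + (max 0 (real n * ((t - a) * (b - t)) - 1))\<^sup>2)\<^sup>2
         * (real n * ((b - t) - (t - a))))"
  unfolding time_test_def
proof (intro conjI allI)
  fix t
  have "((\<lambda>t. real n * ((t - a) * (b - t)) - 1) has_real_derivative real n * ((b - t) - (t - a))) (at t)"
    by (auto intro!: derivative_eq_intros)
  from DERIV_chain2[OF DERIV_cutoff this]
  show "((\<lambda>t. cutoff (real n * ((t - a) * (b - t)) - 1)) has_real_derivative
      2 * max 0 (real n * ((t - a) * (b - t)) - 1) / (1 + (max 0 (real n * ((t - a) * (b - t)) - 1))\<^sup>2)\<^sup>2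
         * (real n * ((b - t) - (t - a)))) (at t)" .
next
  show "continuous_on UNIV (\<lambda>t. 2 * max 0 (real n * ((t - a) * (b - t)) - 1) / (1 + (max 0 (real n * ((t - a) * (b - t)) - 1))\<^sup>2)\<^sup>2
         * (real n * ((b - t) - (t - a))))"
    by (intro continuous_on_mult[of _ "\<lambda>t. _ / _"] continuous_on_compose2[OF continuous_cutoff_deriv, of _ "\<lambda>t. real n * ((t - a) * (b - t)) - 1"] continuous_intros) auto
next
  \<comment> \<open>Within distance \<open>d\<close> of an end point, \<open>(t - a) (b - t)\<close>
    is at most \<open>d (b - a) = 1 / n\<close>, so the cutoff vanishes there.\<close>
  define d where "d = 1 / (real n * (b - a))"
  show "\<exists>a' b'. 0 < a' \<and> b' < T \<and> (\<forall>t. t \<notin> {a'..b'} \<longrightarrow> cutoff (real n * ((t - a) * (b - t)) - 1) = 0)"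
  proof (cases "n = 0")
    case True
    have "0 < b" "b - 1 < T" using assms by auto
    \<comment> \<open>For \<open>n = 0\<close> the function is zero, and the support interval is
      taken empty, from \<open>b\<close> to \<open>b - 1\<close>.\<close>
    then show ?thesis using True by (intro exI[of _ "b"] exI[of _ "b - 1"]) (auto simp: cutoff_nonpos)
  next
    case False
    then have n: "real n > 0" by simp
    have d: "d > 0" using n assms by (simp add: d_def)
    have nd: "real n * (d * (b - a)) = 1" using n assms by (simp add: d_def)
    have "cutoff (real n * ((t - a) * (b - t)) - 1) = 0" if t: "t \<notin> {a + d..b - d}" for t
    proof (rule cutoff_nonpos)
      have "(t - a) * (b - t) \<le> d * (b - a)"
      proof (cases "a < t \<and> t < b")
        case False
        then have "(t - a) * (b - t) \<le> 0" using assms by (auto simp: mult_le_0_iff)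
        also have "0 \<le> d * (b - a)" using d assms by simp
        finally show ?thesis .
      next
        case True
        from t have "t - a \<le> d \<or> b - t \<le> d" by auto
        then show ?thesis
        proof
          assume "t - a \<le> d" then show ?thesis using True d by (intro mult_mono) auto
        next
          assume "b - t \<le> d"
          then have "(b - t) * (t - a) \<le> d * (b - a)" using True d by (intro mult_mono) auto
          then show ?thesis by (simp add: mult.commute)
        qed
      qed
      then have "real n * ((t - a) * (b - t)) \<le> real n * (d * (b - a))" using n by (intro mult_left_mono) auto
      then show "real n * ((t - a) * (b - t)) - 1 \<le> 0" using nd by simp
    qed
    then show ?thesis using d assms by (intro exI[of _ "a + d"] exI[of _ "b - d"]) auto
  qed
qed

text \<open>The periodic substitute for \<open>(x - c) (d - x)\<close>: each sine changes sign under
  a unit shift, so their product has period one, and for \<open>0 \<le> c < d \<le> 1\<close> it is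
  positive in \<open>(0,1)\<close> exactly between \<open>c\<close> and \<open>d\<close>.\<close>

lemma per_test_cutoff:
  "per_test (\<lambda>x. cutoff (real n * (sin (pi * (x - c)) * sin (pi * (d - x))) - 1))
    (\<lambda>x. 2 * max 0 (real n * (sin (pi * (x - c)) * sin (pi * (d - x))) - 1) / (1 + (max 0 (real n * (sin (pi * (x - c)) * sin (pi * (d - x))) - 1))\<^sup>2)\<^sup>2
         * (real n * (pi * cos (pi * (x - c)) * sin (pi * (d - x)) - pi * sin (pi * (x - c)) * cos (pi * (d - x)))))"
  unfolding per_test_def
proof (intro conjI allI)
  fix x
  have "((\<lambda>x. real n * (sin (pi * (x - c)) * sin (pi * (d - x))) - 1) has_real_derivative 
     real n * (pi * cos (pi * (x - c)) * sin (pi * (d - x)) - pi * sin (pi * (x - c)) * cos (pi * (d - x)))) (at x)"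
    by (auto intro!: derivative_eq_intros)
  from DERIV_chain2[OF DERIV_cutoff this]
  show "((\<lambda>x. cutoff (real n * (sin (pi * (x - c)) * sin (pi * (d - x))) - 1)) has_real_derivative
      2 * max 0 (real n * (sin (pi * (x - c)) * sin (pi * (d - x))) - 1) / (1 + (max 0 (real n * (sin (pi * (x - c)) * sin (pi * (d - x))) - 1))\<^sup>2)\<^sup>2
         * (real n * (pi * cos (pi * (x - c)) * sin (pi * (d - x)) - pi * sin (pi * (x - c)) * cos (pi * (d - x))))) (at x)" .
next
  show "continuous_on UNIV (\<lambda>x. 2 * max 0 (real n * (sin (pi * (x - c)) * sin (pi * (d - x))) - 1) / (1 + (max 0 (real n * (sin (pi * (x - c)) * sin (pi * (d - x))) - 1))\<^sup>2)\<^sup>2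
         * (real n * (pi * cos (pi * (x - c)) * sin (pi * (d - x)) - pi * sin (pi * (x - c)) * cos (pi * (d - x)))))"
    by (intro continuous_on_mult[of _ "\<lambda>t. _ / _"] 
     continuous_on_compose2[OF continuous_cutoff_deriv, of _ "\<lambda>x. real n * (sin (pi * (x - c)) * sin (pi * (d - x))) - 1"] continuous_intros) auto
next
  have "sin (pi * (x + 1 - c)) = - sin (pi * (x - c))" for x
    using sin_periodic_pi[of "pi * (x - c)"] by (simp add: algebra_simps)
  moreover have "sin (pi * (d - (x + 1))) = - sin (pi * (d - x))" for x
    using sin_periodic_pi[of "pi * (d - (x + 1))"] by (simp add: algebra_simps)
  ultimately show "per1 (\<lambda>x. cutoff (real n * (sin (pi * (x - c)) * sin (pi * (d - x))) - 1))"
    by (simp add: per1_def)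
qed

lemma time_test_continuous: "time_test T \<theta> \<theta>' \<Longrightarrow> continuous_on UNIV \<theta>"
  unfolding time_test_def by (blast intro: continuous_deriv_comp)

lemma per_test_continuous: "per_test \<theta> \<theta>' \<Longrightarrow> continuous_on UNIV \<theta>"
  unfolding per_test_def by (blast intro: continuous_deriv_comp)

lemma continuous_bounded:
  assumes "continuous_on UNIV (f :: real \<Rightarrow> real)" "bounded A"
  obtains B where "\<And>x. x \<in> A \<Longrightarrow> \<bar>f x\<bar> \<le> B"
proof -
  have "compact (f ` closure A)"
    by (intro compact_continuous_image continuous_on_subset[OF assms(1)]) (use assms(2) in auto)
  then obtain B where "\<forall>y\<in>f ` closure A. norm y \<le> B" using compact_imp_bounded bounded_iff by blast
  then show ?thesis using that closure_subset by (metis imageI real_norm_def subsetD)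
qed

lemma cutoff_measurable [measurable]: "cutoff \<in> borel_measurable borel"
  unfolding cutoff_def[abs_def] by measurable

lemma measurable_fst_borel2 [measurable]: "fst \<in> borel_measurable (borel :: (real \<times> real) measure)"
  by (intro borel_measurable_continuous_onI continuous_intros)

lemma measurable_snd_borel2 [measurable]: "snd \<in> borel_measurable (borel :: (real \<times> real) measure)"
  by (intro borel_measurable_continuous_onI continuous_intros)

text \<open>Products of time and space cutoffs are admissible in \<open>orth\<close>. Off the null
  set where \<open>x\<close> is \<open>0\<close> or \<open>1\<close> they converge to the indicator
  of the rectangle, and \<open>\<bar>h\<bar>\<close> dominates.\<close>

lemma orth_rectangle:
  fixes h :: "real \<times> real \<Rightarrow> real"
  assumes T: "T > 0" and h: "integrable (lbon ({0<..<T} \<times> {0..1})) h"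
    and orth: "\<And>\<theta> \<theta>' \<eta> \<eta>'. time_test T \<theta> \<theta>' \<Longrightarrow> per_test \<eta> \<eta>' \<Longrightarrow>
       (\<integral>z. h z * (\<theta> (fst z) * \<eta> (snd z)) \<partial>lbon ({0<..<T} \<times> {0..1})) = 0"
    and ab: "0 \<le> a" "a < b" "b \<le> T" and cd: "0 \<le> c" "c < d" "d \<le> 1"
  shows "(\<integral>z. indicator ({a<..<b} \<times> {c<..<d}) z * h z \<partial>lbon ({0<..<T} \<times> {0..1})) = 0"
proof -
  let ?N = "lbon ({0<..<T} \<times> {0..1::real})"
  let ?y = "\<lambda>t. (t - a) * (b - t)" and ?x = "\<lambda>x. sin (pi * (x - c)) * sin (pi * (d - x))"
  note [measurable] = borel_measurable_integrable[OF h]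
  have [measurable]: "h \<in> borel_measurable (borel \<Otimes>\<^sub>M borel)"
    using borel_measurable_integrable[OF h] by (simp add: borel_prod)
  have lim: "(\<lambda>n. h z * (cutoff (real n * ?y (fst z) - 1) * cutoff (real n * ?x (snd z) - 1))) \<longlonglongrightarrow>
      h z * ((if ?y (fst z) > 0 then 1 else 0) * (if ?x (snd z) > 0 then 1 else 0))" for z
    by (intro tendsto_mult tendsto_const cutoff_tendsto)
  have "(\<lambda>n. \<integral>z. h z * (cutoff (real n * ?y (fst z) - 1) * cutoff (real n * ?x (snd z) - 1)) \<partial>?N) \<longlonglongrightarrow>
      (\<integral>z. h z * ((if ?y (fst z) > 0 then 1 else 0) * (if ?x (snd z) > 0 then 1 else 0)) \<partial>?N)"
  proof (rule integral_dominated_convergence)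
    show "integrable ?N (\<lambda>z. \<bar>h z\<bar>)" using h by simp
    show "AE z in ?N. (\<lambda>n. h z * (cutoff (real n * ?y (fst z) - 1) * cutoff (real n * ?x (snd z) - 1))) \<longlonglongrightarrow>
      h z * ((if ?y (fst z) > 0 then 1 else 0) * (if ?x (snd z) > 0 then 1 else 0))"
      using lim by simp
    show "AE z in ?N. norm (h z * (cutoff (real n * ?y (fst z) - 1) * cutoff (real n * ?x (snd z) - 1))) \<le> \<bar>h z\<bar>" for n
      by (auto simp: abs_mult cutoff_bounds intro!: mult_left_le mult_le_one)
  qed measurable
  moreover have "(\<integral>z. h z * (cutoff (real n * ?y (fst z) - 1) * cutoff (real n * ?x (snd z) - 1)) \<partial>?N) = 0" for n
    by (rule orth[OF time_test_cutoff[OF ab] per_test_cutoff])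
  ultimately have 0: "(\<integral>z. h z * ((if ?y (fst z) > 0 then 1 else 0) * (if ?x (snd z) > 0 then 1 else 0)) \<partial>?N) = 0"
    by (simp add: LIMSEQ_const_iff)
  have y: "?y t > 0 \<longleftrightarrow> t \<in> {a<..<b}" for t
    using ab by (auto simp: zero_less_mult_iff)
  have x: "?x x > 0 \<longleftrightarrow> x \<in> {c<..<d}" if "x \<in> {0<..<1}" for x
  proof -
    have 1: "sin (pi * s) > 0 \<longleftrightarrow> s > 0" "sin (pi * s) < 0 \<longleftrightarrow> s < 0" if "-1 < s" "s < 1" for s
    proof -
      have A: "s > 0 \<Longrightarrow> sin (pi * s) > 0" using that by (intro sin_gt_zero) auto
      have B: "sin (pi * s) < 0" if "s < 0"
      proof -
        have "sin (- (pi * s)) > 0"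
        proof (rule sin_gt_zero)
          have "pi * (- s) > 0" using that by (intro mult_pos_pos) auto
          then show "0 < - (pi * s)" by simp
          have "pi * (- s) < pi * 1" using \<open>-1 < s\<close> by (intro mult_strict_left_mono) auto
          then show "- (pi * s) < pi" by simp
        qed
        then show ?thesis by simp
      qed
      show "sin (pi * s) > 0 \<longleftrightarrow> s > 0" "sin (pi * s) < 0 \<longleftrightarrow> s < 0"
        using A B by (cases s "0::real" rule: linorder_cases; force)+
    qed
    show ?thesis using 1[of "x - c"] 1[of "d - x"] that cd by (auto simp: zero_less_mult_iff)
  qed
  have "AE z in ?N. snd z \<in> {0<..<1}"
  proof -
    have N: "?N = lbon {0<..<T} \<Otimes>\<^sub>M lbon {0..1::real}" by (simp add: pair_lbon)
    interpret pair_sigma_finite "lbon {0<..<T}" "lbon {0..1::real}"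
      by (simp add: pair_sigma_finite_def)
    show ?thesis unfolding N
    proof (rule AE_pair_measure)
      have "AE x in lbon {0..1::real}. x \<in> {0<..<1}"
        using AE_lborel_singleton[of "0::real"] AE_lborel_singleton[of "1::real"]
        by (subst AE_lbon) (auto elim!: eventually_elim2)
      then show "AE x in lbon {0<..<T}. AE y in lbon {0..1::real}. snd (x, y) \<in> {0<..<1}" by simp
    qed measurable
  qed
  then have eq: "AE z in ?N. indicator ({a<..<b} \<times> {c<..<d}) z * h z = h z * ((if ?y (fst z) > 0 then 1 else 0) * (if ?x (snd z) > 0 then 1 else 0))"
    by eventually_elim (auto simp: y x indicator_def)
  have "(\<integral>z. indicator ({a<..<b} \<times> {c<..<d}) z * h z \<partial>?N) = (\<integral>z. h z * ((if ?y (fst z) > 0 then 1 else 0) * (if ?x (snd z) > 0 then 1 else 0)) \<partial>?N)"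
  proof (rule integral_cong_AE[OF _ _ eq])
    show "(\<lambda>z. indicator ({a<..<b} \<times> {c<..<d}) z * h z) \<in> borel_measurable ?N"
      by (auto intro!: borel_measurable_times borel_measurable_indicator borel_Times simp: borel_measurable_integrable[OF h])
  qed measurable
  then show ?thesis using 0 by simp
qed

lemma cylinder_borel [simp, measurable]: "{0<..<T::real} \<times> {0..1::real} \<in> sets borel"
  by (rule borel_Times) auto

text \<open>Vanishing integrals over open boxes extend to all Borel sets by a pi-lambda argument,
  since boxes form an intersection-stable generator; a function with zero integral over every set
  vanishes almost everywhere.\<close>

lemma orth_2D:
  fixes h :: "real \<times> real \<Rightarrow> real"
  assumes T: "T > 0" and h: "integrable (lbon ({0<..<T} \<times> {0..1})) h"
    and orth: "\<And>\<theta> \<theta>' \<eta> \<eta>'. time_test T \<theta> \<theta>' \<Longrightarrow> per_test \<eta> \<eta>' \<Longrightarrow>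
       (\<integral>z. h z * (\<theta> (fst z) * \<eta> (snd z)) \<partial>lbon ({0<..<T} \<times> {0..1})) = 0"
  shows "AE z in lbon ({0<..<T} \<times> {0..1}). h z = 0"
proof (rule sigma_finite_measure.density_zero[OF sigma_finite_lbon[OF cylinder_borel] h])
  let ?N = "lbon ({0<..<T} \<times> {0..1::real})"
  note [measurable] = borel_measurable_integrable[OF h]
  have rect: "(\<integral>z. indicator (box p q) z * h z \<partial>?N) = 0" for p q
  proof -
    \<comment> \<open>Clipping the box to the cylinder changes it only on the null lines
      \<open>x = 0\<close> and \<open>x = 1\<close>.\<close>
    define a b c d where "a = max 0 (fst p)" and "b = min T (fst q)" and "c = max 0 (snd p)" and "d = min 1 (snd q)"
    have "(\<integral>z. indicator (box p q) z * h z \<partial>?N) = (\<integral>z. indicator ({a<..<b} \<times> {c<..<d}) z * h z \<partial>?N)"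
    proof (rule integral_cong_AE)
      have "AE z in lborel. snd (z::real\<times>real) \<noteq> (0::real) \<and> snd z \<noteq> (1::real)"
      proof -
        have "AE z in lborel \<Otimes>\<^sub>M lborel. snd (z::real\<times>real) \<noteq> (0::real) \<and> snd z \<noteq> (1::real)"
          by (rule lborel_pair.AE_pair_measure)
             (measurable, use AE_lborel_singleton[of "0::real"] AE_lborel_singleton[of "1::real"] in \<open>auto elim!: eventually_elim2\<close>)
        then show ?thesis unfolding lborel_prod .
      qed
      then show "AE z in ?N. indicator (box p q) z * h z = indicator ({a<..<b} \<times> {c<..<d}) z * h z"
        by (subst AE_lbon[OF borel_Times], simp, simp, eventually_elim)
           (auto simp: box_prod indicator_def a_def b_def c_def d_def)
    qed (auto intro!: borel_measurable_times borel_measurable_indicator borel_Times simp: borel_measurable_integrable[OF h])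
    also have "\<dots> = 0"
    proof (cases "a < b \<and> c < d")
      case True
      then show ?thesis by (intro orth_rectangle[OF T h orth]) (auto simp: a_def b_def c_def d_def)
    next
      case False
      then have e: "{a<..<b} \<times> {c<..<d} = {}" by auto
      show ?thesis unfolding e by simp
    qed
    finally show ?thesis .
  qed
  \<comment> \<open>Complements need the total integral, which is the integral over one box that
    contains the cylinder.\<close>
  have UN: "(\<integral>z. h z \<partial>?N) = 0"
  proof -
    have "AE z in ?N. h z = indicator (box (-1, -1) (T + 1, 2)) z * h z"
      by (subst AE_lbon[OF borel_Times]) (simp_all add: box_prod indicator_def split_beta' mem_Times_iff)
    then have "(\<integral>z. h z \<partial>?N) = (\<integral>z. indicator (box (-1, -1) (T + 1, 2)) z * h z \<partial>?N)"
      by (intro integral_cong_AE) auto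
    then show ?thesis using rect by simp
  qed
  fix A assume "A \<in> sets ?N"
  then have A: "A \<in> sigma_sets UNIV (range (\<lambda>(a, b). box a b :: (real \<times> real) set))"
    by (simp add: borel_eq_box)
  have st: "Int_stable (range (\<lambda>(a, b). box a b :: (real \<times> real) set))"
    by (auto simp: Int_stable_def box_Int_box)
  from A have "(\<integral>z. indicator A z * h z \<partial>?N) = 0"
  proof (induction rule: sigma_sets_induct_disjoint[OF st subset_Pow_Union[THEN order_trans, OF Pow_mono[OF subset_UNIV]], consumes 1, case_names basic empty compl union])
    case (basic A)
    then show ?case using rect by auto
  next
    case empty
    then show ?case by simp
  next
    case (compl A)
    then have [measurable]: "A \<in> sets borel" by (simp add: borel_eq_box)
    have "(\<integral>z. indicator (UNIV - A) z * h z \<partial>?N) = (\<integral>z. h z - indicator A z * h z \<partial>?N)"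
      by (rule Bochner_Integration.integral_cong) (auto simp: indicator_def)
    also have "\<dots> = (\<integral>z. h z \<partial>?N) - (\<integral>z. indicator A z * h z \<partial>?N)"
      by (rule Bochner_Integration.integral_diff) (auto intro!: h integrable_ind_mult)
    finally show ?case using compl UN by simp
  next
    case (union A)
    then have A[measurable]: "A i \<in> sets borel" for i by (auto simp: borel_eq_box)
    have "(\<integral>z. indicator (\<Union>i. A i) z *\<^sub>R h z \<partial>?N) = (\<Sum>i. set_lebesgue_integral ?N (A i) h)"
      unfolding set_lebesgue_integral_def[symmetric]
    proof (rule lebesgue_integral_countable_add)
      show "A i \<inter> A j = {}" if "i \<noteq> j" for i j
        using union(1) that by (auto simp: disjoint_family_on_def)
      show "set_integrable ?N (\<Union>i. A i) h"
        unfolding set_integrable_def by (rule integrable_mult_indicator) (auto intro: h)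
    qed (use A in auto)
    also have "\<dots> = 0" using union(3) by (simp add: set_lebesgue_integral_def)
    finally show ?case by simp
  qed
  then show "set_lebesgue_integral ?N A h = 0" by (simp add: set_lebesgue_integral_def)
qed

section \<open>The circle, the time interval and their product\<close>

abbreviation I1 :: "real measure" where "I1 \<equiv> lbon {0..1}"
abbreviation JT :: "real \<Rightarrow> real measure" where "JT T \<equiv> lbon {0<..<T}"

lemma measurable_lbon [simp]: "measurable (lbon A) N = measurable borel N"
  by (rule measurable_cong_sets) auto

lemma pair_JI: "pair_sigma_finite (JT T) I1"
  by (simp add: pair_sigma_finite_def)

lemma JI_eq: "lbon ({0<..<T} \<times> {0..1}) = JT T \<Otimes>\<^sub>M I1"
  by (simp add: pair_lbon)

lemma sets_JI: "sets (JT T \<Otimes>\<^sub>M I1) = sets (borel \<Otimes>\<^sub>M borel)"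
  by (intro sets_pair_measure_cong) auto

lemma finite_I1: "finite_measure I1" and finite_JT: "finite_measure (JT T)"
  by (auto intro!: finite_measure_lbon)

lemma AE_I1_const: "(AE x in I1. P) \<longleftrightarrow> P"
proof (cases P)
  case False
  have "\<not> (AE x in I1. False)"
  proof
    assume "AE x in I1. False"
    then have "emeasure I1 UNIV = 0" using AE_iff_measurable[of UNIV I1 "\<lambda>_. False"] by simp
    then show False by (simp add: emeasure_lbon)
  qed
  then show ?thesis using False by simp
qed simp

lemma integral_I1_const: "(\<integral>x. c \<partial>I1) = (c::real)"
  by (simp add: measure_lbon)

lemma L2S_iff: "L2S f \<longleftrightarrow> f \<in> borel_measurable borel \<and> per1 f \<and> sqi I1 f"
proof -
  have "f \<in> borel_measurable borel \<Longrightarrow> set_integrable lborel {0..1} (\<lambda>x. (f x)\<^sup>2) \<longleftrightarrow> integrable I1 (\<lambda>x. (f x)\<^sup>2)"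
    by (subst integrable_lbon) auto
  then show ?thesis unfolding L2S_def sqi_def by auto
qed

lemma nL2_eq: "f \<in> borel_measurable borel \<Longrightarrow> nL2 f = n2 I1 f"
  by (simp add: nL2_def n2_def integral_lbon)

lemma L2Q_measurable: "L2Q T f \<Longrightarrow> case_prod f \<in> borel_measurable (borel \<Otimes>\<^sub>M borel)"
  by (simp add: L2Q_def borel_prod)

lemma L2Q_iff:
  "L2Q T f \<longleftrightarrow> case_prod f \<in> borel_measurable (borel \<Otimes>\<^sub>M borel) \<and> (\<forall>t. per1 (f t)) \<and> sqi (JT T \<Otimes>\<^sub>M I1) (case_prod f)"
proof -
  have "set_integrable lborel ({0<..<T} \<times> {0..1}) (\<lambda>(t, x). (f t x)\<^sup>2) \<longleftrightarrow> integrable (JT T \<Otimes>\<^sub>M I1) (\<lambda>z. (case_prod f z)\<^sup>2)"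
    if m: "case_prod f \<in> borel_measurable (borel \<Otimes>\<^sub>M borel)"
  proof -
    from m have [measurable]: "case_prod f \<in> borel_measurable borel" by (simp add: borel_prod)
    have "(\<lambda>z. (case_prod f z)\<^sup>2) \<in> borel_measurable borel" by measurable
    then show ?thesis unfolding JI_eq[symmetric]
      by (subst integrable_lbon) (auto simp: split_beta')
  qed
  then show ?thesis unfolding L2Q_def sqi_def by (auto simp: borel_prod measurable_cong_sets[OF sets_JI refl])
qed

lemma L2Q_slice:
  assumes "L2Q T f" shows "AE t in JT T. L2S (f t)"
proof -
  interpret pair_sigma_finite "JT T" I1 by (rule pair_JI)
  have m[measurable]: "case_prod f \<in> borel_measurable (borel \<Otimes>\<^sub>M borel)" and p: "\<And>t. per1 (f t)"
    and s: "sqi (JT T \<Otimes>\<^sub>M I1) (case_prod f)"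
    using assms by (auto simp: L2Q_iff)
  have "AE t in JT T. integrable I1 (\<lambda>x. (case_prod f (t, x))\<^sup>2)"
    by (rule AE_integrable_fst'[OF sqi_square[OF s]])
  then show ?thesis
  proof eventually_elim
    case (elim t)
    have "f t \<in> borel_measurable borel" by measurable
    with elim p show ?case by (simp add: L2S_iff sqi_def)
  qed
qed

text \<open>The two inclusions for \<open>A\<close> cover the closed unit interval and the open time
  interval at once, because the end points are null.\<close>

lemma cum_FTC:
  assumes F: "\<And>x. (F has_real_derivative f x) (at x)" and f: "continuous_on UNIV f"
    and A: "A \<in> sets borel" "{0<..<L} \<subseteq> A" "A \<subseteq> {0..L}" and t: "0 \<le> t" "t \<le> L"
  shows "cum A f t = F t - F 0"
proof -
  have [measurable]: "f \<in> borel_measurable borel" using f by (simp add: borel_measurable_continuous_onI)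
  note A(1)[measurable]
  have "cum A f t = (\<integral>s. indicator A s * (indicator {..t} s * f s) \<partial>lborel)"
    unfolding cum_def by (subst integral_lbon) (auto simp: set_lebesgue_integral_def)
  also have "\<dots> = (\<integral>s. f s * indicator {0..t} s \<partial>lborel)"
  proof (rule integral_cong_AE)
    show "AE s in lborel. indicator A s * (indicator {..t} s * f s) = f s * indicator {0..t} s"
      using AE_lborel_singleton[of 0] AE_lborel_singleton[of L]
    proof eventually_elim
      case (elim s)
      have "s \<in> A \<and> s \<le> t \<longleftrightarrow> s \<in> {0..t}"
      proof
        assume "s \<in> A \<and> s \<le> t" then show "s \<in> {0..t}" using A(3) by auto
      next
        assume "s \<in> {0..t}" then have "s \<in> {0<..<L}" using elim t by auto
        then show "s \<in> A \<and> s \<le> t" using A(2) \<open>s \<in> {0..t}\<close> by auto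
      qed
      then show ?case by (auto simp: indicator_def)
    qed
  qed measurable
  also have "\<dots> = F t - F 0"
    by (rule integral_FTC_Icc_real) (use t F f in \<open>auto simp: continuous_on_eq_continuous_at\<close>)
  finally show ?thesis .
qed

lemma sqi_continuous:
  assumes "continuous_on UNIV (f :: real \<Rightarrow> real)" "bounded A" "A \<in> sets borel"
  shows "sqi (lbon A) f"
proof -
  obtain B where "\<And>x. x \<in> A \<Longrightarrow> \<bar>f x\<bar> \<le> B" using continuous_bounded[OF assms(1,2)] by blast
  then show ?thesis
    by (intro sqi_bounded[OF finite_measure_lbon, of _ _ B])
       (use assms in \<open>auto simp: AE_lbon borel_measurable_continuous_onI\<close>)
qed

lemma continuous_antiderivative:
  assumes "continuous_on UNIV (f :: real \<Rightarrow> real)"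
  obtains F where "\<And>x. (F has_real_derivative f x) (at x)" "F 0 = 0"
proof -
  have "\<exists>F. \<forall>x::real. -\<infinity> < ereal x \<longrightarrow> ereal x < \<infinity> \<longrightarrow> (F has_vector_derivative f x) (at x)"
    by (rule einterval_antiderivative) (use assms in \<open>auto simp: continuous_on_eq_continuous_at\<close>)
  then obtain F where F: "\<And>x. (F has_real_derivative f x) (at x)"
    by (auto simp: has_real_derivative_iff_has_vector_derivative)
  show ?thesis
  proof (rule that)
    show "((\<lambda>x. F x - F 0) has_real_derivative f x) (at x)" for x
      by (auto intro!: derivative_eq_intros F)
  qed simp
qed

text \<open>By \<open>orth_2D\<close>, tensor products already separate integrable functions on the
  cylinder; they are the means by which \<open>dtw\<close> and \<open>dxw\<close> are
  exploited.\<close>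

lemma st_test_product:
  assumes \<theta>: "time_test T \<theta> \<theta>'" and \<eta>: "per_test \<eta> \<eta>'" and T: "T > 0"
  shows "st_test T (\<lambda>(t, x). \<theta> t * \<eta> x) (\<lambda>(t, x). \<theta>' t * \<eta> x) (\<lambda>(t, x). \<theta> t * \<eta>' x)"
  unfolding st_test_def
proof (intro conjI allI)
  fix p :: "real \<times> real"
  have 1: "((\<lambda>p. \<theta> (fst p)) has_derivative (\<lambda>h. \<theta>' (fst p) * fst h)) (at p)"
    using \<theta> unfolding time_test_def
    by (intro has_derivative_compose[of fst fst p UNIV \<theta> "(*) (\<theta>' (fst p))"])
       (auto intro!: derivative_intros simp: has_field_derivative_def)
  have 2: "((\<lambda>p. \<eta> (snd p)) has_derivative (\<lambda>h. \<eta>' (snd p) * snd h)) (at p)"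
    using \<eta> unfolding per_test_def
    by (intro has_derivative_compose[of snd snd p UNIV \<eta> "(*) (\<eta>' (snd p))"])
       (auto intro!: derivative_intros simp: has_field_derivative_def)
  from has_derivative_mult[OF 1 2]
  show "((\<lambda>(t, x). \<theta> t * \<eta> x) has_derivative
          (\<lambda>h. (case p of (t, x) \<Rightarrow> \<theta>' t * \<eta> x) * fst h + (case p of (t, x) \<Rightarrow> \<theta> t * \<eta>' x) * snd h)) (at p)"
    by (simp add: split_beta' algebra_simps)
next
  have c: "continuous_on UNIV \<theta>" "continuous_on UNIV \<theta>'" "continuous_on UNIV \<eta>" "continuous_on UNIV \<eta>'"
    using time_test_continuous[OF \<theta>] per_test_continuous[OF \<eta>] \<theta> \<eta> by (auto simp: time_test_def per_test_def)
  have c2: "continuous_on UNIV (\<lambda>(t::real, x::real). f t * g x)" if "continuous_on UNIV f" "continuous_on UNIV g" for f g :: "real \<Rightarrow> real"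
    unfolding split_beta'
    by (intro continuous_on_mult continuous_on_compose2[OF that(1)] continuous_on_compose2[OF that(2)] continuous_intros) auto
  show "continuous_on UNIV (\<lambda>(t, x). \<theta>' t * \<eta> x)" "continuous_on UNIV (\<lambda>(t, x). \<theta> t * \<eta>' x)"
    using c c2 by blast+
next
  obtain a b where ab: "0 < a" "b < T" "\<And>t. t \<notin> {a..b} \<Longrightarrow> \<theta> t = 0"
    using \<theta> unfolding time_test_def by blast
  show "\<exists>a b. 0 < a \<and> a \<le> b \<and> b < T \<and> (\<forall>t x. t \<notin> {a..b} \<longrightarrow> (case (t, x) of (t, x) \<Rightarrow> \<theta> t * \<eta> x) = 0)"
  proof (cases "a \<le> b")
    case True
    then show ?thesis using ab by (intro exI[of _ a] exI[of _ b]) auto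
  next
    case False
    then have "\<theta> t = 0" for t using ab(3)[of t] by auto
    \<comment> \<open>An empty support interval forces \<theta> to vanish; \<open>st_test\<close>
      wants a nonempty one, so \<open>T/2\<close> serves as both ends.\<close>
    then show ?thesis using T by (intro exI[of _ "T/2"]) auto
  qed
next
  fix t x show "(case (t, x + 1) of (t, x) \<Rightarrow> \<theta> t * \<eta> x) = (case (t, x) of (t, x) \<Rightarrow> \<theta> t * \<eta> x)"
    using \<eta> by (simp add: per_test_def per1_def)
qed

lemma integral_JI:
  assumes "(\<lambda>(t, x). F t x) \<in> borel_measurable (borel \<Otimes>\<^sub>M borel)"
  shows "set_lebesgue_integral lborel ({0<..<T} \<times> {0..1}) (\<lambda>(t, x). F t x :: real) = (\<integral>z. F (fst z) (snd z) \<partial>(JT T \<Otimes>\<^sub>M I1))"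
proof -
  from assms have "(\<lambda>z. F (fst z) (snd z)) \<in> borel_measurable borel" by (simp add: borel_prod split_beta')
  then show ?thesis unfolding JI_eq[symmetric]
    by (subst integral_lbon) (simp_all add: split_beta')
qed

lemma test_measurable:
  assumes "time_test T \<theta> \<theta>'" shows "\<theta> \<in> borel_measurable borel" "\<theta>' \<in> borel_measurable borel"
  using time_test_continuous[OF assms] assms by (auto simp: time_test_def intro!: borel_measurable_continuous_onI)

lemma per_test_measurable:
  assumes "per_test \<theta> \<theta>'" shows "\<theta> \<in> borel_measurable borel" "\<theta>' \<in> borel_measurable borel"
  using per_test_continuous[OF assms] assms by (auto simp: per_test_def intro!: borel_measurable_continuous_onI)

lemma dtw_product:
  assumes T: "T > 0" and f: "L2Q T f" and g: "L2Q T g" and d: "dtw T f g"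
    and \<theta>: "time_test T \<theta> \<theta>'" and \<eta>: "per_test \<eta> \<eta>'"
  shows "(\<integral>z. f (fst z) (snd z) * (\<theta>' (fst z) * \<eta> (snd z)) \<partial>(JT T \<Otimes>\<^sub>M I1))
       = - (\<integral>z. g (fst z) (snd z) * (\<theta> (fst z) * \<eta> (snd z)) \<partial>(JT T \<Otimes>\<^sub>M I1))"
proof -
  note [measurable] = test_measurable[OF \<theta>] per_test_measurable[OF \<eta>] L2Q_measurable[OF f] L2Q_measurable[OF g]
  show ?thesis using d[unfolded dtw_def, rule_format, OF st_test_product[OF \<theta> \<eta> T]]
    by (simp add: integral_JI)
qed

lemma dxw_product:
  assumes T: "T > 0" and f: "L2Q T f" and g: "L2Q T g" and d: "dxw T f g"
    and \<theta>: "time_test T \<theta> \<theta>'" and \<eta>: "per_test \<eta> \<eta>'"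
  shows "(\<integral>z. f (fst z) (snd z) * (\<theta> (fst z) * \<eta>' (snd z)) \<partial>(JT T \<Otimes>\<^sub>M I1))
       = - (\<integral>z. g (fst z) (snd z) * (\<theta> (fst z) * \<eta> (snd z)) \<partial>(JT T \<Otimes>\<^sub>M I1))"
proof -
  note [measurable] = test_measurable[OF \<theta>] per_test_measurable[OF \<eta>] L2Q_measurable[OF f] L2Q_measurable[OF g]
  show ?thesis using d[unfolded dxw_def, rule_format, OF st_test_product[OF \<theta> \<eta> T]]
    by (simp add: integral_JI)
qed

lemma orth_JI:
  fixes h :: "real \<times> real \<Rightarrow> real"
  assumes T: "T > 0" and h: "integrable (JT T \<Otimes>\<^sub>M I1) h"
    and orth: "\<And>\<theta> \<theta>' \<eta> \<eta>'. time_test T \<theta> \<theta>' \<Longrightarrow> per_test \<eta> \<eta>' \<Longrightarrow>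
       (\<integral>z. h z * (\<theta> (fst z) * \<eta> (snd z)) \<partial>(JT T \<Otimes>\<^sub>M I1)) = 0"
  shows "AE t in JT T. AE x in I1. h (t, x) = 0"
proof -
  interpret pair_sigma_finite "JT T" I1 by (rule pair_JI)
  have "AE z in JT T \<Otimes>\<^sub>M I1. h z = 0"
    using orth_2D[OF T, of h] h orth unfolding JI_eq by blast
  then show ?thesis by (rule AE_pair)
qed

lemma sqi_JI_integrable: "sqi (JT T \<Otimes>\<^sub>M I1) f \<Longrightarrow> integrable (JT T \<Otimes>\<^sub>M I1) f"
  by (rule sqi_imp_integrable) (auto simp: JI_eq[symmetric] intro!: finite_measure_lbon borel_Times bounded_Times)

lemma integrable_JI_bounded_mult:
  assumes "integrable (JT T \<Otimes>\<^sub>M I1) f" "continuous_on UNIV \<theta>" "continuous_on UNIV \<eta>"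
  shows "integrable (JT T \<Otimes>\<^sub>M I1) (\<lambda>z. f z * (\<theta> (fst z) * \<eta> (snd z)) :: real)"
proof -
  have [measurable]: "\<theta> \<in> borel_measurable borel" "\<eta> \<in> borel_measurable borel"
    using assms by (auto intro!: borel_measurable_continuous_onI)
  obtain B where B: "\<And>x. x \<in> {0<..<T} \<Longrightarrow> \<bar>\<theta> x\<bar> \<le> B" using continuous_bounded[OF assms(2), of "{0<..<T}"] by auto
  obtain C where C: "\<And>x. x \<in> {0..1} \<Longrightarrow> \<bar>\<eta> x\<bar> \<le> C" using continuous_bounded[OF assms(3), of "{0..1}"] by auto
  show ?thesis
  proof (rule integrable_bounded_mult[OF assms(1), of _ "B * C"])
    have "AE z in lbon ({0<..<T} \<times> {0..1}). \<bar>\<theta> (fst z) * \<eta> (snd z)\<bar> \<le> B * C"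
      unfolding AE_lbon[OF borel_Times[OF borel_open[OF open_greaterThanLessThan] borel_closed[OF closed_atLeastAtMost]]]
      using B C by (intro always_eventually) (auto simp: abs_mult intro!: mult_mono B C intro: order_trans[OF abs_ge_zero])
    then show "AE z in JT T \<Otimes>\<^sub>M I1. \<bar>\<theta> (fst z) * \<eta> (snd z)\<bar> \<le> B * C" unfolding JI_eq .
    show "(\<lambda>z. \<theta> (fst z) * \<eta> (snd z)) \<in> borel_measurable (JT T \<Otimes>\<^sub>M I1)"
      by (simp add: measurable_cong_sets[OF sets_JI refl])
  qed
qed

text \<open>Zero mean gives equal values at \<open>0\<close> and \<open>1\<close>, and
  \<open>\<psi> (x + 1) - \<psi> x\<close> has derivative zero because \<eta> is periodic; together
  they make the primitive periodic.\<close>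

lemma per_test_antiderivative:
  assumes c: "continuous_on UNIV \<eta>" and p: "per1 \<eta>" and 0: "(\<integral>x. \<eta> x \<partial>I1) = 0"
  obtains \<psi> where "per_test \<psi> \<eta>" "\<psi> 0 = 0" "\<psi> 1 = 0"
proof -
  have [measurable]: "\<eta> \<in> borel_measurable borel" by (rule borel_measurable_continuous_onI[OF c])
  obtain \<psi> where d: "\<And>x. (\<psi> has_real_derivative \<eta> x) (at x)" and z: "\<psi> 0 = 0" using continuous_antiderivative[OF c] by blast
  have "cum {0..1} \<eta> 1 = \<psi> 1 - \<psi> 0" by (rule cum_FTC[OF d c, where L = 1]) auto
  moreover have "cum {0..1} \<eta> 1 = (\<integral>x. \<eta> x \<partial>I1)"
    unfolding cum_def
    by (rule integral_cong_AE) (auto simp: AE_lbon indicator_def)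
  ultimately have 1: "\<psi> 1 = 0" using 0 z by simp
  have "((\<lambda>x. \<psi> (x + 1) - \<psi> x) has_real_derivative 0) (at x)" for x
  proof -
    have "((\<lambda>x. \<psi> (x + 1) - \<psi> x) has_real_derivative \<eta> (x + 1) * 1 - \<eta> x) (at x)"
      by (intro DERIV_diff d DERIV_chain2[OF d]) (auto intro!: derivative_eq_intros)
    then show ?thesis using p by (simp add: per1_def)
  qed
  then have "\<psi> (x + 1) - \<psi> x = \<psi> (0 + 1) - \<psi> 0" for x
    using DERIV_isconst_all[of "\<lambda>x. \<psi> (x + 1) - \<psi> x"] by blast
  then have "per1 \<psi>" using 1 z by (simp add: per1_def)
  then show ?thesis using that d c z 1 by (auto simp: per_test_def)
qed

lemma cum_eq_integral:
  assumes A: "A \<in> sets borel" "A \<subseteq> {..L}" and [measurable]: "g \<in> borel_measurable borel"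
  shows "cum A g L = (\<integral>x. g x \<partial>lbon A)"
  unfolding cum_def
  by (rule integral_cong_AE) (use A in \<open>auto simp: AE_lbon indicator_def\<close>)

text \<open>This is \<open>cum_product\<close> at the right end \<open>L\<close>, where the product
  vanishes because \<psi> does, so no boundary term remains.\<close>

lemma integral_cum_parts:
  assumes A: "A \<in> sets borel" "{0<..<L} \<subseteq> A" "A \<subseteq> {0..L}" "0 \<le> L"
    and g: "integrable (lbon A) g" and c: "continuous_on UNIV \<eta>" and \<psi>: "\<And>x. (\<psi> has_real_derivative \<eta> x) (at x)"
    and 0: "\<psi> 0 = 0" "\<psi> L = 0"
  shows "(\<integral>x. cum A g x * \<eta> x \<partial>lbon A) = - (\<integral>x. g x * \<psi> x \<partial>lbon A)"
proof -
  note A(1)[measurable]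
  have bA: "bounded A" using bounded_subset[OF bounded_closed_interval A(3)] .
  have \<eta>: "integrable (lbon A) \<eta>"
    by (rule sqi_imp_integrable[OF finite_measure_lbon[OF A(1) bA] sqi_continuous[OF c bA A(1)]])
  note [measurable] = borel_measurable_integrable[OF g, simplified] borel_measurable_integrable[OF \<eta>, simplified]
  have \<psi>c: "continuous_on UNIV \<psi>" using continuous_deriv_comp[OF \<psi>] .
  have [measurable]: "\<psi> \<in> borel_measurable borel" by (rule borel_measurable_continuous_onI[OF \<psi>c])
  have cum: "cum A \<eta> x = \<psi> x" if "x \<in> {0..L}" for x
    using cum_FTC[OF \<psi> c A(1-3), of x] that 0 by simp
  have "cum A (\<lambda>x. g x * cum A \<eta> x + \<eta> x * cum A g x) L = 0"
    using cum_product[OF A(1) g \<eta>, of L] cum[of L] 0 A(4) by simp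
  also have "cum A (\<lambda>x. g x * cum A \<eta> x + \<eta> x * cum A g x) L = (\<integral>x. g x * cum A \<eta> x + \<eta> x * cum A g x \<partial>lbon A)"
    by (rule cum_eq_integral) (use A in auto)
  also have "\<dots> = (\<integral>x. g x * \<psi> x + \<eta> x * cum A g x \<partial>lbon A)"
  proof (rule integral_cong_AE)
    have "x \<in> A \<longrightarrow> cum A \<eta> x = \<psi> x" for x using A(3) cum[of x] by auto
    then show "AE x in lbon A. g x * cum A \<eta> x + \<eta> x * cum A g x = g x * \<psi> x + \<eta> x * cum A g x"
      by (auto simp: AE_lbon)
  qed auto
  also have "\<dots> = (\<integral>x. g x * \<psi> x \<partial>lbon A) + (\<integral>x. \<eta> x * cum A g x \<partial>lbon A)"
  proof (rule Bochner_Integration.integral_add)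
    obtain B where "\<And>x. x \<in> A \<Longrightarrow> \<bar>\<psi> x\<bar> \<le> B" using continuous_bounded[OF \<psi>c bA] by auto
    then show "integrable (lbon A) (\<lambda>x. g x * \<psi> x)"
      by (intro integrable_bounded_mult[OF g, of _ B]) (auto simp: AE_lbon)
    show "integrable (lbon A) (\<lambda>x. \<eta> x * cum A g x)" by (rule integrable_mult_cum[OF A(1) \<eta> g])
  qed
  finally show ?thesis by (simp add: mult.commute)
qed

section \<open>Weak space derivatives on time slices\<close>

lemma integrable_JI_fst: 
  fixes m :: "real \<Rightarrow> real"
  assumes "integrable (JT T) m"
  shows "integrable (JT T \<Otimes>\<^sub>M I1) (\<lambda>z. m (fst z))"
  using integrable_product_fun[OF pair_JI assms, of "\<lambda>_. 1"] finite_measure.integrable_const[OF finite_I1, of "1::real"]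
  by (simp add: split_beta')

lemma integrable_JI_snd: 
  fixes m :: "real \<Rightarrow> real"
  assumes "integrable I1 m"
  shows "integrable (JT T \<Otimes>\<^sub>M I1) (\<lambda>z. m (snd z))"
  using integrable_product_fun[OF pair_JI _ assms, of T "\<lambda>_. 1"] finite_measure.integrable_const[OF finite_JT, of T "1::real"]
  by (simp add: split_beta')

lemma cum_measurable2':
  assumes A: "A \<in> sets borel" and f: "case_prod f \<in> borel_measurable (borel \<Otimes>\<^sub>M borel)"
  shows "(\<lambda>(t, x). cum A (f t) x) \<in> borel_measurable (borel \<Otimes>\<^sub>M borel)"
proof -
  have "(\<lambda>(x, t). f t x) \<in> borel_measurable (borel \<Otimes>\<^sub>M borel)"
    using measurable_compose[OF measurable_pair_swap' f] by (simp add: split_beta')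
  from cum_measurable2[OF A this]
  have "(\<lambda>(x, t). cum A (f t) x) \<in> borel_measurable (borel \<Otimes>\<^sub>M borel)" .
  from measurable_compose[OF measurable_pair_swap' this] show ?thesis by (simp add: split_beta')
qed

lemma integrable_cum_x:
  assumes g: "sqi (JT T \<Otimes>\<^sub>M I1) (case_prod g)" and [measurable]: "case_prod g \<in> borel_measurable (borel \<Otimes>\<^sub>M borel)"
  shows "integrable (JT T \<Otimes>\<^sub>M I1) (\<lambda>z. cum {0..1} (g (fst z)) (snd z))"
proof -
  interpret pair_sigma_finite "JT T" I1 by (rule pair_JI)
  have gi: "integrable (JT T \<Otimes>\<^sub>M I1) (case_prod g)" by (rule sqi_JI_integrable[OF g])
  have [measurable]: "(\<lambda>z. cum {0..1} (g (fst z)) (snd z)) \<in> borel_measurable (borel \<Otimes>\<^sub>M borel)"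
    using cum_measurable2'[of "{0..1}" g] by (simp add: split_beta')
  show ?thesis
  proof (rule Bochner_Integration.integrable_bound)
    show "integrable (JT T \<Otimes>\<^sub>M I1) (\<lambda>z. \<integral>x. \<bar>g (fst z) x\<bar> \<partial>I1)"
      using integrable_fst'[OF integrable_abs[OF gi]] by (intro integrable_JI_fst) simp
    show "AE z in JT T \<Otimes>\<^sub>M I1. norm (cum {0..1} (g (fst z)) (snd z)) \<le> norm (\<integral>x. \<bar>g (fst z) x\<bar> \<partial>I1)"
    proof (rule AE_pair_measure)
      show "AE t in JT T. AE x in I1. norm (cum {0..1} (g (fst (t, x))) (snd (t, x))) \<le> norm (\<integral>y. \<bar>g (fst (t, x)) y\<bar> \<partial>I1)"
        using AE_integrable_fst'[OF gi]
      proof eventually_elim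
        case (elim t)
        have "\<bar>cum {0..1} (g t) x\<bar> \<le> \<bar>\<integral>y. \<bar>g t y\<bar> \<partial>I1\<bar>" for x
          using abs_cum_le[of "{0..1}" "g t" x] elim by (auto intro: order_trans)
        then show ?case by simp
      qed
    qed measurable
  qed measurable
qed

text \<open>Du Bois-Reymond for almost every time. Only mean-zero functions have periodic
  primitives, so a general \<eta> is replaced by \<eta> minus its mean; correspondingly, the
  remainder \<open>w = f - cum g\<close> is shown to equal its own mean over the circle.\<close>

lemma dxw_slices:
  assumes T: "T > 0" and f: "L2Q T f" and g: "L2Q T g" and d: "dxw T f g"
  shows "AE t in JT T. (\<integral>x. g t x \<partial>I1) = 0 \<and> (\<exists>c. AE x in I1. f t x = c + cum {0..1} (g t) x)"
proof -
  interpret pair_sigma_finite "JT T" I1 by (rule pair_JI)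
  have [measurable]: "case_prod f \<in> borel_measurable (borel \<Otimes>\<^sub>M borel)" "case_prod g \<in> borel_measurable (borel \<Otimes>\<^sub>M borel)"
    using f g by (auto simp: L2Q_iff)
  have fs: "sqi (JT T \<Otimes>\<^sub>M I1) (case_prod f)" and gs: "sqi (JT T \<Otimes>\<^sub>M I1) (case_prod g)"
    using f g by (auto simp: L2Q_iff)
  have fi: "integrable (JT T \<Otimes>\<^sub>M I1) (\<lambda>z. f (fst z) (snd z))" and gi: "integrable (JT T \<Otimes>\<^sub>M I1) (\<lambda>z. g (fst z) (snd z))"
    using sqi_JI_integrable[OF fs] sqi_JI_integrable[OF gs] by (auto simp: split_beta')
  define m where "m t = (\<integral>x. g t x \<partial>I1)" for t
  have mi: "integrable (JT T) m" unfolding m_def using integrable_fst'[OF gi] by simp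
  have "AE t in JT T. AE x in I1. m t = 0"
  proof (rule orth_JI[OF T, of "\<lambda>z. m (fst z)", simplified])
    show "integrable (JT T \<Otimes>\<^sub>M I1) (\<lambda>z. m (fst z))" by (rule integrable_JI_fst[OF mi])
    fix \<theta> \<theta>' \<eta> \<eta>' assume \<theta>: "time_test T \<theta> \<theta>'" and \<eta>: "per_test \<eta> \<eta>'"
    \<comment> \<open>Testing with the constant \<open>1\<close> in space yields the vanishing mean
      of \<open>g\<close>.\<close>
    have one: "per_test (\<lambda>_. 1) (\<lambda>_. 0)" by (auto simp: per_test_def per1_def)
    have "(\<integral>t. m t * \<theta> t \<partial>JT T) = (\<integral>t. \<integral>x. g t x * (\<theta> t * 1) \<partial>I1 \<partial>JT T)"
      by (rule Bochner_Integration.integral_cong) (auto simp: m_def)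
    also have "\<dots> = (\<integral>z. g (fst z) (snd z) * (\<theta> (fst z) * 1) \<partial>(JT T \<Otimes>\<^sub>M I1))"
      using integral_fst'[OF integrable_JI_bounded_mult[OF gi time_test_continuous[OF \<theta>] continuous_on_const[of _ 1]]] by simp
    also have "\<dots> = 0" using dxw_product[OF T f g d \<theta> one] by simp
    finally have 0: "(\<integral>t. m t * \<theta> t \<partial>JT T) = 0" .
    have "(\<integral>z. m (fst z) * (\<theta> (fst z) * \<eta> (snd z)) \<partial>(JT T \<Otimes>\<^sub>M I1)) = (\<integral>t. \<integral>x. (m t * \<theta> t) * \<eta> x \<partial>I1 \<partial>JT T)"
      using integral_fst'[OF integrable_JI_bounded_mult[OF integrable_JI_fst[OF mi] time_test_continuous[OF \<theta>] per_test_continuous[OF \<eta>]]]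
      by (simp add: mult.assoc)
    also have "\<dots> = (\<integral>t. (m t * \<theta> t) * (\<integral>x. \<eta> x \<partial>I1) \<partial>JT T)" by simp
    also have "\<dots> = 0" unfolding integral_mult_left_zero 0 by simp
    finally show "(\<integral>z. m (fst z) * (\<theta> (fst z) * \<eta> (snd z)) \<partial>(JT T \<Otimes>\<^sub>M I1)) = 0" .
  qed
  then have m0: "AE t in JT T. m t = 0" by (simp add: AE_I1_const)
  define w where "w t x = f t x - cum {0..1} (g t) x" for t x
  have [measurable]: "(\<lambda>z. cum {0..1} (g (fst z)) (snd z)) \<in> borel_measurable (borel \<Otimes>\<^sub>M borel)"
    using cum_measurable2'[of "{0..1}" g] by (simp add: split_beta')
  have wi: "integrable (JT T \<Otimes>\<^sub>M I1) (\<lambda>z. w (fst z) (snd z))"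
    unfolding w_def by (intro Bochner_Integration.integrable_diff fi integrable_cum_x[OF gs]) measurable
  define M where "M t = (\<integral>x. w t x \<partial>I1)" for t
  have Mi: "integrable (JT T) M" unfolding M_def using integrable_fst'[OF wi] by simp
  have "AE t in JT T. AE x in I1. w t x - M t = 0"
  proof (rule orth_JI[OF T, of "\<lambda>z. w (fst z) (snd z) - M (fst z)", unfolded fst_conv snd_conv])
    show hi: "integrable (JT T \<Otimes>\<^sub>M I1) (\<lambda>z. w (fst z) (snd z) - M (fst z))"
      by (intro Bochner_Integration.integrable_diff wi integrable_JI_fst[OF Mi])
    fix \<theta> \<theta>' \<eta> \<eta>' assume \<theta>: "time_test T \<theta> \<theta>'" and \<eta>: "per_test \<eta> \<eta>'"
    note \<theta>c = time_test_continuous[OF \<theta>] and \<eta>c = per_test_continuous[OF \<eta>]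
    define e where "e = (\<integral>x. \<eta> x \<partial>I1)"
    have \<eta>i: "integrable I1 \<eta>" by (rule sqi_imp_integrable[OF finite_I1 sqi_continuous[OF \<eta>c]]) auto
    have \<eta>0c: "continuous_on UNIV (\<lambda>x. \<eta> x - e)" by (intro continuous_intros \<eta>c)
    have \<eta>0: "(\<integral>x. \<eta> x - e \<partial>I1) = 0"
      using Bochner_Integration.integral_diff[OF \<eta>i finite_measure.integrable_const[OF finite_I1, of e]]
      unfolding integral_I1_const e_def by simp
    obtain \<psi> where \<psi>: "per_test \<psi> (\<lambda>x. \<eta> x - e)" "\<psi> 0 = 0" "\<psi> 1 = 0"
      by (rule per_test_antiderivative[OF \<eta>0c _ \<eta>0]) (use \<eta> in \<open>auto simp: per_test_def per1_def\<close>)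
    note \<psi>c = per_test_continuous[OF \<psi>(1)]
    have \<psi>d: "(\<psi> has_real_derivative \<eta> x - e) (at x)" for x using \<psi>(1) by (simp add: per_test_def)
    have "(\<integral>z. (w (fst z) (snd z) - M (fst z)) * (\<theta> (fst z) * \<eta> (snd z)) \<partial>(JT T \<Otimes>\<^sub>M I1)) =
      (\<integral>t. \<integral>x. (w t x - M t) * (\<theta> t * \<eta> x) \<partial>I1 \<partial>JT T)"
      using integral_fst'[OF integrable_JI_bounded_mult[OF hi \<theta>c \<eta>c]] by simp
    \<comment> \<open>Subtracting \<open>M t\<close> from \<open>w\<close> amounts to subtracting
      the mean \<open>e\<close> from \<eta>; integrating the primitive of \<open>g\<close> by parts
      then produces the weak derivative identity tested with \<psi>.\<close>
    also have "\<dots> = (\<integral>t. \<integral>x. f t x * (\<theta> t * (\<eta> x - e)) + g t x * (\<theta> t * \<psi> x) \<partial>I1 \<partial>JT T)"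
    proof (rule integral_cong_AE)
      show "AE t in JT T. (\<integral>x. (w t x - M t) * (\<theta> t * \<eta> x) \<partial>I1) = (\<integral>x. f t x * (\<theta> t * (\<eta> x - e)) + g t x * (\<theta> t * \<psi> x) \<partial>I1)"
        using AE_integrable_fst'[OF wi] AE_integrable_fst'[OF fi] AE_integrable_fst'[OF gi]
          AE_integrable_fst'[OF integrable_JI_bounded_mult[OF wi continuous_on_const[of _ 1] \<eta>c]]
          AE_integrable_fst'[OF integrable_JI_bounded_mult[OF fi continuous_on_const[of _ 1] \<eta>0c]]
          AE_integrable_fst'[OF integrable_JI_bounded_mult[OF gi continuous_on_const[of _ 1] \<psi>c]]
      proof eventually_elim
        case (elim t)
        have w1: "integrable I1 (w t)" and f1: "integrable I1 (f t)" and g1: "integrable I1 (g t)"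
          and w2: "integrable I1 (\<lambda>x. w t x * \<eta> x)" and f2: "integrable I1 (\<lambda>x. f t x * (\<eta> x - e))"
          and g2: "integrable I1 (\<lambda>x. g t x * \<psi> x)" using elim by simp_all
        have cm: "integrable I1 (\<lambda>x. (\<eta> x - e) * cum {0..1} (g t) x)"
          by (rule integrable_mult_cum) (use g1 sqi_imp_integrable[OF finite_I1 sqi_continuous[OF \<eta>0c]] in auto)
        have "(\<integral>x. (w t x - M t) * (\<theta> t * \<eta> x) \<partial>I1) = (\<integral>x. \<theta> t * (w t x * \<eta> x) - \<theta> t * (M t * \<eta> x) \<partial>I1)"
          by (rule Bochner_Integration.integral_cong) (auto simp: algebra_simps)
        also have "\<dots> = \<theta> t * (\<integral>x. w t x * \<eta> x \<partial>I1) - \<theta> t * (M t * e)"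
          using w2 \<eta>i by (simp add: e_def)
        also have "\<dots> = \<theta> t * ((\<integral>x. w t x * \<eta> x \<partial>I1) - (\<integral>x. e * w t x \<partial>I1))"
          by (simp add: M_def algebra_simps)
        also have "\<dots> = \<theta> t * (\<integral>x. w t x * \<eta> x - e * w t x \<partial>I1)"
          using w1 w2 by simp
        also have "(\<integral>x. w t x * \<eta> x - e * w t x \<partial>I1) = (\<integral>x. f t x * (\<eta> x - e) - (\<eta> x - e) * cum {0..1} (g t) x \<partial>I1)"
          by (rule Bochner_Integration.integral_cong) (auto simp: w_def algebra_simps)
        also have "\<dots> = (\<integral>x. f t x * (\<eta> x - e) \<partial>I1) - (\<integral>x. cum {0..1} (g t) x * (\<eta> x - e) \<partial>I1)"
          using Bochner_Integration.integral_diff[OF f2 cm] by (simp add: mult.commute)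
        also have "(\<integral>x. cum {0..1} (g t) x * (\<eta> x - e) \<partial>I1) = - (\<integral>x. g t x * \<psi> x \<partial>I1)"
          by (rule integral_cum_parts[OF _ _ _ _ g1 \<eta>0c \<psi>d \<psi>(2,3)]) auto
        also have "\<theta> t * ((\<integral>x. f t x * (\<eta> x - e) \<partial>I1) - - (\<integral>x. g t x * \<psi> x \<partial>I1)) =
          (\<integral>x. \<theta> t * (f t x * (\<eta> x - e)) + \<theta> t * (g t x * \<psi> x) \<partial>I1)"
          using f2 g2 by (simp add: distrib_left)
        finally show ?case by (simp add: mult.left_commute)
      qed
      note [measurable] = borel_measurable_continuous_onI[OF \<theta>c] borel_measurable_continuous_onI[OF \<eta>c] borel_measurable_continuous_onI[OF \<psi>c]
      have [measurable]: "M \<in> borel_measurable borel" using borel_measurable_integrable[OF Mi] by simp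
      have [measurable]: "(\<lambda>z. w (fst z) (snd z)) \<in> borel_measurable (borel \<Otimes>\<^sub>M borel)" unfolding w_def by measurable
      have "(\<lambda>t. \<integral>x. (w (fst (t, x)) (snd (t, x)) - M t) * (\<theta> t * \<eta> x) \<partial>I1) \<in> borel_measurable (JT T)"
        by measurable
      then show "(\<lambda>t. \<integral>x. (w t x - M t) * (\<theta> t * \<eta> x) \<partial>I1) \<in> borel_measurable (JT T)" by simp
      show "(\<lambda>t. \<integral>x. f t x * (\<theta> t * (\<eta> x - e)) + g t x * (\<theta> t * \<psi> x) \<partial>I1) \<in> borel_measurable (JT T)"
        by measurable
    qed
    also have "\<dots> = (\<integral>z. f (fst z) (snd z) * (\<theta> (fst z) * (\<eta> (snd z) - e)) + g (fst z) (snd z) * (\<theta> (fst z) * \<psi> (snd z)) \<partial>(JT T \<Otimes>\<^sub>M I1))"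
      using integral_fst'[OF Bochner_Integration.integrable_add[OF integrable_JI_bounded_mult[OF fi \<theta>c \<eta>0c] integrable_JI_bounded_mult[OF gi \<theta>c \<psi>c]]] by simp
    also have "\<dots> = 0"
      using dxw_product[OF T f g d \<theta> \<psi>(1)]
      by (subst Bochner_Integration.integral_add) (auto intro!: integrable_JI_bounded_mult fi gi \<theta>c \<eta>0c \<psi>c)
    finally show "(\<integral>z. (w (fst z) (snd z) - M (fst z)) * (\<theta> (fst z) * \<eta> (snd z)) \<partial>(JT T \<Otimes>\<^sub>M I1)) = 0" .
  qed
  with m0 show ?thesis
  proof eventually_elim
    case (elim t)
    then have "AE x in I1. f t x = M t + cum {0..1} (g t) x"
      by (auto elim!: eventually_mono simp: w_def)
    with elim show ?case by (auto simp: m_def)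
  qed
qed

section \<open>Weak derivatives in time and on the circle\<close>

lemma AE_JT_False: "T > 0 \<Longrightarrow> \<not> (AE t in JT T. False)"
proof
  assume "T > 0" "AE t in JT T. False"
  then have "emeasure (JT T) UNIV = 0" using AE_iff_measurable[of UNIV "JT T" "\<lambda>_. False"] by simp
  then show False using \<open>T > 0\<close> by (simp add: emeasure_lbon)
qed

text \<open>If every admissible \<theta> had zero integral, the constant \<open>1\<close> would be
  orthogonal to all tensor products and hence vanish by \<open>orth_JI\<close>. This avoids
  integrating a concrete cutoff.\<close>

lemma time_test_unit:
  assumes T: "T > 0"
  obtains \<theta> \<theta>' where "time_test T \<theta> \<theta>'" "(\<integral>t. \<theta> t \<partial>JT T) = 1"
proof -
  interpret pair_sigma_finite "JT T" I1 by (rule pair_JI)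
  have "\<exists>\<theta> \<theta>'. time_test T \<theta> \<theta>' \<and> (\<integral>t. \<theta> t \<partial>JT T) \<noteq> 0"
  proof (rule ccontr)
    assume *: "\<not> ?thesis"
    have i: "integrable (JT T \<Otimes>\<^sub>M I1) (\<lambda>z. 1 :: real)"
      by (intro integrable_JI_fst finite_measure.integrable_const finite_JT)
    have "AE t in JT T. AE x in I1. (1::real) = 0"
    proof (rule orth_JI[OF T i])
      fix \<theta> \<theta>' \<eta> \<eta>' assume \<theta>: "time_test T \<theta> \<theta>'" and \<eta>: "per_test \<eta> \<eta>'"
      have "(\<integral>z. 1 * (\<theta> (fst z) * \<eta> (snd z)) \<partial>(JT T \<Otimes>\<^sub>M I1)) = (\<integral>t. \<integral>x. \<theta> t * \<eta> x \<partial>I1 \<partial>JT T)"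
        using integral_fst'[OF integrable_JI_bounded_mult[OF i time_test_continuous[OF \<theta>] per_test_continuous[OF \<eta>]]] by simp
      also have "\<dots> = 0"
      proof -
        have "(\<integral>t. \<theta> t \<partial>JT T) = 0" using * \<theta> by blast
        then show ?thesis by simp
      qed
      finally show "(\<integral>z. 1 * (\<theta> (fst z) * \<eta> (snd z)) \<partial>(JT T \<Otimes>\<^sub>M I1)) = 0" .
    qed
    then show False using AE_JT_False[OF T] by (simp add: AE_I1_const)
  qed
  then obtain \<theta> \<theta>' where \<theta>: "time_test T \<theta> \<theta>'" and c: "(\<integral>t. \<theta> t \<partial>JT T) \<noteq> 0" by blast
  let ?c = "\<integral>t. \<theta> t \<partial>JT T"
  show ?thesis
  proof (rule that)
    show "time_test T (\<lambda>t. inverse ?c * \<theta> t) (\<lambda>t. inverse ?c * \<theta>' t)"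
      using \<theta> unfolding time_test_def by (fastforce intro!: DERIV_cmult continuous_intros)
    show "(\<integral>t. inverse ?c * \<theta> t \<partial>JT T) = 1" using c by simp
  qed
qed

text \<open>The zero integral is what lets the primitive return to \<open>0\<close> to the right of
  the support; on either side of the support it is constant by the mean value theorem.\<close>

lemma time_test_antiderivative:
  assumes \<theta>: "time_test T \<theta> \<theta>'" and 0: "(\<integral>t. \<theta> t \<partial>JT T) = 0" and T: "T > 0"
  obtains \<Theta> where "time_test T \<Theta> \<theta>" "\<Theta> 0 = 0" "\<Theta> T = 0"
proof -
  note c = time_test_continuous[OF \<theta>]
  obtain \<Theta> where d: "\<And>x. (\<Theta> has_real_derivative \<theta> x) (at x)" and z: "\<Theta> 0 = 0" using continuous_antiderivative[OF c] by blast
  have "cum {0<..<T} \<theta> T = \<Theta> T - \<Theta> 0"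
    by (rule cum_FTC[OF d c, where L = T]) (use T in \<open>auto simp: greaterThanLessThan_subseteq_atLeastAtMost_iff\<close>)
  moreover have "cum {0<..<T} \<theta> T = (\<integral>t. \<theta> t \<partial>JT T)"
    by (rule cum_eq_integral) (auto intro: test_measurable[OF \<theta>])
  ultimately have 1: "\<Theta> T = 0" using 0 z by simp
  obtain a b where ab: "0 < a" "b < T" "\<And>t. t \<notin> {a..b} \<Longrightarrow> \<theta> t = 0"
    using \<theta> unfolding time_test_def by blast
  have mvt: "\<Theta> s = \<Theta> t" if "s < t" "\<And>r. s < r \<Longrightarrow> r < t \<Longrightarrow> \<theta> r = 0" for s t
  proof -
    have "\<exists>z>s. z < t \<and> \<Theta> t - \<Theta> s = (t - s) * \<theta> z" by (rule MVT2[OF that(1)]) (rule d)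
    then obtain r where r: "s < r" "r < t" "\<Theta> t - \<Theta> s = (t - s) * \<theta> r" by blast
    then show ?thesis using that(2)[OF r(1,2)] by simp
  qed
  have "\<Theta> t = 0" if tt: "t \<notin> {a..b}" for t
  proof -
    consider "t < a" | "t > b" using tt by fastforce
    then show ?thesis
    proof cases
      case 1
      have "\<theta> r = 0" if "r < a" for r using ab(3)[of r] that by auto
      then show ?thesis using mvt[of t 0] mvt[of 0 t] z ab(1) 1 by (cases t "0::real" rule: linorder_cases) auto
    next
      case 2
      have "\<theta> r = 0" if "r > b" for r using ab(3)[of r] that by auto
      then show ?thesis using mvt[of t T] mvt[of T t] 1 ab(2) 2 \<open>\<Theta> T = 0\<close> by (cases t T rule: linorder_cases) auto
    qed
  qed
  then have "time_test T \<Theta> \<theta>" using d c ab(1,2) unfolding time_test_def by blast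
  then show ?thesis using that z 1 by blast
qed

lemma integrable_cum_t:
  assumes g: "sqi (JT T \<Otimes>\<^sub>M I1) (case_prod g)" and [measurable]: "case_prod g \<in> borel_measurable (borel \<Otimes>\<^sub>M borel)"
  shows "integrable (JT T \<Otimes>\<^sub>M I1) (\<lambda>z. cum {0<..<T} (\<lambda>s. g s (snd z)) (fst z))"
proof -
  interpret pair_sigma_finite "JT T" I1 by (rule pair_JI)
  have gi: "integrable (JT T \<Otimes>\<^sub>M I1) (\<lambda>(s, x). g s x)" by (rule sqi_JI_integrable[OF g])
  have gia: "integrable (JT T \<Otimes>\<^sub>M I1) (\<lambda>(s, x). \<bar>g s x\<bar>)" using integrable_abs[OF gi] by (simp add: split_beta')
  have [measurable]: "(\<lambda>z. cum {0<..<T} (\<lambda>s. g s (snd z)) (fst z)) \<in> borel_measurable (borel \<Otimes>\<^sub>M borel)"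
    using cum_measurable2[of "{0<..<T}" g borel] by (simp add: split_beta')
  show ?thesis
  proof (rule Bochner_Integration.integrable_bound)
    show "integrable (JT T \<Otimes>\<^sub>M I1) (\<lambda>z. \<integral>s. \<bar>g s (snd z)\<bar> \<partial>JT T)"
      using integrable_snd[OF gia] by (intro integrable_JI_snd) simp
    show "AE z in JT T \<Otimes>\<^sub>M I1. norm (cum {0<..<T} (\<lambda>s. g s (snd z)) (fst z)) \<le> norm (\<integral>s. \<bar>g s (snd z)\<bar> \<partial>JT T)"
    proof (rule AE_pair_measure)
      have "AE x in I1. \<forall>t. norm (cum {0<..<T} (\<lambda>s. g s x) t) \<le> norm (\<integral>s. \<bar>g s x\<bar> \<partial>JT T)"
        using AE_integrable_snd[OF gi]
      proof eventually_elim
        case (elim x)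
        have "\<bar>cum {0<..<T} (\<lambda>s. g s x) t\<bar> \<le> \<bar>\<integral>s. \<bar>g s x\<bar> \<partial>JT T\<bar>" for t
          using abs_cum_le[of "{0<..<T}" "\<lambda>s. g s x" t] elim by (auto intro: order_trans)
        then show ?case by simp
      qed
      then have "AE x in I1. norm (cum {0<..<T} (\<lambda>s. g s x) t) \<le> norm (\<integral>s. \<bar>g s x\<bar> \<partial>JT T)" for t
        by (rule eventually_mono) blast
      then show "AE t in JT T. AE x in I1. norm (cum {0<..<T} (\<lambda>s. g s (snd (t, x))) (fst (t, x))) \<le> norm (\<integral>s. \<bar>g s (snd (t, x))\<bar> \<partial>JT T)"
        by simp
    qed measurable
  qed measurable
qed

text \<open>Du Bois-Reymond in time. Subtracting a constant from \<theta> would destroy the compact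
  support, so a multiple of a fixed test function \<open>\<theta>0\<close> with unit integral is
  subtracted instead, and the integration constant \<open>a\<close> is the average of the remainder
  \<open>w\<close> with weight \<open>\<theta>0\<close>.\<close>

lemma dtw_AC:
  assumes T: "T > 0" and f: "L2Q T f" and g: "L2Q T g" and d: "dtw T f g"
  obtains a where "a \<in> borel_measurable borel" "AE t in JT T. AE x in I1. f t x = a x + cum {0<..<T} (\<lambda>s. g s x) t"
proof -
  interpret pair_sigma_finite "JT T" I1 by (rule pair_JI)
  have [measurable]: "case_prod f \<in> borel_measurable (borel \<Otimes>\<^sub>M borel)" "case_prod g \<in> borel_measurable (borel \<Otimes>\<^sub>M borel)"
    using f g by (auto simp: L2Q_iff)
  have fs: "sqi (JT T \<Otimes>\<^sub>M I1) (case_prod f)" and gs: "sqi (JT T \<Otimes>\<^sub>M I1) (case_prod g)"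
    using f g by (auto simp: L2Q_iff)
  have fi: "integrable (JT T \<Otimes>\<^sub>M I1) (\<lambda>z. f (fst z) (snd z))" and gi: "integrable (JT T \<Otimes>\<^sub>M I1) (\<lambda>z. g (fst z) (snd z))"
    using sqi_JI_integrable[OF fs] sqi_JI_integrable[OF gs] by (auto simp: split_beta')
  define w where "w t x = f t x - cum {0<..<T} (\<lambda>s. g s x) t" for t x
  have [measurable]: "(\<lambda>z. cum {0<..<T} (\<lambda>s. g s (snd z)) (fst z)) \<in> borel_measurable (borel \<Otimes>\<^sub>M borel)"
    using cum_measurable2[of "{0<..<T}" g borel] by (simp add: split_beta')
  have wi: "integrable (JT T \<Otimes>\<^sub>M I1) (\<lambda>z. w (fst z) (snd z))"
    unfolding w_def by (intro Bochner_Integration.integrable_diff fi integrable_cum_t[OF gs]) measurable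
  note swap_AE = AE_integrable_snd[of "\<lambda>t x. h (t, x)" for h, simplified]
  note swap_int = integral_snd[of "\<lambda>t x. h (t, x)" for h, simplified]
  obtain \<theta>0 \<theta>0' where \<theta>0: "time_test T \<theta>0 \<theta>0'" and one: "(\<integral>t. \<theta>0 t \<partial>JT T) = 1" by (rule time_test_unit[OF T])
  note \<theta>0c = time_test_continuous[OF \<theta>0]
  have w0i: "integrable (JT T \<Otimes>\<^sub>M I1) (\<lambda>z. w (fst z) (snd z) * (\<theta>0 (fst z) * 1))"
    by (rule integrable_JI_bounded_mult[OF wi \<theta>0c]) (rule continuous_on_const)
  define a where "a x = (\<integral>t. w t x * \<theta>0 t \<partial>JT T)" for x
  have ai: "integrable I1 a" unfolding a_def using integrable_snd[of "\<lambda>t x. w t x * \<theta>0 t"] w0i by (simp add: split_beta')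
  have \<theta>0i: "integrable (JT T) \<theta>0" by (rule sqi_imp_integrable[OF finite_JT sqi_continuous[OF \<theta>0c]]) auto
  have "AE t in JT T. AE x in I1. w t x - a x = 0"
  proof (rule orth_JI[OF T, of "\<lambda>z. w (fst z) (snd z) - a (snd z)", unfolded fst_conv snd_conv])
    show hi: "integrable (JT T \<Otimes>\<^sub>M I1) (\<lambda>z. w (fst z) (snd z) - a (snd z))"
      by (intro Bochner_Integration.integrable_diff wi integrable_JI_snd[OF ai])
    fix \<theta> \<theta>' \<eta> \<eta>' assume \<theta>: "time_test T \<theta> \<theta>'" and \<eta>: "per_test \<eta> \<eta>'"
    note \<theta>c = time_test_continuous[OF \<theta>] and \<eta>c = per_test_continuous[OF \<eta>]
    define e where "e = (\<integral>t. \<theta> t \<partial>JT T)"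
    have \<theta>i: "integrable (JT T) \<theta>" by (rule sqi_imp_integrable[OF finite_JT sqi_continuous[OF \<theta>c]]) auto
    define \<theta>1 where "\<theta>1 t = \<theta> t - e * \<theta>0 t" for t
    have \<theta>1c: "continuous_on UNIV \<theta>1" unfolding \<theta>1_def by (intro continuous_intros \<theta>c \<theta>0c)
    have \<theta>1t: "time_test T \<theta>1 (\<lambda>t. \<theta>' t - e * \<theta>0' t)"
    proof -
      obtain a b where ab: "0 < a" "b < T" "\<And>t. t \<notin> {a..b} \<Longrightarrow> \<theta> t = 0"
        using \<theta> unfolding time_test_def by blast
      obtain a' b' where ab': "0 < a'" "b' < T" "\<And>t. t \<notin> {a'..b'} \<Longrightarrow> \<theta>0 t = 0"
        using \<theta>0 unfolding time_test_def by blast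
      have "\<theta>1 t = 0" if "t \<notin> {min a a'..max b b'}" for t
      proof -
        have "t \<notin> {a..b}" "t \<notin> {a'..b'}" using that by (auto simp: min_def max_def split: if_splits)
        then show ?thesis using ab(3) ab'(3) by (simp add: \<theta>1_def)
      qed
      moreover have "0 < min a a'" "max b b' < T" using ab ab' by auto
      moreover have "\<forall>t. (\<theta>1 has_real_derivative \<theta>' t - e * \<theta>0' t) (at t)"
        unfolding \<theta>1_def[abs_def] using \<theta> \<theta>0 unfolding time_test_def by (auto intro!: DERIV_diff DERIV_cmult)
      moreover have "continuous_on UNIV (\<lambda>t. \<theta>' t - e * \<theta>0' t)"
        using \<theta> \<theta>0 unfolding time_test_def by (intro continuous_intros) auto
      ultimately show ?thesis unfolding time_test_def by blast
    qed
    have "(\<integral>t. \<theta>1 t \<partial>JT T) = 0" unfolding \<theta>1_def using \<theta>i \<theta>0i one by (simp add: e_def)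
    then obtain \<Theta> where \<Theta>: "time_test T \<Theta> \<theta>1" "\<Theta> 0 = 0" "\<Theta> T = 0" by (rule time_test_antiderivative[OF \<theta>1t _ T])
    note \<Theta>c = time_test_continuous[OF \<Theta>(1)]
    have \<Theta>d: "(\<Theta> has_real_derivative \<theta>1 x) (at x)" for x using \<Theta>(1) by (simp add: time_test_def)
    have c1: "continuous_on UNIV (\<lambda>x::real. 1::real)" by (rule continuous_on_const)
    have "(\<integral>z. (w (fst z) (snd z) - a (snd z)) * (\<theta> (fst z) * \<eta> (snd z)) \<partial>(JT T \<Otimes>\<^sub>M I1)) =
      (\<integral>x. \<integral>t. (w t x - a x) * (\<theta> t * \<eta> x) \<partial>JT T \<partial>I1)"
      using swap_int[OF integrable_JI_bounded_mult[OF hi \<theta>c \<eta>c]] by simp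
    also have "\<dots> = (\<integral>x. \<integral>t. f t x * (\<theta>1 t * \<eta> x) + g t x * (\<Theta> t * \<eta> x) \<partial>JT T \<partial>I1)"
    proof (rule integral_cong_AE)
      show "AE x in I1. (\<integral>t. (w t x - a x) * (\<theta> t * \<eta> x) \<partial>JT T) = (\<integral>t. f t x * (\<theta>1 t * \<eta> x) + g t x * (\<Theta> t * \<eta> x) \<partial>JT T)"
        using swap_AE[OF wi] swap_AE[OF gi]
          swap_AE[OF integrable_JI_bounded_mult[OF wi \<theta>c c1]]
          swap_AE[OF integrable_JI_bounded_mult[OF wi \<theta>0c c1]]
          swap_AE[OF integrable_JI_bounded_mult[OF fi \<theta>1c c1]]
          swap_AE[OF integrable_JI_bounded_mult[OF gi \<Theta>c c1]]
      proof eventually_elim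
        case (elim x)
        have w1: "integrable (JT T) (\<lambda>t. w t x)" and g1: "integrable (JT T) (\<lambda>t. g t x)"
          and w2: "integrable (JT T) (\<lambda>t. w t x * \<theta> t)" and w3: "integrable (JT T) (\<lambda>t. w t x * \<theta>0 t)"
          and f2: "integrable (JT T) (\<lambda>t. f t x * \<theta>1 t)"
          and g2: "integrable (JT T) (\<lambda>t. g t x * \<Theta> t)" using elim by simp_all
        have cm: "integrable (JT T) (\<lambda>t. \<theta>1 t * cum {0<..<T} (\<lambda>s. g s x) t)"
          by (rule integrable_mult_cum) (use g1 sqi_imp_integrable[OF finite_JT sqi_continuous[OF \<theta>1c]] in auto)
        have "(\<integral>t. (w t x - a x) * (\<theta> t * \<eta> x) \<partial>JT T) = (\<integral>t. \<eta> x * (w t x * \<theta> t) - \<eta> x * (a x * \<theta> t) \<partial>JT T)"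
          by (rule Bochner_Integration.integral_cong) (auto simp: algebra_simps)
        also have "\<dots> = \<eta> x * (\<integral>t. w t x * \<theta> t \<partial>JT T) - \<eta> x * (a x * e)"
          using w2 \<theta>i by (simp add: e_def)
        also have "\<dots> = \<eta> x * ((\<integral>t. w t x * \<theta> t \<partial>JT T) - (\<integral>t. e * (w t x * \<theta>0 t) \<partial>JT T))"
          by (simp add: a_def algebra_simps)
        also have "\<dots> = \<eta> x * (\<integral>t. w t x * \<theta> t - e * (w t x * \<theta>0 t) \<partial>JT T)"
          using w3 w2 by simp
        also have "(\<integral>t. w t x * \<theta> t - e * (w t x * \<theta>0 t) \<partial>JT T) = (\<integral>t. f t x * \<theta>1 t - \<theta>1 t * cum {0<..<T} (\<lambda>s. g s x) t \<partial>JT T)"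
          by (rule Bochner_Integration.integral_cong) (auto simp: w_def \<theta>1_def algebra_simps)
        also have "\<dots> = (\<integral>t. f t x * \<theta>1 t \<partial>JT T) - (\<integral>t. cum {0<..<T} (\<lambda>s. g s x) t * \<theta>1 t \<partial>JT T)"
          using Bochner_Integration.integral_diff[OF f2 cm] by (simp add: mult.commute)
        also have "(\<integral>t. cum {0<..<T} (\<lambda>s. g s x) t * \<theta>1 t \<partial>JT T) = - (\<integral>t. g t x * \<Theta> t \<partial>JT T)"
          by (rule integral_cum_parts[OF _ _ _ _ g1 \<theta>1c \<Theta>d \<Theta>(2,3)])
             (use T in \<open>auto simp: greaterThanLessThan_subseteq_atLeastAtMost_iff\<close>)
        also have "\<eta> x * ((\<integral>t. f t x * \<theta>1 t \<partial>JT T) - - (\<integral>t. g t x * \<Theta> t \<partial>JT T)) =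
          (\<integral>t. \<eta> x * (f t x * \<theta>1 t) + \<eta> x * (g t x * \<Theta> t) \<partial>JT T)"
          using f2 g2 by (simp add: distrib_left)
        finally show ?case by (simp add: mult_ac)
      qed
      note [measurable] = borel_measurable_continuous_onI[OF \<theta>c] borel_measurable_continuous_onI[OF \<eta>c] borel_measurable_continuous_onI[OF \<Theta>c]
        borel_measurable_continuous_onI[OF \<theta>1c]
      have [measurable]: "a \<in> borel_measurable borel" using borel_measurable_integrable[OF ai] by simp
      have [measurable]: "(\<lambda>z. w (fst z) (snd z)) \<in> borel_measurable (borel \<Otimes>\<^sub>M borel)" unfolding w_def by measurable
      have "(\<lambda>x. \<integral>t. (w (fst (t, x)) (snd (t, x)) - a x) * (\<theta> t * \<eta> x) \<partial>JT T) \<in> borel_measurable I1"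
        by measurable
      then show "(\<lambda>x. \<integral>t. (w t x - a x) * (\<theta> t * \<eta> x) \<partial>JT T) \<in> borel_measurable I1" by simp
      show "(\<lambda>x. \<integral>t. f t x * (\<theta>1 t * \<eta> x) + g t x * (\<Theta> t * \<eta> x) \<partial>JT T) \<in> borel_measurable I1"
        by measurable
    qed
    also have "\<dots> = (\<integral>z. f (fst z) (snd z) * (\<theta>1 (fst z) * \<eta> (snd z)) + g (fst z) (snd z) * (\<Theta> (fst z) * \<eta> (snd z)) \<partial>(JT T \<Otimes>\<^sub>M I1))"
      using swap_int[OF Bochner_Integration.integrable_add[OF integrable_JI_bounded_mult[OF fi \<theta>1c \<eta>c] integrable_JI_bounded_mult[OF gi \<Theta>c \<eta>c]]] by simp
    also have "\<dots> = 0"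
      using dtw_product[OF T f g d \<Theta>(1) \<eta>]
      by (subst Bochner_Integration.integral_add) (auto intro!: integrable_JI_bounded_mult fi gi \<Theta>c \<theta>1c \<eta>c)
    finally show "(\<integral>z. (w (fst z) (snd z) - a (snd z)) * (\<theta> (fst z) * \<eta> (snd z)) \<partial>(JT T \<Otimes>\<^sub>M I1)) = 0" .
  qed
  then have "AE t in JT T. AE x in I1. f t x = a x + cum {0<..<T} (\<lambda>s. g s x) t"
    by (rule eventually_mono) (auto elim!: eventually_mono simp: w_def)
  moreover have "a \<in> borel_measurable borel" using borel_measurable_integrable[OF ai] by simp
  ultimately show ?thesis using that by blast
qed

section \<open>Weak derivatives on the circle\<close>

lemma test_per_iff: "test_per \<psi> \<longleftrightarrow> per_test \<psi> (deriv \<psi>)"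
  by (simp add: test_per_def per_test_def DERIV_deriv_iff_real_differentiable)

lemma per_test_deriv: "per_test \<psi> \<eta> \<Longrightarrow> deriv \<psi> = \<eta> \<and> test_per \<psi>"
proof -
  assume p: "per_test \<psi> \<eta>"
  then have "deriv \<psi> x = \<eta> x" for x by (auto simp: per_test_def intro: DERIV_imp_deriv)
  then have "deriv \<psi> = \<eta>" by blast
  with p show ?thesis by (simp add: test_per_iff)
qed

lemma is_wderiv_iff:
  "is_wderiv f g \<longleftrightarrow> L2S f \<and> L2S g \<and> (\<forall>\<psi> \<eta>. per_test \<psi> \<eta> \<longrightarrow> (\<integral>x. f x * \<eta> x \<partial>I1) = - (\<integral>x. g x * \<psi> x \<partial>I1))"
proof -
  have "set_lebesgue_integral lborel {0..1} (\<lambda>x. f x * \<eta> x) = (\<integral>x. f x * \<eta> x \<partial>I1) \<and>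
     set_lebesgue_integral lborel {0..1} (\<lambda>x. g x * \<psi> x) = (\<integral>x. g x * \<psi> x \<partial>I1)"
    if "L2S f" "L2S g" "per_test \<psi> \<eta>" for \<psi> \<eta>
  proof -
    have [measurable]: "f \<in> borel_measurable borel" "g \<in> borel_measurable borel" using that by (auto simp: L2S_iff)
    note [measurable] = per_test_measurable[OF that(3)]
    show ?thesis by (simp add: integral_lbon)
  qed
  note eq = this
  show ?thesis
  proof
    assume *: "is_wderiv f g"
    then have L: "L2S f" "L2S g" by (auto simp: is_wderiv_def)
    have "(\<integral>x. f x * \<eta> x \<partial>I1) = - (\<integral>x. g x * \<psi> x \<partial>I1)" if p: "per_test \<psi> \<eta>" for \<psi> \<eta>
    proof -
      have d: "deriv \<psi> = \<eta>" and t: "test_per \<psi>" using per_test_deriv[OF p] by auto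
      show ?thesis using * t eq[OF L p] d by (auto simp: is_wderiv_def)
    qed
    with L show "L2S f \<and> L2S g \<and> (\<forall>\<psi> \<eta>. per_test \<psi> \<eta> \<longrightarrow> (\<integral>x. f x * \<eta> x \<partial>I1) = - (\<integral>x. g x * \<psi> x \<partial>I1))" by blast
  next
    assume *: "L2S f \<and> L2S g \<and> (\<forall>\<psi> \<eta>. per_test \<psi> \<eta> \<longrightarrow> (\<integral>x. f x * \<eta> x \<partial>I1) = - (\<integral>x. g x * \<psi> x \<partial>I1))"
    show "is_wderiv f g" unfolding is_wderiv_def
    proof (intro conjI allI impI)
      fix \<psi> assume "test_per \<psi>"
      then have p: "per_test \<psi> (deriv \<psi>)" by (simp add: test_per_iff)
      show "set_lebesgue_integral lborel {0..1} (\<lambda>x. f x * deriv \<psi> x) = - set_lebesgue_integral lborel {0..1} (\<lambda>x. g x * \<psi> x)"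
        using * eq[OF _ _ p] p by simp
    qed (use * in auto)
  qed
qed

lemma is_wderivI:
  assumes f: "L2S f" and g: "L2S g" and 0: "(\<integral>x. g x \<partial>I1) = 0" and AC: "AE x in I1. f x = c + cum {0..1} g x"
  shows "is_wderiv f g"
  unfolding is_wderiv_iff
proof (intro conjI allI impI f g)
  fix \<psi> \<eta> assume \<psi>: "per_test \<psi> \<eta>"
  have [measurable]: "f \<in> borel_measurable borel" "g \<in> borel_measurable borel" using f g by (auto simp: L2S_iff)
  note [measurable] = per_test_measurable[OF \<psi>]
  have gi: "integrable I1 g" using g by (auto simp: L2S_iff intro: sqi_imp_integrable[OF finite_I1])
  have d: "\<And>x. (\<psi> has_real_derivative \<eta> x) (at x)" and \<eta>c: "continuous_on UNIV \<eta>"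
    using \<psi> by (auto simp: per_test_def)
  note \<psi>c = per_test_continuous[OF \<psi>]
  have \<eta>i: "integrable I1 \<eta>" by (rule sqi_imp_integrable[OF finite_I1 sqi_continuous[OF \<eta>c]]) auto
  have \<psi>i: "sqi I1 \<psi>" by (rule sqi_continuous[OF \<psi>c]) auto
  have \<psi>1: "\<psi> 1 = \<psi> 0" using \<psi> by (auto simp: per_test_def per1_def dest: spec[of _ 0])
  have "cum {0..1} \<eta> 1 = \<psi> 1 - \<psi> 0" by (rule cum_FTC[OF d \<eta>c, where L = 1]) auto
  moreover have "cum {0..1} \<eta> 1 = (\<integral>x. \<eta> x \<partial>I1)" by (rule cum_eq_integral) auto
  ultimately have \<eta>0: "(\<integral>x. \<eta> x \<partial>I1) = 0" using \<psi>1 by simp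
  have "(\<integral>x. f x * \<eta> x \<partial>I1) = (\<integral>x. c * \<eta> x + \<eta> x * cum {0..1} g x \<partial>I1)"
    by (rule integral_cong_AE) (use AC in \<open>auto elim!: eventually_mono simp: algebra_simps\<close>)
  also have "\<dots> = c * (\<integral>x. \<eta> x \<partial>I1) + (\<integral>x. \<eta> x * cum {0..1} g x \<partial>I1)"
    using \<eta>i integrable_mult_cum[OF _ \<eta>i gi] by simp
  also have "\<dots> = (\<integral>x. cum {0..1} g x * \<eta> x \<partial>I1)" using \<eta>0 by (simp add: mult.commute)
  \<comment> \<open>\<open>\<psi> - \<psi> 0\<close> vanishes at both ends, as
    \<open>integral_cum_parts\<close> requires; the constant drops out because \<open>g\<close> has
    mean zero.\<close>
  also have "\<dots> = - (\<integral>x. g x * (\<psi> x - \<psi> 0) \<partial>I1)"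
    by (rule integral_cum_parts[of "{0..1}" 1 g \<eta> "\<lambda>x. \<psi> x - \<psi> 0", OF _ _ _ _ gi \<eta>c]) (use \<psi>1 in \<open>auto intro!: derivative_eq_intros d\<close>)
  also have "(\<integral>x. g x * (\<psi> x - \<psi> 0) \<partial>I1) = (\<integral>x. g x * \<psi> x \<partial>I1) - (\<integral>x. g x * \<psi> 0 \<partial>I1)"
    using sqi_mult[OF _ \<psi>i, of g] g gi by (subst Bochner_Integration.integral_diff[symmetric]) (auto simp: L2S_iff algebra_simps)
  also have "\<dots> = (\<integral>x. g x * \<psi> x \<partial>I1)" using 0 by simp
  finally show "(\<integral>x. f x * \<eta> x \<partial>I1) = - (\<integral>x. g x * \<psi> x \<partial>I1)" .
qed

text \<open>Slices of a space-time test function are periodic test functions, so a weak derivative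
  on the circle is a time-independent weak derivative on the cylinder. In this way the results on
  the cylinder carry over to the circle.\<close>

lemma dxw_const:
  assumes w: "is_wderiv f g"
  shows "dxw T (\<lambda>_. f) (\<lambda>_. g)"
  unfolding dxw_def
proof (intro allI impI)
  interpret pair_sigma_finite "JT T" I1 by (rule pair_JI)
  fix \<psi> pt px assume st: "st_test T \<psi> pt px"
  have L: "L2S f" "L2S g" using w by (auto simp: is_wderiv_iff)
  have [measurable]: "f \<in> borel_measurable borel" "g \<in> borel_measurable borel" using L by (auto simp: L2S_iff)
  have fi: "integrable I1 f" "integrable I1 g" using L by (auto simp: L2S_iff intro: sqi_imp_integrable[OF finite_I1])
  have d: "(\<psi> has_derivative (\<lambda>h. pt p * fst h + px p * snd h)) (at p)" for p
    using st unfolding st_test_def by blast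
  have pxc: "continuous_on UNIV px" using st by (simp add: st_test_def)
  have \<psi>c: "continuous_on UNIV \<psi>" using d by (meson continuous_at_imp_continuous_on has_derivative_continuous)
  have i: "integrable (JT T \<Otimes>\<^sub>M I1) (\<lambda>z. f (snd z) * h z)" if "continuous_on UNIV h" "integrable I1 f" for f :: "real \<Rightarrow> real" and h :: "real \<times> real \<Rightarrow> real"
  proof -
    have "compact (h ` ({0..T} \<times> {0..1}))"
      by (intro compact_continuous_image continuous_on_subset[OF that(1)] compact_Times) auto
    then obtain B where B: "\<And>z. z \<in> {0..T} \<times> {0..1} \<Longrightarrow> \<bar>h z\<bar> \<le> B"
      using compact_imp_bounded bounded_iff by (metis imageI real_norm_def)
    show ?thesis
    proof (rule integrable_bounded_mult[OF integrable_JI_snd[OF that(2)], of _ _ B])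
      show "h \<in> borel_measurable (JT T \<Otimes>\<^sub>M I1)"
        using borel_measurable_continuous_onI[OF that(1)] by (simp add: measurable_cong_sets[OF sets_JI refl] borel_prod)
      show "AE z in JT T \<Otimes>\<^sub>M I1. \<bar>h z\<bar> \<le> B"
        unfolding JI_eq[symmetric] AE_lbon[OF cylinder_borel] using B by (intro always_eventually) auto
    qed
  qed
  have [measurable]: "px \<in> borel_measurable (borel \<Otimes>\<^sub>M borel)" "\<psi> \<in> borel_measurable (borel \<Otimes>\<^sub>M borel)"
    using borel_measurable_continuous_onI[OF pxc] borel_measurable_continuous_onI[OF \<psi>c] by (simp_all add: borel_prod)
  have "per_test (\<lambda>x. \<psi> (t, x)) (\<lambda>x. px (t, x))" for t
    unfolding per_test_def
  proof (intro conjI allI)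
    fix x
    have "((\<lambda>x. \<psi> (t, x)) has_derivative (\<lambda>h. pt (t, x) * fst (0, h) + px (t, x) * snd (0, h))) (at x)"
    proof -
      have 1: "((\<lambda>x. (t, x)) has_derivative (\<lambda>h. (0, h))) (at x)" by (auto intro!: derivative_eq_intros)
      from has_derivative_compose[OF 1 d[of "(t, x)"]] show ?thesis by simp
    qed
    then show "((\<lambda>x. \<psi> (t, x)) has_real_derivative px (t, x)) (at x)" by (simp add: has_field_derivative_def)
    show "continuous_on UNIV (\<lambda>x. px (t, x))" by (rule continuous_on_compose2[OF pxc]) (auto intro!: continuous_intros)
    show "per1 (\<lambda>x. \<psi> (t, x))" using st by (simp add: st_test_def per1_def)
  qed
  then have e: "(\<integral>x. f x * px (t, x) \<partial>I1) = - (\<integral>x. g x * \<psi> (t, x) \<partial>I1)" for t using w by (simp add: is_wderiv_iff)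
  have "(\<integral>z. f (snd z) * px z \<partial>(JT T \<Otimes>\<^sub>M I1)) = - (\<integral>z. g (snd z) * \<psi> z \<partial>(JT T \<Otimes>\<^sub>M I1))"
    using integral_fst'[OF i[OF pxc fi(1)]] integral_fst'[OF i[OF \<psi>c fi(2)]] e by simp
  then show "set_lebesgue_integral lborel ({0<..<T} \<times> {0..1}) (\<lambda>(t, x). f x * px (t, x))
      = - set_lebesgue_integral lborel ({0<..<T} \<times> {0..1}) (\<lambda>(t, x). g x * \<psi> (t, x))"
    by (simp add: integral_JI)
qed

lemma L2Q_const:
  assumes "L2S f" shows "L2Q T (\<lambda>_. f)"
proof -
  have [measurable]: "f \<in> borel_measurable borel" using assms by (auto simp: L2S_iff)
  show ?thesis using integrable_JI_snd[of "\<lambda>x. (f x)\<^sup>2" T] assms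
    by (auto simp: L2Q_iff L2S_iff sqi_def split_beta' measurable_cong_sets[OF sets_JI refl])
qed

text \<open>\<open>dxw_slices\<close> is applied to functions constant in time; its conclusion then
  does not involve \<open>t\<close>, so holding for almost every \<open>t\<close> means
  holding.\<close>

lemma is_wderivD:
  assumes w: "is_wderiv f g"
  obtains c where "(\<integral>x. g x \<partial>I1) = 0" "AE x in I1. f x = c + cum {0..1} g x"
proof -
  have L: "L2S f" "L2S g" using w by (auto simp: is_wderiv_iff)
  have "AE t in JT 1. (\<integral>x. g x \<partial>I1) = 0 \<and> (\<exists>c. AE x in I1. f x = c + cum {0..1} g x)"
    by (rule dxw_slices[OF _ L2Q_const[OF L(1)] L2Q_const[OF L(2)] dxw_const[OF w]]) simp
  then have "(\<integral>x. g x \<partial>I1) = 0 \<and> (\<exists>c. AE x in I1. f x = c + cum {0..1} g x)"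
  proof (rule contrapos_pp)
    assume n: "\<not> ?thesis"
    show "\<not> (AE t in JT 1. (\<integral>x. g x \<partial>I1) = 0 \<and> (\<exists>c. AE x in I1. f x = c + cum {0..1} g x))"
      using n AE_JT_False[of 1] by (auto simp only: simp_thms)
  qed
  then show ?thesis using that by blast
qed

lemma dxw_slices_wderiv:
  assumes T: "T > 0" and f: "L2Q T f" and g: "L2Q T g" and d: "dxw T f g"
  shows "AE t in JT T. is_wderiv (f t) (g t)"
  using dxw_slices[OF assms] L2Q_slice[OF f] L2Q_slice[OF g]
  by eventually_elim (auto intro: is_wderivI)

lemma L2S_lin:
  assumes "L2S f" "L2S g" shows "L2S (\<lambda>x. a * f x + b * g x)"
  using assms by (auto simp: L2S_iff per1_def intro!: sqi_add sqi_cmult)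

lemma L2S_sqi: "L2S f \<Longrightarrow> sqi I1 f"
  by (simp add: L2S_iff)

lemma L2S_integrable: "L2S f \<Longrightarrow> integrable I1 f"
  by (rule sqi_imp_integrable[OF finite_I1 L2S_sqi])

lemma L2S_measurable: "L2S f \<Longrightarrow> f \<in> borel_measurable borel"
  by (simp add: L2S_iff)

lemma per_test_sqi: "per_test \<psi> \<eta> \<Longrightarrow> sqi I1 \<psi>" "per_test \<psi> \<eta> \<Longrightarrow> sqi I1 \<eta>"
  using sqi_continuous[OF per_test_continuous, of _ _ "{0..1}"] sqi_continuous[of _ "{0..1}"]
  by (auto simp: per_test_def)

lemma is_wderiv_L2S: "is_wderiv f g \<Longrightarrow> L2S f" "is_wderiv f g \<Longrightarrow> L2S g"
  by (auto simp: is_wderiv_iff)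

lemma is_wderiv_test: "is_wderiv f g \<Longrightarrow> per_test \<psi> \<eta> \<Longrightarrow> (\<integral>x. f x * \<eta> x \<partial>I1) = - (\<integral>x. g x * \<psi> x \<partial>I1)"
  by (auto simp: is_wderiv_iff)

lemma is_wderiv_lin:
  assumes 1: "is_wderiv f1 g1" and 2: "is_wderiv f2 g2"
  shows "is_wderiv (\<lambda>x. a * f1 x + b * f2 x) (\<lambda>x. a * g1 x + b * g2 x)"
  unfolding is_wderiv_iff
proof (intro conjI allI impI L2S_lin is_wderiv_L2S[OF 1] is_wderiv_L2S[OF 2])
  fix \<psi> \<eta> assume p: "per_test \<psi> \<eta>"
  note L = is_wderiv_L2S[OF 1, THEN L2S_sqi] is_wderiv_L2S[OF 2, THEN L2S_sqi]
  have i: "integrable I1 (\<lambda>x. f1 x * \<eta> x)" "integrable I1 (\<lambda>x. f2 x * \<eta> x)" "integrable I1 (\<lambda>x. g1 x * \<psi> x)" "integrable I1 (\<lambda>x. g2 x * \<psi> x)"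
    using L per_test_sqi[OF p] by (auto intro: sqi_mult)
  show "(\<integral>x. (a * f1 x + b * f2 x) * \<eta> x \<partial>I1) = - (\<integral>x. (a * g1 x + b * g2 x) * \<psi> x \<partial>I1)"
    using i is_wderiv_test[OF 1 p] is_wderiv_test[OF 2 p] by (simp add: distrib_right mult.assoc)
qed

lemma is_wderiv_cong:
  assumes w: "is_wderiv f g" and L: "L2S f'" "L2S g'" and e: "AE x in I1. f x = f' x" "AE x in I1. g x = g' x"
  shows "is_wderiv f' g'"
  unfolding is_wderiv_iff
proof (intro conjI allI impI L)
  fix \<psi> \<eta> assume p: "per_test \<psi> \<eta>"
  note [measurable] = per_test_measurable[OF p] L[THEN L2S_measurable] is_wderiv_L2S[OF w, THEN L2S_measurable]
  have "(\<integral>x. f' x * \<eta> x \<partial>I1) = (\<integral>x. f x * \<eta> x \<partial>I1)"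
    by (rule integral_cong_AE) (use e in \<open>auto elim: eventually_mono\<close>)
  moreover have "(\<integral>x. g' x * \<psi> x \<partial>I1) = (\<integral>x. g x * \<psi> x \<partial>I1)"
    by (rule integral_cong_AE) (use e in \<open>auto elim: eventually_mono\<close>)
  ultimately show "(\<integral>x. f' x * \<eta> x \<partial>I1) = - (\<integral>x. g' x * \<psi> x \<partial>I1)" using is_wderiv_test[OF w p] by simp
qed

text \<open>The difference of the two derivatives is orthogonal to every periodic test function;
  \<open>orth_JI\<close> is applied to it as a function constant in time.\<close>

lemma is_wderiv_uniq:
  assumes 1: "is_wderiv f g" and 2: "is_wderiv f' g'" and e: "AE x in I1. f x = f' x"
  shows "AE x in I1. g x = g' x"
proof -
  interpret pair_sigma_finite "JT 1" I1 by (rule pair_JI)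
  have 3: "is_wderiv f g'"
    by (rule is_wderiv_cong[OF 2 is_wderiv_L2S(1)[OF 1] is_wderiv_L2S(2)[OF 2]]) (use e in \<open>auto elim: eventually_mono\<close>)
  let ?h = "\<lambda>x. 1 * g x + (-1) * g' x"
  have L: "L2S ?h" by (rule L2S_lin) (use 1 3 is_wderiv_L2S in auto)
  have hi: "integrable (JT 1 \<Otimes>\<^sub>M I1) (\<lambda>z. ?h (snd z))" by (rule integrable_JI_snd[OF L2S_integrable[OF L]])
  have "AE t in JT 1. AE x in I1. ?h x = 0"
  proof (rule orth_JI[of 1 "\<lambda>z. ?h (snd z)", unfolded snd_conv, OF _ hi])
    fix \<theta> \<theta>' \<eta> \<eta>' assume \<theta>: "time_test 1 \<theta> \<theta>'" and \<eta>: "per_test \<eta> \<eta>'"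
    have i: "integrable I1 (\<lambda>x. g x * \<eta> x)" "integrable I1 (\<lambda>x. g' x * \<eta> x)"
      using is_wderiv_L2S[OF 1] is_wderiv_L2S[OF 3] per_test_sqi[OF \<eta>] by (auto intro: sqi_mult L2S_sqi)
    have "(\<integral>x. ?h x * \<eta> x \<partial>I1) = (\<integral>x. g x * \<eta> x \<partial>I1) - (\<integral>x. g' x * \<eta> x \<partial>I1)"
      using i by (simp add: left_diff_distrib)
    also have "\<dots> = 0" using is_wderiv_test[OF 1 \<eta>] is_wderiv_test[OF 3 \<eta>] by simp
    finally have 0: "(\<integral>x. ?h x * \<eta> x \<partial>I1) = 0" .
    have "(\<integral>z. ?h (snd z) * (\<theta> (fst z) * \<eta> (snd z)) \<partial>(JT 1 \<Otimes>\<^sub>M I1)) = (\<integral>t. \<integral>x. \<theta> t * (?h x * \<eta> x) \<partial>I1 \<partial>JT 1)"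
      using integral_fst'[OF integrable_JI_bounded_mult[OF hi time_test_continuous[OF \<theta>] per_test_continuous[OF \<eta>]]]
      by (simp add: mult.left_commute)
    also have "\<dots> = 0" unfolding integral_mult_right_zero 0 by simp
    finally show "(\<integral>z. ?h (snd z) * (\<theta> (fst z) * \<eta> (snd z)) \<partial>(JT 1 \<Otimes>\<^sub>M I1)) = 0" .
  qed simp
  then have "AE x in I1. ?h x = 0"
    by (rule contrapos_pp) (use AE_JT_False[of 1] in \<open>auto simp only: simp_thms\<close>)
  then show ?thesis by (auto elim: eventually_mono)
qed

text \<open>Neither factor is a test function. Both are written as a constant plus a primitive,
  \<open>cum_product\<close> is evaluated at \<open>1\<close>, and the constants drop out because
  both derivatives have mean zero.\<close>

lemma is_wderiv_parts:
  assumes 1: "is_wderiv f f'" and 2: "is_wderiv g g'"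
  shows "(\<integral>x. f x * g' x \<partial>I1) = - (\<integral>x. f' x * g x \<partial>I1)"
proof -
  obtain c where c: "(\<integral>x. f' x \<partial>I1) = 0" "AE x in I1. f x = c + cum {0..1} f' x" by (rule is_wderivD[OF 1])
  obtain d where d: "(\<integral>x. g' x \<partial>I1) = 0" "AE x in I1. g x = d + cum {0..1} g' x" by (rule is_wderivD[OF 2])
  have f'i: "integrable I1 f'" and g'i: "integrable I1 g'" using 1 2 by (auto intro: L2S_integrable is_wderiv_L2S)
  note [measurable] = is_wderiv_L2S[OF 1, THEN L2S_measurable] is_wderiv_L2S[OF 2, THEN L2S_measurable]
  note m1 = integrable_mult_cum[OF borel_closed[OF closed_atLeastAtMost] g'i f'i] and m2 = integrable_mult_cum[OF borel_closed[OF closed_atLeastAtMost] f'i g'i]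
  have "0 = cum {0..1} f' 1 * cum {0..1} g' 1" using cum_eq_integral[of "{0..1}" 1 f'] c(1) by simp
  also have "\<dots> = cum {0..1} (\<lambda>s. f' s * cum {0..1} g' s + g' s * cum {0..1} f' s) 1"
    by (rule cum_product) (use f'i g'i in auto)
  also have "\<dots> = (\<integral>s. f' s * cum {0..1} g' s + g' s * cum {0..1} f' s \<partial>I1)"
    by (rule cum_eq_integral) auto
  also have "\<dots> = (\<integral>s. f' s * cum {0..1} g' s \<partial>I1) + (\<integral>s. g' s * cum {0..1} f' s \<partial>I1)"
    using m1 m2 by simp
  finally have 0: "(\<integral>s. g' s * cum {0..1} f' s \<partial>I1) = - (\<integral>s. f' s * cum {0..1} g' s \<partial>I1)" by simp
  have "(\<integral>x. f x * g' x \<partial>I1) = (\<integral>x. c * g' x + g' x * cum {0..1} f' x \<partial>I1)"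
    by (rule integral_cong_AE) (use c(2) in \<open>auto elim!: eventually_mono simp: algebra_simps\<close>)
  also have "\<dots> = (\<integral>x. g' x * cum {0..1} f' x \<partial>I1)" using g'i m1 d(1) by simp
  also have "\<dots> = - (\<integral>s. d * f' s + f' s * cum {0..1} g' s \<partial>I1)" unfolding 0 using f'i m2 c(1) by simp
  also have "(\<integral>s. d * f' s + f' s * cum {0..1} g' s \<partial>I1) = (\<integral>x. f' x * g x \<partial>I1)"
    by (rule integral_cong_AE) (use d(2) in \<open>auto elim!: eventually_mono simp: algebra_simps\<close>)
  finally show ?thesis .
qed

lemma n2_integral_le:
  assumes "sqi I1 f" shows "(\<integral>x. \<bar>f x\<bar> \<partial>I1) \<le> n2 I1 f"
proof -
  have s: "sqi I1 (\<lambda>x. \<bar>f x\<bar>)" using assms by (rule sqi_bound) (use assms in \<open>auto simp: sqi_def\<close>)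
  have "n2 I1 (\<lambda>x. \<bar>f x\<bar>) = n2 I1 f" "n2 I1 (\<lambda>x. 1) = 1" by (auto simp: n2_def measure_lbon)
  then show ?thesis using n2_Cauchy_Schwarz[OF s sqi_const[OF finite_I1, of 1]] by simp
qed

lemma cum_diff:
  assumes A: "A \<in> sets borel" and g: "integrable (lbon A) g" and "x \<le> y"
  shows "cum A g y - cum A g x = (\<integral>s. indicator {x<..y} s * g s \<partial>lbon A)"
proof -
  have "cum A g y - cum A g x = (\<integral>s. indicator {..y} s * g s - indicator {..x} s * g s \<partial>lbon A)"
    unfolding cum_def using g by (intro Bochner_Integration.integral_diff[symmetric] integrable_ind_mult) auto
  also have "\<dots> = (\<integral>s. indicator {x<..y} s * g s \<partial>lbon A)"
    by (rule Bochner_Integration.integral_cong) (use \<open>x \<le> y\<close> in \<open>auto simp: indicator_def\<close>)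
  finally show ?thesis .
qed

lemma abs_ind_integral_le:
  assumes g: "integrable M (g :: _ \<Rightarrow> real)" and A: "A \<in> sets M"
  shows "\<bar>\<integral>s. indicator A s * g s \<partial>M\<bar> \<le> (\<integral>s. indicator A s * \<bar>g s\<bar> \<partial>M)"
    and "(\<integral>s. indicator A s * \<bar>g s\<bar> \<partial>M) \<le> (\<integral>s. \<bar>g s\<bar> \<partial>M)"
proof -
  have "\<bar>\<integral>s. indicator A s * g s \<partial>M\<bar> \<le> (\<integral>s. \<bar>indicator A s * g s\<bar> \<partial>M)" by (rule integral_abs_bound)
  then show "\<bar>\<integral>s. indicator A s * g s \<partial>M\<bar> \<le> (\<integral>s. indicator A s * \<bar>g s\<bar> \<partial>M)" by (simp add: abs_mult)
  show "(\<integral>s. indicator A s * \<bar>g s\<bar> \<partial>M) \<le> (\<integral>s. \<bar>g s\<bar> \<partial>M)"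
    by (rule integral_mono, intro integrable_ind_mult integrable_abs g A, intro integrable_abs g) (simp add: indicator_def)
qed

lemma abs_cum_diff_le:
  assumes A: "A \<in> sets borel" and g: "integrable (lbon A) g"
  shows "\<bar>cum A g y - cum A g x\<bar> \<le> (\<integral>s. \<bar>g s\<bar> \<partial>lbon A)"
proof -
  have *: "\<bar>cum A g y - cum A g x\<bar> \<le> (\<integral>s. \<bar>g s\<bar> \<partial>lbon A)" if "x \<le> y" for x y
    unfolding cum_diff[OF A g that] using abs_ind_integral_le[OF g, of "{x<..y}"] by simp
  show ?thesis using *[of x y] *[of y x] by (cases x y rule: linorder_le_cases) (auto simp: abs_minus_commute)
qed

text \<open>Two values of \<open>f\<close> differ by at most the \<open>L^1\<close> norm of
  \<open>g\<close>; averaging over the second point brings in the mean.\<close>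

lemma is_wderiv_sup:
  assumes w: "is_wderiv f g"
  shows "AE x in I1. \<bar>f x\<bar> \<le> \<bar>\<integral>y. f y \<partial>I1\<bar> + n2 I1 g"
proof -
  obtain c where c: "AE x in I1. f x = c + cum {0..1} g x" by (rule is_wderivD[OF w])
  have fi: "integrable I1 f" and gi: "integrable I1 g" and gs: "sqi I1 g" using w by (auto intro: L2S_integrable L2S_sqi is_wderiv_L2S)
  from c show ?thesis
  proof (eventually_elim)
    case (elim x)
    have "\<bar>\<integral>y. f x - f y \<partial>I1\<bar> \<le> (\<integral>y. \<bar>f x - f y\<bar> \<partial>I1)" by (rule integral_abs_bound)
    also have "\<dots> \<le> (\<integral>y. n2 I1 g \<partial>I1)"
    proof (rule integral_mono_AE)
      show "AE y in I1. \<bar>f x - f y\<bar> \<le> n2 I1 g"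
        using c
      proof eventually_elim
        case (elim y)
        have "\<bar>f x - f y\<bar> \<le> (\<integral>s. \<bar>g s\<bar> \<partial>I1)" using abs_cum_diff_le[OF _ gi, of x y] elim \<open>f x = _\<close> by simp
        then show ?case using n2_integral_le[OF gs] by linarith
      qed
    qed (intro integrable_abs Bochner_Integration.integrable_diff fi finite_measure.integrable_const[OF finite_I1])+
    also have "\<dots> = n2 I1 g" by (rule integral_I1_const)
    finally have "\<bar>\<integral>y. f x - f y \<partial>I1\<bar> \<le> n2 I1 g" .
    moreover have "(\<integral>y. f x - f y \<partial>I1) = f x - (\<integral>y. f y \<partial>I1)"
      using Bochner_Integration.integral_diff[OF finite_measure.integrable_const[OF finite_I1, of "f x"] fi] unfolding integral_I1_const .
    ultimately show ?case by linarith
  qed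
qed

lemma is_wderiv_mean0: "is_wderiv f g \<Longrightarrow> (\<integral>x. g x \<partial>I1) = 0"
  using is_wderivD by blast

lemma n2_le_integral: "sqi I1 f \<Longrightarrow> \<bar>\<integral>x. f x \<partial>I1\<bar> \<le> n2 I1 f"
  using n2_integral_le[of f] integral_abs_bound[of I1 f] by linarith

section \<open>Continuity of primitives and the chain rule\<close>

lemma cum_continuous:
  assumes A [measurable]: "A \<in> sets borel" and g: "integrable (lbon A) g"
  shows "continuous_on UNIV (cum A g)"
proof (rule continuous_at_imp_continuous_on, intro ballI)
  fix x
  note [measurable] = borel_measurable_integrable[OF g, simplified]
  show "isCont (cum A g) x"
    unfolding continuous_at_sequentially o_def
  proof (intro allI impI)
    fix u :: "nat \<Rightarrow> real" assume u: "u \<longlonglongrightarrow> x"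
    show "(\<lambda>n. cum A g (u n)) \<longlonglongrightarrow> cum A g x"
      unfolding cum_def
    proof (rule integral_dominated_convergence)
      show "integrable (lbon A) (\<lambda>s. \<bar>g s\<bar>)" using g by simp
      show "AE s in lbon A. (\<lambda>n. indicator {..u n} s * g s) \<longlonglongrightarrow> indicator {..x} s * g s"
        using AE_lbon_singleton[OF A, of x]
      proof eventually_elim
        case (elim s)
        have "eventually (\<lambda>n. indicator {..u n} s * g s = indicator {..x} s * g s) sequentially"
        proof (cases "s < x")
          case True
          have "eventually (\<lambda>n. s < u n) sequentially" using order_tendstoD(1)[OF u True] .
          then show ?thesis by eventually_elim (use True in \<open>auto simp: indicator_def\<close>)
        next
          case False
          then have "x < s" using elim by auto
          then have "eventually (\<lambda>n. u n < s) sequentially" using order_tendstoD(2)[OF u] by blast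
          then show ?thesis by eventually_elim (use \<open>x < s\<close> in \<open>auto simp: indicator_def\<close>)
        qed
        then show ?case by (rule tendsto_eventually)
      qed
    qed (auto simp: indicator_def)
  qed
qed

text \<open>Summing over a fine partition telescopes and bounds the total change of \<open>D\<close>
  by \<open>e (G x - G 0)\<close>, for every \<open>e\<close>. This takes the place of an
  almost-everywhere differentiation argument for absolutely continuous functions.\<close>

lemma const_of_small_increments:
  fixes D G :: "real \<Rightarrow> real"
  assumes "\<And>e. e > 0 \<Longrightarrow> \<exists>\<delta>>0. \<forall>a b. 0 \<le> a \<longrightarrow> a \<le> b \<longrightarrow> b \<le> 1 \<longrightarrow> b - a < \<delta> \<longrightarrow> \<bar>D b - D a\<bar> \<le> e * (G b - G a)"
    and x: "0 \<le> x" "x \<le> 1"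
  shows "D x = D 0"
proof -
  have "\<bar>D x - D 0\<bar> \<le> e * (G x - G 0)" if "e > 0" for e
  proof -
    from assms(1)[OF that] obtain \<delta> where \<delta>: "\<delta> > 0"
      "\<And>a b. 0 \<le> a \<Longrightarrow> a \<le> b \<Longrightarrow> b \<le> 1 \<Longrightarrow> b - a < \<delta> \<Longrightarrow> \<bar>D b - D a\<bar> \<le> e * (G b - G a)" by blast
    obtain n where n: "real n > x / \<delta>" using reals_Archimedean2 by blast
    then have n0: "n > 0" using x \<delta>(1) by (metis divide_nonneg_pos gr0I not_less of_nat_0)
    define y where "y i = real i * (x / real n)" for i
    have yn: "y n = x" "y 0 = 0" using n0 by (auto simp: y_def)
    have step: "\<bar>D (y (Suc i)) - D (y i)\<bar> \<le> e * (G (y (Suc i)) - G (y i))" if "i < n" for i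
    proof (rule \<delta>(2))
      show "0 \<le> y i" using x by (simp add: y_def)
      show "y i \<le> y (Suc i)" using x by (simp add: y_def divide_right_mono mult_right_mono)
      have "y (Suc i) \<le> y n" unfolding y_def using that x by (intro mult_right_mono) auto
      then show "y (Suc i) \<le> 1" using yn x by simp
      have "y (Suc i) - y i = x / real n" by (simp add: y_def distrib_right add_divide_distrib)
      also have "\<dots> < \<delta>" using n n0 \<delta>(1) by (simp add: field_simps)
      finally show "y (Suc i) - y i < \<delta>" .
    qed
    have "\<bar>D (y n) - D (y 0)\<bar> = \<bar>\<Sum>i<n. D (y (Suc i)) - D (y i)\<bar>"
      by (simp add: sum_lessThan_telescope[of "\<lambda>i. D (y i)"])
    also have "\<dots> \<le> (\<Sum>i<n. \<bar>D (y (Suc i)) - D (y i)\<bar>)" by (rule sum_abs)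
    also have "\<dots> \<le> (\<Sum>i<n. e * (G (y (Suc i)) - G (y i)))" by (rule sum_mono) (use step in auto)
    also have "\<dots> = e * (G (y n) - G (y 0))" by (simp add: sum_lessThan_telescope[of "\<lambda>i. G (y i)"] flip: sum_distrib_left)
    finally show ?thesis by (simp add: yn)
  qed
  note le = this
  show ?thesis
  proof (rule ccontr)
    assume "D x \<noteq> D 0"
    then have p: "\<bar>D x - D 0\<bar> > 0" by simp
    \<comment> \<open>\<open>H\<close> is positive and at least \<open>G x - G 0\<close>, so
      choosing \<open>e\<close> as the gap divided by \<open>2 H\<close> leaves at most half of the
      gap, a contradiction.\<close>
    define H where "H = \<bar>G x - G 0\<bar> + 1"
    have H: "H > 0" by (simp add: H_def)
    have "\<bar>D x - D 0\<bar> \<le> (\<bar>D x - D 0\<bar> / (2 * H)) * (G x - G 0)" using p H by (intro le) auto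
    also have "\<dots> \<le> (\<bar>D x - D 0\<bar> / (2 * H)) * H" using p H by (intro mult_left_mono) (auto simp: H_def)
    also have "\<dots> = \<bar>D x - D 0\<bar> / 2" using H by simp
    finally have "2 * \<bar>D x - D 0\<bar> \<le> \<bar>D x - D 0\<bar>" by (simp add: field_simps)
    then show False using p by simp
  qed
qed

text \<open>Over \<open>[a,b]\<close> the defect \<open>D\<close> of the formula changes by the
  integral of \<open>(\<Phi>' \<xi> - \<Phi>' (F s)) g s\<close> with an intermediate value \<xi>.
  Uniform continuity of \<open>\<Phi>'\<close> makes this small relative to the increment of
  \<open>G\<close>, the primitive of \<open>\<bar>g\<bar>\<close>.\<close>

lemma chain_rule_cum:
  assumes g: "integrable I1 g" and \<Phi>: "\<And>y. (\<Phi> has_real_derivative \<Phi>' y) (at y)" and c\<Phi>: "continuous_on UNIV \<Phi>'"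
    and x: "0 \<le> x" "x \<le> 1"
  shows "\<Phi> (c + cum {0..1} g x) = \<Phi> (c + cum {0..1} g 0) + cum {0..1} (\<lambda>s. \<Phi>' (c + cum {0..1} g s) * g s) x
      - cum {0..1} (\<lambda>s. \<Phi>' (c + cum {0..1} g s) * g s) 0"
proof -
  define F where "F x = c + cum {0..1} g x" for x
  define k where "k s = \<Phi>' (F s) * g s" for s
  define G where "G = cum {0..1} (\<lambda>s. \<bar>g s\<bar>)"
  have Fc: "continuous_on UNIV F" unfolding F_def[abs_def] by (intro continuous_intros cum_continuous g) auto
  have [measurable]: "g \<in> borel_measurable borel" using borel_measurable_integrable[OF g] by simp
  have [measurable]: "F \<in> borel_measurable borel" "\<Phi>' \<in> borel_measurable borel" using Fc c\<Phi> by (auto intro: borel_measurable_continuous_onI)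
  have \<Phi>Fc: "continuous_on UNIV (\<lambda>s. \<Phi>' (F s))" by (rule continuous_on_compose2[OF c\<Phi> Fc]) auto
  obtain B where B: "\<And>x. x \<in> {0..1} \<Longrightarrow> \<bar>\<Phi>' (F x)\<bar> \<le> B" using continuous_bounded[OF \<Phi>Fc, of "{0..1}"] by auto
  have ki: "integrable I1 k"
    unfolding k_def using integrable_bounded_mult[OF g, of "\<lambda>s. \<Phi>' (F s)" B] B by (simp add: AE_lbon mult.commute)
  define D where "D x = \<Phi> (F x) - cum {0..1} k x" for x
  have "D x = D 0"
  proof (rule const_of_small_increments[OF _ x, of D G])
    fix e :: real assume e: "e > 0"
    have "uniformly_continuous_on {0..1} (\<lambda>s. F s)"
      by (rule compact_uniformly_continuous[OF continuous_on_subset[OF Fc]]) auto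
    obtain K where K: "\<And>x. x \<in> {0..1} \<Longrightarrow> \<bar>F x\<bar> \<le> K" using continuous_bounded[OF Fc, of "{0..1}"] by auto
    have "uniformly_continuous_on {-K..K} \<Phi>'"
      by (rule compact_uniformly_continuous[OF continuous_on_subset[OF c\<Phi>]]) auto
    then obtain d1 where d1: "d1 > 0" "\<And>a b. a \<in> {-K..K} \<Longrightarrow> b \<in> {-K..K} \<Longrightarrow> dist b a < d1 \<Longrightarrow> dist (\<Phi>' b) (\<Phi>' a) < e"
      unfolding uniformly_continuous_on_def using e by metis
    from \<open>uniformly_continuous_on {0..1} _\<close> obtain d2 where d2: "d2 > 0" "\<And>a b. a \<in> {0..1} \<Longrightarrow> b \<in> {0..1} \<Longrightarrow> dist b a < d2 \<Longrightarrow> dist (F b) (F a) < d1 / 2"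
      unfolding uniformly_continuous_on_def using d1(1) by (metis half_gt_zero)
    show "\<exists>\<delta>>0. \<forall>a b. 0 \<le> a \<longrightarrow> a \<le> b \<longrightarrow> b \<le> 1 \<longrightarrow> b - a < \<delta> \<longrightarrow> \<bar>D b - D a\<bar> \<le> e * (G b - G a)"
    proof (intro exI[of _ d2] conjI allI impI d2(1))
      fix a b :: real assume ab: "0 \<le> a" "a \<le> b" "b \<le> 1" "b - a < d2"
      \<comment> \<open>Mean value theorem along the values of \<open>F\<close>, which may rise,
        fall or coincide; \<xi> stays as close to \<open>F a\<close> as \<open>F b\<close> is, and
        within the range bound \<open>K\<close>.\<close>
      have "\<exists>\<xi>. \<bar>\<xi> - F a\<bar> \<le> \<bar>F b - F a\<bar> \<and> \<bar>\<xi>\<bar> \<le> K \<and> \<Phi> (F b) - \<Phi> (F a) = \<Phi>' \<xi> * (F b - F a)"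
      proof -
        have Fab: "\<bar>F a\<bar> \<le> K" "\<bar>F b\<bar> \<le> K" using K[of a] K[of b] ab by auto
        consider "F a = F b" | "F a < F b" | "F b < F a" by linarith
        then show ?thesis
        proof cases
          case 1 then show ?thesis using Fab by (intro exI[of _ "F a"]) auto
        next
          case 2
          have "\<exists>z>F a. z < F b \<and> \<Phi> (F b) - \<Phi> (F a) = (F b - F a) * \<Phi>' z" by (rule MVT2[OF 2]) (rule \<Phi>)
          then obtain z where "F a < z" "z < F b" "\<Phi> (F b) - \<Phi> (F a) = (F b - F a) * \<Phi>' z" by blast
          then show ?thesis using Fab by (intro exI[of _ z]) (auto simp: mult.commute)
        next
          case 3
          have "\<exists>z>F b. z < F a \<and> \<Phi> (F a) - \<Phi> (F b) = (F a - F b) * \<Phi>' z" by (rule MVT2[OF 3]) (rule \<Phi>)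
          then obtain z where "F b < z" "z < F a" "\<Phi> (F a) - \<Phi> (F b) = (F a - F b) * \<Phi>' z" by blast
          then show ?thesis using Fab by (intro exI[of _ z]) (auto simp: algebra_simps)
        qed
      qed
      then obtain \<xi> where \<xi>: "\<bar>\<xi> - F a\<bar> \<le> \<bar>F b - F a\<bar>" "\<bar>\<xi>\<bar> \<le> K" "\<Phi> (F b) - \<Phi> (F a) = \<Phi>' \<xi> * (F b - F a)" by blast
      let ?i = "indicator {a<..b} :: real \<Rightarrow> real"
      have cg: "F b - F a = (\<integral>s. ?i s * g s \<partial>I1)" using cum_diff[OF _ g ab(2)] by (simp add: F_def)
      have "D b - D a = \<Phi>' \<xi> * (F b - F a) - (cum {0..1} k b - cum {0..1} k a)" using \<xi>(3) by (simp add: D_def)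
      also have "\<dots> = (\<integral>s. \<Phi>' \<xi> * (?i s * g s) \<partial>I1) - (\<integral>s. ?i s * k s \<partial>I1)"
        using cum_diff[OF _ ki ab(2)] cg by simp
      also have "\<dots> = (\<integral>s. \<Phi>' \<xi> * (?i s * g s) - ?i s * k s \<partial>I1)"
        by (rule Bochner_Integration.integral_diff[symmetric]) (auto intro!: integrable_ind_mult g ki)
      finally have "\<bar>D b - D a\<bar> \<le> (\<integral>s. \<bar>\<Phi>' \<xi> * (?i s * g s) - ?i s * k s\<bar> \<partial>I1)"
        using integral_abs_bound[of I1 "\<lambda>s. \<Phi>' \<xi> * (?i s * g s) - ?i s * k s"] by simp
      also have "\<dots> \<le> (\<integral>s. e * (?i s * \<bar>g s\<bar>) \<partial>I1)"
      proof (rule integral_mono)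
        show "integrable I1 (\<lambda>s. \<bar>\<Phi>' \<xi> * (?i s * g s) - ?i s * k s\<bar>)"
          by (intro integrable_abs Bochner_Integration.integrable_diff integrable_mult_right integrable_ind_mult g ki) auto
        show "integrable I1 (\<lambda>s. e * (?i s * \<bar>g s\<bar>))"
          by (intro integrable_mult_right integrable_ind_mult integrable_abs g) auto
        fix s
        show "\<bar>\<Phi>' \<xi> * (?i s * g s) - ?i s * k s\<bar> \<le> e * (?i s * \<bar>g s\<bar>)"
        proof (cases "s \<in> {a<..b}")
          case True
          have s: "s \<in> {0..1}" "a \<in> {0..1}" "b \<in> {0..1}" using True ab by auto
          have "dist (F b) (F a) < d1 / 2" "dist (F s) (F a) < d1 / 2" using d2(2) s ab True by (auto simp: dist_real_def)
          then have "dist \<xi> (F s) < d1" using \<xi>(1) unfolding dist_real_def by linarith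
          then have "dist (\<Phi>' \<xi>) (\<Phi>' (F s)) < e" using \<xi>(2) K[OF s(1)] by (intro d1(2)) (auto simp: abs_le_iff)
          then have "\<bar>\<Phi>' \<xi> - \<Phi>' (F s)\<bar> * \<bar>g s\<bar> \<le> e * \<bar>g s\<bar>" by (intro mult_right_mono) (auto simp: dist_real_def)
          then show ?thesis using True by (simp add: k_def left_diff_distrib flip: abs_mult)
        qed simp
      qed
      also have "\<dots> = e * (G b - G a)" using cum_diff[OF _ integrable_abs[OF g] ab(2)] by (simp add: G_def)
      finally show "\<bar>D b - D a\<bar> \<le> e * (G b - G a)" .
    qed
  qed
  then show ?thesis unfolding D_def k_def F_def by simp
qed

lemma cum_at_0: "A \<in> sets borel \<Longrightarrow> A \<subseteq> {0..} \<Longrightarrow> f \<in> borel_measurable borel \<Longrightarrow> cum A f 0 = 0"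
proof -
  assume [measurable]: "A \<in> sets borel" "f \<in> borel_measurable borel" and A: "A \<subseteq> {0..}"
  have "cum A f 0 = (\<integral>s. 0 \<partial>lbon A)"
    unfolding cum_def
  proof (rule integral_cong_AE)
    have "AE s in lborel. s \<noteq> (0::real)" by (rule AE_lborel_singleton)
    then show "AE s in lbon A. indicator {..0} s * f s = 0"
      unfolding AE_lbon[OF \<open>A \<in> sets borel\<close>] by eventually_elim (use A in \<open>auto simp: indicator_def\<close>)
  qed auto
  then show ?thesis by simp
qed

text \<open>\<Phi> may grow arbitrarily: \<open>f\<close> is essentially bounded by
  \<open>is_wderiv_sup\<close>, and continuity bounds \<Phi> and \<open>\<Phi>'\<close> on that
  range.\<close>

lemma is_wderiv_chain:
  assumes w: "is_wderiv f g" and \<Phi>: "\<And>y. (\<Phi> has_real_derivative \<Phi>' y) (at y)" and c\<Phi>: "continuous_on UNIV \<Phi>'"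
  shows "is_wderiv (\<lambda>x. \<Phi> (f x)) (\<lambda>x. \<Phi>' (f x) * g x)"
proof -
  have L: "L2S f" "L2S g" using w by (auto intro: is_wderiv_L2S)
  have gi: "integrable I1 g" by (rule L2S_integrable[OF L(2)])
  note [measurable] = L[THEN L2S_measurable]
  have \<Phi>c: "continuous_on UNIV \<Phi>" by (rule continuous_deriv_comp[OF \<Phi>])
  have [measurable]: "\<Phi> \<in> borel_measurable borel" "\<Phi>' \<in> borel_measurable borel" using \<Phi>c c\<Phi> by (auto intro: borel_measurable_continuous_onI)
  obtain c where c0: "(\<integral>x. g x \<partial>I1) = 0" and c: "AE x in I1. f x = c + cum {0..1} g x" by (rule is_wderivD[OF w])
  define M where "M = \<bar>\<integral>y. f y \<partial>I1\<bar> + n2 I1 g"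
  have M: "AE x in I1. \<bar>f x\<bar> \<le> M" unfolding M_def by (rule is_wderiv_sup[OF w])
  have bd: "bounded {y. \<bar>y\<bar> \<le> M}" unfolding bounded_iff by auto
  obtain B where B: "\<And>y. \<bar>y\<bar> \<le> M \<Longrightarrow> \<bar>\<Phi> y\<bar> \<le> B" using continuous_bounded[OF \<Phi>c bd] by (metis mem_Collect_eq)
  obtain B' where B': "\<And>y. \<bar>y\<bar> \<le> M \<Longrightarrow> \<bar>\<Phi>' y\<bar> \<le> B'" using continuous_bounded[OF c\<Phi> bd] by (metis mem_Collect_eq)
  have L1: "L2S (\<lambda>x. \<Phi> (f x))"
    unfolding L2S_iff using L(1) M
    by (auto simp: L2S_iff per1_def intro!: sqi_bounded[OF finite_I1, of _ B] elim!: eventually_mono intro: B)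
  have L2: "L2S (\<lambda>x. \<Phi>' (f x) * g x)"
    unfolding L2S_iff using L M
    by (auto simp: L2S_iff per1_def intro!: sqi_mult_bounded[of _ _ _ B'] elim!: eventually_mono intro: B')
  let ?k = "\<lambda>s. \<Phi>' (c + cum {0..1} g s) * g s"
  have ek: "AE x in I1. \<Phi>' (f x) * g x = ?k x" using c by eventually_elim simp
  have cumk: "cum {0..1} (\<lambda>x. \<Phi>' (f x) * g x) y = cum {0..1} ?k y" for y
    unfolding cum_def[of _ _ y]
  proof (rule integral_cong_AE)
    show "AE s in I1. indicator {..y} s * (\<Phi>' (f s) * g s) = indicator {..y} s * ?k s"
      using ek by eventually_elim simp
  qed measurable
  have z: "cum {0..1} g 0 = 0" "cum {0..1} ?k 0 = 0" by (auto intro!: cum_at_0)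
  have ch: "\<Phi> (c + cum {0..1} g x) = \<Phi> c + cum {0..1} (\<lambda>x. \<Phi>' (f x) * g x) x" if "x \<in> {0..1}" for x
    using chain_rule_cum[OF gi \<Phi> c\<Phi>, of x c] that z cumk by simp
  show ?thesis
  proof (rule is_wderivI[OF L1 L2, of "\<Phi> c"])
    have "(\<integral>x. \<Phi>' (f x) * g x \<partial>I1) = cum {0..1} (\<lambda>x. \<Phi>' (f x) * g x) 1" by (rule cum_eq_integral[symmetric]) auto
    also have "\<dots> = \<Phi> (c + cum {0..1} g 1) - \<Phi> c" using ch[of 1] by simp
    also have "cum {0..1} g 1 = 0" using c0 cum_eq_integral[of "{0..1}" 1 g] by simp
    finally show "(\<integral>x. \<Phi>' (f x) * g x \<partial>I1) = 0" by simp
    have "AE x in I1. x \<in> {0..1}" by (simp add: AE_lbon)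
    with c show "AE x in I1. \<Phi> (f x) = \<Phi> c + cum {0..1} (\<lambda>x. \<Phi>' (f x) * g x) x"
      by eventually_elim (use ch in auto)
  qed
qed

lemma wd_is_wderiv: "is_wderiv f g \<Longrightarrow> is_wderiv f (wd f)"
  unfolding wd_def by (rule someI[of "is_wderiv f"])

text \<open>\<open>wd\<close> selects a weak derivative by choice, so it can be compared with a
  known one only almost everywhere.\<close>

lemma wd_AE: "is_wderiv f g \<Longrightarrow> AE x in I1. wd f x = g x"
  by (rule is_wderiv_uniq[OF wd_is_wderiv]) auto

section \<open>The nonlocal operator\<close>

lemma per1_of_int: "per1 f \<Longrightarrow> f (x + of_int k) = f x"
proof (induction k rule: int_induct[of _ 0])
  case base
  then show ?case by simp
next
  case (step1 i)
  then have "f (x + of_int i + 1) = f (x + of_int i)" unfolding per1_def by blast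
  moreover have "x + of_int (i + 1) = x + of_int i + 1" by simp
  ultimately show ?case using step1 by metis
next
  case (step2 i)
  then have "f (x + of_int (i - 1) + 1) = f (x + of_int (i - 1))" unfolding per1_def by blast
  moreover have "x + of_int (i - 1) + 1 = x + of_int i" by simp
  ultimately show ?case using step2 by metis
qed

lemma per1_frac: "per1 f \<Longrightarrow> f (frac x) = f x"
  using per1_of_int[of f "frac x" "\<lfloor>x\<rfloor>"] by (simp add: frac_def)

lemma frac_measurable [measurable]: "(frac :: real \<Rightarrow> real) \<in> borel_measurable borel"
  unfolding frac_def[abs_def] by measurable

text \<open>The part of the shifted unit interval that sticks out beyond \<open>1\<close> is moved
  back by periodicity.\<close>

lemma nn_integral_per_shift_aux:
  fixes f :: "real \<Rightarrow> ennreal"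
  assumes [measurable]: "f \<in> borel_measurable borel" and per: "\<And>x. f (x + 1) = f x" and b: "0 \<le> b" "b < 1"
  shows "(\<integral>\<^sup>+x. f (x + b) * indicator {0..1} x \<partial>lborel) = (\<integral>\<^sup>+x. f x * indicator {0..1} x \<partial>lborel)"
proof -
  have "(\<integral>\<^sup>+x. f (x + b) * indicator {0..1} x \<partial>lborel) = (\<integral>\<^sup>+y. f (-b + 1 * y + b) * indicator {0..1} (-b + 1 * y) \<partial>lborel)"
    by (subst nn_integral_real_affine[where c = 1 and t = "-b"]) auto
  also have "\<dots> = (\<integral>\<^sup>+y. f y * indicator {b..1} y + f y * indicator {1<..1+b} y \<partial>lborel)"
    by (rule nn_integral_cong) (use b in \<open>auto simp: indicator_def\<close>)
  also have "\<dots> = (\<integral>\<^sup>+y. f y * indicator {b..1} y \<partial>lborel) + (\<integral>\<^sup>+y. f y * indicator {1<..1+b} y \<partial>lborel)"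
    by (rule nn_integral_add) auto
  also have "(\<integral>\<^sup>+y. f y * indicator {1<..1+b} y \<partial>lborel) = (\<integral>\<^sup>+y. f (1 + 1 * y) * indicator {1<..1+b} (1 + 1 * y) \<partial>lborel)"
    by (subst nn_integral_real_affine[where c = 1 and t = 1]) auto
  also have "\<dots> = (\<integral>\<^sup>+y. f y * indicator {0<..b} y \<partial>lborel)"
    by (rule nn_integral_cong) (use per in \<open>auto simp: indicator_def add.commute\<close>)
  also have "(\<integral>\<^sup>+y. f y * indicator {b..1} y \<partial>lborel) + (\<integral>\<^sup>+y. f y * indicator {0<..b} y \<partial>lborel) = (\<integral>\<^sup>+y. f y * indicator {b..1} y + f y * indicator {0<..b} y \<partial>lborel)"
    by (rule nn_integral_add[symmetric]) auto
  also have "\<dots> = (\<integral>\<^sup>+x. f x * indicator {0..1} x \<partial>lborel)"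
  proof (rule nn_integral_cong_AE)
    show "AE y in lborel. f y * indicator {b..1} y + f y * indicator {0<..b} y = f y * indicator {0..1} y"
      using AE_lborel_singleton[of b] AE_lborel_singleton[of 0]
      by eventually_elim (use b in \<open>auto simp: indicator_def\<close>)
  qed
  finally show ?thesis .
qed

text \<open>Rotation invariance in the form of a pushforward, from which integrals, integrability
  and null sets all inherit it.\<close>

lemma distr_frac: "distr I1 borel (\<lambda>x. frac (x + a)) = I1"
proof (rule measure_eqI)
  fix B assume "B \<in> sets (distr I1 borel (\<lambda>x. frac (x + a)))"
  then have [measurable]: "B \<in> sets borel" by simp
  let ?f = "\<lambda>x. indicator B (frac x) :: ennreal"
  have "(\<lambda>x. frac (x + a)) -` B \<inter> space borel \<in> sets borel" by measurable
  then have S: "(\<lambda>x. frac (x + a)) -` B \<in> sets borel" by simp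
  have "emeasure (distr I1 borel (\<lambda>x. frac (x + a))) B = emeasure lborel ({0..1} \<inter> ((\<lambda>x. frac (x + a)) -` B))"
    using S by (subst emeasure_distr) (auto simp: emeasure_lbon)
  also have "\<dots> = (\<integral>\<^sup>+x. indicator ({0..1} \<inter> ((\<lambda>x. frac (x + a)) -` B)) x \<partial>lborel)"
    by (rule nn_integral_indicator[symmetric]) (use S in auto)
  also have "\<dots> = (\<integral>\<^sup>+x. ?f (x + frac a) * indicator {0..1} x \<partial>lborel)"
    by (rule nn_integral_cong) (auto simp: indicator_def)
  also have "\<dots> = (\<integral>\<^sup>+x. ?f x * indicator {0..1} x \<partial>lborel)"
    by (rule nn_integral_per_shift_aux) (auto simp: frac_1_eq frac_lt_1)
  also have "\<dots> = (\<integral>\<^sup>+x. indicator ({0..1} \<inter> B) x \<partial>lborel)"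
  proof (rule nn_integral_cong_AE)
    show "AE x in lborel. ?f x * indicator {0..1} x = indicator ({0..1} \<inter> B) x"
      using AE_lborel_singleton[of 1]
    proof eventually_elim
      case (elim x)
      then show ?case by (cases "x \<in> {0..<1}") (auto simp: indicator_def)
    qed
  qed
  also have "\<dots> = emeasure I1 B" by (subst nn_integral_indicator) (auto simp: emeasure_lbon)
  finally show "emeasure (distr I1 borel (\<lambda>x. frac (x + a))) B = emeasure I1 B" .
qed simp

lemma per_integral_shift:
  fixes f :: "real \<Rightarrow> real"
  assumes [measurable]: "f \<in> borel_measurable borel" and p: "per1 f"
  shows "(\<integral>x. f (x + a) \<partial>I1) = (\<integral>x. f x \<partial>I1)"
proof -
  have "(\<integral>x. f x \<partial>I1) = (\<integral>x. f x \<partial>distr I1 borel (\<lambda>x. frac (x + a)))" by (simp add: distr_frac)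
  also have "\<dots> = (\<integral>x. f (frac (x + a)) \<partial>I1)" by (rule integral_distr) auto
  finally show ?thesis by (simp add: per1_frac[OF p])
qed

lemma per_integrable_shift:
  fixes f :: "real \<Rightarrow> real"
  assumes [measurable]: "f \<in> borel_measurable borel" and p: "per1 f"
  shows "integrable I1 (\<lambda>x. f (x + a)) \<longleftrightarrow> integrable I1 f"
proof -
  have "integrable I1 f \<longleftrightarrow> integrable (distr I1 borel (\<lambda>x. frac (x + a))) f" by (simp add: distr_frac)
  also have "\<dots> \<longleftrightarrow> integrable I1 (\<lambda>x. f (frac (x + a)))" by (rule integrable_distr_eq) auto
  finally show ?thesis by (simp add: per1_frac[OF p])
qed

lemma L2S_shift: "L2S f \<Longrightarrow> L2S (\<lambda>x. f (x + a))"
proof -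
  assume L: "L2S f"
  then have [measurable]: "f \<in> borel_measurable borel" and p: "per1 f" by (auto simp: L2S_iff)
  have "per1 (\<lambda>x. (f x)\<^sup>2)" using p by (simp add: per1_def)
  from per_integrable_shift[OF _ this, of a] L
  have "sqi I1 (\<lambda>x. f (x + a))" by (simp add: L2S_iff sqi_def)
  moreover have "f (x + 1 + a) = f (x + a)" for x
    using p[unfolded per1_def, rule_format, of "x + a"] by (simp add: add_ac)
  ultimately show ?thesis by (simp add: L2S_iff per1_def)
qed

lemma per_test_shift: "per_test \<psi> \<eta> \<Longrightarrow> per_test (\<lambda>x. \<psi> (x + a)) (\<lambda>x. \<eta> (x + a))"
  unfolding per_test_def per1_def
proof (intro conjI allI; elim conjE)
  fix x assume "\<forall>x. (\<psi> has_real_derivative \<eta> x) (at x)"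
  then have "((\<lambda>x. \<psi> (x + a)) has_real_derivative \<eta> (x + a) * 1) (at x)"
    by (intro DERIV_chain2[of \<psi>]) (auto intro!: derivative_eq_intros)
  then show "((\<lambda>x. \<psi> (x + a)) has_real_derivative \<eta> (x + a)) (at x)" by simp
next
  assume "continuous_on UNIV \<eta>"
  then show "continuous_on UNIV (\<lambda>x. \<eta> (x + a))"
    by (rule continuous_on_compose2) (auto intro!: continuous_intros)
next
  fix x assume "\<forall>x. \<psi> (x + 1) = \<psi> x"
  then have "\<psi> (x + a + 1) = \<psi> (x + a)" by blast
  then show "\<psi> (x + 1 + a) = \<psi> (x + a)" by (simp add: add_ac)
qed

lemma is_wderiv_shift:
  assumes w: "is_wderiv f g" shows "is_wderiv (\<lambda>x. f (x + a)) (\<lambda>x. g (x + a))"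
  unfolding is_wderiv_iff
proof (intro conjI allI impI L2S_shift is_wderiv_L2S[OF w])
  fix \<psi> \<eta> assume p: "per_test \<psi> \<eta>"
  have p': "per_test (\<lambda>x. \<psi> (x + - a)) (\<lambda>x. \<eta> (x + - a))" by (rule per_test_shift[OF p])
  have \<psi>p: "per1 \<psi>" using p by (simp add: per_test_def)
  \<comment> \<open>\<open>per_test\<close> states periodicity for \<psi>; for its derivative it
    follows from uniqueness of derivatives.\<close>
  have \<eta>p: "per1 \<eta>" unfolding per1_def
  proof
    fix x
    have "\<psi> = (\<lambda>x. \<psi> (x + 1))" using \<psi>p by (simp add: per1_def)
    then have "(\<psi> has_real_derivative \<eta> (x + 1)) (at x)" using per_test_shift[OF p, of 1] by (simp add: per_test_def)
    then show "\<eta> (x + 1) = \<eta> x" using p by (auto simp: per_test_def intro: DERIV_unique)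
  qed
  have fp: "per1 f" "per1 g" using is_wderiv_L2S[OF w] by (auto simp: L2S_iff)
  note [measurable] = per_test_measurable[OF p] is_wderiv_L2S[OF w, THEN L2S_measurable]
  have sh: "h (x + 1 + - a) = h (x + - a)" if "per1 h" for h x
    using that[unfolded per1_def, rule_format, of "x + - a"] by (simp add: algebra_simps)
  have "(\<integral>x. f (x + a) * \<eta> x \<partial>I1) = (\<integral>x. f (x + a) * \<eta> (x + a + - a) \<partial>I1)" by simp
  also have "\<dots> = (\<integral>x. f x * \<eta> (x + - a) \<partial>I1)"
    by (rule per_integral_shift[of "\<lambda>x. f x * \<eta> (x + - a)"], measurable) (use fp sh[OF \<eta>p] in \<open>simp add: per1_def\<close>)
  also have "\<dots> = - (\<integral>x. g x * \<psi> (x + - a) \<partial>I1)" by (rule is_wderiv_test[OF w p'])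
  also have "(\<integral>x. g x * \<psi> (x + - a) \<partial>I1) = (\<integral>x. g (x + a) * \<psi> (x + a + - a) \<partial>I1)"
    by (rule per_integral_shift[of "\<lambda>x. g x * \<psi> (x + - a)", symmetric], measurable) (use fp sh[OF \<psi>p] in \<open>simp add: per1_def\<close>)
  finally show "(\<integral>x. f (x + a) * \<eta> x \<partial>I1) = - (\<integral>x. g (x + a) * \<psi> x \<partial>I1)" by simp
qed

text \<open>The kernel in the unscaled variable \<open>z = (x - y) / \<epsilon>\<close>. Under
  \<open>kernel_ok\<close> it is a probability measure; it does not change with \<epsilon>, and
  convolution becomes an average of shifts by \<open>\<epsilon> z\<close>.\<close>

definition kmeas :: "(real \<Rightarrow> real) \<Rightarrow> real measure" where
  "kmeas \<phi> = density lborel (\<lambda>z. ennreal (\<phi> z))"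

section \<open>Averages of shifts with respect to the kernel\<close>

locale kernel =
  fixes \<phi> :: "real \<Rightarrow> real" and \<gamma> :: real
  assumes ok: "kernel_ok \<phi> \<gamma>"
begin

lemma cont: "continuous_on UNIV \<phi>"
proof (rule continuous_at_imp_continuous_on, intro ballI)
  fix x
  have "(deriv ^^ 0) \<phi> differentiable at x" using ok unfolding kernel_ok_def smooth_fun_def by blast
  then show "isCont \<phi> x" by (simp add: differentiable_imp_continuous_within)
qed

lemma meas [measurable]: "\<phi> \<in> borel_measurable borel"
  using cont by (rule borel_measurable_continuous_onI)

lemma nonneg: "0 \<le> \<phi> z" and supp: "\<bar>z\<bar> > 1 \<Longrightarrow> \<phi> z = 0" and even: "\<phi> (- z) = \<phi> z"
  and int1: "integral\<^sup>L lborel \<phi> = 1" and int2: "integral\<^sup>L lborel (\<lambda>x. \<phi> x * x\<^sup>2) = 2 * \<gamma>"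
  using ok unfolding kernel_ok_def by auto

text \<open>Chosen from \<phi> alone, so that the threshold for \<epsilon> may depend on it.\<close>

definition Km :: real where "Km = (SOME B. 0 \<le> B \<and> (\<forall>z. \<phi> z \<le> B))"

lemma Km: "0 \<le> Km" "\<phi> z \<le> Km"
proof -
  obtain B where B: "\<And>z. z \<in> {-1..1} \<Longrightarrow> \<bar>\<phi> z\<bar> \<le> B" using continuous_bounded[OF cont, of "{-1..1}"] by auto
  have "B \<ge> 0" using B[of 0] by simp
  moreover have "\<phi> z \<le> B" for z
  proof (cases "z \<in> {-1..1}")
    case True then show ?thesis using B[of z] by auto
  next
    case False
    then have "\<bar>z\<bar> > 1" by auto
    then show ?thesis using supp \<open>B \<ge> 0\<close> by simp
  qed
  ultimately have "\<exists>B. 0 \<le> B \<and> (\<forall>z. \<phi> z \<le> B)" by blast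
  from someI_ex[OF this] show "0 \<le> Km" "\<phi> z \<le> Km" unfolding Km_def by auto
qed

lemma integrable_phi: "integrable lborel \<phi>"
  using int1 not_integrable_integral_eq by force

abbreviation K where "K \<equiv> kmeas \<phi>"

lemma sets_K [simp, measurable_cong]: "sets K = sets borel" and space_K [simp]: "space K = UNIV"
  by (auto simp: kmeas_def)

lemma measurable_K [simp]: "measurable K N = measurable borel N"
  by (rule measurable_cong_sets) auto

lemma emeasure_K: "emeasure K UNIV = 1"
proof -
  have "emeasure K UNIV = (\<integral>\<^sup>+z. ennreal (\<phi> z) \<partial>lborel)"
    unfolding kmeas_def by (subst emeasure_density) auto
  also have "\<dots> = ennreal 1" using nn_integral_eq_integral[OF integrable_phi] nonneg int1 by simp
  finally show ?thesis by simp
qed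

lemma finite_K: "finite_measure K"
  by standard (simp add: emeasure_K)

lemma integral_K_const: "(\<integral>z. c \<partial>K) = (c::real)"
  by (simp add: measure_def emeasure_K)

lemma AE_K: "AE z in K. \<bar>z\<bar> \<le> 1"
proof -
  have "0 < \<phi> z \<Longrightarrow> \<bar>z\<bar> \<le> 1" for z using supp[of z] by (cases "\<bar>z\<bar> > 1") auto
  then show ?thesis unfolding kmeas_def by (subst AE_density) auto
qed

lemma integral_K:
  fixes f :: "real \<Rightarrow> real"
  assumes [measurable]: "f \<in> borel_measurable borel"
  shows "(\<integral>z. f z \<partial>K) = (\<integral>z. \<phi> z * f z \<partial>lborel)"
  unfolding kmeas_def using nonneg by (subst integral_density) auto

lemma integral_K_neg:
  fixes f :: "real \<Rightarrow> real"
  assumes [measurable]: "f \<in> borel_measurable borel"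
  shows "(\<integral>z. f (- z) \<partial>K) = (\<integral>z. f z \<partial>K)"
proof -
  have "(\<integral>z. f (- z) \<partial>K) = (\<integral>z. \<phi> z * f (- z) \<partial>lborel)" by (rule integral_K) auto
  also have "\<dots> = (\<integral>z. \<phi> z * f z \<partial>lborel)"
    by (subst lborel_integral_real_affine[of "-1" _ 0]) (auto simp: even)
  also have "\<dots> = (\<integral>z. f z \<partial>K)" by (rule integral_K[symmetric]) auto
  finally show ?thesis .
qed

lemma sqi_K_continuous:
  fixes f :: "real \<Rightarrow> real"
  assumes "continuous_on UNIV f" shows "integrable K f"
proof -
  have [measurable]: "f \<in> borel_measurable borel" using assms by (rule borel_measurable_continuous_onI)
  obtain B where B: "\<And>z. z \<in> {-1..1} \<Longrightarrow> \<bar>f z\<bar> \<le> B" using continuous_bounded[OF assms, of "{-1..1}"] by auto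
  show ?thesis
  proof (rule sqi_imp_integrable[OF finite_K], rule sqi_bounded[OF finite_K, of _ B])
    show "AE z in K. \<bar>f z\<bar> \<le> B" using AE_K
    proof eventually_elim
      case (elim z)
      then have "z \<in> {-1..1}" by auto
      then show ?case by (rule B)
    qed
  qed auto
qed

lemma integral_K_id: "(\<integral>z. z \<partial>K) = 0"
  using integral_K_neg[of "\<lambda>z. z"] by simp

lemma integral_K_sq: "(\<integral>z. z\<^sup>2 \<partial>K) = 2 * \<gamma>"
  by (subst integral_K) (auto simp: int2)

lemma pair_IK: "pair_sigma_finite I1 K"
  using finite_K finite_I1 by (simp add: pair_sigma_finite_def finite_measure.axioms)

lemma sets_IK: "sets (I1 \<Otimes>\<^sub>M K) = sets (borel \<Otimes>\<^sub>M borel)"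
  by (intro sets_pair_measure_cong) auto

text \<open>A form of the periodic convolution without \<open>frac\<close> and \<open>pdist\<close>;
  \<open>conv_eps_eq_cv\<close> identifies the two for \<open>\<epsilon> < 1/2\<close>.\<close>

definition cv :: "real \<Rightarrow> (real \<Rightarrow> real) \<Rightarrow> real \<Rightarrow> real" where
  "cv \<epsilon> w x = (\<integral>z. w (x - \<epsilon> * z) \<partial>K)"

text \<open>For fixed \<open>z\<close> a shift preserves the integral over the circle, so
  integrating in \<open>x\<close> first settles both claims. Integrability is shown with the factors
  swapped because Fubini's criterion makes the first factor the outer variable.\<close>

lemma sqi_shift2:
  assumes L: "L2S f"
  shows "sqi (I1 \<Otimes>\<^sub>M K) (\<lambda>p. f (fst p - \<epsilon> * snd p))"
    and "(\<integral>p. (f (fst p - \<epsilon> * snd p))\<^sup>2 \<partial>(I1 \<Otimes>\<^sub>M K)) = (\<integral>x. (f x)\<^sup>2 \<partial>I1)"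
proof -
  interpret pair_sigma_finite I1 K by (rule pair_IK)
  have [measurable]: "f \<in> borel_measurable borel" and p: "per1 f" using L by (auto simp: L2S_iff)
  have p2: "per1 (\<lambda>x. (f x)\<^sup>2)" using p by (simp add: per1_def)
  have e: "(\<integral>x. (f (x - \<epsilon> * z))\<^sup>2 \<partial>I1) = (\<integral>x. (f x)\<^sup>2 \<partial>I1)" for z
    using per_integral_shift[OF _ p2, of "- \<epsilon> * z"] by simp
  have i: "integrable I1 (\<lambda>x. (f (x - \<epsilon> * z))\<^sup>2)" for z
    using per_integrable_shift[OF _ p2, of "- \<epsilon> * z"] L by (simp add: L2S_iff sqi_def)
  interpret Q: pair_sigma_finite K I1 ..
  have 1: "integrable (K \<Otimes>\<^sub>M I1) (\<lambda>p. (f (snd p - \<epsilon> * fst p))\<^sup>2)"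
  proof (rule Q.Fubini_integrable)
    show "AE z in K. integrable I1 (\<lambda>y. (f (snd (z, y) - \<epsilon> * fst (z, y)))\<^sup>2)" using i by simp
    show "integrable K (\<lambda>z. \<integral>y. norm ((f (snd (z, y) - \<epsilon> * fst (z, y)))\<^sup>2) \<partial>I1)"
      by (simp add: e finite_measure.integrable_const[OF finite_K])
  qed measurable
  from Q.integrable_product_swap[OF this]
  have 2: "integrable (I1 \<Otimes>\<^sub>M K) (\<lambda>p. (f (fst p - \<epsilon> * snd p))\<^sup>2)" by (simp add: split_beta')
  then show "sqi (I1 \<Otimes>\<^sub>M K) (\<lambda>p. f (fst p - \<epsilon> * snd p))" by (simp add: sqi_def)
  show "(\<integral>p. (f (fst p - \<epsilon> * snd p))\<^sup>2 \<partial>(I1 \<Otimes>\<^sub>M K)) = (\<integral>x. (f x)\<^sup>2 \<partial>I1)"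
    using integral_snd[of "\<lambda>x z. (f (x - \<epsilon> * z))\<^sup>2"] 2 e by (simp add: split_beta' measure_def emeasure_K)
qed

lemma cv_measurable [measurable]: "f \<in> borel_measurable borel \<Longrightarrow> cv \<epsilon> f \<in> borel_measurable borel"
proof -
  assume [measurable]: "f \<in> borel_measurable borel"
  interpret finite_measure K by (rule finite_K)
  show ?thesis unfolding cv_def[abs_def] by measurable
qed

lemma cv_sq_le:
  assumes "sqi K (\<lambda>z. f (x - \<epsilon> * z))"
  shows "(cv \<epsilon> f x)\<^sup>2 \<le> (\<integral>z. (f (x - \<epsilon> * z))\<^sup>2 \<partial>K)"
  using sqi_Cauchy_Schwarz[OF assms sqi_const[OF finite_K, of 1]] by (simp add: cv_def measure_def emeasure_K)

text \<open>Jensen's inequality for the probability measure \<open>K\<close> and then shift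
  invariance: averaging does not increase the \<open>L^2\<close> norm.\<close>

lemma cv_L2S:
  assumes L: "L2S f" shows "L2S (cv \<epsilon> f)" and "(\<integral>x. (cv \<epsilon> f x)\<^sup>2 \<partial>I1) \<le> (\<integral>x. (f x)\<^sup>2 \<partial>I1)"
proof -
  interpret pair_sigma_finite I1 K by (rule pair_IK)
  have [measurable]: "f \<in> borel_measurable borel" and p: "per1 f" using L by (auto simp: L2S_iff)
  note s = sqi_shift2[OF L, of \<epsilon>]
  have 1: "AE x in I1. (cv \<epsilon> f x)\<^sup>2 \<le> (\<integral>z. (f (x - \<epsilon> * z))\<^sup>2 \<partial>K)"
    using AE_integrable_fst'[OF sqi_square[OF s(1)]] by eventually_elim (rule cv_sq_le, simp add: sqi_def)
  have 2: "integrable I1 (\<lambda>x. \<integral>z. (f (x - \<epsilon> * z))\<^sup>2 \<partial>K)" using integrable_fst'[OF sqi_square[OF s(1)]] by simp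
  have 3: "integrable I1 (\<lambda>x. (cv \<epsilon> f x)\<^sup>2)"
    by (rule Bochner_Integration.integrable_bound[OF 2]) (use 1 in \<open>auto elim!: eventually_mono intro: order_trans\<close>)
  have "per1 (cv \<epsilon> f)"
    unfolding per1_def cv_def
  proof
    fix x
    have "f (x + 1 - \<epsilon> * z) = f (x - \<epsilon> * z)" for z
      using p[unfolded per1_def, rule_format, of "x - \<epsilon> * z"] by (simp add: algebra_simps)
    then show "(\<integral>z. f (x + 1 - \<epsilon> * z) \<partial>K) = (\<integral>z. f (x - \<epsilon> * z) \<partial>K)" by simp
  qed
  with 3 show "L2S (cv \<epsilon> f)" by (simp add: L2S_iff sqi_def)
  have "(\<integral>x. (cv \<epsilon> f x)\<^sup>2 \<partial>I1) \<le> (\<integral>x. \<integral>z. (f (x - \<epsilon> * z))\<^sup>2 \<partial>K \<partial>I1)"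
    by (rule integral_mono_AE[OF 3 2 1])
  also have "\<dots> = (\<integral>x. (f x)\<^sup>2 \<partial>I1)" using integral_fst'[OF sqi_square[OF s(1)]] s(2) by simp
  finally show "(\<integral>x. (cv \<epsilon> f x)\<^sup>2 \<partial>I1) \<le> (\<integral>x. (f x)\<^sup>2 \<partial>I1)" .
qed

lemma integral_cv_mult:
  assumes f: "L2S f" and h: "sqi I1 h"
  shows "integrable (I1 \<Otimes>\<^sub>M K) (\<lambda>p. f (fst p - \<epsilon> * snd p) * h (fst p))"
    and "(\<integral>x. cv \<epsilon> f x * h x \<partial>I1) = (\<integral>z. \<integral>x. f (x - \<epsilon> * z) * h x \<partial>I1 \<partial>K)"
    and "(\<integral>x. cv \<epsilon> f x * h x \<partial>I1) = (\<integral>p. f (fst p - \<epsilon> * snd p) * h (fst p) \<partial>(I1 \<Otimes>\<^sub>M K))"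
proof -
  interpret pair_sigma_finite I1 K by (rule pair_IK)
  have [measurable]: "h \<in> borel_measurable borel" using h by (simp add: sqi_def)
  have h2: "sqi (I1 \<Otimes>\<^sub>M K) (\<lambda>p. h (fst p))"
    using integrable_product_fun[OF pair_IK sqi_square[OF h], of "\<lambda>_. 1"] finite_measure.integrable_const[OF finite_K, of "1::real"]
    by (simp add: sqi_def split_beta')
  show i: "integrable (I1 \<Otimes>\<^sub>M K) (\<lambda>p. f (fst p - \<epsilon> * snd p) * h (fst p))"
    by (rule sqi_mult[OF sqi_shift2(1)[OF f] h2])
  show "(\<integral>x. cv \<epsilon> f x * h x \<partial>I1) = (\<integral>z. \<integral>x. f (x - \<epsilon> * z) * h x \<partial>I1 \<partial>K)"
    using Fubini_integral[of "\<lambda>x z. f (x - \<epsilon> * z) * h x"] i by (simp add: split_beta' cv_def)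
  show "(\<integral>x. cv \<epsilon> f x * h x \<partial>I1) = (\<integral>p. f (fst p - \<epsilon> * snd p) * h (fst p) \<partial>(I1 \<Otimes>\<^sub>M K))"
    using integral_fst'[OF i] by (simp add: cv_def)
qed

text \<open>Shifts commute with weak derivatives, and testing commutes with the average over
  \<open>z\<close>.\<close>

lemma is_wderiv_cv:
  assumes w: "is_wderiv f g" shows "is_wderiv (cv \<epsilon> f) (cv \<epsilon> g)"
  unfolding is_wderiv_iff
proof (intro conjI allI impI cv_L2S is_wderiv_L2S[OF w])
  fix \<psi> \<eta> assume p: "per_test \<psi> \<eta>"
  have "(\<integral>x. f (x - \<epsilon> * z) * \<eta> x \<partial>I1) = - (\<integral>x. g (x - \<epsilon> * z) * \<psi> x \<partial>I1)" for z
    using is_wderiv_test[OF is_wderiv_shift[OF w, of "- \<epsilon> * z"] p] by simp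
  then show "(\<integral>x. cv \<epsilon> f x * \<eta> x \<partial>I1) = - (\<integral>x. cv \<epsilon> g x * \<psi> x \<partial>I1)"
    using integral_cv_mult(2)[OF is_wderiv_L2S(1)[OF w] per_test_sqi(2)[OF p]]
      integral_cv_mult(2)[OF is_wderiv_L2S(2)[OF w] per_test_sqi(1)[OF p]] by simp
qed

end

section \<open>The periodic convolution expressed through shifts\<close>

lemma conv_eps_cong:
  assumes [measurable]: "w \<in> borel_measurable borel" "w' \<in> borel_measurable borel" "\<phi> \<in> borel_measurable borel"
    and e: "AE x in I1. w x = w' x"
  shows "conv_eps \<phi> \<epsilon> w x = conv_eps \<phi> \<epsilon> w' x"
proof -
  have [measurable]: "(\<lambda>y. phi_eps \<phi> \<epsilon> (pdist (frac x) y)) \<in> borel_measurable borel"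
    unfolding phi_eps_def[abs_def] pdist_def by measurable
  have "(\<integral>y. phi_eps \<phi> \<epsilon> (pdist (frac x) y) * w y \<partial>I1) = (\<integral>y. phi_eps \<phi> \<epsilon> (pdist (frac x) y) * w' y \<partial>I1)"
    by (rule integral_cong_AE) (use e in \<open>auto elim: eventually_mono\<close>)
  then show ?thesis unfolding conv_eps_def by (simp add: integral_lbon)
qed

text \<open>The line is folded onto the circle; a support in \<open>[-1,2]\<close> meets just three
  unit cells.\<close>

lemma integral_unfold3:
  fixes h :: "real \<Rightarrow> real"
  assumes h: "integrable lborel h" and supp: "\<And>y. y \<notin> {-1..2} \<Longrightarrow> h y = 0"
  shows "(\<integral>y. h y \<partial>lborel) = (\<integral>y. h y + h (y - 1) + h (y + 1) \<partial>I1)"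
proof -
  note [measurable] = borel_measurable_integrable[OF h, simplified]
  let ?i = "indicator {0..1} :: real \<Rightarrow> real"
  have h1: "integrable lborel (\<lambda>y. h (y - 1))" "integrable lborel (\<lambda>y. h (y + 1))"
    using lborel_integrable_real_affine[OF h, of 1 "-1"] lborel_integrable_real_affine[OF h, of 1 1] by (simp_all add: add.commute)
  have i: "integrable lborel (\<lambda>y. indicator A y * g y)" if "integrable lborel g" "A \<in> sets borel" for g :: "real \<Rightarrow> real" and A
    by (rule integrable_ind_mult) (use that in auto)
  have "(\<integral>y. h y + h (y - 1) + h (y + 1) \<partial>I1) = (\<integral>y. ?i y * h y + ?i y * h (y - 1) + ?i y * h (y + 1) \<partial>lborel)"
    by (subst integral_lbon) (auto simp: set_lebesgue_integral_def distrib_left)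
  also have "\<dots> = (\<integral>y. ?i y * h y \<partial>lborel) + (\<integral>y. ?i y * h (y - 1) \<partial>lborel) + (\<integral>y. ?i y * h (y + 1) \<partial>lborel)"
  proof -
    have "integrable lborel (\<lambda>y. ?i y * h y)" "integrable lborel (\<lambda>y. ?i y * h (y - 1))" "integrable lborel (\<lambda>y. ?i y * h (y + 1))"
      by (rule i[OF h] i[OF h1(1)] i[OF h1(2)], simp)+
    then show ?thesis by (simp only: Bochner_Integration.integral_add Bochner_Integration.integrable_add)
  qed
  also have "(\<integral>y. ?i y * h (y - 1) \<partial>lborel) = (\<integral>y. ?i (y + 1) * h y \<partial>lborel)"
    by (subst lborel_integral_real_affine[of 1 _ 1]) (auto simp: add.commute)
  also have "(\<integral>y. ?i y * h (y + 1) \<partial>lborel) = (\<integral>y. ?i (y - 1) * h y \<partial>lborel)"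
    by (subst lborel_integral_real_affine[of 1 _ "-1"]) (auto simp: add.commute)
  also have "(\<integral>y. ?i y * h y \<partial>lborel) + (\<integral>y. ?i (y + 1) * h y \<partial>lborel) + (\<integral>y. ?i (y - 1) * h y \<partial>lborel)
     = (\<integral>y. ?i y * h y + ?i (y + 1) * h y + ?i (y - 1) * h y \<partial>lborel)"
  proof -
    have e: "?i (y + 1) = indicator {-1..0} y" "?i (y - 1) = indicator {1..2} y" for y by (auto simp: indicator_def)
    have "integrable lborel (\<lambda>y. ?i y * h y)" "integrable lborel (\<lambda>y. ?i (y + 1) * h y)" "integrable lborel (\<lambda>y. ?i (y - 1) * h y)"
      unfolding e by (auto intro!: i h)
    then show ?thesis by simp
  qed
  also have "\<dots> = (\<integral>y. h y \<partial>lborel)"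
  proof (rule integral_cong_AE)
    show "AE y in lborel. ?i y * h y + ?i (y + 1) * h y + ?i (y - 1) * h y = h y"
      using AE_lborel_singleton[of 0] AE_lborel_singleton[of 1]
    proof eventually_elim
      case (elim y)
      then show ?case using supp[of y] by (cases "y \<in> {-1..2}") (auto simp: indicator_def)
    qed
  qed auto
  finally show ?thesis by simp
qed

context kernel
begin

text \<open>For \<open>\<epsilon> < 1/2\<close> the scaled kernel lives on distances below
  \<open>1/2\<close>, so only the translate realising the periodic distance can contribute. Evenness
  absorbs the absolute value.\<close>

lemma phi_eps_pdist:
  assumes e: "0 < \<epsilon>" "\<epsilon> < 1/2"
  shows "phi_eps \<phi> \<epsilon> (\<xi> - y) + phi_eps \<phi> \<epsilon> (\<xi> - (y - 1)) + phi_eps \<phi> \<epsilon> (\<xi> - (y + 1)) = phi_eps \<phi> \<epsilon> (pdist \<xi> y)"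
proof -
  have z: "phi_eps \<phi> \<epsilon> d = 0" if "\<bar>d\<bar> \<ge> 1/2" for d
  proof -
    have "\<bar>d / \<epsilon>\<bar> > 1" using that e by (simp add: abs_div less_divide_eq)
    then show ?thesis by (simp add: phi_eps_def supp)
  qed
  have ev: "phi_eps \<phi> \<epsilon> \<bar>d\<bar> = phi_eps \<phi> \<epsilon> d" for d
    using even[of "d / \<epsilon>"] by (cases "d \<ge> 0") (auto simp: phi_eps_def)
  define d where "d = \<xi> - y"
  have e': "\<xi> - (y - 1) = d + 1" "\<xi> - (y + 1) = d - 1" "pdist \<xi> y = min \<bar>d\<bar> (min \<bar>d + 1\<bar> \<bar>d - 1\<bar>)"
    by (auto simp: d_def pdist_def algebra_simps)
  \<comment> \<open>Any two of the three distances add up to at least \<open>1\<close>, so the two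
    that are not the chosen minimum are at least \<open>1/2\<close>.\<close>
  have tri: "1 \<le> \<bar>d\<bar> + \<bar>d + 1\<bar>" "1 \<le> \<bar>d\<bar> + \<bar>d - 1\<bar>" "1 \<le> \<bar>d + 1\<bar> + \<bar>d - 1\<bar>" by linarith+
  consider "\<bar>d\<bar> \<le> \<bar>d + 1\<bar>" "\<bar>d\<bar> \<le> \<bar>d - 1\<bar>" | "\<bar>d + 1\<bar> \<le> \<bar>d\<bar>" "\<bar>d + 1\<bar> \<le> \<bar>d - 1\<bar>" | "\<bar>d - 1\<bar> \<le> \<bar>d\<bar>" "\<bar>d - 1\<bar> \<le> \<bar>d + 1\<bar>"
    by (meson le_cases order_trans)
  then have "phi_eps \<phi> \<epsilon> d + phi_eps \<phi> \<epsilon> (d + 1) + phi_eps \<phi> \<epsilon> (d - 1) = phi_eps \<phi> \<epsilon> (min \<bar>d\<bar> (min \<bar>d + 1\<bar> \<bar>d - 1\<bar>))"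
  proof cases
    case 1
    have "min \<bar>d\<bar> (min \<bar>d + 1\<bar> \<bar>d - 1\<bar>) = \<bar>d\<bar>" by (rule min_absorb1[OF min.boundedI[OF 1]])
    moreover have "phi_eps \<phi> \<epsilon> (d + 1) = 0" by (rule z) (use 1 tri(1) in argo)
    moreover have "phi_eps \<phi> \<epsilon> (d - 1) = 0" by (rule z) (use 1 tri(2) in argo)
    ultimately show ?thesis by (simp only: ev add_0_right)
  next
    case 2
    have "min \<bar>d + 1\<bar> \<bar>d - 1\<bar> = \<bar>d + 1\<bar>" by (rule min_absorb1) (rule 2)
    then have "min \<bar>d\<bar> (min \<bar>d + 1\<bar> \<bar>d - 1\<bar>) = \<bar>d + 1\<bar>" using min_absorb2[OF 2(1)] by simp
    moreover have "phi_eps \<phi> \<epsilon> d = 0" by (rule z) (use 2 tri(1) in argo)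
    moreover have "phi_eps \<phi> \<epsilon> (d - 1) = 0" by (rule z) (use 2 tri(3) in argo)
    ultimately show ?thesis by (simp only: ev add_0_right add_0_left)
  next
    case 3
    have "min \<bar>d + 1\<bar> \<bar>d - 1\<bar> = \<bar>d - 1\<bar>" by (rule min_absorb2) (rule 3)
    then have "min \<bar>d\<bar> (min \<bar>d + 1\<bar> \<bar>d - 1\<bar>) = \<bar>d - 1\<bar>" using min_absorb2[OF 3(1)] by simp
    moreover have "phi_eps \<phi> \<epsilon> d = 0" by (rule z) (use 3 tri(2) in argo)
    moreover have "phi_eps \<phi> \<epsilon> (d + 1) = 0" by (rule z) (use 3 tri(3) in argo)
    ultimately show ?thesis by (simp only: ev add_0_right add_0_left)
  qed
  then show ?thesis unfolding e' d_def[symmetric] .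
qed

lemma integrable_lborel_bounded:
  fixes w :: "real \<Rightarrow> real"
  assumes w: "integrable I1 w" and p: "per1 w"
  shows "integrable lborel (\<lambda>y. indicator {-1..2} y * w y)"
proof -
  note [measurable] = borel_measurable_integrable[OF w, simplified]
  have 1: "integrable lborel (\<lambda>y. indicator {0..1} y * w y)"
    using w by (subst (asm) integrable_lbon) (auto simp: set_integrable_def)
  have "integrable lborel (\<lambda>y. indicator {0..1} (1 + 1 * y) * w (1 + 1 * y))"
    and "integrable lborel (\<lambda>y. indicator {0..1} (-1 + 1 * y) * w (-1 + 1 * y))"
    using lborel_integrable_real_affine[OF 1, of 1 1] lborel_integrable_real_affine[OF 1, of 1 "-1"] by auto
  moreover have "w (1 + 1 * y) = w y" "w (-1 + 1 * y) = w y" for y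
    using per1_of_int[OF p, of y 1] per1_of_int[OF p, of y "-1"] by (simp_all add: add.commute)
  ultimately have "integrable lborel (\<lambda>y. \<bar>indicator {0..1} y * w y\<bar> + \<bar>indicator {0..1} (1 + 1 * y) * w y\<bar> + \<bar>indicator {0..1} (-1 + 1 * y) * w y\<bar>)"
    using 1 by (intro Bochner_Integration.integrable_add integrable_abs) simp_all
  then show ?thesis
  proof (rule Bochner_Integration.integrable_bound)
    have "\<bar>indicator {-1..2} y * w y\<bar> \<le> \<bar>indicator {0..1} y * w y\<bar> + \<bar>indicator {0..1} (1 + 1 * y) * w y\<bar> + \<bar>indicator {0..1} (-1 + 1 * y) * w y\<bar>" for y
    proof -
      consider "y \<notin> {-1..2}" | "y \<in> {0..1}" | "1 + 1 * y \<in> {0..1}" | "-1 + 1 * y \<in> {0..1}" by fastforce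
      then show ?thesis by cases (auto simp: abs_mult intro!: add_nonneg_nonneg add_increasing add_increasing2 mult_right_le_one_le mult_left_le_one_le)
    qed
    then show "AE y in lborel. norm (indicator {-1..2} y * w y) \<le> norm (\<bar>indicator {0..1} y * w y\<bar> + \<bar>indicator {0..1} (1 + 1 * y) * w y\<bar> + \<bar>indicator {0..1} (-1 + 1 * y) * w y\<bar>)"
      by (simp add: order_trans[OF _ abs_ge_self])
  qed measurable
qed

text \<open>The substitution \<open>y = x - \<epsilon> z\<close>, with \<open>x\<close> reduced
  modulo one, gives an integral over the line; folding it onto the circle produces exactly the three
  translates of \<open>phi_eps_pdist\<close>.\<close>

lemma conv_eps_eq_cv:
  assumes e: "0 < \<epsilon>" "\<epsilon> < 1/2" and w: "integrable I1 w" and p: "per1 w"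
  shows "conv_eps \<phi> \<epsilon> w x = cv \<epsilon> w x"
proof -
  note [measurable] = borel_measurable_integrable[OF w, simplified]
  define \<xi> where "\<xi> = frac x"
  have \<xi>: "0 \<le> \<xi>" "\<xi> < 1" by (auto simp: \<xi>_def frac_lt_1)
  let ?k = "phi_eps \<phi> \<epsilon>"
  have [measurable]: "?k \<in> borel_measurable borel" unfolding phi_eps_def[abs_def] by measurable
  define h where "h y = ?k (\<xi> - y) * w y" for y
  have [measurable]: "h \<in> borel_measurable borel" unfolding h_def by measurable
  have h0: "h y = 0" if "y \<notin> {-1..2}" for y
  proof -
    have "\<bar>(\<xi> - y) / \<epsilon>\<bar> > 1" using that \<xi> e by (auto simp: abs_div less_divide_eq)
    then show ?thesis by (simp add: h_def phi_eps_def supp)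
  qed
  have hi: "integrable lborel h"
  proof (rule Bochner_Integration.integrable_bound)
    show "integrable lborel (\<lambda>y. (Km / \<epsilon>) * (indicator {-1..2} y * w y))" by (intro integrable_mult_right integrable_lborel_bounded w p)
    have "\<bar>h y\<bar> \<le> \<bar>(Km / \<epsilon>) * (indicator {-1..2} y * w y)\<bar>" for y
    proof (cases "y \<in> {-1..2}")
      case True
      have "\<bar>?k (\<xi> - y)\<bar> \<le> Km / \<epsilon>" using nonneg Km e by (simp add: phi_eps_def divide_right_mono)
      then have "\<bar>?k (\<xi> - y)\<bar> * \<bar>w y\<bar> \<le> (Km / \<epsilon>) * \<bar>w y\<bar>" by (rule mult_right_mono) simp
      then show ?thesis using True Km(1) e by (simp add: h_def abs_mult)
    qed (simp add: h0)
    then show "AE y in lborel. norm (h y) \<le> norm ((Km / \<epsilon>) * (indicator {-1..2} y * w y))" by simp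
  qed measurable
  have "cv \<epsilon> w x = (\<integral>z. \<phi> z * w (x - \<epsilon> * z) \<partial>lborel)" unfolding cv_def by (rule integral_K) measurable
  also have "(\<lambda>z. w (x - \<epsilon> * z)) = (\<lambda>z. w (\<xi> - \<epsilon> * z))"
  proof
    fix z show "w (x - \<epsilon> * z) = w (\<xi> - \<epsilon> * z)"
      using per1_of_int[OF p, of "\<xi> - \<epsilon> * z" "\<lfloor>x\<rfloor>"] by (simp add: \<xi>_def frac_def algebra_simps)
  qed
  then have "(\<integral>z. \<phi> z * w (x - \<epsilon> * z) \<partial>lborel) = (\<integral>z. \<phi> z * w (\<xi> - \<epsilon> * z) \<partial>lborel)" by metis
  also have "\<dots> = (\<integral>y. h y \<partial>lborel)"
  proof -
    have "(\<integral>y. h y \<partial>lborel) = \<bar>- \<epsilon>\<bar> *\<^sub>R (\<integral>z. h (\<xi> + (- \<epsilon>) * z) \<partial>lborel)"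
      by (rule lborel_integral_real_affine) (use e in auto)
    also have "\<dots> = (\<integral>z. \<epsilon> * h (\<xi> - \<epsilon> * z) \<partial>lborel)" using e by simp
    also have "(\<lambda>z. \<epsilon> * h (\<xi> - \<epsilon> * z)) = (\<lambda>z. \<phi> z * w (\<xi> - \<epsilon> * z))"
      using e by (auto simp: h_def phi_eps_def)
    finally show ?thesis by simp
  qed
  also have "\<dots> = (\<integral>y. h y + h (y - 1) + h (y + 1) \<partial>I1)" by (rule integral_unfold3[OF hi h0])
  also have "(\<lambda>y. h y + h (y - 1) + h (y + 1)) = (\<lambda>y. ?k (pdist \<xi> y) * w y)"
  proof
    fix y
    have "w (y - 1) = w y" "w (y + 1) = w y" using per1_of_int[OF p, of y "-1"] per1_of_int[OF p, of y 1] by simp_all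
    then have "h y + h (y - 1) + h (y + 1) = (?k (\<xi> - y) + ?k (\<xi> - (y - 1)) + ?k (\<xi> - (y + 1))) * w y"
      by (simp add: h_def algebra_simps)
    then show "h y + h (y - 1) + h (y + 1) = ?k (pdist \<xi> y) * w y" using phi_eps_pdist[OF e] by simp
  qed
  also have "(\<integral>y. ?k (pdist \<xi> y) * w y \<partial>I1) = conv_eps \<phi> \<epsilon> w x"
  proof -
    have [measurable]: "(\<lambda>y. pdist \<xi> y) \<in> borel_measurable borel" unfolding pdist_def by measurable
    show ?thesis unfolding conv_eps_def \<xi>_def[symmetric] by (subst integral_lbon) auto
  qed
  finally show ?thesis by simp
qed

text \<open>Cauchy-Schwarz with the weight split into two square roots: the scaled kernel has mass
  one and is at most \<open>Km / \<epsilon>\<close>. The power \<open>-1/2\<close> of \<epsilon>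
  found here decides the order of the pointwise error.\<close>

lemma cv_sup:
  assumes e: "0 < \<epsilon>" "\<epsilon> < 1/2" and L: "L2S w"
  shows "\<bar>cv \<epsilon> w x\<bar> \<le> sqrt (Km / \<epsilon>) * n2 I1 w"
proof -
  have [measurable]: "w \<in> borel_measurable borel" and p: "per1 w" using L by (auto simp: L2S_iff)
  have p2: "per1 (\<lambda>x. (w x)\<^sup>2)" using p by (simp add: per1_def)
  have i2: "integrable I1 (\<lambda>x. (w x)\<^sup>2)" using L by (simp add: L2S_iff sqi_def)
  let ?k = "\<lambda>y. phi_eps \<phi> \<epsilon> (pdist (frac x) y)"
  have [measurable]: "?k \<in> borel_measurable borel"
    unfolding phi_eps_def[abs_def] pdist_def by measurable
  have k: "0 \<le> ?k y" "?k y \<le> Km / \<epsilon>" for y using nonneg Km e by (auto simp: phi_eps_def divide_right_mono)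
  have ki: "integrable I1 ?k"
    by (rule sqi_imp_integrable[OF finite_I1], rule sqi_bounded[OF finite_I1, of _ "Km / \<epsilon>"]) (use k in auto)
  have one: "(\<integral>y. ?k y \<partial>I1) = 1"
  proof -
    have "(\<integral>y. ?k y \<partial>I1) = conv_eps \<phi> \<epsilon> (\<lambda>_. 1) x" unfolding conv_eps_def by (subst integral_lbon) auto
    also have "\<dots> = cv \<epsilon> (\<lambda>_. 1) x"
      by (rule conv_eps_eq_cv[OF e]) (auto simp: per1_def finite_measure.integrable_const[OF finite_I1])
    also have "\<dots> = 1" unfolding cv_def by (rule integral_K_const)
    finally show ?thesis .
  qed
  have s1: "sqi I1 (\<lambda>y. sqrt (?k y))" using ki k by (simp add: sqi_def)
  have s2: "sqi I1 (\<lambda>y. sqrt (?k y) * w y)"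
    by (rule sqi_mult_bounded[of _ _ _ "sqrt (Km / \<epsilon>)"]) (use L k in \<open>auto simp: L2S_iff\<close>)
  have "cv \<epsilon> w x = conv_eps \<phi> \<epsilon> w x" by (rule conv_eps_eq_cv[OF e L2S_integrable[OF L] p, symmetric])
  also have "\<dots> = (\<integral>y. ?k y * w y \<partial>I1)" unfolding conv_eps_def by (subst integral_lbon) auto
  also have "\<dots> = (\<integral>y. sqrt (?k y) * (sqrt (?k y) * w y) \<partial>I1)" using k by (simp flip: mult.assoc)
  finally have "(cv \<epsilon> w x)\<^sup>2 \<le> (\<integral>y. (sqrt (?k y))\<^sup>2 \<partial>I1) * (\<integral>y. (sqrt (?k y) * w y)\<^sup>2 \<partial>I1)"
    using sqi_Cauchy_Schwarz[OF s1 s2] by simp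
  also have "\<dots> = (\<integral>y. ?k y * (w y)\<^sup>2 \<partial>I1)" using k one by (simp add: power_mult_distrib)
  also have "\<dots> \<le> (\<integral>y. (Km / \<epsilon>) * (w y)\<^sup>2 \<partial>I1)"
  proof (rule integral_mono)
    show "integrable I1 (\<lambda>y. ?k y * (w y)\<^sup>2)" using sqi_square[OF s2] k by (simp add: power_mult_distrib)
    show "integrable I1 (\<lambda>y. (Km / \<epsilon>) * (w y)\<^sup>2)" using i2 by simp
    show "?k y * (w y)\<^sup>2 \<le> (Km / \<epsilon>) * (w y)\<^sup>2" for y by (rule mult_right_mono[OF k(2)]) simp
  qed
  also have "\<dots> = (sqrt (Km / \<epsilon>) * n2 I1 w)\<^sup>2" using Km(1) e by (simp add: power_mult_distrib n2_sq)
  finally have "(cv \<epsilon> w x)\<^sup>2 \<le> (sqrt (Km / \<epsilon>) * n2 I1 w)\<^sup>2" .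
  then have "\<bar>cv \<epsilon> w x\<bar>\<^sup>2 \<le> (sqrt (Km / \<epsilon>) * n2 I1 w)\<^sup>2" by simp
  then show ?thesis by (rule power2_le_imp_le) (use Km(1) e in simp)
qed

end

section \<open>Continuous representatives and consistency of the nonlocal operator\<close>

lemma continuous_AE_eq:
  assumes f: "continuous_on UNIV (f :: real \<Rightarrow> real)" and g: "continuous_on UNIV g"
    and e: "AE x in I1. f x = g x" and y: "y \<in> {0<..<1}"
  shows "f y = g y"
proof (rule ccontr)
  assume n: "f y \<noteq> g y"
  define U where "U = {x. f x \<noteq> g x} \<inter> {0<..<1}"
  have "open U" unfolding U_def by (intro open_Int open_Collect_neq f g open_greaterThanLessThan)
  moreover have "U \<in> null_sets lborel"
  proof (rule AE_iff_null_sets[THEN iffD2])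
    show "U \<in> sets lborel" using \<open>open U\<close> by simp
    show "AE x in lborel. x \<notin> U" using e by (auto simp: AE_lbon U_def elim!: eventually_mono)
  qed
  then have "negligible U" by (simp add: negligible_iff_null_sets null_sets_completionI)
  ultimately have "U = {}" using open_not_negligible by blast
  then show False using n y by (auto simp: U_def)
qed

lemma per_AE_shift:
  assumes [measurable]: "f \<in> borel_measurable borel" "g \<in> borel_measurable borel" and p: "per1 f" "per1 g"
    and e: "AE x in I1. f x = g x"
  shows "AE x in I1. f (x + a) = g (x + a)"
proof -
  have e': "AE x in distr I1 borel (\<lambda>x. frac (x + a)). f x = g x" using e unfolding distr_frac .
  have "AE x in I1. f (frac (x + a)) = g (frac (x + a))"
    using e' by (subst (asm) AE_distr_iff) auto
  then show ?thesis by (simp add: per1_frac p)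
qed

text \<open>The modulus of continuity is the integral of \<open>\<bar>g\<bar>\<close> over a window
  of radius \<epsilon>. The window stays centred at \<open>1/2\<close> and the function is shifted
  instead, so that for \<open>\<epsilon> < 1/2\<close> it never crosses the seam of the unit
  interval.\<close>

lemma is_wderiv_cont_rep:
  assumes w: "is_wderiv f g"
  obtains F where "continuous_on UNIV F" "per1 F" "AE x in I1. f x = F x"
    "\<And>x h \<epsilon>. \<bar>h\<bar> \<le> \<epsilon> \<Longrightarrow> \<epsilon> < 1/2 \<Longrightarrow>
      \<bar>F (x + h) - F x\<bar> \<le> (\<integral>y. indicator {1/2 - \<epsilon>..1/2 + \<epsilon>} y * \<bar>g (y + (x - 1/2))\<bar> \<partial>I1)"
proof -
  obtain c where c: "(\<integral>x. g x \<partial>I1) = 0" "AE x in I1. f x = c + cum {0..1} g x" by (rule is_wderivD[OF w])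
  have L: "L2S f" "L2S g" using is_wderiv_L2S[OF w] .
  note [measurable] = L[THEN L2S_measurable]
  have gi: "integrable I1 g" by (rule L2S_integrable[OF L(2)])
  have C: "continuous_on UNIV (cum {0..1} g)" by (rule cum_continuous[OF _ gi]) simp
  have C0: "cum {0..1} g x = 0" if "x \<le> 0" for x
  proof -
    have "cum {0..1} g x = (\<integral>s. 0 \<partial>I1)" unfolding cum_def
    proof (rule integral_cong_AE)
      show "AE s in I1. indicator {..x} s * g s = 0"
        unfolding AE_lbon[OF borel_closed[OF closed_atLeastAtMost]] using AE_lborel_singleton[of 0]
        by eventually_elim (use that in \<open>auto simp: indicator_def\<close>)
    qed auto
    then show ?thesis by simp
  qed
  have C1: "cum {0..1} g x = 0" if "x \<ge> 1" for x
    using cum_eq_integral[of "{0..1}" x g] that c(1) by auto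
  define F where "F x = c + cum {0..1} g (frac x)" for x
  have Fc: "continuous_on UNIV F"
  proof (rule continuous_at_imp_continuous_on, intro ballI)
    fix x :: real
    define n where "n = real_of_int \<lfloor>x\<rfloor>"
    have n: "n - 1 < x" "x < n + 1" unfolding n_def by linarith+
    \<comment> \<open>One formula on both sides of the integer \<open>n\<close>: of the two
      primitives one is in its zero range, either before \<open>0\<close> or, because
      \<open>g\<close> has mean zero, beyond \<open>1\<close>.\<close>
    have eq: "F y = c + cum {0..1} g (y - n) + cum {0..1} g (y - n + 1)" if y: "y \<in> {n - 1<..<n + 1}" for y
    proof (cases "n \<le> y")
      case True
      then have "\<lfloor>y\<rfloor> = \<lfloor>x\<rfloor>" using y unfolding n_def by (intro floor_unique) auto
      then have "frac y = y - n" by (simp add: frac_def n_def)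
      then show ?thesis using True C1[of "y - n + 1"] by (simp add: F_def)
    next
      case False
      then have "\<lfloor>y\<rfloor> = \<lfloor>x\<rfloor> - 1" using y unfolding n_def by (intro floor_unique) auto
      then have "frac y = y - n + 1" by (simp add: frac_def n_def)
      then show ?thesis using False C0[of "y - n"] by (simp add: F_def)
    qed
    have "continuous_on {n - 1<..<n + 1} F"
    proof (rule continuous_on_eq)
      show "continuous_on {n - 1<..<n + 1} (\<lambda>y. c + cum {0..1} g (y - n) + cum {0..1} g (y - n + 1))"
        by (intro continuous_intros continuous_on_compose2[OF C]) auto
    qed (simp add: eq)
    then show "isCont F x" using n by (auto simp: continuous_on_eq_continuous_at)
  qed
  have Fp: "per1 F" by (simp add: per1_def F_def frac_1_eq)
  have AEF: "AE x in I1. f x = F x"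
    unfolding AE_lbon[OF borel_closed[OF closed_atLeastAtMost]]
    using c(2)[unfolded AE_lbon[OF borel_closed[OF closed_atLeastAtMost]]] AE_lborel_singleton[of 1]
  proof eventually_elim
    case (elim x)
    then show ?case by (auto simp: F_def frac_eq)
  qed
  have [measurable]: "F \<in> borel_measurable borel" using Fc by (rule borel_measurable_continuous_onI)
  have mod: "\<bar>F (x + h) - F x\<bar> \<le> (\<integral>y. indicator {1/2 - \<epsilon>..1/2 + \<epsilon>} y * \<bar>g (y + (x - 1/2))\<bar> \<partial>I1)"
    if h: "\<bar>h\<bar> \<le> \<epsilon>" "\<epsilon> < 1/2" for x h \<epsilon>
  proof -
    define a where "a = x - 1/2"
    note w' = is_wderiv_shift[OF w, of a]
    obtain d where d: "AE y in I1. f (y + a) = d + cum {0..1} (\<lambda>y. g (y + a)) y" by (rule is_wderivD[OF w'])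
    have ga: "integrable I1 (\<lambda>y. g (y + a))" by (rule L2S_integrable[OF is_wderiv_L2S(2)[OF w']])
    have "AE y in I1. f (y + a) = F (y + a)"
      by (rule per_AE_shift) (use AEF L Fp in \<open>auto simp: L2S_iff\<close>)
    with d have e: "AE y in I1. F (y + a) = d + cum {0..1} (\<lambda>y. g (y + a)) y" by eventually_elim simp
    have eq: "F (y + a) = d + cum {0..1} (\<lambda>y. g (y + a)) y" if "y \<in> {0<..<1}" for y
      by (rule continuous_AE_eq[OF _ _ e that])
         (auto intro!: continuous_intros continuous_on_compose2[OF Fc] cum_continuous ga)
    have *: "\<bar>cum {0..1} (\<lambda>y. g (y + a)) v - cum {0..1} (\<lambda>y. g (y + a)) u\<bar> \<le> (\<integral>y. indicator {1/2 - \<epsilon>..1/2 + \<epsilon>} y * \<bar>g (y + a)\<bar> \<partial>I1)"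
      if uv: "1/2 - \<epsilon> \<le> u" "u \<le> v" "v \<le> 1/2 + \<epsilon>" for u v
    proof -
      have "\<bar>cum {0..1} (\<lambda>y. g (y + a)) v - cum {0..1} (\<lambda>y. g (y + a)) u\<bar> \<le> (\<integral>y. indicator {u<..v} y * \<bar>g (y + a)\<bar> \<partial>I1)"
        unfolding cum_diff[OF borel_closed[OF closed_atLeastAtMost] ga uv(2)] by (rule abs_ind_integral_le(1)[OF ga]) simp
      also have "\<dots> \<le> (\<integral>y. indicator {1/2 - \<epsilon>..1/2 + \<epsilon>} y * \<bar>g (y + a)\<bar> \<partial>I1)"
        by (rule integral_mono, (intro integrable_ind_mult integrable_abs ga, simp)+)
           (use uv in \<open>auto simp: indicator_def\<close>)
      finally show ?thesis .
    qed
    have "F (x + h) - F x = cum {0..1} (\<lambda>y. g (y + a)) (1/2 + h) - cum {0..1} (\<lambda>y. g (y + a)) (1/2)"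
    proof -
      have "1/2 + h \<in> {0<..<1}" using h by (auto simp: abs_le_iff)
      from eq[OF this] eq[of "1/2"] show ?thesis by (simp add: a_def algebra_simps)
    qed
    then show ?thesis
      using *[of "1/2" "1/2 + h"] *[of "1/2 + h" "1/2"] h unfolding a_def
      by (cases "h \<ge> 0") (auto simp: abs_minus_commute)
  qed
  show ?thesis by (rule that[OF Fc Fp AEF mod])
qed

text \<open>Raises the regularity of the representative by one order. Two applications, starting
  from the continuous second derivative, give the C^2 function to which Taylor's formula
  applies.\<close>

lemma is_wderiv_C1_rep:
  assumes w: "is_wderiv f g" and G: "continuous_on UNIV G" "per1 G" "AE x in I1. g x = G x"
  obtains F where "per_test F G" "AE x in I1. f x = F x"
proof -
  obtain c where c: "(\<integral>x. g x \<partial>I1) = 0" "AE x in I1. f x = c + cum {0..1} g x" by (rule is_wderivD[OF w])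
  have L: "L2S f" "L2S g" using is_wderiv_L2S[OF w] .
  note [measurable] = L[THEN L2S_measurable] borel_measurable_continuous_onI[OF G(1)]
  have "(\<integral>x. G x \<partial>I1) = (\<integral>x. g x \<partial>I1)" by (rule integral_cong_AE) (use G(3) in \<open>auto elim: eventually_mono\<close>)
  then have "(\<integral>x. G x \<partial>I1) = 0" using c(1) by simp
  then obtain \<psi> where \<psi>: "per_test \<psi> G" "\<psi> 0 = 0" using per_test_antiderivative[OF G(1,2)] by metis
  have d: "(\<psi> has_real_derivative G x) (at x)" for x using \<psi>(1) by (simp add: per_test_def)
  have cumG: "cum {0..1} g x = \<psi> x" if "x \<in> {0..1}" for x
  proof -
    have "cum {0..1} g x = cum {0..1} G x" unfolding cum_def
      by (rule integral_cong_AE) (use G(3) in \<open>auto elim: eventually_mono\<close>)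
    then show ?thesis using cum_FTC[OF d G(1), of "{0..1}" 1 x] that \<psi>(2) by (simp add: greaterThanLessThan_subseteq_atLeastAtMost_iff)
  qed
  show ?thesis
  proof (rule that[of "\<lambda>x. c + \<psi> x"])
    show "per_test (\<lambda>x. c + \<psi> x) G" using \<psi>(1) unfolding per_test_def per1_def by (auto intro!: derivative_eq_intros)
    have "AE x in I1. x \<in> {0..1}" by (simp add: AE_lbon)
    with c(2) show "AE x in I1. f x = c + \<psi> x" by eventually_elim (simp add: cumG)
  qed
qed

lemma taylor2_bound:
  fixes F F1 F2 :: "real \<Rightarrow> real"
  assumes F: "\<And>x. (F has_real_derivative F1 x) (at x)" and F1: "\<And>x. (F1 has_real_derivative F2 x) (at x)"
    and A: "\<And>t. \<bar>t\<bar> \<le> \<bar>h\<bar> \<Longrightarrow> \<bar>F2 (x + t) - F2 x\<bar> \<le> A"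
  shows "\<bar>F (x + h) - F x - h * F1 x - h\<^sup>2 / 2 * F2 x\<bar> \<le> h\<^sup>2 / 2 * A"
proof -
  define diff where "diff m t = (if m = 0 then F (x + t) else if m = 1 then F1 (x + t) else F2 (x + t))" for m :: nat and t
  have "\<exists>t. \<bar>t\<bar> \<le> \<bar>h\<bar> \<and> F (x + h) = (\<Sum>m<2. diff m 0 / fact m * h ^ m) + diff 2 t / fact 2 * h ^ 2"
  proof (rule Maclaurin_bi_le)
    show "diff 0 = (\<lambda>h. F (x + h))" by (simp add: diff_def fun_eq_iff)
    have "((\<lambda>t. F (x + t)) has_real_derivative F1 (x + t) * 1) (at t)" for t
      by (rule DERIV_chain2[OF F]) (auto intro!: derivative_eq_intros)
    moreover have "((\<lambda>t. F1 (x + t)) has_real_derivative F2 (x + t) * 1) (at t)" for t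
      by (rule DERIV_chain2[OF F1]) (auto intro!: derivative_eq_intros)
    ultimately show "\<forall>m t. m < 2 \<and> \<bar>t\<bar> \<le> \<bar>h\<bar> \<longrightarrow> (diff m has_real_derivative diff (Suc m) t) (at t)"
      by (auto simp: diff_def[abs_def] less_2_cases_iff)
  qed
  then obtain t where t: "\<bar>t\<bar> \<le> \<bar>h\<bar>" "F (x + h) = F x + F1 x * h + F2 (x + t) / 2 * h\<^sup>2"
    by (auto simp: diff_def numeral_2_eq_2)
  have "F (x + h) - F x - h * F1 x - h\<^sup>2 / 2 * F2 x = h\<^sup>2 / 2 * (F2 (x + t) - F2 x)"
    unfolding t(2) by (simp add: field_simps)
  then have "\<bar>F (x + h) - F x - h * F1 x - h\<^sup>2 / 2 * F2 x\<bar> = \<bar>h\<^sup>2 / 2 * (F2 (x + t) - F2 x)\<bar>"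
    by (rule arg_cong)
  also have "\<dots> = h\<^sup>2 / 2 * \<bar>F2 (x + t) - F2 x\<bar>" by (simp add: abs_mult)
  also have "\<dots> \<le> h\<^sup>2 / 2 * A" by (rule mult_left_mono[OF A[OF t(1)]]) simp
  finally show ?thesis .
qed

text \<open>Cauchy-Schwarz on a window of length \<open>2 \<epsilon>\<close> yields one factor
  \<open>2 \<epsilon>\<close>, and exchanging the integrals yields the second, since each point is
  seen by windows of total measure \<open>2 \<epsilon>\<close>.\<close>

lemma sqi_window:
  assumes g: "L2S g" and \<epsilon>: "0 < \<epsilon>" "\<epsilon> < 1/2"
  defines "A \<equiv> \<lambda>x. \<integral>y. indicator {1/2 - \<epsilon>..1/2 + \<epsilon>} y * \<bar>g (y + (x - 1/2))\<bar> \<partial>I1"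
  shows "A \<in> borel_measurable borel" "0 \<le> A x" "A x \<le> n2 I1 g" "(\<integral>x. (A x)\<^sup>2 \<partial>I1) \<le> (2 * \<epsilon> * n2 I1 g)\<^sup>2"
proof -
  interpret P: pair_sigma_finite I1 I1 by (simp add: pair_sigma_finite_def)
  have [measurable]: "g \<in> borel_measurable borel" and p: "per1 g" and s: "sqi I1 g" using g by (auto simp: L2S_iff)
  have p2: "per1 (\<lambda>x. (g x)\<^sup>2)" using p by (simp add: per1_def)
  let ?i = "indicator {1/2 - \<epsilon>..1/2 + \<epsilon>} :: real \<Rightarrow> real"
  have sh: "sqi I1 (\<lambda>y. g (y + a))" for a using L2S_shift[OF g] by (rule L2S_sqi)
  have sh2: "(\<integral>y. (g (y + a))\<^sup>2 \<partial>I1) = (n2 I1 g)\<^sup>2" for a using per_integral_shift[OF _ p2, of a] by (simp add: n2_sq)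
  have abs: "sqi I1 (\<lambda>y. \<bar>g (y + a)\<bar>)" for a by (rule sqi_bound[OF sh[of a]]) auto
  have isq0: "sqi I1 ?i" by (rule sqi_bounded[OF finite_I1, of _ 1]) (auto simp: indicator_def)
  have i1: "(\<integral>y. (?i y)\<^sup>2 \<partial>I1) = 2 * \<epsilon>"
  proof -
    have "(\<lambda>y. (?i y)\<^sup>2) = ?i" by (auto simp: indicator_def)
    then have "(\<integral>y. (?i y)\<^sup>2 \<partial>I1) = measure I1 {1/2 - \<epsilon>..1/2 + \<epsilon>}" by simp
    also have "\<dots> = measure lborel {1/2 - \<epsilon>..1/2 + \<epsilon>}"
      using \<epsilon> by (simp add: measure_lbon Int_absorb1 del: measure_lborel_Icc)
    also have "\<dots> = 2 * \<epsilon>" using \<epsilon> by simp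
    finally show ?thesis .
  qed
  have [measurable]: "A \<in> borel_measurable borel" unfolding A_def by measurable
  then show "A \<in> borel_measurable borel" .
  show A0: "0 \<le> A x" for x unfolding A_def by (rule integral_nonneg_AE) auto
  have "A x \<le> (\<integral>y. \<bar>g (y + (x - 1/2))\<bar> \<partial>I1)"
    unfolding A_def by (rule abs_ind_integral_le(2)) (use sqi_imp_integrable[OF finite_I1 sh] in auto)
  also have "\<dots> \<le> n2 I1 (\<lambda>y. g (y + (x - 1/2)))" by (rule n2_integral_le[OF sh])
  also have "\<dots> = n2 I1 g" using sh2[of "x - 1/2"] by (simp add: n2_def)
  finally show "A x \<le> n2 I1 g" .
  have isq: "sqi I1 (\<lambda>y. ?i y * \<bar>g (y + a)\<bar>)" for a
    by (rule sqi_mult_bounded[OF abs, of _ 1]) (auto simp: indicator_def)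
  have Asq: "(A x)\<^sup>2 \<le> 2 * \<epsilon> * (\<integral>y. ?i y * (g (y + (x - 1/2)))\<^sup>2 \<partial>I1)" for x
  proof -
    have "A x = (\<integral>y. ?i y * (?i y * \<bar>g (y + (x - 1/2))\<bar>) \<partial>I1)"
      unfolding A_def by (rule Bochner_Integration.integral_cong) (auto simp: indicator_def)
    then have "(A x)\<^sup>2 \<le> (\<integral>y. (?i y)\<^sup>2 \<partial>I1) * (\<integral>y. (?i y * \<bar>g (y + (x - 1/2))\<bar>)\<^sup>2 \<partial>I1)"
      using sqi_Cauchy_Schwarz[OF isq0 isq] by simp
    also have "(\<lambda>y. (?i y * \<bar>g (y + (x - 1/2))\<bar>)\<^sup>2) = (\<lambda>y. ?i y * (g (y + (x - 1/2)))\<^sup>2)"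
      by (auto simp: indicator_def)
    finally show ?thesis unfolding i1 .
  qed
  have ii: "integrable (I1 \<Otimes>\<^sub>M I1) (\<lambda>(y, x). ?i y * (g (y + (x - 1/2)))\<^sup>2)"
  proof (rule P.Fubini_integrable)
    have e: "(\<integral>x. (g (y + (x - 1/2)))\<^sup>2 \<partial>I1) = (n2 I1 g)\<^sup>2" for y
      using sh2[of "y - 1/2"] by (simp add: algebra_simps)
    show "integrable I1 (\<lambda>y. \<integral>x. norm (case (y, x) of (y, x) \<Rightarrow> ?i y * (g (y + (x - 1/2)))\<^sup>2) \<partial>I1)"
      using sqi_imp_integrable[OF finite_I1 isq0] by (simp add: abs_mult e)
    have "integrable I1 (\<lambda>x. (g (y + (x - 1/2)))\<^sup>2)" for y
      using sqi_square[OF sh[of "y - 1/2"]] by (simp add: algebra_simps)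
    then show "AE y in I1. integrable I1 (\<lambda>x. case (y, x) of (y, x) \<Rightarrow> ?i y * (g (y + (x - 1/2)))\<^sup>2)" by simp
  qed measurable
  have int: "(\<integral>x. \<integral>y. ?i y * (g (y + (x - 1/2)))\<^sup>2 \<partial>I1 \<partial>I1) = 2 * \<epsilon> * (n2 I1 g)\<^sup>2"
  proof -
    have "(\<integral>x. \<integral>y. ?i y * (g (y + (x - 1/2)))\<^sup>2 \<partial>I1 \<partial>I1) = (\<integral>y. \<integral>x. ?i y * (g (y + (x - 1/2)))\<^sup>2 \<partial>I1 \<partial>I1)"
      by (rule P.Fubini_integral[OF ii])
    also have "\<dots> = (\<integral>y. ?i y * (n2 I1 g)\<^sup>2 \<partial>I1)"
    proof -
      have e: "(\<integral>x. (g (y + (x - 1/2)))\<^sup>2 \<partial>I1) = (n2 I1 g)\<^sup>2" for y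
        using sh2[of "y - 1/2"] by (simp add: algebra_simps)
      show ?thesis by (simp add: e)
    qed
    also have "\<dots> = (\<integral>y. ?i y \<partial>I1) * (n2 I1 g)\<^sup>2" by (rule integral_mult_left_zero)
    also have "(\<integral>y. ?i y \<partial>I1) = (\<integral>y. (?i y)\<^sup>2 \<partial>I1)"
      by (rule Bochner_Integration.integral_cong) (auto simp: indicator_def)
    finally show ?thesis unfolding i1 .
  qed
  have "(\<integral>x. (A x)\<^sup>2 \<partial>I1) \<le> (\<integral>x. 2 * \<epsilon> * (\<integral>y. ?i y * (g (y + (x - 1/2)))\<^sup>2 \<partial>I1) \<partial>I1)"
  proof (rule integral_mono[OF _ _ Asq])
    show I: "integrable I1 (\<lambda>x. 2 * \<epsilon> * (\<integral>y. ?i y * (g (y + (x - 1/2)))\<^sup>2 \<partial>I1))"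
      using P.integrable_snd[OF ii] by simp
    show "integrable I1 (\<lambda>x. (A x)\<^sup>2)"
      by (rule Bochner_Integration.integrable_bound[OF I]) (use Asq in \<open>auto intro: order_trans[OF _ abs_ge_self]\<close>)
  qed
  also have "\<dots> = (2 * \<epsilon> * n2 I1 g)\<^sup>2" using int by (simp add: power_mult_distrib power2_eq_square)
  finally show "(\<integral>x. (A x)\<^sup>2 \<partial>I1) \<le> (2 * \<epsilon> * n2 I1 g)\<^sup>2" .
qed

context kernel
begin

lemma conv_eps_L2S:
  assumes "0 < \<epsilon>" "\<epsilon> < 1/2" "L2S w" shows "conv_eps \<phi> \<epsilon> w = cv \<epsilon> w"
  using conv_eps_eq_cv[OF assms(1,2) L2S_integrable[OF assms(3)]] assms(3) by (auto simp: L2S_iff)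

lemma is_wderiv_Leps:
  assumes \<epsilon>: "0 < \<epsilon>" "\<epsilon> < 1/2" and w: "is_wderiv f g"
  shows "is_wderiv (Leps \<phi> \<epsilon> f) (Leps \<phi> \<epsilon> g)"
proof -
  have "is_wderiv (\<lambda>x. 1 / \<epsilon>\<^sup>2 * cv \<epsilon> f x + (- (1 / \<epsilon>\<^sup>2)) * f x) (\<lambda>x. 1 / \<epsilon>\<^sup>2 * cv \<epsilon> g x + (- (1 / \<epsilon>\<^sup>2)) * g x)"
    by (rule is_wderiv_lin[OF is_wderiv_cv[OF w] w])
  moreover have "Leps \<phi> \<epsilon> h = (\<lambda>x. 1 / \<epsilon>\<^sup>2 * cv \<epsilon> h x + (- (1 / \<epsilon>\<^sup>2)) * h x)" if "L2S h" for h
    by (simp add: Leps_def[abs_def] conv_eps_L2S[OF \<epsilon> that] diff_divide_distrib)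
  ultimately show ?thesis using is_wderiv_L2S[OF w] by simp
qed

lemma Leps_consistency:
  assumes \<epsilon>: "0 < \<epsilon>" "\<epsilon> < 1/2"
    and w: "is_wderiv f f1" "is_wderiv f1 f2" "is_wderiv f2 f3"
  shows "AE x in I1. \<bar>Leps \<phi> \<epsilon> f x - \<gamma> * f2 x\<bar> \<le> (\<integral>y. indicator {1/2 - \<epsilon>..1/2 + \<epsilon>} y * \<bar>f3 (y + (x - 1/2))\<bar> \<partial>I1)"
proof -
  define A where "A x = (\<integral>y. indicator {1/2 - \<epsilon>..1/2 + \<epsilon>} y * \<bar>f3 (y + (x - 1/2))\<bar> \<partial>I1)" for x
  obtain F2 where F2: "continuous_on UNIV F2" "per1 F2" "AE x in I1. f2 x = F2 x"
    and mod: "\<And>x h. \<bar>h\<bar> \<le> \<epsilon> \<Longrightarrow> \<bar>F2 (x + h) - F2 x\<bar> \<le> A x"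
    unfolding A_def by (rule is_wderiv_cont_rep[OF w(3)]) (use \<epsilon> in blast)
  obtain F1 where F1: "per_test F1 F2" "AE x in I1. f1 x = F1 x" by (rule is_wderiv_C1_rep[OF w(2) F2(1,2,3)])
  have F1c: "continuous_on UNIV F1" "per1 F1" using per_test_continuous[OF F1(1)] F1(1) by (auto simp: per_test_def)
  obtain F where F: "per_test F F1" "AE x in I1. f x = F x" by (rule is_wderiv_C1_rep[OF w(1) F1c F1(2)])
  have Fc: "continuous_on UNIV F" "per1 F" using per_test_continuous[OF F(1)] F(1) by (auto simp: per_test_def)
  have d: "\<And>x. (F has_real_derivative F1 x) (at x)" "\<And>x. (F1 has_real_derivative F2 x) (at x)"
    using F(1) F1(1) by (auto simp: per_test_def)
  have LF: "L2S F" using Fc sqi_continuous[OF Fc(1), of "{0..1}"] by (auto simp: L2S_iff intro: borel_measurable_continuous_onI)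
  have conv: "conv_eps \<phi> \<epsilon> f x = cv \<epsilon> F x" for x
    using conv_eps_cong[of f F \<phi> \<epsilon> x] F(2) is_wderiv_L2S[OF w(1)] LF conv_eps_L2S[OF \<epsilon> LF] by (auto simp: L2S_iff)
  have est: "\<bar>(cv \<epsilon> F x - F x) / \<epsilon>\<^sup>2 - \<gamma> * F2 x\<bar> \<le> A x" for x
  proof -
    have c: "continuous_on UNIV (\<lambda>z. F (x - \<epsilon> * z))"
      by (rule continuous_on_compose2[OF Fc(1)]) (auto intro!: continuous_intros)
    have i: "integrable K (\<lambda>z. F (x - \<epsilon> * z))" "integrable K (\<lambda>z. F x)" "integrable K (\<lambda>z. \<epsilon> * F1 x * z)" "integrable K (\<lambda>z. \<epsilon>\<^sup>2 / 2 * F2 x * z\<^sup>2)"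
      "integrable K (\<lambda>z. \<epsilon>\<^sup>2 / 2 * A x)"
      by (rule sqi_K_continuous, (rule c | intro continuous_intros))+
    \<comment> \<open>The increment is \<open>- \<epsilon> z\<close>, whence the plus sign of the
      first-order term.\<close>
    let ?r = "\<lambda>z. F (x - \<epsilon> * z) - F x + \<epsilon> * F1 x * z - \<epsilon>\<^sup>2 / 2 * F2 x * z\<^sup>2"
    have "(\<integral>z. ?r z \<partial>K) = (\<integral>z. F (x - \<epsilon> * z) \<partial>K) - (\<integral>z. F x \<partial>K) + (\<integral>z. \<epsilon> * F1 x * z \<partial>K) - (\<integral>z. \<epsilon>\<^sup>2 / 2 * F2 x * z\<^sup>2 \<partial>K)"
      using i by (simp only: Bochner_Integration.integral_add Bochner_Integration.integral_diff
          Bochner_Integration.integrable_add Bochner_Integration.integrable_diff)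
    also have "\<dots> = cv \<epsilon> F x - F x - \<epsilon>\<^sup>2 * (\<gamma> * F2 x)"
      by (simp only: integral_mult_right_zero integral_K_id integral_K_sq integral_K_const cv_def) simp
    finally have r: "(\<integral>z. ?r z \<partial>K) = cv \<epsilon> F x - F x - \<epsilon>\<^sup>2 * (\<gamma> * F2 x)" .
    have ri: "integrable K ?r" by (intro Bochner_Integration.integrable_add Bochner_Integration.integrable_diff i)
    have A0: "0 \<le> A x" using mod[of 0 x] \<epsilon> by simp
    have "\<bar>\<integral>z. ?r z \<partial>K\<bar> \<le> (\<integral>z. \<bar>?r z\<bar> \<partial>K)" by (rule integral_abs_bound)
    also have "\<dots> \<le> (\<integral>z. \<epsilon>\<^sup>2 / 2 * A x \<partial>K)"
    proof (rule integral_mono_AE[OF integrable_abs[OF ri] i(5)])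
      show "AE z in K. \<bar>?r z\<bar> \<le> \<epsilon>\<^sup>2 / 2 * A x"
        using AE_K
      proof eventually_elim
        case (elim z)
        have ez: "\<bar>- \<epsilon> * z\<bar> \<le> \<epsilon>" using elim \<epsilon> by (simp add: abs_mult mult_left_le)
        have "\<bar>F (x + (- \<epsilon> * z)) - F x - (- \<epsilon> * z) * F1 x - (- \<epsilon> * z)\<^sup>2 / 2 * F2 x\<bar> \<le> (- \<epsilon> * z)\<^sup>2 / 2 * A x"
          by (rule taylor2_bound[OF d]) (use mod ez in \<open>blast intro: order_trans\<close>)
        also have "\<dots> \<le> \<epsilon>\<^sup>2 / 2 * A x"
          using abs_le_square_iff[of "- \<epsilon> * z" \<epsilon>] ez \<epsilon> by (intro mult_right_mono A0) auto
        finally show ?case by (simp add: power_mult_distrib algebra_simps)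
      qed
    qed
    also have "\<dots> = \<epsilon>\<^sup>2 / 2 * A x" by (rule integral_K_const)
    finally have "\<bar>cv \<epsilon> F x - F x - \<epsilon>\<^sup>2 * (\<gamma> * F2 x)\<bar> \<le> \<epsilon>\<^sup>2 * (A x / 2)" unfolding r by simp
    moreover have "cv \<epsilon> F x - F x - \<epsilon>\<^sup>2 * (\<gamma> * F2 x) = \<epsilon>\<^sup>2 * ((cv \<epsilon> F x - F x) / \<epsilon>\<^sup>2 - \<gamma> * F2 x)"
      using \<epsilon> by (simp add: field_simps)
    ultimately have "\<epsilon>\<^sup>2 * \<bar>(cv \<epsilon> F x - F x) / \<epsilon>\<^sup>2 - \<gamma> * F2 x\<bar> \<le> \<epsilon>\<^sup>2 * (A x / 2)" by (simp add: abs_mult)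
    then have "\<bar>(cv \<epsilon> F x - F x) / \<epsilon>\<^sup>2 - \<gamma> * F2 x\<bar> \<le> A x / 2" using \<epsilon> by (simp only: mult_le_cancel_left_pos zero_less_power)
    then show ?thesis using A0 by linarith
  qed
  show ?thesis
    using F(2) F2(3) unfolding A_def[symmetric]
    by eventually_elim (use est in \<open>simp add: Leps_def conv\<close>)
qed

end

section \<open>Energy identity, Gronwall's inequality and the damped equation\<close>

lemma measure_JT: "0 \<le> T \<Longrightarrow> measure (JT T) UNIV = T"
  by (simp add: measure_lbon)

lemma n2_mono_AE:
  assumes "sqi M f" "sqi M g" "AE x in M. \<bar>f x\<bar> \<le> \<bar>g x\<bar>"
  shows "(\<integral>x. (f x)\<^sup>2 \<partial>M) \<le> (\<integral>x. (g x)\<^sup>2 \<partial>M)"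
  by (rule integral_mono_AE) (use assms in \<open>auto simp: sqi_def abs_le_square_iff\<close>)

lemma cum_mono_AE:
  assumes A: "A \<in> sets borel" and f: "integrable (lbon A) f" "integrable (lbon A) g"
    and le: "AE s in lbon A. s \<le> t \<longrightarrow> f s \<le> g s"
  shows "cum A f t \<le> cum A g t"
  unfolding cum_def
proof (rule integral_mono_AE)
  show "AE s in lbon A. indicator {..t} s * f s \<le> indicator {..t} s * g s"
    using le by eventually_elim (auto simp: indicator_def)
qed (auto intro!: integrable_ind_mult f)

lemma cum_add:
  assumes A: "A \<in> sets borel" and f: "integrable (lbon A) f" "integrable (lbon A) g"
  shows "cum A (\<lambda>s. f s + g s) t = cum A f t + cum A g t"
  unfolding cum_def distrib_left
  by (rule Bochner_Integration.integral_add) (auto intro!: integrable_ind_mult f)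

lemma cum_cmult: "cum A (\<lambda>s. c * f s) t = c * cum A f t"
  unfolding cum_def by (simp add: mult.left_commute)

lemma cum_cong_AE:
  assumes A: "A \<in> sets borel" and [measurable]: "f \<in> borel_measurable borel" "g \<in> borel_measurable borel"
    and e: "AE s in lbon A. f s = g s"
  shows "cum A f t = cum A g t"
  unfolding cum_def by (rule integral_cong_AE) (use e in \<open>auto elim: eventually_mono\<close>)

lemma abs_cum_le_sq:
  assumes T: "T \<ge> 0" and f: "sqi (JT T) f"
  shows "(cum {0<..<T} f t)\<^sup>2 \<le> T * (\<integral>s. (f s)\<^sup>2 \<partial>JT T)"
proof -
  have i: "sqi (JT T) (indicator {..t})" by (rule sqi_bounded[OF finite_JT, of _ _ 1]) (auto simp: indicator_def)
  have "(cum {0<..<T} f t)\<^sup>2 \<le> (\<integral>s. (indicator {..t} s)\<^sup>2 \<partial>JT T) * (\<integral>s. (f s)\<^sup>2 \<partial>JT T)"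
    unfolding cum_def by (rule sqi_Cauchy_Schwarz[OF i f])
  also have "\<dots> \<le> (\<integral>s. 1\<^sup>2 \<partial>JT T) * (\<integral>s. (f s)\<^sup>2 \<partial>JT T)"
    by (intro mult_right_mono n2_mono_AE i sqi_const finite_JT) (auto simp: indicator_def intro!: integral_nonneg_AE)
  also have "\<dots> = T * (\<integral>s. (f s)\<^sup>2 \<partial>JT T)" using T by (simp add: measure_JT)
  finally show ?thesis .
qed

text \<open>For fixed \<open>z\<close> this is \<open>cum_product\<close> with equal factors; Fubini
  does the rest. \<open>M\<close> is general because the identity is used on the circle for
  \<open>p\<close> and \<open>q\<close>, and on the circle times the kernel measure for the nonlocal
  energy.\<close>

lemma energy_identity:
  fixes f :: "real \<Rightarrow> 'a \<Rightarrow> real"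
  assumes T: "T \<ge> 0" and sf: "sigma_finite_measure M"
    and m [measurable]: "case_prod f \<in> borel_measurable (borel \<Otimes>\<^sub>M M)"
    and f: "sqi (JT T \<Otimes>\<^sub>M M) (case_prod f)"
  defines "F \<equiv> \<lambda>t z. cum {0<..<T} (\<lambda>s. f s z) t"
  shows "sqi (JT T \<Otimes>\<^sub>M M) (\<lambda>z. F (fst z) (snd z))"
    and "sqi M (F t)"
    and "(\<integral>z. (F t z)\<^sup>2 \<partial>M) \<le> T * (\<integral>z. (case_prod f z)\<^sup>2 \<partial>(JT T \<Otimes>\<^sub>M M))"
    and "integrable (JT T) (\<lambda>s. \<integral>z. f s z * F s z \<partial>M)"
    and "(\<integral>z. (F t z)\<^sup>2 \<partial>M) = 2 * cum {0<..<T} (\<lambda>s. \<integral>z. f s z * F s z \<partial>M) t"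
proof -
  interpret M: sigma_finite_measure M by fact
  interpret J: sigma_finite_measure "JT T" by simp
  interpret pair_sigma_finite "JT T" M ..
  have sets: "sets (JT T \<Otimes>\<^sub>M M) = sets (borel \<Otimes>\<^sub>M M)" by (intro sets_pair_measure_cong) auto
  have f2: "integrable (JT T \<Otimes>\<^sub>M M) (\<lambda>(s, z). (f s z)\<^sup>2)" using sqi_square[OF f] by (simp add: split_beta')
  define \<Phi> where "\<Phi> z = (\<integral>s. (f s z)\<^sup>2 \<partial>JT T)" for z
  have \<Phi>i: "integrable M \<Phi>" unfolding \<Phi>_def using integrable_snd[OF f2] .
  have AEz: "AE z in M. sqi (JT T) (\<lambda>s. f s z)"
    using AE_integrable_snd[OF f2] AE_space by eventually_elim (auto simp: sqi_def)
  have Fm [measurable]: "(\<lambda>z. F (fst z) (snd z)) \<in> borel_measurable (borel \<Otimes>\<^sub>M M)"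
    unfolding F_def using cum_measurable2[of "{0<..<T}" f M] by (simp add: split_beta')
  have Fle: "AE z in M. \<forall>t. (F t z)\<^sup>2 \<le> T * \<Phi> z"
    using AEz by eventually_elim (auto simp: F_def \<Phi>_def intro: abs_cum_le_sq[OF T])
  have Fle1: "AE z in M. (F t z)\<^sup>2 \<le> T * \<Phi> z" for t using Fle by (rule eventually_mono) blast
  have Ftm [measurable]: "F t \<in> borel_measurable M" for t
    using measurable_compose[OF _ Fm, of "\<lambda>z. (t, z)"] by simp
  show Fs: "sqi (JT T \<Otimes>\<^sub>M M) (\<lambda>z. F (fst z) (snd z))"
    unfolding sqi_def
  proof
    have I: "integrable (JT T \<Otimes>\<^sub>M M) (\<lambda>(s, z). T * \<Phi> z)"
      using integrable_product_fun[OF pair_sigma_finite_axioms finite_measure.integrable_const[OF finite_JT, of T 1], of "\<lambda>z. T * \<Phi> z"] \<Phi>i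
      by simp
    show "integrable (JT T \<Otimes>\<^sub>M M) (\<lambda>z. (F (fst z) (snd z))\<^sup>2)"
    proof (rule Bochner_Integration.integrable_bound[OF I])
      show "AE z in JT T \<Otimes>\<^sub>M M. norm ((F (fst z) (snd z))\<^sup>2) \<le> norm (case z of (s, z) \<Rightarrow> T * \<Phi> z)"
      proof (rule AE_pair_measure)
        have "AE z in M. norm ((F t z)\<^sup>2) \<le> norm (T * \<Phi> z)" for t
          using Fle1[of t] by eventually_elim (simp add: order_trans[OF _ abs_ge_self])
        then show "AE t in JT T. AE z in M. norm ((F (fst (t, z)) (snd (t, z)))\<^sup>2) \<le> norm (case (t, z) of (s, z) \<Rightarrow> T * \<Phi> z)" by simp
        have [measurable]: "\<Phi> \<in> borel_measurable M" using \<Phi>i by simp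
        show "{z \<in> space (JT T \<Otimes>\<^sub>M M). norm ((F (fst z) (snd z))\<^sup>2) \<le> norm (case z of (s, z) \<Rightarrow> T * \<Phi> z)} \<in> sets (JT T \<Otimes>\<^sub>M M)"
          by measurable
      qed
    qed measurable
  qed measurable
  show Fts: "sqi M (F t)" for t
    unfolding sqi_def
    by (intro conjI Ftm Bochner_Integration.integrable_bound[OF integrable_mult_right[OF \<Phi>i, of T]])
       (use Fle1[of t] in \<open>auto elim!: eventually_mono intro: order_trans[OF _ abs_ge_self]\<close>)
  have "(\<integral>z. (F t z)\<^sup>2 \<partial>M) \<le> (\<integral>z. T * \<Phi> z \<partial>M)"
    by (rule integral_mono_AE) (use sqi_square[OF Fts] \<Phi>i Fle1 in auto)
  also have "\<dots> = T * (\<integral>z. (case_prod f z)\<^sup>2 \<partial>(JT T \<Otimes>\<^sub>M M))"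
    unfolding \<Phi>_def integral_mult_right_zero using integral_snd[OF f2] by (simp add: split_beta')
  finally show "(\<integral>z. (F t z)\<^sup>2 \<partial>M) \<le> T * (\<integral>z. (case_prod f z)\<^sup>2 \<partial>(JT T \<Otimes>\<^sub>M M))" .
  have fF: "integrable (JT T \<Otimes>\<^sub>M M) (\<lambda>(s, z). f s z * F s z)"
    using sqi_mult[OF f Fs] by (simp add: split_beta')
  show "integrable (JT T) (\<lambda>s. \<integral>z. f s z * F s z \<partial>M)" by (rule integrable_fst[OF fF])
  have ind: "integrable (JT T \<Otimes>\<^sub>M M) (\<lambda>(s, z). indicator {..t} s * (f s z * F s z))"
  proof (rule Bochner_Integration.integrable_bound[OF fF])
    show "AE z in JT T \<Otimes>\<^sub>M M. norm (case z of (s, z) \<Rightarrow> indicator {..t} s * (f s z * F s z)) \<le> norm (case z of (s, z) \<Rightarrow> f s z * F s z)"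
      by (intro always_eventually) (auto simp: indicator_def)
  qed measurable
  have "(\<integral>z. (F t z)\<^sup>2 \<partial>M) = (\<integral>z. 2 * (\<integral>s. indicator {..t} s * (f s z * F s z) \<partial>JT T) \<partial>M)"
  proof (rule integral_cong_AE)
    show "AE z in M. (F t z)\<^sup>2 = 2 * (\<integral>s. indicator {..t} s * (f s z * F s z) \<partial>JT T)"
      using AEz
    proof eventually_elim
      case (elim z)
      have i: "integrable (JT T) (\<lambda>s. f s z)" by (rule sqi_imp_integrable[OF finite_JT elim])
      have "(F t z)\<^sup>2 = cum {0<..<T} (\<lambda>s. f s z * F s z + f s z * F s z) t"
        unfolding F_def power2_eq_square by (rule cum_product[OF _ i i]) simp
      also have "\<dots> = cum {0<..<T} (\<lambda>s. 2 * (f s z * F s z)) t" by (simp only: mult_2)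
      also have "\<dots> = 2 * (\<integral>s. indicator {..t} s * (f s z * F s z) \<partial>JT T)" unfolding cum_cmult by (simp add: cum_def)
      finally show ?case .
    qed
    show "(\<lambda>z. (F t z)\<^sup>2) \<in> borel_measurable M" by measurable
    show "(\<lambda>z. 2 * (\<integral>s. indicator {..t} s * (f s z * F s z) \<partial>JT T)) \<in> borel_measurable M"
      using integrable_snd[OF ind] by simp
  qed
  also have "\<dots> = 2 * (\<integral>s. \<integral>z. indicator {..t} s * (f s z * F s z) \<partial>M \<partial>JT T)"
    using Fubini_integral[OF ind] by simp
  also have "\<dots> = 2 * cum {0<..<T} (\<lambda>s. \<integral>z. f s z * F s z \<partial>M) t" by (simp add: cum_def)
  finally show "(\<integral>z. (F t z)\<^sup>2 \<partial>M) = 2 * cum {0<..<T} (\<lambda>s. \<integral>z. f s z * F s z \<partial>M) t" .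
qed

lemma cum_exp:
  assumes "0 \<le> t" "t \<le> T" "l \<noteq> 0"
  shows "cum {0<..<T} (\<lambda>s. exp (l * s)) t = (exp (l * t) - 1) / l"
proof -
  have "cum {0<..<T} (\<lambda>s. exp (l * s)) t = exp (l * t) / l - exp (l * 0) / l"
    by (rule cum_FTC[where F = "\<lambda>s. exp (l * s) / l"])
       (use assms in \<open>auto intro!: derivative_eq_intros continuous_intros simp: greaterThanLessThan_subseteq_atLeastAtMost_iff\<close>)
  then show ?thesis by (simp add: diff_divide_distrib)
qed

lemma integrable_exp_JT: "integrable (JT T) (\<lambda>s. exp (l * s) :: real)"
  by (rule sqi_imp_integrable[OF finite_JT sqi_continuous]) (auto intro!: continuous_intros)

text \<open>\<open>e\<close> is merely measurable and bounded, so the proof works with the supremum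
  \<open>m\<close> of \<open>e s\<close> times \<open>exp (- 2 K s)\<close>. The doubled rate makes
  the integral term contribute at most \<open>m / 2\<close>, whence
  \<open>m \<le> 2 a\<close>.\<close>

lemma gronwall:
  assumes T: "0 \<le> t0" "t0 \<le> T" and e: "e \<in> borel_measurable borel" "\<And>s. 0 \<le> e s" "\<And>s. e s \<le> B" and K: "K > 0"
    and le: "\<And>t. 0 \<le> t \<Longrightarrow> t \<le> t0 \<Longrightarrow> e t \<le> a + K * cum {0<..<T} e t"
    and t: "0 \<le> t" "t \<le> t0"
  shows "e t \<le> 2 * a * exp (2 * K * t)"
proof -
  define S where "S = (\<lambda>s. e s * exp (- (2 * K * s))) ` {0..t0}"
  have S0: "S \<noteq> {}" using T by (auto simp: S_def)
  have B0: "0 \<le> B" using e(2,3) order_trans by blast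
  have bd: "bdd_above S"
  proof (rule bdd_aboveI)
    fix y assume "y \<in> S"
    then obtain s where s: "0 \<le> s" "y = e s * exp (- (2 * K * s))" by (auto simp: S_def)
    have "exp (- (2 * K * s)) \<le> 1" using s K by simp
    then show "y \<le> B * 1" unfolding s using e(2,3)[of s] B0 by (intro mult_mono) auto
  qed
  define m where "m = Sup S"
  have em: "e s \<le> m * exp (2 * K * s)" if "0 \<le> s" "s \<le> t0" for s
  proof -
    have "e s * exp (- (2 * K * s)) \<le> m" unfolding m_def by (rule cSup_upper[OF _ bd]) (use that in \<open>auto simp: S_def\<close>)
    then have "e s * exp (- (2 * K * s)) * exp (2 * K * s) \<le> m * exp (2 * K * s)" by (rule mult_right_mono) simp
    then show ?thesis by (simp add: mult.assoc flip: exp_add)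
  qed
  have ei: "integrable (JT T) e"
    by (rule sqi_imp_integrable[OF finite_JT], rule sqi_bounded[OF finite_JT, of _ _ B]) (use e in auto)
  have m0: "0 \<le> m"
  proof -
    have "e 0 \<le> m" using em[of 0] T by simp
    then show ?thesis using e(2)[of 0] by linarith
  qed
  have "m \<le> a + m / 2"
    unfolding m_def
  proof (rule cSup_least[OF S0])
    fix y assume "y \<in> S"
    then obtain s where s: "0 \<le> s" "s \<le> t0" "y = e s * exp (- (2 * K * s))" by (auto simp: S_def)
    have "e s \<le> a + K * cum {0<..<T} e s" by (rule le[OF s(1,2)])
    also have "cum {0<..<T} e s \<le> cum {0<..<T} (\<lambda>r. m * exp (2 * K * r)) s"
      by (rule cum_mono_AE) (use ei integrable_exp_JT s em in \<open>auto simp: AE_lbon\<close>)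
    also have "\<dots> = m * ((exp (2 * K * s) - 1) / (2 * K))"
      unfolding cum_cmult using cum_exp[of s T "2 * K"] s T K by simp
    finally have "e s \<le> a + K * (m * ((exp (2 * K * s) - 1) / (2 * K)))" using K by simp
    also have "\<dots> = a + (m / 2) * (exp (2 * K * s) - 1)" using K by simp
    finally have 1: "e s \<le> a + (m / 2) * (exp (2 * K * s) - 1)" .
    have a0: "a \<ge> 0" 
    proof -
      have "e 0 \<le> a + K * cum {0<..<T} e 0" using le[of 0] T by simp
      also have "cum {0<..<T} e 0 = 0" by (rule cum_at_0) (use e in auto)
      finally show ?thesis using e(2)[of 0] by simp
    qed
    have "e s * exp (- (2 * K * s)) \<le> (a + (m / 2) * (exp (2 * K * s) - 1)) * exp (- (2 * K * s))"
      by (rule mult_right_mono[OF 1]) simp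
    also have "\<dots> = a * exp (- (2 * K * s)) + (m / 2) * (1 - exp (- (2 * K * s)))"
      by (simp add: algebra_simps flip: exp_add)
    also have "\<dots> \<le> a * 1 + (m / 2) * 1"
      using s K a0 m0 by (intro add_mono mult_left_mono) auto
    finally show "y \<le> a + Sup S / 2" using s by (simp add: m_def)
  qed
  then have "m \<le> 2 * a" by simp
  have "e t \<le> m * exp (2 * K * t)" by (rule em[OF t])
  also have "\<dots> \<le> 2 * a * exp (2 * K * t)" by (rule mult_right_mono) (use \<open>m \<le> 2 * a\<close> in auto)
  finally show ?thesis .
qed

text \<open>Damped equation \<open>y' = - l y + G\<close> with \<open>\<bar>G\<bar> \<le> B\<close> and \<open>y(0) = 0\<close>, solved with the
  integrating factor \<open>exp (l t)\<close>.\<close>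
lemma damped_ode_bound:
  assumes k: "integrable (JT T) k" and l: "l > 0" and B: "B \<ge> 0" and t0: "t0 \<le> T"
    and le: "AE s in JT T. s \<le> t0 \<longrightarrow> \<bar>k s + l * cum {0<..<T} k s\<bar> \<le> B"
    and t: "0 \<le> t" "t \<le> t0"
  shows "\<bar>cum {0<..<T} k t\<bar> \<le> B / l"
proof -
  define y where "y = cum {0<..<T} k"
  define E where "E s = exp (l * s)" for s
  have [measurable]: "k \<in> borel_measurable borel" using borel_measurable_integrable[OF k] by simp
  have Ei: "integrable (JT T) E" unfolding E_def by (rule integrable_exp_JT)
  have cE: "cum {0<..<T} E s = (E s - 1) / l" if "0 \<le> s" "s \<le> T" for s
    unfolding E_def using cum_exp[OF that, of l] l by simp
  have [measurable]: "E \<in> borel_measurable borel" "y \<in> borel_measurable borel" unfolding E_def[abs_def] y_def by measurable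
  have tT: "t \<le> T" using t t0 by simp
  have Ec: "continuous_on UNIV E" unfolding E_def[abs_def] by (intro continuous_intros)
  obtain Bd where Bd: "\<And>s. s \<in> {0<..<T} \<Longrightarrow> \<bar>E s\<bar> \<le> Bd" using continuous_bounded[OF Ec, of "{0<..<T}"] by auto
  have kE: "integrable (JT T) (\<lambda>s. k s * E s)"
    by (rule integrable_bounded_mult[OF k, of _ Bd]) (use Bd in \<open>auto simp: AE_lbon\<close>)
  have Ey: "integrable (JT T) (\<lambda>s. E s * y s)" unfolding y_def by (rule integrable_mult_cum[OF _ Ei k]) simp
  \<comment> \<open>\<open>(E - 1) / l\<close> is the primitive of \<open>E\<close>; in this form
    the product rule for primitives introduces the integrating factor.\<close>
  have "y t * ((E t - 1) / l) = cum {0<..<T} (\<lambda>s. k s * cum {0<..<T} E s + E s * y s) t"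
    unfolding y_def cE[OF t(1) tT, symmetric] by (rule cum_product[OF _ k Ei]) simp
  also have "\<dots> = cum {0<..<T} (\<lambda>s. (1 / l) * (k s * E s) + (- (1 / l)) * k s + E s * y s) t"
  proof (rule cum_cong_AE)
    show "AE s in JT T. k s * cum {0<..<T} E s + E s * y s = (1 / l) * (k s * E s) + (- (1 / l)) * k s + E s * y s"
      using cE by (auto simp: AE_lbon right_diff_distrib diff_divide_distrib)
  qed auto
  also have "\<dots> = (1 / l) * cum {0<..<T} (\<lambda>s. k s * E s) t + (- (1 / l)) * y t + cum {0<..<T} (\<lambda>s. E s * y s) t"
  proof -
    have a: "integrable (JT T) (\<lambda>s. (1 / l) * (k s * E s))" "integrable (JT T) (\<lambda>s. (- (1 / l)) * k s)"
      using integrable_mult_right[OF kE, of "1 / l"] integrable_mult_right[OF k, of "- (1 / l)"] by auto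
    show ?thesis
      unfolding cum_add[OF borel_open[OF open_greaterThanLessThan] Bochner_Integration.integrable_add[OF a] Ey]
        cum_add[OF borel_open[OF open_greaterThanLessThan] a] cum_cmult by (simp only: y_def)
  qed
  finally have "y t * (E t - 1) = cum {0<..<T} (\<lambda>s. k s * E s) t - y t + l * cum {0<..<T} (\<lambda>s. E s * y s) t"
    using l by (simp add: field_simps)
  then have "y t * E t = cum {0<..<T} (\<lambda>s. k s * E s) t + cum {0<..<T} (\<lambda>s. l * (E s * y s)) t"
    unfolding cum_cmult by (simp add: algebra_simps)
  also have "\<dots> = cum {0<..<T} (\<lambda>s. k s * E s + l * (E s * y s)) t"
    by (rule cum_add[symmetric]) (use kE Ey in auto)
  finally have yE: "y t * E t = cum {0<..<T} (\<lambda>s. k s * E s + l * (E s * y s)) t" .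
  let ?G = "\<lambda>s. k s * E s + l * (E s * y s)"
  have Gi: "integrable (JT T) ?G" using kE Ey by simp
  have AEG: "AE s in JT T. s \<le> t \<longrightarrow> \<bar>?G s\<bar> \<le> B * E s"
    using le
  proof eventually_elim
    case (elim s)
    show ?case
    proof
      assume "s \<le> t"
      then have "\<bar>k s + l * y s\<bar> * E s \<le> B * E s" using elim t by (intro mult_right_mono) (auto simp: y_def E_def)
      moreover have "?G s = (k s + l * y s) * E s" by (simp add: algebra_simps)
      then have "\<bar>?G s\<bar> = \<bar>k s + l * y s\<bar> * E s" by (simp add: abs_mult E_def)
      ultimately show "\<bar>?G s\<bar> \<le> B * E s" by simp
    qed
  qed
  have BE: "cum {0<..<T} (\<lambda>s. B * E s) t \<le> B / l * E t"
  proof -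
    have "cum {0<..<T} (\<lambda>s. B * E s) t = B * ((E t - 1) / l)" unfolding cum_cmult cE[OF t(1) tT] ..
    also have "\<dots> \<le> B / l * E t" using B l by (simp add: field_simps)
    finally show ?thesis .
  qed
  have "y t * E t \<le> B / l * E t"
  proof -
    have "cum {0<..<T} ?G t \<le> cum {0<..<T} (\<lambda>s. B * E s) t"
    proof (rule cum_mono_AE)
      show "AE s in JT T. s \<le> t \<longrightarrow> ?G s \<le> B * E s" using AEG by eventually_elim (auto simp: abs_le_iff)
    qed (use Gi Ei in auto)
    then show ?thesis unfolding yE using BE by simp
  qed
  moreover have "- (y t * E t) \<le> B / l * E t"
  proof -
    have "- cum {0<..<T} ?G t = cum {0<..<T} (\<lambda>s. -1 * ?G s) t" unfolding cum_cmult by simp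
    also have "\<dots> \<le> cum {0<..<T} (\<lambda>s. B * E s) t"
    proof (rule cum_mono_AE)
      show "AE s in JT T. s \<le> t \<longrightarrow> -1 * ?G s \<le> B * E s" using AEG by eventually_elim (auto simp: abs_le_iff)
      show "integrable (JT T) (\<lambda>s. -1 * ?G s)" by (rule integrable_mult_right[OF Gi])
      show "integrable (JT T) (\<lambda>s. B * E s)" using Ei by simp
    qed auto
    finally show ?thesis unfolding yE using BE by simp
  qed
  ultimately have "\<bar>y t\<bar> * E t \<le> B / l * E t" by (cases "y t \<ge> 0") auto
  moreover have "0 < E t" by (simp add: E_def)
  ultimately have "\<bar>y t\<bar> \<le> B / l" by (simp only: mult_le_cancel_right_pos)
  then show ?thesis by (simp only: y_def)
qed

section \<open>Stability of the difference of the two models\<close>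

text \<open>Difference of the two models: \<open>p = u\<^sup>\<epsilon> - u\<close>, \<open>q = v\<^sup>\<epsilon> - v\<close>, \<open>g = p\<^sub>t = q\<^sub>x\<close>, \<open>h = q\<^sub>t\<close>,
  \<open>N = W'(u + p) - W'(u)\<close>, and \<open>R = L\<^sub>\<epsilon>[u] - \<gamma> u\<^sub>x\<^sub>x\<close> is the consistency error.\<close>
locale difference = kernel \<phi> \<gamma> for \<phi> :: "real \<Rightarrow> real" and \<gamma> :: real +
  fixes T \<mu> \<epsilon> \<Lambda> M :: real and g h N R :: "real \<Rightarrow> real \<Rightarrow> real" and k :: "real \<Rightarrow> real"
  assumes T: "T > 0" and \<mu>: "\<mu> > 0" and \<epsilon>: "0 < \<epsilon>" "\<epsilon> < 1/2" and \<Lambda>: "\<Lambda> \<ge> 0" and M: "M > 0"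
    and g: "L2Q T g" and h: "L2Q T h"
  fixes p q :: "real \<Rightarrow> real \<Rightarrow> real"
  defines p_def: "p t x \<equiv> cum {0<..<T} (\<lambda>s. g s x) t" and q_def: "q t x \<equiv> cum {0<..<T} (\<lambda>s. h s x) t"
  fixes F :: "real \<Rightarrow> real \<Rightarrow> real"
  defines F_def: "F t x \<equiv> N t x + \<mu> * g t x - (cv \<epsilon> (p t) x - p t x) / \<epsilon>\<^sup>2 - R t x"
  assumes q_x: "AE t in JT T. is_wderiv (q t) (g t)"
    and q_t: "AE t in JT T. is_wderiv (F t) (h t)"
    and R: "AE t in JT T. R t \<in> borel_measurable borel \<and> (AE x in I1. \<bar>R t x\<bar> \<le> M) \<and> (\<integral>x. (R t x)\<^sup>2 \<partial>I1) \<le> (M * \<epsilon>)\<^sup>2"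
    and N: "AE t in JT T. N t \<in> borel_measurable borel \<and> (AE x in I1. \<bar>p t x\<bar> \<le> 1 \<longrightarrow> \<bar>N t x\<bar> \<le> \<Lambda> * \<bar>p t x\<bar>)"
    and k: "sqi (JT T) k" "AE t in JT T. AE x in I1. \<bar>g t x\<bar> \<le> k t"
begin

lemma g_meas [measurable]: "case_prod g \<in> borel_measurable (borel \<Otimes>\<^sub>M borel)" and h_meas [measurable]: "case_prod h \<in> borel_measurable (borel \<Otimes>\<^sub>M borel)"
  using g h by (auto simp: L2Q_iff)

lemma g_sqi: "sqi (JT T \<Otimes>\<^sub>M I1) (case_prod g)" and h_sqi: "sqi (JT T \<Otimes>\<^sub>M I1) (case_prod h)"
  using g h by (auto simp: L2Q_iff)

lemma case_I1: "borel_measurable (borel \<Otimes>\<^sub>M I1) = borel_measurable (borel \<Otimes>\<^sub>M borel)"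
  by (rule measurable_cong_sets[OF sets_pair_measure_cong]) auto

lemma p_meas [measurable]: "case_prod p \<in> borel_measurable (borel \<Otimes>\<^sub>M borel)"
  unfolding p_def using cum_measurable2[of "{0<..<T}" g borel] by simp

lemma q_meas [measurable]: "case_prod q \<in> borel_measurable (borel \<Otimes>\<^sub>M borel)"
  unfolding q_def using cum_measurable2[of "{0<..<T}" h borel] by simp

lemmas p_energy = energy_identity[OF less_imp_le[OF T] sigma_finite_lbon[OF borel_closed[OF closed_atLeastAtMost]] g_meas[folded case_I1] g_sqi, folded p_def]
lemmas q_energy = energy_identity[OF less_imp_le[OF T] sigma_finite_lbon[OF borel_closed[OF closed_atLeastAtMost]] h_meas[folded case_I1] h_sqi, folded q_def]

lemma p_L2S: "L2S (p t)" and q_L2S: "L2S (q t)"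
proof -
  have "per1 (g s)" "per1 (h s)" for s using g h by (auto simp: L2Q_iff)
  then have "per1 (p t)" "per1 (q t)" by (simp_all add: p_def q_def per1_def)
  then show "L2S (p t)" "L2S (q t)" using p_energy(2)[of t] q_energy(2)[of t] by (simp_all add: L2S_iff)
qed

definition e where "e t = (\<integral>x. (p t x)\<^sup>2 \<partial>I1) + (\<integral>x. (q t x)\<^sup>2 \<partial>I1)"

lemma e_meas: "e \<in> borel_measurable borel"
proof -
  interpret sigma_finite_measure I1 by simp
  show ?thesis unfolding e_def[abs_def] by measurable
qed

lemma e_nonneg: "0 \<le> e t"
  unfolding e_def by (auto intro!: integral_nonneg_AE add_nonneg_nonneg)

lemma e_bound: "e t \<le> T * (\<integral>z. (case_prod g z)\<^sup>2 \<partial>(JT T \<Otimes>\<^sub>M I1)) + T * (\<integral>z. (case_prod h z)\<^sup>2 \<partial>(JT T \<Otimes>\<^sub>M I1))"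
  unfolding e_def using p_energy(3)[of t] q_energy(3)[of t] by linarith

lemma n2_p_le: "n2 I1 (p t) \<le> sqrt (e t)" and n2_q_le: "n2 I1 (q t) \<le> sqrt (e t)"
  unfolding n2_def e_def by (auto intro!: integral_nonneg_AE real_sqrt_le_mono)

definition G where "G s = (\<integral>x. g s x * (cv \<epsilon> (p s) x - p s x) \<partial>I1)"

text \<open>Rotating the circle moves the shift by \<open>- \<epsilon> z\<close> to the other factor
  as a shift by \<open>\<epsilon> z\<close>, and evenness of the kernel restores the sign.\<close>

lemma cv_symmetric:
  assumes a: "L2S a" and b: "L2S b"
  shows "(\<integral>x. cv \<epsilon> a x * b x \<partial>I1) = (\<integral>x. cv \<epsilon> b x * a x \<partial>I1)"
proof -
  have [measurable]: "a \<in> borel_measurable borel" "b \<in> borel_measurable borel" and pa: "per1 a" and pb: "per1 b"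
    using a b by (auto simp: L2S_iff)
  have e: "(\<integral>x. a (x - \<epsilon> * z) * b x \<partial>I1) = (\<integral>x. b (x + \<epsilon> * z) * a x \<partial>I1)" for z
  proof -
    have "b (x + 1 + \<epsilon> * z) = b (x + \<epsilon> * z)" for x using pb[unfolded per1_def, rule_format, of "x + \<epsilon> * z"] by (simp add: algebra_simps)
    then have "per1 (\<lambda>x. b (x + \<epsilon> * z) * a x)" using pa by (simp add: per1_def)
    from per_integral_shift[OF _ this, of "- \<epsilon> * z"] show ?thesis by (simp add: mult.commute)
  qed
  interpret S: sigma_finite_measure I1 by simp
  have [measurable]: "(\<lambda>z. \<integral>x. b (x - \<epsilon> * z) * a x \<partial>I1) \<in> borel_measurable borel" by measurable
  have "(\<integral>x. cv \<epsilon> a x * b x \<partial>I1) = (\<integral>z. (\<integral>x. b (x - \<epsilon> * (- z)) * a x \<partial>I1) \<partial>K)"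
    using integral_cv_mult(2)[OF a L2S_sqi[OF b]] e by simp
  also have "\<dots> = (\<integral>z. (\<integral>x. b (x - \<epsilon> * z) * a x \<partial>I1) \<partial>K)"
    by (rule integral_K_neg) measurable
  also have "\<dots> = (\<integral>x. cv \<epsilon> b x * a x \<partial>I1)" using integral_cv_mult(2)[OF b L2S_sqi[OF a]] by simp
  finally show ?thesis .
qed

text \<open>The nonlocal operator is symmetric and negative semidefinite: the double integral of
  \<open>(p(x) - p(x - \<epsilon> z))\<^sup>2\<close> is nonnegative and its time derivative is \<open>- 4 G\<close>.\<close>
lemma nonlocal_energy: "cum {0<..<T} G t \<le> 0" and G_integrable: "integrable (JT T) G"
proof -
  define M2 where "M2 = I1 \<Otimes>\<^sub>M K"
  interpret IK: pair_sigma_finite I1 K by (rule pair_IK)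
  have sf: "sigma_finite_measure M2" unfolding M2_def by (rule IK.sigma_finite_measure_axioms)
  interpret M2: sigma_finite_measure M2 by fact
  interpret J: sigma_finite_measure "JT T" by simp
  interpret JM: pair_sigma_finite "JT T" M2 ..
  have setsM: "sets M2 = sets (borel \<Otimes>\<^sub>M borel)" unfolding M2_def by (rule sets_IK)
  have [measurable_cong]: "sets M2 = sets (borel \<Otimes>\<^sub>M borel)" by (rule setsM)
  \<comment> \<open>\<open>f1 - f2\<close> is the time derivative of
    \<open>p(x) - p(x - \<epsilon> z)\<close>, so \<open>energy_identity\<close> applies to it on
    the circle times the kernel measure.\<close>
  define f1 f2 where "f1 s z = g s (fst z)" and "f2 s z = g s (fst z - \<epsilon> * snd z)" for s and z :: "real \<times> real"
  define f where "f s z = f1 s z - f2 s z" for s z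
  have m1 [measurable]: "case_prod f1 \<in> borel_measurable (borel \<Otimes>\<^sub>M M2)" unfolding f1_def by measurable
  have m2 [measurable]: "case_prod f2 \<in> borel_measurable (borel \<Otimes>\<^sub>M M2)" unfolding f2_def by measurable
  have m3 [measurable]: "case_prod f \<in> borel_measurable (borel \<Otimes>\<^sub>M M2)" unfolding f_def by measurable
  have slice: "AE s in JT T. L2S (g s)" by (rule L2Q_slice[OF g])
  have n2g: "integrable (JT T) (\<lambda>s. \<integral>x. (g s x)\<^sup>2 \<partial>I1)"
  proof -
    interpret P: pair_sigma_finite "JT T" I1 by (rule pair_JI)
    show ?thesis using P.integrable_fst'[OF sqi_square[OF g_sqi]] by simp
  qed
  have sq: "sqi (JT T \<Otimes>\<^sub>M M2) (\<lambda>(s, z). g s (fst z - c * snd z))" for c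
    unfolding sqi_def
  proof
    show mm: "(\<lambda>(s, z). g s (fst z - c * snd z)) \<in> borel_measurable (JT T \<Otimes>\<^sub>M M2)" by measurable
    show "integrable (JT T \<Otimes>\<^sub>M M2) (\<lambda>sz. (case sz of (s, z) \<Rightarrow> g s (fst z - c * snd z))\<^sup>2)"
    proof (rule JM.Fubini_integrable)
      show "AE s in JT T. integrable M2 (\<lambda>z. (case (s, z) of (s, z) \<Rightarrow> g s (fst z - c * snd z))\<^sup>2)"
        using slice by eventually_elim (use sqi_shift2(1) in \<open>auto simp: M2_def sqi_def\<close>)
      have "AE s in JT T. (\<integral>z. (g s (fst z - c * snd z))\<^sup>2 \<partial>M2) = (\<integral>x. (g s x)\<^sup>2 \<partial>I1)"
        using slice by eventually_elim (use sqi_shift2(2) in \<open>auto simp: M2_def\<close>)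
      then have "integrable (JT T) (\<lambda>s. \<integral>z. (g s (fst z - c * snd z))\<^sup>2 \<partial>M2)"
        by (intro integrable_cong_AE[THEN iffD2, OF _ _ _ n2g]) (auto elim: eventually_mono)
      then show "integrable (JT T) (\<lambda>s. \<integral>z. norm ((case (s, z) of (s, z) \<Rightarrow> g s (fst z - c * snd z))\<^sup>2) \<partial>M2)" by simp
    qed (use mm in measurable)
  qed
  have s1: "sqi (JT T \<Otimes>\<^sub>M M2) (case_prod f1)" using sq[of 0] by (simp add: f1_def[abs_def])
  have s2: "sqi (JT T \<Otimes>\<^sub>M M2) (case_prod f2)" using sq[of \<epsilon>] by (simp add: f2_def[abs_def])
  have s3: "sqi (JT T \<Otimes>\<^sub>M M2) (case_prod f)"
    using sqi_diff[OF s1 s2] by (simp add: f_def[abs_def] split_beta')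
  note en = energy_identity[OF less_imp_le[OF T] sf m3 s3]
  have AEz: "AE z in M2. \<forall>t. cum {0<..<T} (\<lambda>s. f s z) t = p t (fst z) - p t (fst z - \<epsilon> * snd z)"
  proof -
    have sq': "integrable (JT T \<Otimes>\<^sub>M M2) (\<lambda>(s, z). (f1 s z)\<^sup>2)" "integrable (JT T \<Otimes>\<^sub>M M2) (\<lambda>(s, z). (f2 s z)\<^sup>2)"
      using sqi_square[OF s1] sqi_square[OF s2] by (simp_all add: split_beta')
    have "AE z in M2. sqi (JT T) (\<lambda>s. f1 s z)" "AE z in M2. sqi (JT T) (\<lambda>s. f2 s z)"
      using JM.AE_integrable_snd[OF sq'(1)] JM.AE_integrable_snd[OF sq'(2)] by (auto simp: sqi_def f1_def f2_def)
    then show ?thesis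
    proof eventually_elim
      case (elim z)
      have i: "integrable (JT T) (\<lambda>s. f1 s z)" "integrable (JT T) (\<lambda>s. - 1 * f2 s z)"
        using elim sqi_imp_integrable[OF finite_JT] by auto
      have "cum {0<..<T} (\<lambda>s. f s z) t = cum {0<..<T} (\<lambda>s. f1 s z) t + (-1) * cum {0<..<T} (\<lambda>s. f2 s z) t" for t
        unfolding cum_cmult[symmetric] cum_add[OF borel_open[OF open_greaterThanLessThan] i, symmetric] by (simp add: f_def)
      then show ?case by (simp add: p_def f1_def f2_def)
    qed
  qed
  \<comment> \<open>Of the four products, the two unmixed ones agree by shift invariance and the two
    mixed ones by \<open>cv_symmetric\<close>, which leaves \<open>-2 G s\<close>.\<close>
  have Gs: "AE s in JT T. (\<integral>z. f s z * cum {0<..<T} (\<lambda>r. f r z) s \<partial>M2) = -2 * G s"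
    using slice
  proof eventually_elim
    case (elim s)
    have [measurable]: "g s \<in> borel_measurable borel" "p s \<in> borel_measurable borel" using elim p_L2S[of s] by (auto simp: L2S_iff)
    have gs: "sqi I1 (g s)" "sqi I1 (p s)" using elim p_L2S[of s] by (auto simp: L2S_iff)
    have per: "per1 (\<lambda>x. g s x * p s x)" using elim p_L2S[of s] by (auto simp: L2S_iff per1_def)
    note S = sqi_shift2(1)[OF elim, of \<epsilon>] sqi_shift2(1)[OF elim, of 0] sqi_shift2(1)[OF p_L2S[of s], of \<epsilon>] sqi_shift2(1)[OF p_L2S[of s], of 0]
    let ?a = "\<lambda>z. g s (fst z)" and ?b = "\<lambda>z. g s (fst z - \<epsilon> * snd z)" and ?c = "\<lambda>z. p s (fst z)" and ?d = "\<lambda>z. p s (fst z - \<epsilon> * snd z)"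
    have i: "integrable M2 (\<lambda>z. ?a z * ?c z)" "integrable M2 (\<lambda>z. ?a z * ?d z)" "integrable M2 (\<lambda>z. ?b z * ?c z)" "integrable M2 (\<lambda>z. ?b z * ?d z)"
      using S by (auto simp: M2_def intro!: sqi_mult)
    have "(\<integral>z. f s z * cum {0<..<T} (\<lambda>r. f r z) s \<partial>M2) = (\<integral>z. ?a z * ?c z - ?a z * ?d z - ?b z * ?c z + ?b z * ?d z \<partial>M2)"
    proof (rule integral_cong_AE)
      show "AE z in M2. f s z * cum {0<..<T} (\<lambda>r. f r z) s = ?a z * ?c z - ?a z * ?d z - ?b z * ?c z + ?b z * ?d z"
        using AEz
      proof eventually_elim
        case (elim z)
        then have c: "cum {0<..<T} (\<lambda>r. f r z) s = ?c z - ?d z" by blast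
        show ?case unfolding c by (simp add: f_def f1_def f2_def algebra_simps)
      qed
      have "(\<lambda>z. cum {0<..<T} (\<lambda>r. f r z) s) \<in> borel_measurable M2" using en(2)[of s] by (rule sqi_measurable)
      then show "(\<lambda>z. f s z * cum {0<..<T} (\<lambda>r. f r z) s) \<in> borel_measurable M2"
        unfolding f_def[of s] f1_def f2_def by measurable
    qed measurable
    also have "\<dots> = (\<integral>z. ?a z * ?c z \<partial>M2) - (\<integral>z. ?a z * ?d z \<partial>M2) - (\<integral>z. ?b z * ?c z \<partial>M2) + (\<integral>z. ?b z * ?d z \<partial>M2)"
      using i by simp
    also have "(\<integral>z. ?a z * ?c z \<partial>M2) = (\<integral>x. g s x * p s x \<partial>I1)"
      using IK.integral_fst'[OF i(1)[unfolded M2_def]] by (simp add: M2_def measure_def emeasure_K)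
    also have "(\<integral>z. ?b z * ?d z \<partial>M2) = (\<integral>x. g s x * p s x \<partial>I1)"
    proof -
      have e: "(\<integral>x. g s (x - \<epsilon> * z) * p s (x - \<epsilon> * z) \<partial>I1) = (\<integral>x. g s x * p s x \<partial>I1)" for z
        using per_integral_shift[OF _ per, of "- \<epsilon> * z"] by simp
      have "(\<integral>z. ?b z * ?d z \<partial>M2) = (\<integral>z. (\<integral>x. g s (x - \<epsilon> * z) * p s (x - \<epsilon> * z) \<partial>I1) \<partial>K)"
        using IK.integral_snd[of "\<lambda>x z. g s (x - \<epsilon> * z) * p s (x - \<epsilon> * z)"] i(4) by (simp add: M2_def split_beta')
      then show ?thesis unfolding e integral_K_const .
    qed
    also have "(\<integral>z. ?a z * ?d z \<partial>M2) = (\<integral>x. cv \<epsilon> (p s) x * g s x \<partial>I1)"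
      using integral_cv_mult(3)[OF p_L2S[of s] gs(1)] by (simp add: M2_def mult.commute)
    also have "(\<integral>z. ?b z * ?c z \<partial>M2) = (\<integral>x. cv \<epsilon> (g s) x * p s x \<partial>I1)"
      using integral_cv_mult(3)[OF elim gs(2)] by (simp add: M2_def)
    also have "\<dots> = (\<integral>x. cv \<epsilon> (p s) x * g s x \<partial>I1)" by (rule cv_symmetric[OF elim p_L2S])
    also have "(\<integral>x. g s x * p s x \<partial>I1) - (\<integral>x. cv \<epsilon> (p s) x * g s x \<partial>I1) - (\<integral>x. cv \<epsilon> (p s) x * g s x \<partial>I1) + (\<integral>x. g s x * p s x \<partial>I1) = -2 * G s"
    proof -
      have "integrable I1 (\<lambda>x. g s x * cv \<epsilon> (p s) x)" "integrable I1 (\<lambda>x. g s x * p s x)"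
        using gs cv_L2S(1)[OF p_L2S[of s]] by (auto intro!: sqi_mult L2S_sqi)
      then have "G s = (\<integral>x. g s x * cv \<epsilon> (p s) x \<partial>I1) - (\<integral>x. g s x * p s x \<partial>I1)"
        unfolding G_def right_diff_distrib by (rule Bochner_Integration.integral_diff)
      then show ?thesis by (simp add: mult.commute)
    qed
    finally show ?case .
  qed
  have Gm [measurable]: "G \<in> borel_measurable borel"
  proof -
    interpret S: sigma_finite_measure I1 by simp
    interpret finite_measure K by (rule finite_K)
    have [measurable]: "(\<lambda>(s, x). cv \<epsilon> (p s) x) \<in> borel_measurable (borel \<Otimes>\<^sub>M borel)" unfolding cv_def by measurable
    show ?thesis unfolding G_def[abs_def] by measurable
  qed
  have i4: "integrable (JT T) (\<lambda>s. \<integral>z. f s z * cum {0<..<T} (\<lambda>r. f r z) s \<partial>M2)" by (rule en(4))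
  have "integrable (JT T) (\<lambda>s. -2 * G s)"
    by (rule integrable_cong_AE[THEN iffD1, OF _ _ Gs i4]) (use borel_measurable_integrable[OF i4] in auto)
  then show "integrable (JT T) G" by simp
  have "0 \<le> (\<integral>z. (cum {0<..<T} (\<lambda>s. f s z) t)\<^sup>2 \<partial>M2)" by (rule integral_nonneg_AE) auto
  also have "\<dots> = 2 * cum {0<..<T} (\<lambda>s. \<integral>z. f s z * cum {0<..<T} (\<lambda>r. f r z) s \<partial>M2) t" by (rule en(5))
  also have "cum {0<..<T} (\<lambda>s. \<integral>z. f s z * cum {0<..<T} (\<lambda>r. f r z) s \<partial>M2) t = cum {0<..<T} (\<lambda>s. -2 * G s) t"
    by (rule cum_cong_AE[OF _ _ _ Gs]) (use borel_measurable_integrable[OF i4] in auto)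
  finally show "cum {0<..<T} G t \<le> 0" unfolding cum_cmult by simp
qed

end

section \<open>The L2 estimate while the difference is pointwise small\<close>

lemma young: "(\<mu>::real) > 0 \<Longrightarrow> 2 * (a * b) \<le> 2 * \<mu> * b\<^sup>2 + a\<^sup>2 / (2 * \<mu>)"
proof -
  assume m: "\<mu> > 0"
  have "0 \<le> (2 * \<mu> * b - a)\<^sup>2 / (2 * \<mu>)" using m by simp
  also have "\<dots> = 2 * \<mu> * b\<^sup>2 + a\<^sup>2 / (2 * \<mu>) - 2 * (a * b)" using m by (simp add: power2_eq_square field_simps)
  finally show ?thesis by simp
qed

lemma young': "(\<mu>::real) > 0 \<Longrightarrow> a * b - \<mu> * b\<^sup>2 \<le> 1 / (4 * \<mu>) * a\<^sup>2"
proof -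
  assume m: "\<mu> > 0"
  have "a\<^sup>2 / (2 * \<mu>) = 2 * (1 / (4 * \<mu>) * a\<^sup>2)" by simp
  with young[OF m, of a b] show ?thesis by linarith
qed

lemma scaled_identity:
  fixes m e :: real
  assumes "m \<noteq> 0" "e \<noteq> 0"
  shows "m * e\<^sup>2 * ((a - b / m) + 1 / (m * e\<^sup>2) * (c - d / m)) = e\<^sup>2 * (m * a - b) + (c - d / m)"
proof -
  have "m * e\<^sup>2 * (1 / (m * e\<^sup>2) * (c - d / m)) = c - d / m" using assms by simp
  moreover have "m * e\<^sup>2 * (a - b / m) = e\<^sup>2 * (m * a - b)" using assms by (simp add: right_diff_distrib)
  ultimately show ?thesis by (simp only: distrib_left)
qed

lemma three_sq: "(a + b + c)\<^sup>2 \<le> 3 * (a\<^sup>2 + b\<^sup>2 + (c::real)\<^sup>2)"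
proof -
  have "0 \<le> (a - b)\<^sup>2 + (b - c)\<^sup>2 + (a - c)\<^sup>2" by simp
  then show ?thesis by (simp add: power2_eq_square algebra_simps)
qed

context difference
begin

text \<open>The exceptional null set does not depend on \<open>t\<close>, so that for almost every
  fixed \<open>x\<close> the whole trajectory can be followed in time.\<close>

definition small :: "real \<Rightarrow> bool" where
  "small t0 \<longleftrightarrow> (AE x in I1. \<forall>t. 0 \<le> t \<and> t \<le> t0 \<longrightarrow> \<bar>p t x\<bar> \<le> 1)"

lemma smallD: "small t0 \<Longrightarrow> 0 \<le> t \<Longrightarrow> t \<le> t0 \<Longrightarrow> AE x in I1. \<bar>p t x\<bar> \<le> 1"
  unfolding small_def by (erule eventually_mono) blast

text \<open>The factor \<open>3 / (2 \<mu>)\<close> is \<open>2\<close> from differentiating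
  squares, times \<open>1 / (4 \<mu>)\<close> from Young's inequality, times \<open>3\<close> from
  the square of a sum of three terms. \<open>1 + \<Lambda>^2\<close> collects \<open>p\<close> and
  \<open>N\<close>; \<open>a0\<close> carries the consistency error in the same way.\<close>

definition K0 where "K0 = 3 / (2 * \<mu>) * (1 + \<Lambda>\<^sup>2)"
definition a0 where "a0 = 3 / (2 * \<mu>) * (M * \<epsilon>)\<^sup>2"

lemma K0: "K0 > 0"
  unfolding K0_def using \<mu> by (intro mult_pos_pos divide_pos_pos) (auto intro: add_pos_nonneg)

lemma a0: "a0 \<ge> 0"
  unfolding a0_def using \<mu> by simp

definition Dt where "Dt s = 2 * (\<integral>x. g s x * p s x \<partial>I1) + 2 * (\<integral>x. h s x * q s x \<partial>I1)"

lemma Dt_integrable: "integrable (JT T) Dt"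
  unfolding Dt_def using p_energy(4) q_energy(4) by simp

lemma e_eq: "e t = cum {0<..<T} Dt t"
  unfolding e_def p_energy(5) q_energy(5) Dt_def cum_cmult[symmetric]
  by (rule cum_add[symmetric]) (use p_energy(4) q_energy(4) in auto)

lemma N_R_sqi:
  assumes "AE x in I1. \<bar>p t x\<bar> \<le> 1" "N t \<in> borel_measurable borel" "AE x in I1. \<bar>p t x\<bar> \<le> 1 \<longrightarrow> \<bar>N t x\<bar> \<le> \<Lambda> * \<bar>p t x\<bar>"
    and "R t \<in> borel_measurable borel" "AE x in I1. \<bar>R t x\<bar> \<le> M"
  shows "sqi I1 (N t)" "sqi I1 (R t)" "(\<integral>x. (N t x)\<^sup>2 \<partial>I1) \<le> \<Lambda>\<^sup>2 * (\<integral>x. (p t x)\<^sup>2 \<partial>I1)" "AE x in I1. \<bar>N t x\<bar> \<le> \<Lambda>"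
proof -
  have le: "AE x in I1. \<bar>N t x\<bar> \<le> \<bar>\<Lambda> * p t x\<bar>"
    using assms(1,3) by eventually_elim (use \<Lambda> in \<open>simp add: abs_mult\<close>)
  have s: "sqi I1 (\<lambda>x. \<Lambda> * p t x)" by (rule sqi_cmult[OF L2S_sqi[OF p_L2S]])
  show N: "sqi I1 (N t)" by (rule sqi_bound[OF s]) (use assms le in auto)
  show "sqi I1 (R t)" by (rule sqi_bounded[OF finite_I1 _ assms(5)]) (use assms(4) in simp)
  show "(\<integral>x. (N t x)\<^sup>2 \<partial>I1) \<le> \<Lambda>\<^sup>2 * (\<integral>x. (p t x)\<^sup>2 \<partial>I1)"
    using n2_mono_AE[OF N s le] by (simp add: power_mult_distrib)
  show "AE x in I1. \<bar>N t x\<bar> \<le> \<Lambda>"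
    using assms(1,3)
  proof eventually_elim
    case (elim x)
    have "\<Lambda> * \<bar>p t x\<bar> \<le> \<Lambda> * 1" by (rule mult_left_mono) (use elim \<Lambda> in auto)
    with elim show ?case by simp
  qed
qed

text \<open>Integration by parts turns \<open>h q\<close> into \<open>- g F\<close>, and
  \<open>F\<close> contributes \<open>- \<mu> g^2\<close>, which absorbs
  \<open>(p - N + R) g\<close> by Young's inequality. The part with \<open>\<epsilon>^-2\<close> is
  kept exactly as a multiple of \<open>G\<close>, because its sign appears only after integration in
  time.\<close>

lemma Dt_le:
  assumes t0: "small t0"
  shows "AE s in JT T. s \<le> t0 \<longrightarrow> Dt s \<le> a0 + K0 * e s + 2 / \<epsilon>\<^sup>2 * G s"
proof -
  have pos: "AE s in JT T. 0 < s" by (simp add: AE_lbon)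
  show ?thesis
    using q_x q_t R N pos L2Q_slice[OF g] L2Q_slice[OF h]
  proof eventually_elim
    case (elim s)
    show ?case
    proof
      assume "s \<le> t0"
      then have p1: "AE x in I1. \<bar>p s x\<bar> \<le> 1" using smallD[OF t0, of s] elim by simp
      note NR = N_R_sqi[OF p1 conjunct1[OF elim(4)] conjunct2[OF elim(4)] conjunct1[OF elim(3)] conjunct1[OF conjunct2[OF elim(3)]]]
      have S: "sqi I1 (g s)" "sqi I1 (h s)" "sqi I1 (p s)" "sqi I1 (q s)" using elim p_L2S q_L2S by (auto simp: L2S_iff)
      have Sl: "sqi I1 (\<lambda>x. cv \<epsilon> (p s) x - p s x)" by (rule sqi_diff[OF L2S_sqi[OF cv_L2S(1)[OF p_L2S]] S(3)])
      have a: "sqi I1 (\<lambda>x. p s x + (-1) * N s x + R s x)" by (intro sqi_add sqi_cmult S NR)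
      have "(\<integral>x. h s x * q s x \<partial>I1) = (\<integral>x. q s x * h s x \<partial>I1)" by (simp add: mult.commute)
      also have "\<dots> = - (\<integral>x. g s x * F s x \<partial>I1)" by (rule is_wderiv_parts[OF elim(1,2)])
      finally have hq: "(\<integral>x. h s x * q s x \<partial>I1) = - (\<integral>x. g s x * F s x \<partial>I1)" .
      have ip: "integrable I1 (\<lambda>x. g s x * p s x)" and ig: "integrable I1 (\<lambda>x. (g s x)\<^sup>2)"
        and il: "integrable I1 (\<lambda>x. g s x * (cv \<epsilon> (p s) x - p s x))"
        and ia: "integrable I1 (\<lambda>x. (p s x + (-1) * N s x + R s x) * g s x)"
        and ia2: "integrable I1 (\<lambda>x. (p s x + (-1) * N s x + R s x)\<^sup>2)"
        by (rule sqi_mult[OF S(1,3)] sqi_square[OF S(1)] sqi_mult[OF S(1) Sl] sqi_mult[OF a S(1)] sqi_square[OF a])+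
      have iF: "integrable I1 (\<lambda>x. g s x * F s x)" using S(1) is_wderiv_L2S(1)[OF elim(2)] by (auto intro: sqi_mult L2S_sqi)
      have "(\<integral>x. g s x * p s x \<partial>I1) - (\<integral>x. g s x * F s x \<partial>I1) = (\<integral>x. g s x * p s x - g s x * F s x \<partial>I1)"
        by (rule Bochner_Integration.integral_diff[OF ip iF, symmetric])
      also have "(\<lambda>x. g s x * p s x - g s x * F s x) =
        (\<lambda>x. (p s x + (-1) * N s x + R s x) * g s x - \<mu> * (g s x)\<^sup>2 + 1 / \<epsilon>\<^sup>2 * (g s x * (cv \<epsilon> (p s) x - p s x)))"
      proof
        fix x
        define L where "L = (cv \<epsilon> (p s) x - p s x) / \<epsilon>\<^sup>2"
        have A: "1 / \<epsilon>\<^sup>2 * (g s x * (cv \<epsilon> (p s) x - p s x)) = g s x * L" by (simp add: L_def)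
        have B: "F s x = N s x + \<mu> * g s x - L - R s x" by (simp add: F_def L_def)
        show "g s x * p s x - g s x * F s x =
          (p s x + (-1) * N s x + R s x) * g s x - \<mu> * (g s x)\<^sup>2 + 1 / \<epsilon>\<^sup>2 * (g s x * (cv \<epsilon> (p s) x - p s x))"
          unfolding A B by (simp add: algebra_simps power2_eq_square)
      qed
      also have "(\<integral>x. (p s x + (-1) * N s x + R s x) * g s x - \<mu> * (g s x)\<^sup>2 + 1 / \<epsilon>\<^sup>2 * (g s x * (cv \<epsilon> (p s) x - p s x)) \<partial>I1)
        = (\<integral>x. (p s x + (-1) * N s x + R s x) * g s x - \<mu> * (g s x)\<^sup>2 \<partial>I1) + (\<integral>x. 1 / \<epsilon>\<^sup>2 * (g s x * (cv \<epsilon> (p s) x - p s x)) \<partial>I1)"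
        by (rule Bochner_Integration.integral_add[OF Bochner_Integration.integrable_diff[OF ia integrable_mult_right[OF ig]] integrable_mult_right[OF il]])
      also have "(\<integral>x. 1 / \<epsilon>\<^sup>2 * (g s x * (cv \<epsilon> (p s) x - p s x)) \<partial>I1) = 1 / \<epsilon>\<^sup>2 * G s"
        unfolding G_def by (rule integral_mult_right_zero)
      finally have 1: "(\<integral>x. g s x * p s x \<partial>I1) - (\<integral>x. g s x * F s x \<partial>I1) =
          (\<integral>x. (p s x + (-1) * N s x + R s x) * g s x - \<mu> * (g s x)\<^sup>2 \<partial>I1) + 1 / \<epsilon>\<^sup>2 * G s" .
      have "(\<integral>x. (p s x + (-1) * N s x + R s x) * g s x - \<mu> * (g s x)\<^sup>2 \<partial>I1) \<le> (\<integral>x. 1 / (4 * \<mu>) * (p s x + (-1) * N s x + R s x)\<^sup>2 \<partial>I1)"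
        by (rule integral_mono[OF Bochner_Integration.integrable_diff[OF ia integrable_mult_right[OF ig]] integrable_mult_right[OF ia2]])
           (rule young'[OF \<mu>])
      also have "\<dots> = 1 / (4 * \<mu>) * (\<integral>x. (p s x + (-1) * N s x + R s x)\<^sup>2 \<partial>I1)"
        by (rule integral_mult_right_zero)
      finally have 2: "(\<integral>x. (p s x + (-1) * N s x + R s x) * g s x - \<mu> * (g s x)\<^sup>2 \<partial>I1) \<le> 1 / (4 * \<mu>) * (\<integral>x. (p s x + (-1) * N s x + R s x)\<^sup>2 \<partial>I1)" .
      have 3: "(\<integral>x. (p s x + (-1) * N s x + R s x)\<^sup>2 \<partial>I1) \<le> 3 * ((1 + \<Lambda>\<^sup>2) * e s + (M * \<epsilon>)\<^sup>2)"
      proof -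
        have i3: "integrable I1 (\<lambda>x. (p s x)\<^sup>2)" "integrable I1 (\<lambda>x. (N s x)\<^sup>2)" "integrable I1 (\<lambda>x. (R s x)\<^sup>2)"
          using S NR by (auto simp: sqi_square)
        have "(\<integral>x. (p s x + (-1) * N s x + R s x)\<^sup>2 \<partial>I1) \<le> (\<integral>x. 3 * ((p s x)\<^sup>2 + (N s x)\<^sup>2 + (R s x)\<^sup>2) \<partial>I1)"
        proof (rule integral_mono[OF ia2])
          fix x show "(p s x + (-1) * N s x + R s x)\<^sup>2 \<le> 3 * ((p s x)\<^sup>2 + (N s x)\<^sup>2 + (R s x)\<^sup>2)"
            using three_sq[of "p s x" "- N s x" "R s x"] by simp
        qed (use i3 in simp)
        also have "\<dots> = 3 * ((\<integral>x. (p s x)\<^sup>2 \<partial>I1) + (\<integral>x. (N s x)\<^sup>2 \<partial>I1) + (\<integral>x. (R s x)\<^sup>2 \<partial>I1))" using i3 by simp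
        also have "\<dots> \<le> 3 * ((\<integral>x. (p s x)\<^sup>2 \<partial>I1) + \<Lambda>\<^sup>2 * (\<integral>x. (p s x)\<^sup>2 \<partial>I1) + (M * \<epsilon>)\<^sup>2)"
          using NR(3) elim(3) by simp
        also have "\<dots> = 3 * ((1 + \<Lambda>\<^sup>2) * (\<integral>x. (p s x)\<^sup>2 \<partial>I1) + (M * \<epsilon>)\<^sup>2)" by (simp add: algebra_simps)
        also have "\<dots> \<le> 3 * ((1 + \<Lambda>\<^sup>2) * e s + (M * \<epsilon>)\<^sup>2)"
          by (intro mult_left_mono add_right_mono) (simp_all add: e_def)
        finally show ?thesis .
      qed
      have "1 / (4 * \<mu>) * (\<integral>x. (p s x + (-1) * N s x + R s x)\<^sup>2 \<partial>I1) \<le> 1 / (4 * \<mu>) * (3 * ((1 + \<Lambda>\<^sup>2) * e s + (M * \<epsilon>)\<^sup>2))"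
        by (rule mult_left_mono[OF 3]) (use \<mu> in simp)
      with 1 2 have "(\<integral>x. g s x * p s x \<partial>I1) - (\<integral>x. g s x * F s x \<partial>I1) \<le>
         1 / (4 * \<mu>) * (3 * ((1 + \<Lambda>\<^sup>2) * e s + (M * \<epsilon>)\<^sup>2)) + 1 / \<epsilon>\<^sup>2 * G s" by linarith
      moreover have "a - b \<le> r \<Longrightarrow> 2 * a + 2 * - b \<le> 2 * r" for a b r :: real by linarith
      ultimately have "Dt s \<le> 2 * (1 / (4 * \<mu>) * (3 * ((1 + \<Lambda>\<^sup>2) * e s + (M * \<epsilon>)\<^sup>2)) + 1 / \<epsilon>\<^sup>2 * G s)"
        unfolding Dt_def hq by blast
      also have "\<dots> = a0 + K0 * e s + 2 / \<epsilon>\<^sup>2 * G s"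
      proof -
        have "2 * (1 / (4 * m) * (3 * ((1 + l) * E + r)) + w * y) = 3 / (2 * m) * r + 3 / (2 * m) * (1 + l) * E + 2 * w * y"
          for m l E r w y :: real by (simp add: ring_distribs add_divide_distrib mult_ac)
        from this[of \<mu> "\<Lambda>\<^sup>2" "e s" "(M * \<epsilon>)\<^sup>2" "1 / \<epsilon>\<^sup>2" "G s"] show ?thesis by (simp add: a0_def K0_def)
      qed
      finally show "Dt s \<le> a0 + K0 * e s + 2 / \<epsilon>\<^sup>2 * G s" .
    qed
  qed
qed

lemma e_integrable: "integrable (JT T) e"
  by (rule sqi_imp_integrable[OF finite_JT], rule sqi_bounded[OF finite_JT, of _ _ "T * (\<integral>z. (case_prod g z)\<^sup>2 \<partial>(JT T \<Otimes>\<^sub>M I1)) + T * (\<integral>z. (case_prod h z)\<^sup>2 \<partial>(JT T \<Otimes>\<^sub>M I1))"])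
     (use e_meas e_nonneg e_bound in auto)

text \<open>The Gronwall bound \<open>2 a0 T exp (2 K0 T)\<close> with the factor
  \<open>\<epsilon>^2\<close> of \<open>a0\<close> taken out.\<close>

definition C1 where "C1 = 2 * (3 / (2 * \<mu>) * M\<^sup>2 * T) * exp (2 * K0 * T)"

lemma energy_estimate:
  assumes t0: "small t0" "0 \<le> t0" "t0 \<le> T" and t: "0 \<le> t" "t \<le> t0"
  shows "e t \<le> C1 * \<epsilon>\<^sup>2"
proof -
  have "e t \<le> 2 * (a0 * T) * exp (2 * K0 * t)"
  proof (rule gronwall[OF t0(2,3) e_meas e_nonneg e_bound K0 _ t])
    fix t assume t: "0 \<le> t" "t \<le> t0"
    have G2: "integrable (JT T) (\<lambda>s. 2 / \<epsilon>\<^sup>2 * G s)" and e2: "integrable (JT T) (\<lambda>s. K0 * e s)"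
      and c2: "integrable (JT T) (\<lambda>s. a0)"
      using G_integrable e_integrable finite_measure.integrable_const[OF finite_JT] by auto
    have "e t \<le> cum {0<..<T} (\<lambda>s. a0 + K0 * e s + 2 / \<epsilon>\<^sup>2 * G s) t"
      unfolding e_eq[of t]
    proof (rule cum_mono_AE[OF _ Dt_integrable])
      show "integrable (JT T) (\<lambda>s. a0 + K0 * e s + 2 / \<epsilon>\<^sup>2 * G s)" by (intro Bochner_Integration.integrable_add c2 e2 G2)
      show "AE s in JT T. s \<le> t \<longrightarrow> Dt s \<le> a0 + K0 * e s + 2 / \<epsilon>\<^sup>2 * G s"
        using Dt_le[OF t0(1)] by eventually_elim (use t in auto)
    qed simp
    also have "\<dots> = cum {0<..<T} (\<lambda>s. a0) t + cum {0<..<T} (\<lambda>s. K0 * e s) t + cum {0<..<T} (\<lambda>s. 2 / \<epsilon>\<^sup>2 * G s) t"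
      unfolding cum_add[OF borel_open[OF open_greaterThanLessThan] Bochner_Integration.integrable_add[OF c2 e2] G2]
        cum_add[OF borel_open[OF open_greaterThanLessThan] c2 e2] ..
    finally have 1: "e t \<le> cum {0<..<T} (\<lambda>s. a0) t + cum {0<..<T} (\<lambda>s. K0 * e s) t + cum {0<..<T} (\<lambda>s. 2 / \<epsilon>\<^sup>2 * G s) t" .
    have 2: "cum {0<..<T} (\<lambda>s. 2 / \<epsilon>\<^sup>2 * G s) t \<le> 0"
      unfolding cum_cmult using nonlocal_energy[of t] by (intro mult_nonneg_nonpos) auto
    have 3: "cum {0<..<T} (\<lambda>s. K0 * e s) t = K0 * cum {0<..<T} e t" by (rule cum_cmult)
    have 4: "cum {0<..<T} (\<lambda>s. a0) t \<le> a0 * T"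
    proof -
      have "\<bar>cum {0<..<T} (\<lambda>s. a0) t\<bar> \<le> (\<integral>s. \<bar>a0\<bar> \<partial>JT T)" by (rule abs_cum_le[OF _ c2]) simp
      also have "\<dots> = a0 * T" using T a0 by (simp add: measure_JT mult.commute)
      finally show ?thesis by linarith
    qed
    show "e t \<le> a0 * T + K0 * cum {0<..<T} e t" using 1 2 3 4 by linarith
  qed
  also have "\<dots> \<le> 2 * (a0 * T) * exp (2 * K0 * T)"
    using t t0 K0 a0 T by (intro mult_left_mono) auto
  also have "\<dots> = C1 * \<epsilon>\<^sup>2" by (simp add: C1_def a0_def power_mult_distrib)
  finally show ?thesis .
qed

end

section \<open>Pointwise relations through the spatial primitive\<close>

context difference
begin

text \<open>Integrating \<open>f\<close> against \<open>ker x\<close> gives the primitive of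
  \<open>f\<close> with mean zero: \<open>1 - y\<close> is the weight with which \<open>f y\<close>
  enters the mean of \<open>cum {0..1} f\<close>. In this form the primitive commutes with
  integration in time.\<close>

definition ker :: "real \<Rightarrow> real \<Rightarrow> real" where "ker x y = indicator {..x} y - (1 - y)"

lemma ker_bound: "y \<in> {0..1} \<Longrightarrow> \<bar>ker x y\<bar> \<le> 1"
  by (auto simp: ker_def indicator_def)

lemma ker_meas [measurable]: "case_prod ker \<in> borel_measurable (borel \<Otimes>\<^sub>M borel)"
proof -
  have "(\<lambda>(x, y). indicator {(x, y). y \<le> x} (x, y) - (1 - y) :: real) \<in> borel_measurable (borel \<Otimes>\<^sub>M borel)"
    by measurable
  then show ?thesis by (simp add: ker_def[abs_def] indicator_def)
qed

definition Q where "Q t x = (\<integral>y. ker x y * q t y \<partial>I1)"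
definition H where "H t x = (\<integral>y. ker x y * h t y \<partial>I1)"

lemma Q_meas [measurable]: "case_prod Q \<in> borel_measurable (borel \<Otimes>\<^sub>M borel)"
  and H_meas [measurable]: "case_prod H \<in> borel_measurable (borel \<Otimes>\<^sub>M borel)"
proof -
  interpret sigma_finite_measure I1 by simp
  show "case_prod Q \<in> borel_measurable (borel \<Otimes>\<^sub>M borel)" unfolding Q_def[abs_def] by measurable
  show "case_prod H \<in> borel_measurable (borel \<Otimes>\<^sub>M borel)" unfolding H_def[abs_def] by measurable
qed

lemma ker_sqi: "sqi I1 f \<Longrightarrow> sqi I1 (\<lambda>y. ker x y * f y)"
proof (rule sqi_mult_bounded[of _ _ _ 1])
  show "ker x \<in> borel_measurable I1" by simp
  show "AE y in I1. \<bar>ker x y\<bar> \<le> 1" by (auto simp: AE_lbon ker_bound)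
qed

lemma ker_integral_le:
  assumes f: "sqi I1 f" shows "\<bar>\<integral>y. ker x y * f y \<partial>I1\<bar> \<le> n2 I1 f"
proof -
  have "\<bar>\<integral>y. ker x y * f y \<partial>I1\<bar> \<le> n2 I1 (\<lambda>y. ker x y * f y)" by (rule n2_le_integral[OF ker_sqi[OF f]])
  also have "\<dots> \<le> n2 I1 f"
    unfolding n2_def
  proof (intro real_sqrt_le_mono n2_mono_AE ker_sqi f)
    have "\<bar>ker x y * f y\<bar> \<le> \<bar>f y\<bar>" if "y \<in> {0..1}" for y
      unfolding abs_mult using mult_right_mono[OF ker_bound[OF that, of x], of "\<bar>f y\<bar>"] by simp
    then show "AE y in I1. \<bar>ker x y * f y\<bar> \<le> \<bar>f y\<bar>" by (auto simp: AE_lbon)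
  qed
  finally show ?thesis .
qed

text \<open>Fubini with a bounded kernel, hence valid for every \<open>x\<close> without an
  exceptional set.\<close>

lemma Q_eq: "Q t x = cum {0<..<T} (\<lambda>s. H s x) t" and H_integrable: "integrable (JT T) (\<lambda>s. H s x)"
proof -
  interpret P: pair_sigma_finite "JT T" I1 by (rule pair_JI)
  have hi: "integrable (JT T \<Otimes>\<^sub>M I1) (case_prod h)" by (rule sqi_JI_integrable[OF h_sqi])
  have i1: "integrable (JT T \<Otimes>\<^sub>M I1) (\<lambda>(s, y). ker x y * h s y)"
  proof (rule Bochner_Integration.integrable_bound[OF hi])
    have "\<bar>ker x y * h s y\<bar> \<le> \<bar>h s y\<bar>" if "y \<in> {0..1}" for s y
      unfolding abs_mult using mult_right_mono[OF ker_bound[OF that, of x], of "\<bar>h s y\<bar>"] by simp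
    then show "AE z in JT T \<Otimes>\<^sub>M I1. norm (case z of (s, y) \<Rightarrow> ker x y * h s y) \<le> norm (case z of (s, y) \<Rightarrow> h s y)"
      unfolding JI_eq[symmetric] AE_lbon[OF cylinder_borel] by (intro always_eventually) auto
  qed measurable
  show "integrable (JT T) (\<lambda>s. H s x)" unfolding H_def by (rule P.integrable_fst[OF i1])
  have i2: "integrable (JT T \<Otimes>\<^sub>M I1) (\<lambda>(s, y). indicator {..t} s * (ker x y * h s y))"
  proof (rule Bochner_Integration.integrable_bound[OF i1])
    show "AE z in JT T \<Otimes>\<^sub>M I1. norm (case z of (s, y) \<Rightarrow> indicator {..t} s * (ker x y * h s y)) \<le> norm (case z of (s, y) \<Rightarrow> ker x y * h s y)"
      by (intro always_eventually) (auto simp: indicator_def)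
  qed measurable
  have "cum {0<..<T} (\<lambda>s. H s x) t = (\<integral>s. \<integral>y. indicator {..t} s * (ker x y * h s y) \<partial>I1 \<partial>JT T)"
    by (simp add: cum_def H_def)
  also have "\<dots> = (\<integral>y. \<integral>s. indicator {..t} s * (ker x y * h s y) \<partial>JT T \<partial>I1)"
    by (rule P.Fubini_integral[OF i2, symmetric])
  also have "\<dots> = Q t x" by (simp add: Q_def q_def cum_def mult.left_commute)
  finally show "Q t x = cum {0<..<T} (\<lambda>s. H s x) t" by simp
qed

text \<open>\<open>h\<close> is the weak space derivative of \<open>F\<close>, so its primitive of
  mean zero is \<open>F\<close> minus the mean of \<open>F\<close>. This replaces the second
  equation by a pointwise relation.\<close>

lemma H_AE: "AE s in JT T. AE x in I1. H s x = F s x - (\<integral>y. F s y \<partial>I1)"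
  using q_t
proof eventually_elim
  case (elim s)
  obtain c where c: "(\<integral>x. h s x \<partial>I1) = 0" "AE x in I1. F s x = c + cum {0..1} (h s) x" by (rule is_wderivD[OF elim])
  have hs: "sqi I1 (h s)" using is_wderiv_L2S(2)[OF elim] by (rule L2S_sqi)
  have hi: "integrable I1 (h s)" by (rule sqi_imp_integrable[OF finite_I1 hs])
  have [measurable]: "h s \<in> borel_measurable borel" "F s \<in> borel_measurable borel" using is_wderiv_L2S[OF elim] by (auto simp: L2S_iff)
  have one: "integrable I1 (\<lambda>y. 1 :: real)" by (rule finite_measure.integrable_const[OF finite_I1])
  have id: "integrable I1 (\<lambda>y. y)" by (rule sqi_imp_integrable[OF finite_I1 sqi_continuous]) (auto intro!: continuous_intros)
  have cum1: "cum {0..1} (\<lambda>_. 1) y = y" if "0 \<le> y" "y \<le> 1" for y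
    using cum_FTC[of "\<lambda>x. x" "\<lambda>_. 1" "{0..1}" 1 y] that by (auto intro!: derivative_eq_intros simp: greaterThanLessThan_subseteq_atLeastAtMost_iff)
  have hy: "integrable I1 (\<lambda>y. h s y * y)" by (rule sqi_mult[OF hs sqi_continuous]) (auto intro!: continuous_intros)
  have hcum: "integrable I1 (\<lambda>y. 1 * cum {0..1} (h s) y)" by (rule integrable_mult_cum[OF _ one hi]) simp
  \<comment> \<open>Integration by parts against \<open>y\<close>, the primitive of the constant
    \<open>1\<close>.\<close>
  have intcum: "(\<integral>x. cum {0..1} (h s) x \<partial>I1) = (\<integral>y. (1 - y) * h s y \<partial>I1)"
  proof -
    have "cum {0..1} (h s) 1 * 1 = cum {0..1} (\<lambda>y. h s y * cum {0..1} (\<lambda>_. 1) y + 1 * cum {0..1} (h s) y) 1"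
      using cum_product[OF _ hi one, of 1] cum1[of 1] by simp
    also have "\<dots> = (\<integral>y. h s y * cum {0..1} (\<lambda>_. 1) y + 1 * cum {0..1} (h s) y \<partial>I1)"
      by (rule cum_eq_integral) auto
    also have "\<dots> = (\<integral>y. h s y * y + 1 * cum {0..1} (h s) y \<partial>I1)"
      by (rule integral_cong_AE) (use cum1 in \<open>auto simp: AE_lbon\<close>)
    also have "\<dots> = (\<integral>y. h s y * y \<partial>I1) + (\<integral>y. 1 * cum {0..1} (h s) y \<partial>I1)"
      by (rule Bochner_Integration.integral_add[OF hy hcum])
    also have "cum {0..1} (h s) 1 = (\<integral>y. h s y \<partial>I1)" by (rule cum_eq_integral) auto
    finally have "(\<integral>x. cum {0..1} (h s) x \<partial>I1) = (\<integral>y. h s y \<partial>I1) - (\<integral>y. h s y * y \<partial>I1)" by simp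
    also have "\<dots> = (\<integral>y. h s y - h s y * y \<partial>I1)" by (rule Bochner_Integration.integral_diff[OF hi hy, symmetric])
    finally show ?thesis by (simp add: algebra_simps)
  qed
  have intF: "(\<integral>x. F s x \<partial>I1) = c + (\<integral>y. (1 - y) * h s y \<partial>I1)"
  proof -
    have "(\<integral>x. F s x \<partial>I1) = (\<integral>x. c + 1 * cum {0..1} (h s) x \<partial>I1)"
      by (rule integral_cong_AE) (use c(2) in auto)
    also have "\<dots> = (\<integral>x. c \<partial>I1) + (\<integral>x. 1 * cum {0..1} (h s) x \<partial>I1)"
      by (rule Bochner_Integration.integral_add[OF finite_measure.integrable_const[OF finite_I1] hcum])
    finally show ?thesis unfolding integral_I1_const using intcum by simp
  qed
  have H: "H s x = cum {0..1} (h s) x - (\<integral>y. (1 - y) * h s y \<partial>I1)" for x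
  proof -
    have i1: "integrable I1 (\<lambda>y. indicator {..x} y * h s y)" by (rule integrable_ind_mult[OF hi]) simp
    have i2: "integrable I1 (\<lambda>y. (1 - y) * h s y)" using Bochner_Integration.integrable_diff[OF hi hy] by (simp add: algebra_simps)
    have "H s x = (\<integral>y. indicator {..x} y * h s y - (1 - y) * h s y \<partial>I1)"
      unfolding H_def by (simp add: ker_def left_diff_distrib)
    then show ?thesis unfolding Bochner_Integration.integral_diff[OF i1 i2] cum_def .
  qed
  from c(2) show ?case by eventually_elim (simp add: H intF)
qed

end

context difference
begin

text \<open>Sup-norm bound with \<open>\<delta>\<close> standing for the bound of the \<open>L\<^sup>2\<close> norms of \<open>p\<close> and \<open>q\<close>.\<close>
definition Bd where "Bd \<delta> = 2 * \<epsilon>\<^sup>2 * (\<Lambda> + M) + 2 * \<delta> + sqrt (Km / \<epsilon>) * \<delta> + \<delta> / \<mu>"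

text \<open>For \<open>y = p - Q / \<mu>\<close> the estimated quantity is
  \<open>y' + y / (\<mu> \<epsilon>^2)\<close>. Replacing \<open>H\<close> by \<open>F\<close> minus
  its mean cancels \<open>\<mu> g\<close> and the local part \<open>p / \<epsilon>^2\<close>;
  multiplied by \<open>\<mu> \<epsilon>^2\<close>, what remains is
  \<open>\<epsilon>^2 (R - N)\<close>, \<open>\<epsilon>^2\<close> times the mean of
  \<open>F\<close>, the convolution, and \<open>- Q / \<mu>\<close>.\<close>

lemma sup_derivative_bound:
  assumes t0: "small t0" and \<delta>: "\<And>t. 0 \<le> t \<Longrightarrow> t \<le> t0 \<Longrightarrow> n2 I1 (p t) \<le> \<delta> \<and> n2 I1 (q t) \<le> \<delta>"
  shows "AE s in JT T. AE x in I1. s \<le> t0 \<longrightarrow>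
     \<bar>(g s x - H s x / \<mu>) + 1 / (\<mu> * \<epsilon>\<^sup>2) * (p s x - Q s x / \<mu>)\<bar> \<le> 1 / (\<mu> * \<epsilon>\<^sup>2) * Bd \<delta>"
proof -
  have pos: "AE s in JT T. 0 < s" by (simp add: AE_lbon)
  show ?thesis
    using q_x q_t R N pos H_AE
  proof eventually_elim
    case (elim s)
    show ?case
    proof (cases "s \<le> t0")
      case False then show ?thesis by simp
    next
      case True
      then have p1: "AE x in I1. \<bar>p s x\<bar> \<le> 1" using smallD[OF t0, of s] elim by simp
      note NR = N_R_sqi[OF p1 conjunct1[OF elim(4)] conjunct2[OF elim(4)] conjunct1[OF elim(3)] conjunct1[OF conjunct2[OF elim(3)]]]
      have RM: "AE x in I1. \<bar>R s x\<bar> \<le> M" using elim(3) by blast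
      have pd: "n2 I1 (p s) \<le> \<delta>" and qd: "n2 I1 (q s) \<le> \<delta>" using \<delta>[of s] True elim by auto
      have S: "sqi I1 (g s)" "sqi I1 (p s)" "sqi I1 (q s)" "sqi I1 (cv \<epsilon> (p s))"
        using is_wderiv_L2S(2)[OF elim(1)] p_L2S q_L2S cv_L2S(1)[OF p_L2S] by (auto simp: L2S_iff)
      note i = S[THEN sqi_imp_integrable[OF finite_I1]] NR(1,2)[THEN sqi_imp_integrable[OF finite_I1]]
      \<comment> \<open>\<open>g\<close> has mean zero as a weak derivative, and the terms of order
        \<open>\<epsilon>^-2\<close> in the mean of \<open>F\<close> become at most
        \<open>2 \<delta>\<close> after multiplication by \<open>\<epsilon>^2\<close>.\<close>
      have mean: "\<epsilon>\<^sup>2 * \<bar>\<integral>y. F s y \<partial>I1\<bar> \<le> \<epsilon>\<^sup>2 * (\<Lambda> + M) + 2 * \<delta>"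
      proof -
        have F': "F s = (\<lambda>x. N s x + \<mu> * g s x - (1 / \<epsilon>\<^sup>2) * (cv \<epsilon> (p s) x - p s x) - R s x)" by (auto simp: F_def)
        have "(\<integral>y. F s y \<partial>I1) = (\<integral>y. N s y \<partial>I1) + \<mu> * (\<integral>y. g s y \<partial>I1) - (1 / \<epsilon>\<^sup>2) * ((\<integral>y. cv \<epsilon> (p s) y \<partial>I1) - (\<integral>y. p s y \<partial>I1)) - (\<integral>y. R s y \<partial>I1)"
          unfolding F'
          by (simp only: Bochner_Integration.integral_add Bochner_Integration.integral_diff integral_mult_right_zero i
              Bochner_Integration.integrable_add Bochner_Integration.integrable_diff integrable_mult_right)
        then have eq: "(\<integral>y. F s y \<partial>I1) = (\<integral>y. N s y \<partial>I1) - (1 / \<epsilon>\<^sup>2) * ((\<integral>y. cv \<epsilon> (p s) y \<partial>I1) - (\<integral>y. p s y \<partial>I1)) - (\<integral>y. R s y \<partial>I1)"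
          using is_wderiv_mean0[OF elim(1)] by simp
        have b: "\<bar>\<integral>y. f y \<partial>I1\<bar> \<le> B" if "integrable I1 f" "AE x in I1. \<bar>f x\<bar> \<le> B" for f :: "real \<Rightarrow> real" and B
        proof -
          have "\<bar>\<integral>y. f y \<partial>I1\<bar> \<le> (\<integral>y. \<bar>f y\<bar> \<partial>I1)" by (rule integral_abs_bound)
          also have "\<dots> \<le> (\<integral>y. B \<partial>I1)"
            by (rule integral_mono_AE) (use that finite_measure.integrable_const[OF finite_I1] in auto)
          finally show ?thesis unfolding integral_I1_const .
        qed
        have 1: "\<bar>\<integral>y. N s y \<partial>I1\<bar> \<le> \<Lambda>" "\<bar>\<integral>y. R s y \<partial>I1\<bar> \<le> M" using b[OF i(5) NR(4)] b[OF i(6) RM] by auto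
        have "n2 I1 (cv \<epsilon> (p s)) \<le> n2 I1 (p s)" unfolding n2_def by (rule real_sqrt_le_mono[OF cv_L2S(2)[OF p_L2S]])
        then have 2: "\<bar>\<integral>y. cv \<epsilon> (p s) y \<partial>I1\<bar> \<le> \<delta>" "\<bar>\<integral>y. p s y \<partial>I1\<bar> \<le> \<delta>"
          using n2_le_integral[OF S(4)] n2_le_integral[OF S(2)] pd by auto
        have "\<epsilon>\<^sup>2 * (\<integral>y. F s y \<partial>I1) = \<epsilon>\<^sup>2 * ((\<integral>y. N s y \<partial>I1) - (\<integral>y. R s y \<partial>I1)) - ((\<integral>y. cv \<epsilon> (p s) y \<partial>I1) - (\<integral>y. p s y \<partial>I1))"
        proof -
          have "\<epsilon>\<^sup>2 * (a - (1 / \<epsilon>\<^sup>2) * b - c) = \<epsilon>\<^sup>2 * (a - c) - b" for a b c :: real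
            using \<epsilon> by (simp add: right_diff_distrib)
          then show ?thesis unfolding eq .
        qed
        then have "\<bar>\<epsilon>\<^sup>2 * (\<integral>y. F s y \<partial>I1)\<bar> \<le> \<bar>\<epsilon>\<^sup>2 * ((\<integral>y. N s y \<partial>I1) - (\<integral>y. R s y \<partial>I1))\<bar> + \<bar>(\<integral>y. cv \<epsilon> (p s) y \<partial>I1) - (\<integral>y. p s y \<partial>I1)\<bar>"
          by (simp only: abs_triangle_ineq4)
        moreover have "\<bar>\<epsilon>\<^sup>2 * ((\<integral>y. N s y \<partial>I1) - (\<integral>y. R s y \<partial>I1))\<bar> \<le> \<epsilon>\<^sup>2 * (\<Lambda> + M)"
          unfolding abs_mult using 1 by (auto intro!: mult_left_mono)
        moreover have "\<bar>\<epsilon>\<^sup>2 * (\<integral>y. F s y \<partial>I1)\<bar> = \<epsilon>\<^sup>2 * \<bar>\<integral>y. F s y \<partial>I1\<bar>" by (simp add: abs_mult)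
        ultimately show ?thesis using 2 by linarith
      qed
      show ?thesis
        using NR(4) RM elim(6)
      proof eventually_elim
        case (elim x)
        have cvb: "\<bar>cv \<epsilon> (p s) x\<bar> \<le> sqrt (Km / \<epsilon>) * \<delta>"
          using cv_sup[OF \<epsilon> p_L2S, of s x] mult_left_mono[OF pd, of "sqrt (Km / \<epsilon>)"] Km(1) \<epsilon> by simp
        have Qb: "\<bar>Q s x\<bar> \<le> \<delta>" unfolding Q_def using ker_integral_le[OF S(3), of x] qd by linarith
        let ?X = "(g s x - H s x / \<mu>) + 1 / (\<mu> * \<epsilon>\<^sup>2) * (p s x - Q s x / \<mu>)"
        have "\<mu> * \<epsilon>\<^sup>2 * ?X = \<epsilon>\<^sup>2 * (R s x - N s x) + \<epsilon>\<^sup>2 * (\<integral>y. F s y \<partial>I1) + cv \<epsilon> (p s) x - Q s x / \<mu>"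
        proof -
          define L where "L = (cv \<epsilon> (p s) x - p s x) / \<epsilon>\<^sup>2"
          have L: "\<epsilon>\<^sup>2 * L = cv \<epsilon> (p s) x - p s x" using \<epsilon> by (simp add: L_def)
          have F: "F s x = N s x + \<mu> * g s x - L - R s x" by (simp add: F_def L_def)
          have "\<mu> * \<epsilon>\<^sup>2 * ?X = \<epsilon>\<^sup>2 * (\<mu> * g s x - H s x) + (p s x - Q s x / \<mu>)"
            by (rule scaled_identity) (use \<mu> \<epsilon> in auto)
          also have "\<epsilon>\<^sup>2 * (\<mu> * g s x - H s x) = \<epsilon>\<^sup>2 * (R s x - N s x) + \<epsilon>\<^sup>2 * (\<integral>y. F s y \<partial>I1) + \<epsilon>\<^sup>2 * L"
            unfolding elim(3) F by (simp add: algebra_simps)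
          finally show ?thesis unfolding L by simp
        qed
        moreover have "\<mu> * \<epsilon>\<^sup>2 * \<bar>?X\<bar> = \<bar>\<mu> * \<epsilon>\<^sup>2 * ?X\<bar>" unfolding abs_mult using \<mu> by simp
        ultimately have "\<mu> * \<epsilon>\<^sup>2 * \<bar>?X\<bar> = \<bar>\<epsilon>\<^sup>2 * (R s x - N s x) + \<epsilon>\<^sup>2 * (\<integral>y. F s y \<partial>I1) + cv \<epsilon> (p s) x - Q s x / \<mu>\<bar>"
          by simp
        moreover have "\<bar>a + b + c - d\<bar> \<le> \<bar>a\<bar> + \<bar>b\<bar> + \<bar>c\<bar> + \<bar>d\<bar>" for a b c d :: real by linarith
        ultimately have "\<mu> * \<epsilon>\<^sup>2 * \<bar>?X\<bar> \<le> \<bar>\<epsilon>\<^sup>2 * (R s x - N s x)\<bar> + \<bar>\<epsilon>\<^sup>2 * (\<integral>y. F s y \<partial>I1)\<bar> + \<bar>cv \<epsilon> (p s) x\<bar> + \<bar>Q s x / \<mu>\<bar>" by metis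
        moreover have "\<bar>\<epsilon>\<^sup>2 * (R s x - N s x)\<bar> \<le> \<epsilon>\<^sup>2 * (\<Lambda> + M)"
          unfolding abs_mult using elim by (auto intro!: mult_left_mono)
        moreover have "\<bar>\<epsilon>\<^sup>2 * (\<integral>y. F s y \<partial>I1)\<bar> \<le> \<epsilon>\<^sup>2 * (\<Lambda> + M) + 2 * \<delta>" using mean by (simp add: abs_mult)
        moreover have "\<bar>Q s x / \<mu>\<bar> \<le> \<delta> / \<mu>" using Qb \<mu> by (simp add: divide_right_mono)
        moreover note cvb
        ultimately have "\<mu> * \<epsilon>\<^sup>2 * \<bar>?X\<bar> \<le> Bd \<delta>" unfolding Bd_def by linarith
        moreover have "0 < \<mu> * \<epsilon>\<^sup>2" using \<mu> \<epsilon> by simp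
        moreover have "m * y \<le> B \<Longrightarrow> 0 < m \<Longrightarrow> y \<le> 1 / m * B" for m y B :: real
          by (simp add: field_simps)
        ultimately show ?case by blast
      qed
    qed
  qed
qed

end

section \<open>From the damped equation to continuation in time\<close>

context difference
begin

lemma AE_g_integrable: "AE x in I1. integrable (JT T) (\<lambda>s. g s x)"
proof -
  interpret P: pair_sigma_finite "JT T" I1 by (rule pair_JI)
  have "integrable (JT T \<Otimes>\<^sub>M I1) (\<lambda>(s, x). g s x)" by (rule sqi_JI_integrable[OF g_sqi])
  from P.AE_integrable_snd[OF this] show ?thesis .
qed

lemma AE_JI_swap:
  assumes m: "Measurable.pred (borel \<Otimes>\<^sub>M borel) (\<lambda>z. P (fst z) (snd z))" and a: "AE s in JT T. AE x in I1. P s x"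
  shows "AE x in I1. AE s in JT T. P s x"
proof -
  interpret P: pair_sigma_finite "JT T" I1 by (rule pair_JI)
  have "{z \<in> space (JT T \<Otimes>\<^sub>M I1). P (fst z) (snd z)} = {z \<in> space (borel \<Otimes>\<^sub>M borel). P (fst z) (snd z)}"
    by (simp add: space_pair_measure)
  then have "{z \<in> space (JT T \<Otimes>\<^sub>M I1). P (fst z) (snd z)} \<in> sets (JT T \<Otimes>\<^sub>M I1)"
    using m unfolding pred_def sets_JI by simp
  from P.AE_commute[OF this] a show ?thesis by simp
qed

text \<open>Exchanging the almost-everywhere quantifiers fixes \<open>x\<close> and leaves a scalar
  damped equation for \<open>p - Q / \<mu>\<close>. The bound on its forcing carries the factor
  \<open>l = 1 / (\<mu> \<epsilon>^2)\<close>, which cancels against the damping rate;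
  \<open>Q / \<mu>\<close> accounts for the extra \<open>\<delta> / \<mu>\<close>.\<close>

lemma sup_bound:
  assumes t0: "small t0" "0 \<le> t0" "t0 \<le> T" and \<delta>: "\<And>t. 0 \<le> t \<Longrightarrow> t \<le> t0 \<Longrightarrow> n2 I1 (p t) \<le> \<delta> \<and> n2 I1 (q t) \<le> \<delta>"
  shows "AE x in I1. \<forall>t. 0 \<le> t \<and> t \<le> t0 \<longrightarrow> \<bar>p t x\<bar> \<le> Bd \<delta> + \<delta> / \<mu>"
proof -
  have \<delta>0: "\<delta> \<ge> 0" using \<delta>[of 0] t0 n2_nonneg[of I1 "p 0"] by linarith
  have Bd0: "Bd \<delta> \<ge> 0" unfolding Bd_def using \<delta>0 \<mu> \<epsilon> \<Lambda> M Km(1) by (intro add_nonneg_nonneg) auto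
  define l where "l = 1 / (\<mu> * \<epsilon>\<^sup>2)"
  have l: "l > 0" using \<mu> \<epsilon> by (simp add: l_def)
  have sw: "AE x in I1. AE s in JT T. s \<le> t0 \<longrightarrow>
     \<bar>(g s x - H s x / \<mu>) + l * (p s x - Q s x / \<mu>)\<bar> \<le> l * Bd \<delta>"
  proof (rule AE_JI_swap)
    show "AE s in JT T. AE x in I1. s \<le> t0 \<longrightarrow> \<bar>(g s x - H s x / \<mu>) + l * (p s x - Q s x / \<mu>)\<bar> \<le> l * Bd \<delta>"
      unfolding l_def by (rule sup_derivative_bound[OF t0(1) \<delta>])
  qed measurable
  from sw AE_g_integrable show ?thesis
  proof eventually_elim
    case (elim x)
    let ?k = "\<lambda>s. g s x + (- (1 / \<mu>)) * H s x"
    have Hi: "integrable (JT T) (\<lambda>s. (- (1 / \<mu>)) * H s x)" by (rule integrable_mult_right[OF H_integrable])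
    have cumk: "cum {0<..<T} ?k t = p t x - Q t x / \<mu>" for t
      unfolding cum_add[OF borel_open[OF open_greaterThanLessThan] elim(2) Hi] cum_cmult Q_eq by (simp add: p_def)
    have ki: "integrable (JT T) ?k" by (rule Bochner_Integration.integrable_add[OF elim(2) Hi])
    have le: "AE s in JT T. s \<le> t0 \<longrightarrow> \<bar>?k s + l * cum {0<..<T} ?k s\<bar> \<le> l * Bd \<delta>"
      unfolding cumk using elim(1) by simp
    show ?case
    proof (intro allI impI)
      fix t assume t: "0 \<le> t \<and> t \<le> t0"
      have "\<bar>cum {0<..<T} ?k t\<bar> \<le> l * Bd \<delta> / l"
        by (rule damped_ode_bound[OF ki l _ t0(3) le]) (use l Bd0 t in auto)
      then have 1: "\<bar>p t x - Q t x / \<mu>\<bar> \<le> Bd \<delta>" unfolding cumk using l by simp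
      have "\<bar>Q t x\<bar> \<le> \<delta>" unfolding Q_def using ker_integral_le[OF L2S_sqi[OF q_L2S[of t]], of x] \<delta>[of t] t by linarith
      then have "\<bar>Q t x / \<mu>\<bar> \<le> \<delta> / \<mu>" using \<mu> by (simp add: divide_right_mono)
      with 1 show "\<bar>p t x\<bar> \<le> Bd \<delta> + \<delta> / \<mu>" by linarith
    qed
  qed
qed

text \<open>The energy estimate provides \<open>\<delta> = sqrt C1 \<epsilon>\<close>. Fed into the
  pointwise bound, it improves the assumed \<open>1\<close> to \<open>1/2\<close> and so leaves room
  to continue.\<close>

lemma half_bound:
  assumes t0: "small t0" "0 \<le> t0" "t0 \<le> T" and c: "Bd (sqrt C1 * \<epsilon>) + sqrt C1 * \<epsilon> / \<mu> \<le> 1/2"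
  shows "AE x in I1. \<forall>t. 0 \<le> t \<and> t \<le> t0 \<longrightarrow> \<bar>p t x\<bar> \<le> 1/2"
proof -
  have "n2 I1 (p t) \<le> sqrt C1 * \<epsilon> \<and> n2 I1 (q t) \<le> sqrt C1 * \<epsilon>" if "0 \<le> t" "t \<le> t0" for t
  proof -
    have "sqrt (e t) \<le> sqrt (C1 * \<epsilon>\<^sup>2)" by (rule real_sqrt_le_mono[OF energy_estimate[OF t0 that]])
    also have "\<dots> = sqrt C1 * \<epsilon>" using \<epsilon> by (simp add: real_sqrt_mult)
    finally show ?thesis using n2_p_le[of t] n2_q_le[of t] by linarith
  qed
  then have "AE x in I1. \<forall>t. 0 \<le> t \<and> t \<le> t0 \<longrightarrow> \<bar>p t x\<bar> \<le> Bd (sqrt C1 * \<epsilon>) + sqrt C1 * \<epsilon> / \<mu>"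
    by (rule sup_bound[OF t0])
  then show ?thesis
  proof eventually_elim
    case (elim x)
    show ?case
    proof (intro allI impI)
      fix t assume "0 \<le> t \<and> t \<le> t0"
      then have "\<bar>p t x\<bar> \<le> Bd (sqrt C1 * \<epsilon>) + sqrt C1 * \<epsilon> / \<mu>" using elim by blast
      then show "\<bar>p t x\<bar> \<le> 1/2" using c by (rule order_trans)
    qed
  qed
qed

text \<open>Over a time interval the trajectory of almost every \<open>x\<close> moves by at most
  the integral of \<open>k\<close>, and square integrability of \<open>k\<close> bounds this by
  \<open>1/2\<close> uniformly in the position of a short interval. The length depends on
  \<open>k\<close>, hence possibly on \<epsilon>; the continuation asks only that it be
  positive.\<close>

lemma small_extend:
  obtains \<eta> where "\<eta> > 0" "\<And>t0 t1. 0 \<le> t0 \<Longrightarrow> t1 \<le> t0 + \<eta> \<Longrightarrow> AE x in I1. \<forall>t. 0 \<le> t \<and> t \<le> t0 \<longrightarrow> \<bar>p t x\<bar> \<le> 1/2 \<Longrightarrow> small t1"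
proof -
  define L where "L = 1 + (\<integral>s. (k s)\<^sup>2 \<partial>JT T)"
  have k2: "(\<integral>s. (k s)\<^sup>2 \<partial>JT T) \<ge> 0" by (rule integral_nonneg_AE) auto
  then have L: "L > 0" unfolding L_def by linarith
  have ki: "integrable (JT T) k" and k2i: "integrable (JT T) (\<lambda>s. (k s)\<^sup>2)"
    using sqi_imp_integrable[OF finite_JT k(1)] sqi_square[OF k(1)] by auto
  have [measurable]: "k \<in> borel_measurable borel" using borel_measurable_integrable[OF ki] by simp
  have intk: "(\<integral>s. indicator {a<..b} s * k s \<partial>JT T) \<le> 1/2" if ab: "a \<le> b" "b \<le> a + 1 / (4 * L)" for a b
  proof -
    have ii: "integrable (JT T) (indicator {a<..b} :: real \<Rightarrow> real)"
      by (rule sqi_imp_integrable[OF finite_JT], rule sqi_bounded[OF finite_JT, of _ _ 1]) (auto simp: indicator_def)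
    have i1: "integrable (JT T) (\<lambda>s. 1 / (4 * L) * (k s)\<^sup>2)" and i2: "integrable (JT T) (\<lambda>s. L * indicator {a<..b} s)"
      by (rule integrable_mult_right[OF k2i], rule integrable_mult_right[OF ii])
    have "(\<integral>s. indicator {a<..b} s * k s \<partial>JT T) \<le> (\<integral>s. 1 / (4 * L) * (k s)\<^sup>2 + L * indicator {a<..b} s \<partial>JT T)"
    proof (rule integral_mono[OF integrable_ind_mult[OF ki] Bochner_Integration.integrable_add[OF i1 i2]])
      fix s
      \<comment> \<open>Young's inequality as \<open>k \<le> k^2 / (4 L) + L\<close>: by the choice
        of \<open>L\<close> the first part integrates to at most \<open>1/4\<close>, and so does the
        second over an interval of length at most \<open>1 / (4 L)\<close>.\<close>
      have "1 * k s - 1 / (4 * L) * (k s)\<^sup>2 \<le> 1 / (4 * (1 / (4 * L))) * 1\<^sup>2" by (rule young') (use L in simp)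
      moreover have "0 \<le> 1 / (4 * L) * (k s)\<^sup>2" using L by simp
      ultimately show "indicator {a<..b} s * k s \<le> 1 / (4 * L) * (k s)\<^sup>2 + L * indicator {a<..b} s"
        by (auto simp: indicator_def)
    qed simp
    also have "\<dots> = 1 / (4 * L) * (\<integral>s. (k s)\<^sup>2 \<partial>JT T) + L * measure (JT T) {a<..b}"
      unfolding Bochner_Integration.integral_add[OF i1 i2] integral_mult_right_zero by simp
    finally have 1: "(\<integral>s. indicator {a<..b} s * k s \<partial>JT T) \<le> 1 / (4 * L) * (\<integral>s. (k s)\<^sup>2 \<partial>JT T) + L * measure (JT T) {a<..b}" .
    have "1 / (4 * L) * (\<integral>s. (k s)\<^sup>2 \<partial>JT T) \<le> 1 / (4 * L) * L" by (rule mult_left_mono) (use L in \<open>auto simp: L_def\<close>)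
    also have "\<dots> = 1/4" using L by simp
    finally have "(\<integral>s. indicator {a<..b} s * k s \<partial>JT T) \<le> 1/4 + L * measure (JT T) {a<..b}" using 1 by linarith
    moreover have "measure (JT T) {a<..b} \<le> b - a"
    proof -
      have "measure (JT T) {a<..b} = measure lborel ({0<..<T} \<inter> {a<..b})" by (rule measure_lbon) auto
      also have "\<dots> \<le> measure lborel {a<..b}" by (rule measure_mono_fmeasurable) (auto simp: fmeasurable_def emeasure_lborel_Ioc[OF ab(1)])
      also have "\<dots> = b - a" using ab by simp
      finally show ?thesis .
    qed
    then have "L * measure (JT T) {a<..b} \<le> L * (1 / (4 * L))" using L ab by (intro mult_left_mono) auto
    moreover have "L * (1 / (4 * L)) = 1/4" using L by simp
    ultimately show ?thesis by linarith
  qed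
  have sw: "AE x in I1. AE s in JT T. \<bar>g s x\<bar> \<le> k s"
    by (rule AE_JI_swap[OF _ k(2)]) measurable
  show ?thesis
  proof (rule that[of "1 / (4 * L)"])
    show "0 < 1 / (4 * L)" using L by simp
    fix t0 t1 assume t: "0 \<le> t0" "t1 \<le> t0 + 1 / (4 * L)" and half: "AE x in I1. \<forall>t. 0 \<le> t \<and> t \<le> t0 \<longrightarrow> \<bar>p t x\<bar> \<le> 1/2"
    show "small t1"
      unfolding small_def using half sw AE_g_integrable
    proof eventually_elim
      case (elim x)
      show ?case
      proof (intro allI impI)
        fix r assume r: "0 \<le> r \<and> r \<le> t1"
        show "\<bar>p r x\<bar> \<le> 1"
        proof (cases "r \<le> t0")
          case True
          then have "\<bar>p r x\<bar> \<le> 1/2" using elim(1) r by blast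
          then show ?thesis by linarith
        next
          case False
          have "\<bar>p r x - p t0 x\<bar> = \<bar>\<integral>s. indicator {t0<..r} s * g s x \<partial>JT T\<bar>"
            unfolding p_def by (subst cum_diff[OF _ elim(3)]) (use False in auto)
          also have "\<dots> \<le> (\<integral>s. indicator {t0<..r} s * \<bar>g s x\<bar> \<partial>JT T)" by (rule abs_ind_integral_le(1)[OF elim(3)]) simp
          also have "\<dots> \<le> (\<integral>s. indicator {t0<..r} s * k s \<partial>JT T)"
          proof (rule integral_mono_AE)
            show "AE s in JT T. indicator {t0<..r} s * \<bar>g s x\<bar> \<le> indicator {t0<..r} s * k s"
              using elim(2) by eventually_elim (auto simp: indicator_def)
            show "integrable (JT T) (\<lambda>s. indicator {t0<..r} s * \<bar>g s x\<bar>)"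
              by (rule integrable_ind_mult[OF integrable_abs[OF elim(3)]]) simp
            show "integrable (JT T) (\<lambda>s. indicator {t0<..r} s * k s)" by (rule integrable_ind_mult[OF ki]) simp
          qed
          also have "\<dots> \<le> 1/2" by (rule intk) (use False r t in auto)
          finally have "\<bar>p r x - p t0 x\<bar> \<le> 1/2" .
          moreover have "\<bar>p t0 x\<bar> \<le> 1/2" using elim(1) t by blast
          ultimately show ?thesis by linarith
        qed
      qed
    qed
  qed
qed

text \<open>Smallness is propagated by induction along the times \<open>min T (n \<eta>)\<close>,
  starting from \<open>p = 0\<close> at time \<open>0\<close>, until \<open>T\<close> is
  reached.\<close>

theorem difference_estimate:
  assumes c: "Bd (sqrt C1 * \<epsilon>) + sqrt C1 * \<epsilon> / \<mu> \<le> 1/2" and t: "0 \<le> t" "t \<le> T"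
  shows "(\<integral>x. (p t x)\<^sup>2 \<partial>I1) + (\<integral>x. (q t x)\<^sup>2 \<partial>I1) \<le> C1 * \<epsilon>\<^sup>2"
proof -
  obtain \<eta> where \<eta>: "\<eta> > 0" "\<And>t0 t1. 0 \<le> t0 \<Longrightarrow> t1 \<le> t0 + \<eta> \<Longrightarrow> AE x in I1. \<forall>t. 0 \<le> t \<and> t \<le> t0 \<longrightarrow> \<bar>p t x\<bar> \<le> 1/2 \<Longrightarrow> small t1"
    using small_extend by blast
  have p0: "p 0 x = 0" for x
  proof -
    have "(\<lambda>s. g s x) \<in> borel_measurable borel" by measurable
    then show ?thesis unfolding p_def by (intro cum_at_0) auto
  qed
  have "small (min T (real n * \<eta>))" for n
  proof (induction n)
    case 0
    have "\<bar>p t x\<bar> \<le> 1" if "0 \<le> t \<and> t \<le> min T (real 0 * \<eta>)" for t x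
    proof -
      have "t = 0" using that by simp
      then show ?thesis using p0 by simp
    qed
    then show ?case unfolding small_def by (intro always_eventually) blast
  next
    case (Suc n)
    have 0: "0 \<le> min T (real n * \<eta>)" using T \<eta>(1) by simp
    show ?case
    proof (rule \<eta>(2)[OF 0])
      show "AE x in I1. \<forall>t. 0 \<le> t \<and> t \<le> min T (real n * \<eta>) \<longrightarrow> \<bar>p t x\<bar> \<le> 1/2"
        by (rule half_bound[OF Suc 0 _ c]) simp
      show "min T (real (Suc n) * \<eta>) \<le> min T (real n * \<eta>) + \<eta>"
        using \<eta>(1) by (simp add: min_def algebra_simps)
    qed
  qed
  moreover obtain n where "real n * \<eta> > T" using \<eta>(1) reals_Archimedean3 by blast
  ultimately have "small T" by (metis less_imp_le min.absorb1)
  from energy_estimate[OF this _ _ t] T show ?thesis by (simp add: e_def)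
qed

end

section \<open>Regularity in time of the two solutions\<close>

text \<open>The sum of the squares has finite integral, so it is finite almost everywhere and its
  terms tend to zero.\<close>

lemma AE_tendsto_of_summable_sq:
  assumes f: "\<And>n. sqi M (f n)" and le: "\<And>n. (\<integral>x. (f n x)\<^sup>2 \<partial>M) \<le> (1/2) ^ n"
  shows "AE x in M. (\<lambda>n. f n x) \<longlonglongrightarrow> 0"
proof -
  have [measurable]: "f n \<in> borel_measurable M" for n using f by (simp add: sqi_def)
  have nn: "(\<integral>\<^sup>+x. ennreal ((f n x)\<^sup>2) \<partial>M) \<le> ennreal ((1/2) ^ n)" for n
    using le[of n] f[of n] by (subst nn_integral_eq_integral) (auto simp: sqi_def ennreal_leI)
  have "(\<integral>\<^sup>+x. (\<Sum>n. ennreal ((f n x)\<^sup>2)) \<partial>M) = (\<Sum>n. \<integral>\<^sup>+x. ennreal ((f n x)\<^sup>2) \<partial>M)"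
    by (rule nn_integral_suminf) measurable
  also have "\<dots> \<le> (\<Sum>n. ennreal ((1/2) ^ n))" by (intro suminf_le nn) auto
  also have "\<dots> = ennreal (\<Sum>n. (1/2) ^ n)" by (rule suminf_ennreal2) (auto intro: summable_geometric)
  also have "\<dots> < \<infinity>" by simp
  finally have "AE x in M. (\<Sum>n. ennreal ((f n x)\<^sup>2)) \<noteq> \<infinity>" by (intro nn_integral_PInf_AE) auto
  then show ?thesis
  proof eventually_elim
    case (elim x)
    have "summable (\<lambda>n. (f n x)\<^sup>2)" by (rule summable_suminf_not_top) (use elim in auto)
    from summable_LIMSEQ_zero[OF this] have "(\<lambda>n. sqrt ((f n x)\<^sup>2)) \<longlonglongrightarrow> sqrt 0" by (rule tendsto_real_sqrt)
    then show ?case by (simp add: tendsto_rabs_zero_iff)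
  qed
qed

text \<open>At level \<open>n\<close> the curve is replaced by a step function: countably many rational intervals on
  which it varies by less than \<open>2\<^sup>-\<^sup>n\<close> cover \<open>(0,T)\<close>, and on the first such interval containing \<open>t\<close>
  a fixed value of the curve is used. The step functions converge almost everywhere for each \<open>t\<close>.\<close>
lemma L2_curve_measurable_rep:
  fixes y :: "real \<Rightarrow> real \<Rightarrow> real" and T :: real
  assumes L: "\<And>t. t \<in> {0<..<T} \<Longrightarrow> L2S (y t)"
    and cont: "\<And>t. t \<in> {0<..<T} \<Longrightarrow> ((\<lambda>s. n2 I1 (\<lambda>x. y s x - y t x)) \<longlongrightarrow> 0) (at t)"
  obtains Y where "case_prod Y \<in> borel_measurable (borel \<Otimes>\<^sub>M borel)" "\<And>t. per1 (Y t)"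
    "\<And>t. t \<in> {0<..<T} \<Longrightarrow> AE x in I1. Y t x = y t x"
proof -
  define I where "I i = (case from_nat i :: rat \<times> rat of (a, b) \<Rightarrow> {real_of_rat a<..<real_of_rat b} \<inter> {0<..<T})" for i :: nat
  define good where "good n i c \<longleftrightarrow> c \<in> {0<..<T} \<and> (\<forall>s\<in>I i. n2 I1 (\<lambda>x. y c x - y s x) \<le> (1/2) ^ n)" for n i c
  have ex: "\<exists>i. t \<in> I i \<and> (\<exists>c. good n i c)" if t: "t \<in> {0<..<T}" for t n
  proof -
    have "eventually (\<lambda>s. n2 I1 (\<lambda>x. y s x - y t x) < (1/2) ^ n) (at t)"
      by (rule order_tendstoD(2)[OF cont[OF t]]) simp
    then obtain d where d: "d > 0" "\<And>s. s \<noteq> t \<Longrightarrow> dist s t < d \<Longrightarrow> n2 I1 (\<lambda>x. y s x - y t x) < (1/2) ^ n"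
      unfolding eventually_at by blast
    obtain a where a: "t - d < real_of_rat a" "real_of_rat a < t" using of_rat_dense[of "t - d" t] d(1) by auto
    obtain b where b: "t < real_of_rat b" "real_of_rat b < t + d" using of_rat_dense[of t "t + d"] d(1) by auto
    have I: "I (to_nat (a, b)) = {real_of_rat a<..<real_of_rat b} \<inter> {0<..<T}" by (simp add: I_def)
    have "good n (to_nat (a, b)) t"
      unfolding good_def
    proof (intro conjI ballI t)
      fix s assume s: "s \<in> I (to_nat (a, b))"
      have e: "n2 I1 (\<lambda>x. y t x - y s x) = n2 I1 (\<lambda>x. y s x - y t x)" by (simp add: n2_def power2_commute)
      show "n2 I1 (\<lambda>x. y t x - y s x) \<le> (1/2) ^ n"
      proof (cases "s = t")
        case True then show ?thesis by (simp add: n2_def)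
      next
        case False
        have "dist s t < d" using s a b unfolding I by (auto simp: dist_real_def)
        from d(2)[OF False this] show ?thesis unfolding e by simp
      qed
    qed
    moreover have "t \<in> I (to_nat (a, b))" using a b t unfolding I by auto
    ultimately show ?thesis by blast
  qed
  define c where "c n i = (SOME c. good n i c)" for n i
  define P where "P n i t \<longleftrightarrow> t \<in> I i \<and> (\<exists>c. good n i c)" for n i t
  \<comment> \<open>The least index is a measurable map from \<open>t\<close> into the naturals,
    which makes each step function jointly measurable.\<close>
  define idx where "idx n t = (LEAST i. P n i t)" for n t
  have idx: "P n (idx n t) t" if t: "t \<in> {0<..<T}" for n t
    unfolding idx_def by (rule LeastI_ex) (use ex[OF t] in \<open>auto simp: P_def\<close>)
  \<comment> \<open>\<open>c n i\<close> is arbitrary when no good centre exists; extension by zero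
    outside \<open>(0,T)\<close> keeps every \<open>y' s\<close> square integrable.\<close>
  define y' where "y' s = (if s \<in> {0<..<T} then y s else (\<lambda>_. 0))" for s
  have y'L: "L2S (y' s)" for s using L by (auto simp: y'_def L2S_iff per1_def sqi_def)
  have [measurable]: "y' s \<in> borel_measurable borel" for s using y'L by (rule L2S_measurable)
  define Yn where "Yn n t x = y' (c n (idx n t)) x" for n t x
  have [measurable]: "I i \<in> sets borel" for i unfolding I_def by (auto split: prod.split)
  have [measurable]: "Measurable.pred borel (P n i)" for n i unfolding P_def by measurable
  have idxm [measurable]: "idx n \<in> measurable borel (count_space UNIV)" for n unfolding idx_def by measurable
  have Ynm [measurable]: "(\<lambda>z. Yn n (fst z) (snd z)) \<in> borel_measurable (borel \<Otimes>\<^sub>M borel)" for n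
    unfolding Yn_def
    by (rule measurable_compose_countable[of "\<lambda>i z. y' (c n i) (snd z)" _ _ "\<lambda>z. idx n (fst z)"]) measurable
  define Y where "Y t x = lim (\<lambda>n. Yn n t x)" for t x
  show ?thesis
  proof (rule that)
    have "(\<lambda>z. Y (fst z) (snd z)) \<in> borel_measurable (borel \<Otimes>\<^sub>M borel)"
      unfolding Y_def by measurable
    then show "case_prod Y \<in> borel_measurable (borel \<Otimes>\<^sub>M borel)" by (simp add: split_beta')
    show "per1 (Y t)" for t
      unfolding per1_def Y_def Yn_def using y'L by (auto simp: L2S_iff per1_def)
    fix t assume t: "t \<in> {0<..<T}"
    have g: "good n (idx n t) (c n (idx n t))" and tI: "t \<in> I (idx n t)" for n
      using idx[OF t, of n] unfolding P_def c_def by (auto intro: someI)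
    have ceq: "Yn n t = y (c n (idx n t))" for n
      using g[of n] by (auto simp: Yn_def[abs_def] y'_def good_def)
    have "AE x in I1. (\<lambda>n. Yn n t x - y t x) \<longlonglongrightarrow> 0"
    proof (rule AE_tendsto_of_summable_sq)
      show s: "sqi I1 (\<lambda>x. Yn n t x - y t x)" for n
        unfolding ceq using g[of n] L t by (intro sqi_diff L2S_sqi) (auto simp: good_def)
      show "(\<integral>x. (Yn n t x - y t x)\<^sup>2 \<partial>I1) \<le> (1/2) ^ n" for n
      proof -
        have "n2 I1 (\<lambda>x. Yn n t x - y t x) \<le> (1/2) ^ n" unfolding ceq using g[of n] tI by (auto simp: good_def)
        then have "(n2 I1 (\<lambda>x. Yn n t x - y t x))\<^sup>2 \<le> ((1/2) ^ n)\<^sup>2" by (intro power_mono) auto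
        also have "\<dots> = ((1/2) ^ n) * ((1/2) ^ n)" by (simp only: power2_eq_square)
        also have "\<dots> \<le> (1/2) ^ n * 1" by (intro mult_left_mono power_le_one) auto
        finally show ?thesis by (simp add: n2_sq)
      qed
    qed
    then show "AE x in I1. Y t x = y t x"
    proof eventually_elim
      case (elim x)
      then have "(\<lambda>n. Yn n t x) \<longlonglongrightarrow> y t x" by (simp add: LIM_zero_iff)
      then show ?case unfolding Y_def by (rule limI)
    qed
  qed
qed

lemma sqi_JI_of_bounded_n2:
  assumes [measurable]: "case_prod Y \<in> borel_measurable (borel \<Otimes>\<^sub>M borel)"
    and s: "AE t in JT T. sqi I1 (Y t) \<and> n2 I1 (Y t) \<le> B"
  shows "sqi (JT T \<Otimes>\<^sub>M I1) (case_prod Y)"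
  unfolding sqi_def
proof
  interpret P: pair_sigma_finite "JT T" I1 by (rule pair_JI)
  show m: "case_prod Y \<in> borel_measurable (JT T \<Otimes>\<^sub>M I1)" by measurable
  have [measurable]: "(\<lambda>t. \<integral>x. (Y t x)\<^sup>2 \<partial>I1) \<in> borel_measurable borel" by measurable
  show "integrable (JT T \<Otimes>\<^sub>M I1) (\<lambda>z. (case_prod Y z)\<^sup>2)"
  proof (rule P.Fubini_integrable)
    show "AE t in JT T. integrable I1 (\<lambda>x. (case_prod Y (t, x))\<^sup>2)" using s by eventually_elim (simp add: sqi_def)
    have "sqi (JT T) (\<lambda>t. \<integral>x. (Y t x)\<^sup>2 \<partial>I1)"
    proof (rule sqi_bounded[OF finite_JT, of _ _ "B\<^sup>2"])
      show "AE t in JT T. \<bar>\<integral>x. (Y t x)\<^sup>2 \<partial>I1\<bar> \<le> B\<^sup>2"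
        using s by eventually_elim (auto simp: n2_sq[symmetric] intro!: power_mono)
    qed simp
    from sqi_imp_integrable[OF finite_JT this]
    show "integrable (JT T) (\<lambda>t. \<integral>x. norm ((case_prod Y (t, x))\<^sup>2) \<partial>I1)" by simp
  qed measurable
qed

lemma abs_ind_le_n2:
  assumes "sqi I1 f" "A \<in> sets borel"
  shows "\<bar>\<integral>x. indicator A x * f x \<partial>I1\<bar> \<le> n2 I1 f"
proof -
  have i: "integrable I1 f" by (rule sqi_imp_integrable[OF finite_I1 assms(1)])
  have "\<bar>\<integral>x. indicator A x * f x \<partial>I1\<bar> \<le> (\<integral>x. \<bar>f x\<bar> \<partial>I1)"
    using abs_ind_integral_le[OF i, of A] assms(2) by simp
  then show ?thesis using n2_integral_le[OF assms(1)] by linarith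
qed

text \<open>An \<open>L^2\<close> limit says nothing at a single \<open>x\<close>, so the curve is
  integrated over a Borel set \<open>A\<close>: the scalar function \<open>l\<close> is continuous
  on \<open>[0,T]\<close> and has derivative \<open>m\<close> inside. The fundamental theorem and
  Fubini give the identity integrated over every \<open>A\<close>, hence almost everywhere.\<close>

lemma L2_curve_AC:
  fixes y y' Y :: "real \<Rightarrow> real \<Rightarrow> real" and T B :: real
  assumes T: "T > 0"
    and L: "\<And>t. t \<in> {0..T} \<Longrightarrow> L2S (y t)"
    and cont: "\<And>t. t \<in> {0..T} \<Longrightarrow> ((\<lambda>s. n2 I1 (\<lambda>x. y s x - y t x)) \<longlongrightarrow> 0) (at t within {0..T})"
    and L': "\<And>t. t \<in> {0<..<T} \<Longrightarrow> L2S (y' t)" "\<And>t. t \<in> {0<..<T} \<Longrightarrow> n2 I1 (y' t) \<le> B"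
    and der: "\<And>t. t \<in> {0<..<T} \<Longrightarrow> ((\<lambda>s. n2 I1 (\<lambda>x. (y s x - y t x) / (s - t) - y' t x)) \<longlongrightarrow> 0) (at t)"
    and Y [measurable]: "case_prod Y \<in> borel_measurable (borel \<Otimes>\<^sub>M borel)"
    and YAE: "\<And>t. t \<in> {0<..<T} \<Longrightarrow> AE x in I1. Y t x = y' t x"
    and t: "t \<in> {0..T}"
  shows "AE x in I1. y t x = y 0 x + cum {0<..<T} (\<lambda>s. Y s x) t"
proof -
  interpret P: pair_sigma_finite "JT T" I1 by (rule pair_JI)
  have Ys: "sqi I1 (Y s)" and Yn: "n2 I1 (Y s) \<le> B" if "s \<in> {0<..<T}" for s
  proof -
    have m: "Y s \<in> borel_measurable I1" "y' s \<in> borel_measurable I1" using L2S_measurable[OF L'(1)[OF that]] by auto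
    have e: "AE x in I1. y' s x = Y s x" using YAE[OF that] by (auto elim: eventually_mono)
    show "sqi I1 (Y s)" by (rule sqi_cong_AE[OF L2S_sqi[OF L'(1)[OF that]] m(1) e])
    show "n2 I1 (Y s) \<le> B" using n2_cong_AE[OF m(2,1) e] L'(2)[OF that] by simp
  qed
  have YS: "sqi (JT T \<Otimes>\<^sub>M I1) (case_prod Y)"
    by (rule sqi_JI_of_bounded_n2[OF Y, where B = B]) (use Ys Yn in \<open>auto simp: AE_lbon\<close>)
  have YI: "integrable (JT T \<Otimes>\<^sub>M I1) (case_prod Y)" by (rule sqi_JI_integrable[OF YS])
  have cumi: "integrable I1 (\<lambda>x. cum {0<..<T} (\<lambda>s. Y s x) t)"
  proof -
    have m: "case_prod Y \<in> borel_measurable (borel \<Otimes>\<^sub>M I1)"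
      using Y by (subst measurable_cong_sets[OF sets_pair_measure_cong[OF refl sets_lbon] refl])
    show ?thesis
      by (rule sqi_imp_integrable[OF finite_I1 energy_identity(2)[OF less_imp_le[OF T] _ m YS]]) simp
  qed
  have yi: "integrable I1 (y s)" if "s \<in> {0..T}" for s by (rule L2S_integrable[OF L[OF that]])
  have 0: "(0::real) \<in> {0..T}" using T by simp
  have fi: "integrable I1 (\<lambda>x. y t x - y 0 x - cum {0<..<T} (\<lambda>s. Y s x) t)"
    by (intro Bochner_Integration.integrable_diff yi t 0 cumi)
  have "AE x in I1. y t x - y 0 x - cum {0<..<T} (\<lambda>s. Y s x) t = 0"
  proof (rule sigma_finite_measure.density_zero[OF _ fi])
    show "sigma_finite_measure I1" by simp
    fix A assume "A \<in> sets I1"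
    then have A [measurable]: "A \<in> sets borel" by simp
    define l where "l s = (\<integral>x. indicator A x * y s x \<partial>I1)" for s
    define m where "m s = (\<integral>x. indicator A x * Y s x \<partial>I1)" for s
    have ii: "integrable I1 (\<lambda>x. indicator A x * y s x)" if "s \<in> {0..T}" for s by (rule integrable_ind_mult[OF yi[OF that]]) simp
    have lc: "continuous_on {0..T} l"
      unfolding continuous_on_def
    proof
      fix s assume s: "s \<in> {0..T}"
      have "((\<lambda>r. l r - l s) \<longlongrightarrow> 0) (at s within {0..T})"
      proof (rule Lim_null_comparison[OF _ cont[OF s]])
        show "\<forall>\<^sub>F r in at s within {0..T}. norm (l r - l s) \<le> n2 I1 (\<lambda>x. y r x - y s x)"
          unfolding eventually_at_filter
        proof (intro always_eventually allI impI)
          fix r assume r: "r \<in> {0..T}"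
          have "l r - l s = (\<integral>x. indicator A x * y r x - indicator A x * y s x \<partial>I1)"
            unfolding l_def by (rule Bochner_Integration.integral_diff[symmetric]) (intro ii r s)+
          also have "\<dots> = (\<integral>x. indicator A x * (y r x - y s x) \<partial>I1)" by (simp only: right_diff_distrib)
          finally show "norm (l r - l s) \<le> n2 I1 (\<lambda>x. y r x - y s x)"
            using abs_ind_le_n2[OF sqi_diff[OF L2S_sqi[OF L[OF r]] L2S_sqi[OF L[OF s]]] A] by simp
        qed
      qed
      then show "(l \<longlongrightarrow> l s) (at s within {0..T})" by (simp add: LIM_zero_iff)
    qed
    have ld: "(l has_vector_derivative m s) (at s)" if s: "s \<in> {0<..<T}" for s
      unfolding has_real_derivative_iff_has_vector_derivative[symmetric] has_field_derivative_iff
    proof -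
      have s': "s \<in> {0..T}" using s by auto
      have "((\<lambda>r. (l r - l s) / (r - s) - m s) \<longlongrightarrow> 0) (at s)"
      proof (rule Lim_null_comparison[OF _ der[OF s]])
        have "\<forall>\<^sub>F r in at s. r \<in> {0<..<T}"
          using s by (intro eventually_at_in_open') auto
        moreover have "\<forall>\<^sub>F r in at s. r \<noteq> s" by (simp add: eventually_at_filter)
        ultimately show "\<forall>\<^sub>F r in at s. norm ((l r - l s) / (r - s) - m s) \<le> n2 I1 (\<lambda>x. (y r x - y s x) / (r - s) - y' s x)"
        proof eventually_elim
          case (elim r)
          then have r: "r \<in> {0..T}" by auto
          have y'i: "integrable I1 (\<lambda>x. indicator A x * y' s x)" by (rule integrable_ind_mult[OF L2S_integrable[OF L'(1)[OF s]]]) simp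
          have m: "m s = (\<integral>x. indicator A x * y' s x \<partial>I1)"
            unfolding m_def by (rule integral_cong_AE) (use YAE[OF s] L2S_measurable[OF L'(1)[OF s]] in \<open>auto elim: eventually_mono\<close>)
          have "(l r - l s) / (r - s) - m s = (\<integral>x. inverse (r - s) * (indicator A x * y r x - indicator A x * y s x) - indicator A x * y' s x \<partial>I1)"
            unfolding Bochner_Integration.integral_diff[OF integrable_mult_right[OF Bochner_Integration.integrable_diff[OF ii[OF r] ii[OF s']]] y'i]
              integral_mult_right_zero Bochner_Integration.integral_diff[OF ii[OF r] ii[OF s']] l_def m
            by (simp add: divide_inverse mult.commute)
          also have "\<dots> = (\<integral>x. indicator A x * ((y r x - y s x) / (r - s) - y' s x) \<partial>I1)"
            by (rule Bochner_Integration.integral_cong) (auto simp: indicator_def divide_inverse mult.commute)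
          finally have "norm ((l r - l s) / (r - s) - m s) = \<bar>\<integral>x. indicator A x * ((y r x - y s x) / (r - s) - y' s x) \<partial>I1\<bar>" by simp
          also have "\<dots> \<le> n2 I1 (\<lambda>x. (y r x - y s x) / (r - s) - y' s x)"
          proof (rule abs_ind_le_n2[OF _ A])
            have "sqi I1 (\<lambda>x. inverse (r - s) * (y r x - y s x) - y' s x)"
              by (intro sqi_diff sqi_cmult L2S_sqi L L' r s s')
            then show "sqi I1 (\<lambda>x. (y r x - y s x) / (r - s) - y' s x)" by (simp add: divide_inverse mult.commute)
          qed
          finally show ?case .
        qed
      qed
      then show "((\<lambda>r. (l r - l s) / (r - s)) \<longlongrightarrow> m s) (at s)" by (simp add: LIM_zero_iff)
    qed
    have [measurable]: "m \<in> borel_measurable borel" unfolding m_def by measurable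
    \<comment> \<open>The bound \<open>B\<close> is available only inside \<open>(0,T)\<close>;
      cutting \<open>m\<close> off there changes it at no more than two points of
      \<open>[0,t]\<close>.\<close>
    define m1 where "m1 s = indicator {0<..<T} s * m s" for s
    have m1b: "\<bar>m1 s\<bar> \<le> \<bar>B\<bar>" for s
      using abs_ind_le_n2[OF Ys A, of s] Yn[of s] by (auto simp: m1_def indicator_def m_def)
    have m1i: "set_integrable lborel {0..t} m1"
      unfolding set_integrable_def
    proof (rule integrableI_bounded_set_indicator[where B = "\<bar>B\<bar>"])
      show "emeasure lborel {0..t} < \<infinity>" using t by (simp add: emeasure_lborel_Icc)
      show "m1 \<in> borel_measurable lborel" unfolding m1_def by measurable
    qed (use m1b in auto)
    have "(m has_integral (l t - l 0)) {0..t}"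
      by (rule fundamental_theorem_of_calculus_interior)
         (use t ld continuous_on_subset[OF lc, of "{0..t}"] in auto)
    then have "(m1 has_integral (l t - l 0)) {0..t}"
      by (rule has_integral_spike_finite[of "{0, T}", rotated 2]) (use t in \<open>auto simp: m1_def indicator_def\<close>)
    then have lt: "l t - l 0 = (\<integral>s. indicator {0..t} s * m1 s \<partial>lborel)"
      using set_borel_integral_eq_integral(2)[OF m1i] by (simp add: set_lebesgue_integral_def integral_unique)
    also have "\<dots> = cum {0<..<T} m t"
      unfolding cum_def
    proof (subst integral_lbon)
      show "(\<integral>s. indicator {0..t} s * m1 s \<partial>lborel) = set_lebesgue_integral lborel {0<..<T} (\<lambda>s. indicator {..t} s * m s)"
        unfolding set_lebesgue_integral_def
        by (rule Bochner_Integration.integral_cong) (auto simp: m1_def indicator_def)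
    qed auto
    finally have lt: "l t - l 0 = cum {0<..<T} m t" .
    have i2: "integrable (JT T \<Otimes>\<^sub>M I1) (\<lambda>(s, x). indicator {..t} s * (indicator A x * Y s x))"
    proof (rule Bochner_Integration.integrable_bound[OF YI])
      show "AE z in JT T \<Otimes>\<^sub>M I1. norm (case z of (s, x) \<Rightarrow> indicator {..t} s * (indicator A x * Y s x)) \<le> norm (case_prod Y z)"
        by (intro always_eventually) (auto simp: indicator_def)
    qed measurable
    have "cum {0<..<T} m t = (\<integral>s. \<integral>x. indicator {..t} s * (indicator A x * Y s x) \<partial>I1 \<partial>JT T)"
      by (simp add: cum_def m_def)
    also have "\<dots> = (\<integral>x. \<integral>s. indicator {..t} s * (indicator A x * Y s x) \<partial>JT T \<partial>I1)"
      by (rule P.Fubini_integral[OF i2, symmetric])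
    also have "\<dots> = (\<integral>x. indicator A x * cum {0<..<T} (\<lambda>s. Y s x) t \<partial>I1)"
      by (simp add: cum_def mult.left_commute)
    finally have cm: "cum {0<..<T} m t = (\<integral>x. indicator A x * cum {0<..<T} (\<lambda>s. Y s x) t \<partial>I1)" .
    have ci: "integrable I1 (\<lambda>x. indicator A x * cum {0<..<T} (\<lambda>s. Y s x) t)" by (rule integrable_ind_mult[OF cumi]) simp
    have "set_lebesgue_integral I1 A (\<lambda>x. y t x - y 0 x - cum {0<..<T} (\<lambda>s. Y s x) t) =
      (\<integral>x. indicator A x * y t x - indicator A x * y 0 x - indicator A x * cum {0<..<T} (\<lambda>s. Y s x) t \<partial>I1)"
      unfolding set_lebesgue_integral_def by (simp add: right_diff_distrib)
    also have "\<dots> = l t - l 0 - cum {0<..<T} m t"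
      unfolding Bochner_Integration.integral_diff[OF Bochner_Integration.integrable_diff[OF ii[OF t] ii[OF 0]] ci]
        Bochner_Integration.integral_diff[OF ii[OF t] ii[OF 0]] l_def cm ..
    finally show "set_lebesgue_integral I1 A (\<lambda>x. y t x - y 0 x - cum {0<..<T} (\<lambda>s. Y s x) t) = 0" using lt by simp
  qed
  then show ?thesis by (auto elim: eventually_mono)
qed

section \<open>Uniform bounds and equations for the local solution\<close>

lemma inHk_wderiv: "inHk k f \<Longrightarrow> j < k \<Longrightarrow> is_wderiv ((wd ^^ j) f) ((wd ^^ Suc j) f)"
  by (simp add: inHk_def)

lemma inHk_L2S: "inHk k f \<Longrightarrow> j \<le> k \<Longrightarrow> L2S ((wd ^^ j) f)"
proof (cases j)
  case 0
  then show "inHk k f \<Longrightarrow> L2S ((wd ^^ j) f)" by (simp add: inHk_def)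
next
  case (Suc i)
  then show "inHk k f \<Longrightarrow> j \<le> k \<Longrightarrow> L2S ((wd ^^ j) f)" using is_wderiv_L2S(2)[OF inHk_wderiv[of k f i]] by simp
qed

lemma nL2_nonneg: "0 \<le> nL2 f"
  by (auto simp: nL2_def set_lebesgue_integral_def intro!: integral_nonneg_AE)

lemma nL2_le_Hnorm: "j \<le> k \<Longrightarrow> nL2 ((wd ^^ j) F) \<le> Hnorm k F"
proof -
  assume "j \<le> k"
  then have "(nL2 ((wd ^^ j) F))\<^sup>2 \<le> (\<Sum>i\<le>k. (nL2 ((wd ^^ i) F))\<^sup>2)"
    by (intro member_le_sum) auto
  then have "sqrt ((nL2 ((wd ^^ j) F))\<^sup>2) \<le> Hnorm k F" unfolding Hnorm_def by (rule real_sqrt_le_mono)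
  then show ?thesis using nL2_nonneg by simp
qed

text \<open>As a choice operator \<open>wd\<close> is linear only up to null sets; the induction
  carries the almost-everywhere identity through each order by
  \<open>is_wderiv_cong\<close>.\<close>

lemma wd_pow_diff:
  assumes f: "inHk k f" and g: "inHk k g"
  shows "j \<le> k \<Longrightarrow> L2S ((wd ^^ j) (\<lambda>x. f x - g x)) \<and> (AE x in I1. (wd ^^ j) (\<lambda>x. f x - g x) x = (wd ^^ j) f x - (wd ^^ j) g x)"
proof (induction j)
  case 0
  have "L2S (\<lambda>x. 1 * f x + (-1) * g x)" by (rule L2S_lin) (use f g in \<open>auto simp: inHk_def\<close>)
  then show ?case by simp
next
  case (Suc j)
  let ?d = "\<lambda>x. f x - g x"
  have IH: "L2S ((wd ^^ j) ?d)" "AE x in I1. (wd ^^ j) ?d x = (wd ^^ j) f x - (wd ^^ j) g x" using Suc by auto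
  have "is_wderiv (\<lambda>x. 1 * (wd ^^ j) f x + (-1) * (wd ^^ j) g x) (\<lambda>x. 1 * (wd ^^ Suc j) f x + (-1) * (wd ^^ Suc j) g x)"
    by (rule is_wderiv_lin[OF inHk_wderiv[OF f] inHk_wderiv[OF g]]) (use Suc in simp_all)
  then have w: "is_wderiv (\<lambda>x. (wd ^^ j) f x - (wd ^^ j) g x) (\<lambda>x. (wd ^^ Suc j) f x - (wd ^^ Suc j) g x)" by simp
  have w': "is_wderiv ((wd ^^ j) ?d) (\<lambda>x. (wd ^^ Suc j) f x - (wd ^^ Suc j) g x)"
    by (rule is_wderiv_cong[OF w IH(1) is_wderiv_L2S(2)[OF w]]) (use IH(2) in \<open>auto elim: eventually_mono\<close>)
  show ?case using wd_AE[OF w'] is_wderiv_L2S(2)[OF wd_is_wderiv[OF w']] by simp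
qed

lemma C0_Hkm_cont:
  assumes C: "C0_Hkm k T u" and j: "j \<le> k" and t: "t \<in> {0..T}"
  shows "((\<lambda>s. n2 I1 (\<lambda>x. (wd ^^ j) (u s) x - (wd ^^ j) (u t) x)) \<longlongrightarrow> 0) (at t within {0..T})"
proof (rule Lim_null_comparison)
  show "((\<lambda>s. Hnorm k (\<lambda>x. u s x - u t x)) \<longlongrightarrow> 0) (at t within {0..T})" using C t by (simp add: C0_Hkm_def)
  show "\<forall>\<^sub>F s in at t within {0..T}. norm (n2 I1 (\<lambda>x. (wd ^^ j) (u s) x - (wd ^^ j) (u t) x)) \<le> Hnorm k (\<lambda>x. u s x - u t x)"
    unfolding eventually_at_filter
  proof (intro always_eventually allI impI)
    fix s assume s: "s \<in> {0..T}"
    have H: "inHk k (u s)" "inHk k (u t)" using C s t by (auto simp: C0_Hkm_def Hkm_def)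
    note d = wd_pow_diff[OF H j]
    have m: "(wd ^^ j) (\<lambda>x. u s x - u t x) \<in> borel_measurable borel" "(wd ^^ j) (u s) \<in> borel_measurable borel" "(wd ^^ j) (u t) \<in> borel_measurable borel"
      using d inHk_L2S[OF H(1) j] inHk_L2S[OF H(2) j] by (auto simp: L2S_iff)
    have "n2 I1 (\<lambda>x. (wd ^^ j) (u s) x - (wd ^^ j) (u t) x) = n2 I1 ((wd ^^ j) (\<lambda>x. u s x - u t x))"
      by (rule n2_cong_AE) (use m d in \<open>auto elim: eventually_mono\<close>)
    also have "\<dots> = nL2 ((wd ^^ j) (\<lambda>x. u s x - u t x))" using nL2_eq[OF m(1)] by simp
    also have "\<dots> \<le> Hnorm k (\<lambda>x. u s x - u t x)" by (rule nL2_le_Hnorm[OF j])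
    finally show "norm (n2 I1 (\<lambda>x. (wd ^^ j) (u s) x - (wd ^^ j) (u t) x)) \<le> Hnorm k (\<lambda>x. u s x - u t x)" by simp
  qed
qed

text \<open>Compactness of \<open>[0,T]\<close> supplies the time-uniform bounds from which the
  constant \<open>M\<close> of the local solution is built.\<close>

lemma C0_Hkm_bounded:
  assumes C: "C0_Hkm k T u" and j: "j \<le> k"
  obtains B where "\<And>t. t \<in> {0..T} \<Longrightarrow> n2 I1 ((wd ^^ j) (u t)) \<le> B"
proof -
  have "continuous_on {0..T} (\<lambda>t. n2 I1 ((wd ^^ j) (u t)))"
    unfolding continuous_on_def
  proof
    fix t assume t: "t \<in> {0..T}"
    have "((\<lambda>s. n2 I1 ((wd ^^ j) (u s)) - n2 I1 ((wd ^^ j) (u t))) \<longlongrightarrow> 0) (at t within {0..T})"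
    proof (rule Lim_null_comparison[OF _ C0_Hkm_cont[OF C j t]])
      show "\<forall>\<^sub>F s in at t within {0..T}. norm (n2 I1 ((wd ^^ j) (u s)) - n2 I1 ((wd ^^ j) (u t))) \<le> n2 I1 (\<lambda>x. (wd ^^ j) (u s) x - (wd ^^ j) (u t) x)"
        unfolding eventually_at_filter
      proof (intro always_eventually allI impI)
        fix s assume s: "s \<in> {0..T}"
        have H: "inHk k (u s)" "inHk k (u t)" using C s t by (auto simp: C0_Hkm_def Hkm_def)
        show "norm (n2 I1 ((wd ^^ j) (u s)) - n2 I1 ((wd ^^ j) (u t))) \<le> n2 I1 (\<lambda>x. (wd ^^ j) (u s) x - (wd ^^ j) (u t) x)"
          using n2_diff[OF L2S_sqi[OF inHk_L2S[OF H(1) j]] L2S_sqi[OF inHk_L2S[OF H(2) j]]] by simp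
      qed
    qed
    then show "((\<lambda>t. n2 I1 ((wd ^^ j) (u t))) \<longlongrightarrow> n2 I1 ((wd ^^ j) (u t))) (at t within {0..T})" by (simp add: LIM_zero_iff)
  qed
  then have "compact ((\<lambda>t. n2 I1 ((wd ^^ j) (u t))) ` {0..T})" by (rule compact_continuous_image) simp
  then obtain B where "\<forall>y\<in>(\<lambda>t. n2 I1 ((wd ^^ j) (u t))) ` {0..T}. norm y \<le> B" using compact_imp_bounded bounded_iff by blast
  then show ?thesis using that[of B] by auto
qed

lemma potential_derivs:
  assumes "potential_ok W"
  shows "(deriv W has_real_derivative (deriv ^^ 2) W x) (at x)" and "continuous_on UNIV ((deriv ^^ 2) W)"
proof -
  have d: "(deriv ^^ j) W differentiable at y" if "j < 3" for j y using assms that by (simp add: potential_ok_def)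
  have "((deriv ^^ 1) W has_real_derivative deriv ((deriv ^^ 1) W) x) (at x)"
    using d[of 1 x] by (simp add: DERIV_deriv_iff_real_differentiable)
  then show "(deriv W has_real_derivative (deriv ^^ 2) W x) (at x)" by (simp add: numeral_2_eq_2)
  show "continuous_on UNIV ((deriv ^^ 2) W)"
    by (rule continuous_at_imp_continuous_on, intro ballI differentiable_imp_continuous_within) (use d[of 2] in auto)
qed

lemma C1_Hkm_L2:
  fixes T :: real
  assumes C: "C1_Hkm k T u ut" and t: "t \<in> {0<..<T}"
  shows "L2S (u t)" "L2S (ut t)"
    "((\<lambda>s. n2 I1 (\<lambda>x. (u s x - u t x) / (s - t) - ut t x)) \<longlongrightarrow> 0) (at t)"
    "((\<lambda>s. n2 I1 (\<lambda>x. ut s x - ut t x)) \<longlongrightarrow> 0) (at t)"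
proof -
  have L: "L2S (u s)" "L2S (ut s)" if "s \<in> {0<..<T}" for s
    using C that by (auto simp: C1_Hkm_def Hkm_def inHk_def)
  then show "L2S (u t)" "L2S (ut t)" using t by auto
  have ev: "\<forall>\<^sub>F s in at t. s \<in> {0<..<T}" using t by (intro eventually_at_in_open') auto
  have le: "n2 I1 F \<le> Hnorm k F" if "F \<in> borel_measurable borel" for F
    using nL2_le_Hnorm[of 0 k F] nL2_eq[OF that] by simp
  show "((\<lambda>s. n2 I1 (\<lambda>x. (u s x - u t x) / (s - t) - ut t x)) \<longlongrightarrow> 0) (at t)"
  proof (rule Lim_null_comparison)
    show "((\<lambda>s. Hnorm k (\<lambda>x. (u s x - u t x) / (s - t) - ut t x)) \<longlongrightarrow> 0) (at t)" using C t by (simp add: C1_Hkm_def)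
    show "\<forall>\<^sub>F s in at t. norm (n2 I1 (\<lambda>x. (u s x - u t x) / (s - t) - ut t x)) \<le> Hnorm k (\<lambda>x. (u s x - u t x) / (s - t) - ut t x)"
      using ev
    proof eventually_elim
      case (elim s)
      have [measurable]: "u s \<in> borel_measurable borel" "u t \<in> borel_measurable borel" "ut t \<in> borel_measurable borel"
        using L[OF elim] L[OF t] by (auto simp: L2S_iff)
      have "n2 I1 (\<lambda>x. (u s x - u t x) / (s - t) - ut t x) \<le> Hnorm k (\<lambda>x. (u s x - u t x) / (s - t) - ut t x)"
        by (rule le) measurable
      then show ?case by simp
    qed
  qed
  show "((\<lambda>s. n2 I1 (\<lambda>x. ut s x - ut t x)) \<longlongrightarrow> 0) (at t)"
  proof (rule Lim_null_comparison)
    show "((\<lambda>s. Hnorm k (\<lambda>x. ut s x - ut t x)) \<longlongrightarrow> 0) (at t)" using C t by (simp add: C1_Hkm_def)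
    show "\<forall>\<^sub>F s in at t. norm (n2 I1 (\<lambda>x. ut s x - ut t x)) \<le> Hnorm k (\<lambda>x. ut s x - ut t x)"
      using ev
    proof eventually_elim
      case (elim s)
      have [measurable]: "ut s \<in> borel_measurable borel" "ut t \<in> borel_measurable borel"
        using L[OF elim] L[OF t] by (auto simp: L2S_iff)
      have "n2 I1 (\<lambda>x. ut s x - ut t x) \<le> Hnorm k (\<lambda>x. ut s x - ut t x)" by (rule le) measurable
      then show ?case by simp
    qed
  qed
qed

text \<open>The bound \<open>B\<close> makes the measurable representative of the time derivative
  square integrable up to the ends of \<open>(0,T)\<close>, where \<open>C1_Hkm\<close> gives no
  control.\<close>

lemma L2_curve_rep_AC:
  fixes T :: real
  assumes T: "T > 0" and C0: "C0_Hkm k T y" and C1: "C1_Hkm k' T y yt"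
    and B: "\<And>t. t \<in> {0<..<T} \<Longrightarrow> n2 I1 (yt t) \<le> B"
  obtains Y where "L2Q T Y" "\<And>t. t \<in> {0<..<T} \<Longrightarrow> L2S (Y t)" "\<And>t. t \<in> {0<..<T} \<Longrightarrow> AE x in I1. Y t x = yt t x"
    "\<And>t. t \<in> {0..T} \<Longrightarrow> AE x in I1. y t x = y 0 x + cum {0<..<T} (\<lambda>s. Y s x) t"
proof -
  obtain Y where m: "case_prod Y \<in> borel_measurable (borel \<Otimes>\<^sub>M borel)" and p: "\<And>t. per1 (Y t)"
    and AE: "\<And>t. t \<in> {0<..<T} \<Longrightarrow> AE x in I1. Y t x = yt t x"
    by (rule L2_curve_measurable_rep[of T yt, OF C1_Hkm_L2(2)[OF C1] C1_Hkm_L2(4)[OF C1]]) auto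
  note [measurable] = m
  have YL: "L2S (Y t)" and Yn: "n2 I1 (Y t) \<le> B" if t: "t \<in> {0<..<T}" for t
  proof -
    have mm: "Y t \<in> borel_measurable borel" "yt t \<in> borel_measurable borel" using L2S_measurable[OF C1_Hkm_L2(2)[OF C1 t]] by auto
    have e: "AE x in I1. yt t x = Y t x" using AE[OF t] by (auto elim: eventually_mono)
    have "sqi I1 (Y t)" by (rule sqi_cong_AE[OF L2S_sqi[OF C1_Hkm_L2(2)[OF C1 t]] _ e]) (use mm in simp)
    then show "L2S (Y t)" using mm p by (simp add: L2S_iff)
    show "n2 I1 (Y t) \<le> B" using n2_cong_AE[OF _ _ e] mm B[OF t] by simp
  qed
  have S: "sqi (JT T \<Otimes>\<^sub>M I1) (case_prod Y)"
    by (rule sqi_JI_of_bounded_n2[OF m, where B = B]) (use YL Yn in \<open>auto simp: AE_lbon L2S_iff\<close>)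
  show ?thesis
  proof (rule that[OF _ YL AE])
    show "L2Q T Y" using m p S by (simp add: L2Q_iff)
    fix t assume t: "t \<in> {0..T}"
    show "AE x in I1. y t x = y 0 x + cum {0<..<T} (\<lambda>s. Y s x) t"
    proof (rule L2_curve_AC[OF T _ _ C1_Hkm_L2(2)[OF C1] B C1_Hkm_L2(3)[OF C1] m AE t])
      show "L2S (y s)" if "s \<in> {0..T}" for s using C0 that by (auto simp: C0_Hkm_def Hkm_def inHk_def)
      show "((\<lambda>s. n2 I1 (\<lambda>x. y s x - y r x)) \<longlongrightarrow> 0) (at r within {0..T})" if "r \<in> {0..T}" for r
        using C0_Hkm_cont[OF C0 _ that, of 0] by simp
    qed auto
  qed auto
qed

text \<open>\<open>C1_Hkm\<close> is a condition on the open interval, so bounds for the time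
  derivatives are read off the equations, whose right sides are controlled by the
  \<open>C0_Hkm\<close> norms on the closed interval. The second equation is recorded with its whole
  right side as one weak derivative, ready for subtraction and integration by parts.\<close>

lemma local_sol_facts:
  assumes sol: "local_sol W \<mu> \<gamma> T u0 v0 u v" and T: "T > 0" and W: "potential_ok W"
  obtains M Ul Vl where "M > 0" "L2Q T Ul" "L2Q T Vl"
    "\<And>t. t \<in> {0<..<T} \<Longrightarrow> AE x in I1. u t x = u0 x + cum {0<..<T} (\<lambda>s. Ul s x) t"
    "\<And>t. t \<in> {0<..<T} \<Longrightarrow> AE x in I1. v t x = v0 x + cum {0<..<T} (\<lambda>s. Vl s x) t"
    "\<And>t. t \<in> {0<..<T} \<Longrightarrow> inHk 3 (u t)"
    "\<And>t. t \<in> {0<..<T} \<Longrightarrow> is_wderiv (v t) (Ul t)"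
    "\<And>t. t \<in> {0<..<T} \<Longrightarrow> is_wderiv (\<lambda>x. deriv W (u t x) + \<mu> * Ul t x - \<gamma> * (wd ^^ 2) (u t) x) (Vl t)"
    "\<And>t. t \<in> {0<..<T} \<Longrightarrow> AE x in I1. \<bar>u t x\<bar> \<le> M"
    "\<And>t. t \<in> {0<..<T} \<Longrightarrow> AE x in I1. \<bar>Ul t x\<bar> \<le> M"
    "\<And>t. t \<in> {0<..<T} \<Longrightarrow> n2 I1 ((wd ^^ 3) (u t)) \<le> M"
proof -
  obtain ut vt where C: "C0_Hkm 3 T u" "C1_Hkm 1 T u ut" "C0_Hkm 2 T v" "C1_Hkm 0 T v vt"
    and eq: "\<And>t. t \<in> {0<..<T} \<Longrightarrow> AE x in lborel. ut t x = wd (v t) x \<and>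
           vt t x = wd (\<lambda>y. deriv W (u t y)) x + \<mu> * (wd ^^ 2) (v t) x - \<gamma> * (wd ^^ 3) (u t) x"
    and init: "AE x in lborel. u 0 x = u0 x" "AE x in lborel. v 0 x = v0 x"
    using sol unfolding local_sol_def by blast
  have Hu: "inHk 3 (u t)" and Hv: "inHk 2 (v t)" if "t \<in> {0..T}" for t
    using C that by (auto simp: C0_Hkm_def Hkm_def)
  obtain B0 where B0: "\<And>t. t \<in> {0..T} \<Longrightarrow> n2 I1 ((wd ^^ 0) (u t)) \<le> B0" by (rule C0_Hkm_bounded[OF C(1), of 0]) auto
  obtain B1 where B1: "\<And>t. t \<in> {0..T} \<Longrightarrow> n2 I1 ((wd ^^ 1) (u t)) \<le> B1" by (rule C0_Hkm_bounded[OF C(1), of 1]) auto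
  obtain B3 where B3: "\<And>t. t \<in> {0..T} \<Longrightarrow> n2 I1 ((wd ^^ 3) (u t)) \<le> B3" by (rule C0_Hkm_bounded[OF C(1), of 3]) auto
  obtain D1 where D1: "\<And>t. t \<in> {0..T} \<Longrightarrow> n2 I1 ((wd ^^ 1) (v t)) \<le> D1" by (rule C0_Hkm_bounded[OF C(3), of 1]) auto
  obtain D2 where D2: "\<And>t. t \<in> {0..T} \<Longrightarrow> n2 I1 ((wd ^^ 2) (v t)) \<le> D2" by (rule C0_Hkm_bounded[OF C(3), of 2]) auto
  have in0: "t \<in> {0..T}" if "t \<in> {0<..<T}" for t using that by auto
  have wu: "is_wderiv (u t) (wd (u t))" "is_wderiv ((wd ^^ 2) (u t)) ((wd ^^ 3) (u t))"
    and wv: "is_wderiv (v t) (wd (v t))" "is_wderiv (wd (v t)) ((wd ^^ 2) (v t))" if "t \<in> {0<..<T}" for t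
    using inHk_wderiv[OF Hu[OF in0[OF that]], of 0] inHk_wderiv[OF Hu[OF in0[OF that]], of 2]
      inHk_wderiv[OF Hv[OF in0[OF that]], of 0] inHk_wderiv[OF Hv[OF in0[OF that]], of 1]
    by (simp_all add: numeral_2_eq_2 numeral_3_eq_3)
  have usup: "AE x in I1. \<bar>u t x\<bar> \<le> B0 + B1" if t: "t \<in> {0<..<T}" for t
  proof -
    have "\<bar>\<integral>y. u t y \<partial>I1\<bar> \<le> B0"
      using n2_le_integral[OF L2S_sqi[OF is_wderiv_L2S(1)[OF wu(1)[OF t]]]] B0[OF in0[OF t]] by simp
    moreover have "n2 I1 (wd (u t)) \<le> B1" using B1[OF in0[OF t]] by simp
    ultimately show ?thesis using is_wderiv_sup[OF wu(1)[OF t]] by (auto elim!: eventually_mono)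
  qed
  \<comment> \<open>The second derivative of \<open>W\<close> is bounded on the range of
    \<open>u\<close>, so the derivative of \<open>W'(u)\<close> is dominated by that of
    \<open>u\<close>.\<close>
  obtain L where L: "\<And>y. y \<in> {z. \<bar>z\<bar> \<le> B0 + B1} \<Longrightarrow> \<bar>(deriv ^^ 2) W y\<bar> \<le> L"
  proof (rule continuous_bounded[OF potential_derivs(2)[OF W], of "{z. \<bar>z\<bar> \<le> B0 + B1}"])
    show "bounded {z::real. \<bar>z\<bar> \<le> B0 + B1}" unfolding bounded_iff by auto
  qed auto
  have chain: "is_wderiv (\<lambda>x. deriv W (u t x)) (\<lambda>x. (deriv ^^ 2) W (u t x) * wd (u t) x)" if "t \<in> {0<..<T}" for t
    by (rule is_wderiv_chain[OF wu(1)[OF that] potential_derivs(1)[OF W] potential_derivs(2)[OF W]])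
  have nW: "n2 I1 (wd (\<lambda>x. deriv W (u t x))) \<le> \<bar>L\<bar> * B1" if t: "t \<in> {0<..<T}" for t
  proof -
    have s: "sqi I1 (wd (\<lambda>x. deriv W (u t x)))" by (rule L2S_sqi[OF is_wderiv_L2S(2)[OF wd_is_wderiv[OF chain[OF t]]]])
    have s1: "sqi I1 (wd (u t))" by (rule L2S_sqi[OF is_wderiv_L2S(2)[OF wu(1)[OF t]]])
    have "AE x in I1. \<bar>wd (\<lambda>x. deriv W (u t x)) x\<bar> \<le> \<bar>\<bar>L\<bar> * wd (u t) x\<bar>"
      using wd_AE[OF chain[OF t]] usup[OF t]
    proof eventually_elim
      case (elim x)
      have "\<bar>(deriv ^^ 2) W (u t x)\<bar> \<le> \<bar>L\<bar>" using L[of "u t x"] elim(2) by auto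
      then show ?case unfolding elim(1) abs_mult by (intro mult_right_mono) auto
    qed
    then have "n2 I1 (wd (\<lambda>x. deriv W (u t x))) \<le> n2 I1 (\<lambda>x. \<bar>L\<bar> * wd (u t) x)"
      unfolding n2_def by (intro real_sqrt_le_mono n2_mono_AE s sqi_cmult s1)
    also have "\<dots> = \<bar>L\<bar> * n2 I1 (wd (u t))" by (simp add: n2_cmult)
    also have "\<dots> \<le> \<bar>L\<bar> * B1" using B1[OF in0[OF t]] by (intro mult_left_mono) auto
    finally show ?thesis .
  qed
  have eqI: "AE x in I1. ut t x = wd (v t) x" "AE x in I1. vt t x = wd (\<lambda>y. deriv W (u t y)) x + \<mu> * (wd ^^ 2) (v t) x - \<gamma> * (wd ^^ 3) (u t) x"
    if "t \<in> {0<..<T}" for t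
  proof -
    have "AE x in I1. ut t x = wd (v t) x \<and> vt t x = wd (\<lambda>y. deriv W (u t y)) x + \<mu> * (wd ^^ 2) (v t) x - \<gamma> * (wd ^^ 3) (u t) x"
      unfolding AE_lbon[OF borel_closed[OF closed_atLeastAtMost]] using eq[OF that] by (rule eventually_mono) blast
    then show "AE x in I1. ut t x = wd (v t) x" "AE x in I1. vt t x = wd (\<lambda>y. deriv W (u t y)) x + \<mu> * (wd ^^ 2) (v t) x - \<gamma> * (wd ^^ 3) (u t) x"
      by (rule eventually_mono, blast)+
  qed
  have nut: "n2 I1 (ut t) \<le> D1" if t: "t \<in> {0<..<T}" for t
    using n2_cong_AE[OF _ _ eqI(1)[OF t]] L2S_measurable[OF C1_Hkm_L2(2)[OF C(2) t]] L2S_measurable[OF is_wderiv_L2S(2)[OF wv(1)[OF t]]]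
      D1[OF in0[OF t]] by simp
  have nvt: "n2 I1 (vt t) \<le> \<bar>L\<bar> * B1 + (\<bar>\<mu>\<bar> * D2 + \<bar>\<gamma>\<bar> * B3)" if t: "t \<in> {0<..<T}" for t
  proof -
    let ?a = "wd (\<lambda>y. deriv W (u t y))" and ?b = "(wd ^^ 2) (v t)" and ?c = "(wd ^^ 3) (u t)"
    have s: "sqi I1 ?a" "sqi I1 ?b" "sqi I1 ?c"
      using is_wderiv_L2S(2)[OF wd_is_wderiv[OF chain[OF t]]] is_wderiv_L2S(2)[OF wv(2)[OF t]] is_wderiv_L2S(2)[OF wu(2)[OF t]] by (auto intro: L2S_sqi)
    have sbc: "sqi I1 (\<lambda>x. \<mu> * ?b x + (- \<gamma>) * ?c x)" by (intro sqi_add sqi_cmult s)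
    have m: "?a \<in> borel_measurable borel" "?b \<in> borel_measurable borel" "?c \<in> borel_measurable borel" using s by (auto simp: sqi_def)
    note [measurable] = m
    have "n2 I1 (vt t) = n2 I1 (\<lambda>x. ?a x + (\<mu> * ?b x + (- \<gamma>) * ?c x))"
    proof (rule n2_cong_AE)
      show "vt t \<in> borel_measurable I1" using L2S_measurable[OF C1_Hkm_L2(2)[OF C(4) t]] by simp
      show "AE x in I1. vt t x = ?a x + (\<mu> * ?b x + (- \<gamma>) * ?c x)" using eqI(2)[OF t] by eventually_elim simp
    qed measurable
    also have "\<dots> \<le> n2 I1 ?a + n2 I1 (\<lambda>x. \<mu> * ?b x + (- \<gamma>) * ?c x)" by (rule n2_add[OF s(1) sbc])
    also have "n2 I1 (\<lambda>x. \<mu> * ?b x + (- \<gamma>) * ?c x) \<le> n2 I1 (\<lambda>x. \<mu> * ?b x) + n2 I1 (\<lambda>x. (- \<gamma>) * ?c x)"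
      by (rule n2_add) (intro sqi_cmult s)+
    also have "n2 I1 (\<lambda>x. \<mu> * ?b x) = \<bar>\<mu>\<bar> * n2 I1 ?b" by (rule n2_cmult)
    also have "n2 I1 (\<lambda>x. (- \<gamma>) * ?c x) = \<bar>- \<gamma>\<bar> * n2 I1 ?c" by (rule n2_cmult)
    finally have "n2 I1 (vt t) \<le> n2 I1 ?a + (\<bar>\<mu>\<bar> * n2 I1 ?b + \<bar>- \<gamma>\<bar> * n2 I1 ?c)" by simp
    moreover have "\<bar>\<mu>\<bar> * n2 I1 ?b \<le> \<bar>\<mu>\<bar> * D2" "\<bar>- \<gamma>\<bar> * n2 I1 ?c \<le> \<bar>\<gamma>\<bar> * B3"
      using D2[OF in0[OF t]] B3[OF in0[OF t]] by (auto intro!: mult_left_mono)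
    ultimately show ?thesis using nW[OF t] by linarith
  qed
  obtain Ul where Ul: "L2Q T Ul" "\<And>t. t \<in> {0<..<T} \<Longrightarrow> L2S (Ul t)" "\<And>t. t \<in> {0<..<T} \<Longrightarrow> AE x in I1. Ul t x = ut t x"
    "\<And>t. t \<in> {0..T} \<Longrightarrow> AE x in I1. u t x = u 0 x + cum {0<..<T} (\<lambda>s. Ul s x) t"
    by (rule L2_curve_rep_AC[OF T C(1,2) nut]) auto
  obtain Vl where Vl: "L2Q T Vl" "\<And>t. t \<in> {0<..<T} \<Longrightarrow> L2S (Vl t)" "\<And>t. t \<in> {0<..<T} \<Longrightarrow> AE x in I1. Vl t x = vt t x"
    "\<And>t. t \<in> {0..T} \<Longrightarrow> AE x in I1. v t x = v 0 x + cum {0<..<T} (\<lambda>s. Vl s x) t"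
    by (rule L2_curve_rep_AC[OF T C(3,4) nvt]) auto
  have Ulwd: "AE x in I1. wd (v t) x = Ul t x" if t: "t \<in> {0<..<T}" for t
    using Ul(3)[OF t] eqI(1)[OF t] by eventually_elim simp
  \<comment> \<open>The \<open>1\<close> in the maximum secures positivity.\<close>
  define M where "M = max 1 (max (B0 + B1) (max D2 B3))"
  have initI: "AE x in I1. u 0 x = u0 x" "AE x in I1. v 0 x = v0 x" using init by (auto simp: AE_lbon elim: eventually_mono)
  show ?thesis
  proof (rule that[of M Ul Vl, OF _ Ul(1) Vl(1)])
    show "M > 0" by (simp add: M_def)
    fix t assume t: "t \<in> {0<..<T}"
    show "AE x in I1. u t x = u0 x + cum {0<..<T} (\<lambda>s. Ul s x) t"
      using Ul(4)[OF in0[OF t]] initI(1) by eventually_elim simp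
    show "AE x in I1. v t x = v0 x + cum {0<..<T} (\<lambda>s. Vl s x) t"
      using Vl(4)[OF in0[OF t]] initI(2) by eventually_elim simp
    show "inHk 3 (u t)" by (rule Hu[OF in0[OF t]])
    show wU: "is_wderiv (v t) (Ul t)"
      by (rule is_wderiv_cong[OF wv(1)[OF t] is_wderiv_L2S(1)[OF wv(1)[OF t]] Ul(2)[OF t] _ Ulwd[OF t]]) simp
    have LU: "is_wderiv (Ul t) ((wd ^^ 2) (v t))"
      by (rule is_wderiv_cong[OF wv(2)[OF t] Ul(2)[OF t] is_wderiv_L2S(2)[OF wv(2)[OF t]] Ulwd[OF t]]) simp
    have 1: "is_wderiv (\<lambda>x. 1 * deriv W (u t x) + \<mu> * Ul t x) (\<lambda>x. 1 * wd (\<lambda>x. deriv W (u t x)) x + \<mu> * (wd ^^ 2) (v t) x)"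
      by (rule is_wderiv_lin[OF wd_is_wderiv[OF chain[OF t]] LU])
    have 2: "is_wderiv (\<lambda>x. 1 * (1 * deriv W (u t x) + \<mu> * Ul t x) + (- \<gamma>) * (wd ^^ 2) (u t) x)
       (\<lambda>x. 1 * (1 * wd (\<lambda>x. deriv W (u t x)) x + \<mu> * (wd ^^ 2) (v t) x) + (- \<gamma>) * (wd ^^ 3) (u t) x)"
      by (rule is_wderiv_lin[OF 1 wu(2)[OF t]])
    then have 3: "is_wderiv (\<lambda>x. deriv W (u t x) + \<mu> * Ul t x - \<gamma> * (wd ^^ 2) (u t) x)
       (\<lambda>x. wd (\<lambda>x. deriv W (u t x)) x + \<mu> * (wd ^^ 2) (v t) x - \<gamma> * (wd ^^ 3) (u t) x)" by simp
    show "is_wderiv (\<lambda>x. deriv W (u t x) + \<mu> * Ul t x - \<gamma> * (wd ^^ 2) (u t) x) (Vl t)"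
    proof (rule is_wderiv_cong[OF 3 is_wderiv_L2S(1)[OF 3] Vl(2)[OF t]])
      show "AE x in I1. wd (\<lambda>x. deriv W (u t x)) x + \<mu> * (wd ^^ 2) (v t) x - \<gamma> * (wd ^^ 3) (u t) x = Vl t x"
        using Vl(3)[OF t] eqI(2)[OF t] by eventually_elim simp
    qed simp
    show "AE x in I1. \<bar>u t x\<bar> \<le> M" using usup[OF t] by eventually_elim (simp add: M_def)
    have "n2 I1 ((wd ^^ 2) (v t)) \<le> M" using D2[OF in0[OF t]] by (simp add: M_def)
    then show "AE x in I1. \<bar>Ul t x\<bar> \<le> M"
      using is_wderiv_sup[OF LU] is_wderiv_mean0[OF wU] by (auto elim!: eventually_mono)
    show "n2 I1 ((wd ^^ 3) (u t)) \<le> M" using B3[OF in0[OF t]] by (simp add: M_def)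
  qed
qed

section \<open>Initial values and equations for the nonlocal solution\<close>

lemma L2Q_diff:
  assumes f: "L2Q T f" and g: "L2Q T g" shows "L2Q T (\<lambda>t x. f t x - g t x)"
proof -
  have [measurable]: "case_prod f \<in> borel_measurable (borel \<Otimes>\<^sub>M borel)" "case_prod g \<in> borel_measurable (borel \<Otimes>\<^sub>M borel)"
    using f g by (auto simp: L2Q_iff)
  have "sqi (JT T \<Otimes>\<^sub>M I1) (\<lambda>z. case_prod f z - case_prod g z)" by (rule sqi_diff) (use f g in \<open>auto simp: L2Q_iff\<close>)
  then have "sqi (JT T \<Otimes>\<^sub>M I1) (case_prod (\<lambda>t x. f t x - g t x))" by (simp add: split_beta')
  moreover have "case_prod (\<lambda>t x. f t x - g t x) \<in> borel_measurable (borel \<Otimes>\<^sub>M borel)" by measurable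
  ultimately show ?thesis using f g by (auto simp: L2Q_iff per1_def)
qed

lemma L2Q_AE_integrable:
  assumes "L2Q T f" shows "AE x in I1. integrable (JT T) (\<lambda>s. f s x)"
proof -
  interpret P: pair_sigma_finite "JT T" I1 by (rule pair_JI)
  have "integrable (JT T \<Otimes>\<^sub>M I1) (\<lambda>(s, x). f s x)" by (rule sqi_JI_integrable) (use assms in \<open>auto simp: L2Q_iff\<close>)
  from P.AE_integrable_snd[OF this] show ?thesis .
qed

lemma cum_L2Q_diff:
  assumes f: "L2Q T f" and g: "L2Q T g"
  shows "AE x in I1. \<forall>t. cum {0<..<T} (\<lambda>s. f s x - g s x) t = cum {0<..<T} (\<lambda>s. f s x) t - cum {0<..<T} (\<lambda>s. g s x) t"
  using L2Q_AE_integrable[OF f] L2Q_AE_integrable[OF g]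
proof eventually_elim
  case (elim x)
  have "integrable (JT T) (\<lambda>s. (-1) * g s x)" using elim(2) by simp
  from cum_add[OF _ elim(1) this] show ?case unfolding cum_cmult by simp
qed

text \<open>Cauchy-Schwarz over \<open>(0,t)\<close> yields the factor \<open>t\<close> instead of
  \<open>T\<close>, so the primitive tends to zero in \<open>L^2\<close> as \<open>t\<close> tends
  to \<open>0\<close>; this serves to identify initial values.\<close>

lemma cum_L2_small:
  assumes T: "T > 0" and f: "L2Q T f" and t: "t \<ge> 0"
  shows "sqi I1 (\<lambda>x. cum {0<..<T} (\<lambda>s. f s x) t)"
    and "(\<integral>x. (cum {0<..<T} (\<lambda>s. f s x) t)\<^sup>2 \<partial>I1) \<le> t * (\<integral>z. (case_prod f z)\<^sup>2 \<partial>(JT T \<Otimes>\<^sub>M I1))"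
proof -
  interpret P: pair_sigma_finite "JT T" I1 by (rule pair_JI)
  have [measurable]: "case_prod f \<in> borel_measurable (borel \<Otimes>\<^sub>M borel)" and s: "sqi (JT T \<Otimes>\<^sub>M I1) (case_prod f)"
    using f by (auto simp: L2Q_iff)
  have m: "case_prod f \<in> borel_measurable (borel \<Otimes>\<^sub>M I1)"
    by (subst measurable_cong_sets[OF sets_pair_measure_cong[OF refl sets_lbon] refl]) measurable
  show S: "sqi I1 (\<lambda>x. cum {0<..<T} (\<lambda>s. f s x) t)"
    by (rule energy_identity(2)[OF less_imp_le[OF T] _ m s]) simp
  have f2: "integrable (JT T \<Otimes>\<^sub>M I1) (\<lambda>(s, x). (f s x)\<^sup>2)" using sqi_square[OF s] by (simp add: split_beta')
  have "(\<integral>x. (cum {0<..<T} (\<lambda>s. f s x) t)\<^sup>2 \<partial>I1) \<le> (\<integral>x. t * (\<integral>s. (f s x)\<^sup>2 \<partial>JT T) \<partial>I1)"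
  proof (rule integral_mono_AE[OF sqi_square[OF S]])
    show "integrable I1 (\<lambda>x. t * (\<integral>s. (f s x)\<^sup>2 \<partial>JT T))" by (rule integrable_mult_right[OF P.integrable_snd[OF f2]])
    show "AE x in I1. (cum {0<..<T} (\<lambda>s. f s x) t)\<^sup>2 \<le> t * (\<integral>s. (f s x)\<^sup>2 \<partial>JT T)"
      using P.AE_integrable_snd[OF f2]
    proof eventually_elim
      case (elim x)
      have fs: "sqi (JT T) (\<lambda>s. f s x)" using elim by (simp add: sqi_def)
      have i: "sqi (JT T) (indicator {..t})" by (rule sqi_bounded[OF finite_JT, of _ _ 1]) (auto simp: indicator_def)
      have "(cum {0<..<T} (\<lambda>s. f s x) t)\<^sup>2 \<le> (\<integral>s. (indicator {..t} s)\<^sup>2 \<partial>JT T) * (\<integral>s. (f s x)\<^sup>2 \<partial>JT T)"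
        unfolding cum_def by (rule sqi_Cauchy_Schwarz[OF i fs])
      also have "\<dots> \<le> t * (\<integral>s. (f s x)\<^sup>2 \<partial>JT T)"
      proof (rule mult_right_mono)
        have "(\<lambda>s. (indicator {..t} s :: real)\<^sup>2) = indicator {..t}" by (auto simp: indicator_def)
        then have "(\<integral>s. (indicator {..t} s)\<^sup>2 \<partial>JT T) = measure (JT T) {..t}" by simp
        also have "\<dots> = measure lborel ({0<..<T} \<inter> {..t})" by (rule measure_lbon) auto
        also have "\<dots> \<le> measure lborel {0..t}"
          by (rule measure_mono_fmeasurable) (use t in \<open>auto simp: fmeasurable_def emeasure_lborel_Icc\<close>)
        also have "\<dots> = t" using t by simp
        finally show "(\<integral>s. (indicator {..t} s)\<^sup>2 \<partial>JT T) \<le> t" .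
      qed (auto intro!: integral_nonneg_AE)
      finally show ?case .
    qed
  qed
  also have "\<dots> = t * (\<integral>z. (case_prod f z)\<^sup>2 \<partial>(JT T \<Otimes>\<^sub>M I1))"
    unfolding integral_mult_right_zero using P.integral_snd[OF f2] by (simp add: split_beta')
  finally show "(\<integral>x. (cum {0<..<T} (\<lambda>s. f s x) t)\<^sup>2 \<partial>I1) \<le> t * (\<integral>z. (case_prod f z)\<^sup>2 \<partial>(JT T \<Otimes>\<^sub>M I1))" .
qed

lemma n2_zero_AE:
  assumes "sqi I1 f" "n2 I1 f = 0" shows "AE x in I1. f x = 0"
proof -
  have "(\<integral>x. (f x)\<^sup>2 \<partial>I1) = 0" using assms(2) n2_sq[of I1 f] by simp
  then have "AE x in I1. (f x)\<^sup>2 = 0"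
    using integral_nonneg_eq_0_iff_AE[OF sqi_square[OF assms(1)]] by simp
  then show ?thesis by simp
qed

text \<open>The integration constant \<open>a\<close> of \<open>dtw_AC\<close> satisfies
  \<open>a - w0 = (f t - w0) - c t\<close> for almost every \<open>t\<close>, and both terms on the
  right are small in \<open>L^2\<close> for small \<open>t\<close>.\<close>

lemma dtw_initial:
  assumes T: "T > 0" and f: "L2Q T f" and g: "L2Q T g" and d: "dtw T f g" and w0: "L2S w0"
    and init: "\<And>r. r > 0 \<Longrightarrow> \<exists>\<delta>>0. AE t in lborel. t \<in> {0<..<\<delta>} \<longrightarrow> nL2 (\<lambda>x. f t x - w0 x) < r"
  shows "AE t in JT T. AE x in I1. f t x = w0 x + cum {0<..<T} (\<lambda>s. g s x) t"
proof -
  obtain a where a [measurable]: "a \<in> borel_measurable borel" and AC: "AE t in JT T. AE x in I1. f t x = a x + cum {0<..<T} (\<lambda>s. g s x) t"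
    by (rule dtw_AC[OF T f g d])
  define c where "c t x = cum {0<..<T} (\<lambda>s. g s x) t" for t x
  have cs: "sqi I1 (c t)" if "t \<ge> 0" for t unfolding c_def by (rule cum_L2_small(1)[OF T g that])
  have w0s: "sqi I1 w0" using w0 by (rule L2S_sqi)
  have good: "AE t in JT T. t > 0 \<and> sqi I1 (f t) \<and> (AE x in I1. f t x = a x + c t x)"
  proof -
    have "AE t in JT T. t > 0" by (simp add: AE_lbon)
    then show ?thesis using AC L2Q_slice[OF f] by eventually_elim (auto simp: c_def L2S_iff)
  qed
  have as: "sqi I1 a"
  proof -
    \<comment> \<open>Almost every time is good, so there is a good one; \<open>a\<close> inherits
      square integrability from it.\<close>
    have "\<exists>t. t > 0 \<and> sqi I1 (f t) \<and> (AE x in I1. f t x = a x + c t x)"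
    proof (rule ccontr)
      assume n: "\<not> ?thesis"
      have "AE t in JT T. False" using good by (rule eventually_mono) (use n in blast)
      then show False using AE_JT_False[OF T] by simp
    qed
    then obtain t where t: "t > 0" "sqi I1 (f t)" "AE x in I1. f t x = a x + c t x" by blast
    have "sqi I1 (\<lambda>x. f t x - c t x)" by (rule sqi_diff[OF t(2) cs]) (use t in simp)
    then show ?thesis by (rule sqi_cong_AE) (use t(3) in \<open>auto elim: eventually_mono\<close>)
  qed
  define C where "C = (\<integral>z. (case_prod g z)\<^sup>2 \<partial>(JT T \<Otimes>\<^sub>M I1))"
  have C0: "C \<ge> 0" unfolding C_def by (rule integral_nonneg_AE) auto
  have das: "sqi I1 (\<lambda>x. a x - w0 x)" by (rule sqi_diff[OF as w0s])
  have "n2 I1 (\<lambda>x. a x - w0 x) \<le> 0 + r" if r: "r > 0" for r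
  proof -
    obtain \<delta> where \<delta>: "\<delta> > 0" "AE t in lborel. t \<in> {0<..<\<delta>} \<longrightarrow> nL2 (\<lambda>x. f t x - w0 x) < r / 2"
      using init[of "r / 2"] r by auto
    \<comment> \<open>The squared norm of the primitive is at most \<open>t C\<close>, so
      \<open>t < D\<close> keeps it below \<open>(r / 2)^2\<close>; \<open>C + 1\<close> avoids
      division by zero.\<close>
    define D where "D = min (min \<delta> T) ((r / 2)\<^sup>2 / (C + 1))"
    have D: "D > 0" unfolding D_def using \<delta>(1) T r C0 by (auto intro!: divide_pos_pos)
    have 1: "AE t in JT D. nL2 (\<lambda>x. f t x - w0 x) < r / 2"
      unfolding AE_lbon[OF borel_open[OF open_greaterThanLessThan]]
      using \<delta>(2) by (rule eventually_mono) (auto simp: D_def)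
    have 2: "AE t in JT D. t > 0 \<and> sqi I1 (f t) \<and> (AE x in I1. f t x = a x + c t x)"
      unfolding AE_lbon[OF borel_open[OF open_greaterThanLessThan]]
      using good[unfolded AE_lbon[OF borel_open[OF open_greaterThanLessThan]]] by (rule eventually_mono) (auto simp: D_def)
    have 3: "AE t in JT D. t < D" by (simp add: AE_lbon)
    have "AE t in JT D. n2 I1 (\<lambda>x. a x - w0 x) \<le> r"
      using 1 2 3
    proof eventually_elim
      case (elim t)
      have [measurable]: "f t \<in> borel_measurable borel" "w0 \<in> borel_measurable borel" "c t \<in> borel_measurable borel"
        using elim w0s cs[of t] by (auto simp: sqi_def)
      have s1: "sqi I1 (\<lambda>x. f t x - w0 x)" by (rule sqi_diff) (use elim w0s in auto)
      have s2: "sqi I1 (\<lambda>x. (-1) * c t x)" by (rule sqi_cmult[OF cs]) (use elim in simp)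
      have "n2 I1 (\<lambda>x. a x - w0 x) = n2 I1 (\<lambda>x. (f t x - w0 x) + (-1) * c t x)"
        by (rule n2_cong_AE) (use elim in \<open>auto elim!: eventually_mono\<close>)
      also have "\<dots> \<le> n2 I1 (\<lambda>x. f t x - w0 x) + n2 I1 (\<lambda>x. (-1) * c t x)" by (rule n2_add[OF s1 s2])
      finally have le: "n2 I1 (\<lambda>x. a x - w0 x) \<le> n2 I1 (\<lambda>x. f t x - w0 x) + n2 I1 (c t)" using n2_cmult[of I1 "-1" "c t"] by simp
      have "n2 I1 (\<lambda>x. f t x - w0 x) < r / 2" using elim(1) by (subst (asm) nL2_eq) auto
      moreover have "n2 I1 (c t) \<le> r / 2"
      proof (rule power2_le_imp_le)
        have "(n2 I1 (c t))\<^sup>2 \<le> t * C" unfolding n2_sq c_def C_def by (rule cum_L2_small(2)[OF T g]) (use elim in simp)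
        also have "\<dots> \<le> ((r / 2)\<^sup>2 / (C + 1)) * C" using elim C0 by (intro mult_right_mono) (auto simp: D_def)
        also have "\<dots> = (r / 2)\<^sup>2 * (C / (C + 1))" by simp
        also have "\<dots> \<le> (r / 2)\<^sup>2 * 1" using C0 by (intro mult_left_mono) auto
        finally show "(n2 I1 (c t))\<^sup>2 \<le> (r / 2)\<^sup>2" by simp
      qed (use r in simp)
      ultimately show ?case using le by linarith
    qed
    then have "n2 I1 (\<lambda>x. a x - w0 x) \<le> r"
    proof (rule contrapos_pp)
      assume n: "\<not> n2 I1 (\<lambda>x. a x - w0 x) \<le> r"
      show "\<not> (AE t in JT D. n2 I1 (\<lambda>x. a x - w0 x) \<le> r)" using n AE_JT_False[OF D] by (auto simp only: simp_thms)
    qed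
    then show ?thesis by simp
  qed
  then have "n2 I1 (\<lambda>x. a x - w0 x) \<le> 0" by (rule field_le_epsilon)
  then have "n2 I1 (\<lambda>x. a x - w0 x) = 0" using n2_nonneg[of I1 "\<lambda>x. a x - w0 x"] by linarith
  from n2_zero_AE[OF das this] have a0: "AE x in I1. a x - w0 x = 0" .
  from AC show ?thesis
  proof eventually_elim
    case (elim t)
    then show ?case using a0 by eventually_elim simp
  qed
qed

text \<open>On almost every slice \<open>v_x\<close> has mean zero, so its essential supremum is at
  most the \<open>L^2\<close> norm of \<open>v_xx\<close>. That norm is square integrable in time;
  it serves as \<open>k\<close> and later enters the length of a continuation step.\<close>

lemma nonlocal_sol_facts:
  assumes sol: "nonlocal_sol W \<phi> \<mu> \<epsilon> T u0 v0 ue ve" and T: "T > 0" and W: "potential_ok W" and \<phi>: "kernel_ok \<phi> \<gamma>"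
    and \<epsilon>: "0 < \<epsilon>" "\<epsilon> < 1/2" and u0: "L2S u0" and v0: "L2S v0"
  obtains ut vt k where "L2Q T ut" "L2Q T vt" "sqi (JT T) k"
    "AE t in JT T. AE x in I1. ue t x = u0 x + cum {0<..<T} (\<lambda>s. ut s x) t"
    "AE t in JT T. AE x in I1. ve t x = v0 x + cum {0<..<T} (\<lambda>s. vt s x) t"
    "AE t in JT T. L2S (ue t)"
    "AE t in JT T. is_wderiv (ve t) (ut t)"
    "AE t in JT T. is_wderiv (\<lambda>x. deriv W (ue t x) + \<mu> * ut t x - Leps \<phi> \<epsilon> (ue t) x) (vt t)"
    "AE t in JT T. AE x in I1. \<bar>ut t x\<bar> \<le> k t"
proof -
  interpret kernel \<phi> \<gamma> by standard (rule \<phi>)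
  obtain ut ux uxt vt vx vxx where
     L: "L2Q T ue" "L2Q T ut" "L2Q T ux" "L2Q T ve" "L2Q T vx" "L2Q T vxx" "L2Q T vt"
     and d: "dtw T ue ut" "dxw T ue ux" "dxw T ve vx" "dxw T vx vxx" "dtw T ve vt"
     and eq: "AE t in lborel. t \<in> {0<..<T} \<longrightarrow> (AE x in lborel.
           ut t x = vx t x \<and>
           vt t x = wd (\<lambda>y. deriv W (ue t y)) x + \<mu> * vxx t x - wd (Leps \<phi> \<epsilon> (ue t)) x)"
     and init: "\<And>r. r > 0 \<Longrightarrow> \<exists>\<delta>>0. AE t in lborel. t \<in> {0<..<\<delta>} \<longrightarrow>
           nL2 (\<lambda>x. ue t x - u0 x) < r \<and> nL2 (\<lambda>x. ve t x - v0 x) < r"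
    using sol unfolding nonlocal_sol_def by blast
  have init_u: "\<exists>\<delta>>0. AE t in lborel. t \<in> {0<..<\<delta>} \<longrightarrow> nL2 (\<lambda>x. ue t x - u0 x) < r"
    and init_v: "\<exists>\<delta>>0. AE t in lborel. t \<in> {0<..<\<delta>} \<longrightarrow> nL2 (\<lambda>x. ve t x - v0 x) < r" if r: "r > 0" for r
  proof -
    obtain \<delta> where \<delta>: "\<delta> > 0" "AE t in lborel. t \<in> {0<..<\<delta>} \<longrightarrow> nL2 (\<lambda>x. ue t x - u0 x) < r \<and> nL2 (\<lambda>x. ve t x - v0 x) < r"
      using init[OF r] by blast
    have "AE t in lborel. t \<in> {0<..<\<delta>} \<longrightarrow> nL2 (\<lambda>x. ue t x - u0 x) < r" "AE t in lborel. t \<in> {0<..<\<delta>} \<longrightarrow> nL2 (\<lambda>x. ve t x - v0 x) < r"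
      using \<delta>(2) by (rule eventually_mono, blast)+
    with \<delta>(1) show "\<exists>\<delta>>0. AE t in lborel. t \<in> {0<..<\<delta>} \<longrightarrow> nL2 (\<lambda>x. ue t x - u0 x) < r"
      "\<exists>\<delta>>0. AE t in lborel. t \<in> {0<..<\<delta>} \<longrightarrow> nL2 (\<lambda>x. ve t x - v0 x) < r" by blast+
  qed
  have eqJ: "AE t in JT T. (AE x in I1. vx t x = ut t x) \<and>
      (AE x in I1. vt t x = wd (\<lambda>y. deriv W (ue t y)) x + \<mu> * vxx t x - wd (Leps \<phi> \<epsilon> (ue t)) x)"
    unfolding AE_lbon[OF borel_open[OF open_greaterThanLessThan]]
    using eq
  proof eventually_elim
    case (elim t)
    show ?case
    proof
      assume "t \<in> {0<..<T}"
      with elim have e: "AE x in lborel. ut t x = vx t x \<and> vt t x = wd (\<lambda>y. deriv W (ue t y)) x + \<mu> * vxx t x - wd (Leps \<phi> \<epsilon> (ue t)) x" by blast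
      show "(AE x in I1. vx t x = ut t x) \<and> (AE x in I1. vt t x = wd (\<lambda>y. deriv W (ue t y)) x + \<mu> * vxx t x - wd (Leps \<phi> \<epsilon> (ue t)) x)"
        unfolding AE_lbon[OF borel_closed[OF closed_atLeastAtMost]]
        by (intro conjI; rule eventually_mono[OF e]) auto
    qed
  qed
  define k where "k t = n2 I1 (vxx t)" for t
  have ks: "sqi (JT T) k"
  proof -
    interpret P: pair_sigma_finite "JT T" I1 by (rule pair_JI)
    have [measurable]: "case_prod vxx \<in> borel_measurable (borel \<Otimes>\<^sub>M borel)" and s: "sqi (JT T \<Otimes>\<^sub>M I1) (case_prod vxx)"
      using L(6) by (auto simp: L2Q_iff)
    have "k \<in> borel_measurable borel" unfolding k_def[abs_def] n2_def by measurable
    moreover have "integrable (JT T) (\<lambda>t. (k t)\<^sup>2)" unfolding k_def n2_sq using P.integrable_fst'[OF sqi_square[OF s]] by simp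
    ultimately show ?thesis by (simp add: sqi_def)
  qed
  have wvx: "AE t in JT T. is_wderiv (ve t) (vx t)" by (rule dxw_slices_wderiv[OF T L(4,5) d(3)])
  have wvxx: "AE t in JT T. is_wderiv (vx t) (vxx t)" by (rule dxw_slices_wderiv[OF T L(5,6) d(4)])
  have wux: "AE t in JT T. is_wderiv (ue t) (ux t)" by (rule dxw_slices_wderiv[OF T L(1,3) d(2)])
  show ?thesis
  proof (rule that[OF L(2,7) ks])
    show "AE t in JT T. AE x in I1. ue t x = u0 x + cum {0<..<T} (\<lambda>s. ut s x) t"
      by (rule dtw_initial[OF T L(1,2) d(1) u0 init_u])
    show "AE t in JT T. AE x in I1. ve t x = v0 x + cum {0<..<T} (\<lambda>s. vt s x) t"
      by (rule dtw_initial[OF T L(4,7) d(5) v0 init_v])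
    show "AE t in JT T. L2S (ue t)" by (rule L2Q_slice[OF L(1)])
    show "AE t in JT T. is_wderiv (ve t) (ut t)"
      using wvx eqJ L2Q_slice[OF L(2)]
      by eventually_elim (rule is_wderiv_cong, auto intro: is_wderiv_L2S)
    show "AE t in JT T. is_wderiv (\<lambda>x. deriv W (ue t x) + \<mu> * ut t x - Leps \<phi> \<epsilon> (ue t) x) (vt t)"
      using wvxx wux eqJ L2Q_slice[OF L(2)] L2Q_slice[OF L(7)]
    proof eventually_elim
      case (elim t)
      have c: "is_wderiv (\<lambda>x. deriv W (ue t x)) (wd (\<lambda>x. deriv W (ue t x)))"
        by (rule wd_is_wderiv[OF is_wderiv_chain[OF elim(2) potential_derivs(1)[OF W] potential_derivs(2)[OF W]]])
      have l: "is_wderiv (Leps \<phi> \<epsilon> (ue t)) (wd (Leps \<phi> \<epsilon> (ue t)))"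
        by (rule wd_is_wderiv[OF is_wderiv_Leps[OF \<epsilon> elim(2)]])
      have u: "is_wderiv (ut t) (vxx t)"
        by (rule is_wderiv_cong[OF elim(1) elim(4) is_wderiv_L2S(2)[OF elim(1)]]) (use elim in auto)
      have "is_wderiv (\<lambda>x. 1 * (1 * deriv W (ue t x) + \<mu> * ut t x) + (-1) * Leps \<phi> \<epsilon> (ue t) x)
        (\<lambda>x. 1 * (1 * wd (\<lambda>x. deriv W (ue t x)) x + \<mu> * vxx t x) + (-1) * wd (Leps \<phi> \<epsilon> (ue t)) x)"
        by (rule is_wderiv_lin[OF is_wderiv_lin[OF c u] l])
      then have w: "is_wderiv (\<lambda>x. deriv W (ue t x) + \<mu> * ut t x - Leps \<phi> \<epsilon> (ue t) x)
        (\<lambda>x. wd (\<lambda>x. deriv W (ue t x)) x + \<mu> * vxx t x - wd (Leps \<phi> \<epsilon> (ue t)) x)" by simp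
      show ?case
      proof (rule is_wderiv_cong[OF w is_wderiv_L2S(1)[OF w] elim(5)])
        show "AE x in I1. wd (\<lambda>x. deriv W (ue t x)) x + \<mu> * vxx t x - wd (Leps \<phi> \<epsilon> (ue t)) x = vt t x"
          using conjunct2[OF elim(3)] by eventually_elim simp
      qed simp
    qed
    show "AE t in JT T. AE x in I1. \<bar>ut t x\<bar> \<le> k t"
      using wvx wvxx eqJ
    proof eventually_elim
      case (elim t)
      have "AE x in I1. \<bar>vx t x\<bar> \<le> k t"
        using is_wderiv_sup[OF elim(2)] is_wderiv_mean0[OF elim(1)] by (simp add: k_def)
      then show ?case using conjunct1[OF elim(3)] by eventually_elim simp
    qed
  qed
qed

section \<open>Convergence\<close>

context kernel begin

lemma AE_integrable_shift:
  assumes "L2S f" shows "AE x in I1. integrable K (\<lambda>z. f (x - \<epsilon> * z))"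
proof -
  interpret pair_sigma_finite I1 K by (rule pair_IK)
  have [measurable]: "f \<in> borel_measurable borel" using assms by (simp add: L2S_iff)
  from AE_integrable_fst'[OF sqi_square[OF sqi_shift2(1)[OF assms, of \<epsilon>]]]
  show ?thesis by eventually_elim (rule sqi_imp_integrable[OF finite_K], simp add: sqi_def)
qed

text \<open>The convolution is split where both shifted functions are integrable against the kernel,
  hence for almost every \<open>x\<close>.\<close>

lemma Leps_add:
  assumes \<epsilon>: "0 < \<epsilon>" "\<epsilon> < 1/2" and f: "L2S f" and d: "L2S d" and F: "L2S F" and e: "AE x in I1. F x = f x + d x"
  shows "AE x in I1. Leps \<phi> \<epsilon> F x = Leps \<phi> \<epsilon> f x + (cv \<epsilon> d x - d x) / \<epsilon>\<^sup>2"
proof -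
  have fd: "L2S (\<lambda>x. f x + d x)" using L2S_lin[OF f d, of 1 1] by simp
  have c: "conv_eps \<phi> \<epsilon> F x = cv \<epsilon> (\<lambda>x. f x + d x) x" for x
    unfolding conv_eps_L2S[OF \<epsilon> fd, symmetric]
    by (rule conv_eps_cong[OF _ _ _ e]) (use F fd in \<open>auto simp: L2S_iff\<close>)
  show ?thesis using e AE_integrable_shift[OF f, of \<epsilon>] AE_integrable_shift[OF d, of \<epsilon>]
  proof eventually_elim
    case (elim x)
    have "cv \<epsilon> (\<lambda>x. f x + d x) x = cv \<epsilon> f x + cv \<epsilon> d x"
      unfolding cv_def by (rule Bochner_Integration.integral_add[OF elim(2,3)])
    then have "conv_eps \<phi> \<epsilon> F x = conv_eps \<phi> \<epsilon> f x + cv \<epsilon> d x" by (simp add: c conv_eps_L2S[OF \<epsilon> f])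
    then show ?case unfolding Leps_def elim(1) by (simp add: add_divide_distrib diff_divide_distrib)
  qed
qed

text \<open>The window estimate applied to the third derivative; the factor \<open>2\<close> is the
  window length divided by \<epsilon>.\<close>

lemma consistency_error:
  assumes \<epsilon>: "0 < \<epsilon>" "\<epsilon> < 1/2" and H: "inHk 3 f"
    and M: "n2 I1 ((wd ^^ 3) f) \<le> M" "0 \<le> M"
  defines "R \<equiv> \<lambda>x. Leps \<phi> \<epsilon> f x - \<gamma> * (wd ^^ 2) f x"
  shows "R \<in> borel_measurable borel" "AE x in I1. \<bar>R x\<bar> \<le> M" "(\<integral>x. (R x)\<^sup>2 \<partial>I1) \<le> (2 * M * \<epsilon>)\<^sup>2"
proof -
  have w: "is_wderiv f (wd f)" "is_wderiv (wd f) ((wd ^^ 2) f)" "is_wderiv ((wd ^^ 2) f) ((wd ^^ 3) f)"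
    using inHk_wderiv[OF H, of 0] inHk_wderiv[OF H, of 1] inHk_wderiv[OF H, of 2] by (simp_all add: numeral_eq_Suc)
  have l: "L2S (Leps \<phi> \<epsilon> f)" by (rule is_wderiv_L2S(1)[OF is_wderiv_Leps[OF \<epsilon> w(1)]])
  have "L2S (\<lambda>x. 1 * Leps \<phi> \<epsilon> f x + (- \<gamma>) * (wd ^^ 2) f x)" by (rule L2S_lin[OF l is_wderiv_L2S(1)[OF w(3)]])
  then have RL: "L2S R" by (simp add: R_def)
  then show "R \<in> borel_measurable borel" by (simp add: L2S_iff)
  define A where "A x = (\<integral>y. indicator {1/2 - \<epsilon>..1/2 + \<epsilon>} y * \<bar>(wd ^^ 3) f (y + (x - 1/2))\<bar> \<partial>I1)" for x
  note A = sqi_window[OF is_wderiv_L2S(2)[OF w(3)] \<epsilon>, folded A_def]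
  have RA: "AE x in I1. \<bar>R x\<bar> \<le> A x" unfolding R_def A_def by (rule Leps_consistency[OF \<epsilon> w])
  then show "AE x in I1. \<bar>R x\<bar> \<le> M"
  proof eventually_elim
    case (elim x) then show ?case using A(3)[of x] M(1) by linarith
  qed
  have "sqi I1 A"
  proof (rule sqi_bounded[OF finite_I1, of _ M])
    show "AE x in I1. \<bar>A x\<bar> \<le> M"
    proof (rule AE_I2)
      fix x show "\<bar>A x\<bar> \<le> M" using A(2)[of x] A(3)[of x] M(1) by linarith
    qed
  qed (use A(1) in simp)
  then have "(\<integral>x. (R x)\<^sup>2 \<partial>I1) \<le> (\<integral>x. (A x)\<^sup>2 \<partial>I1)"
    using RL RA by (intro integral_mono_AE) (auto simp: L2S_iff sqi_def elim!: eventually_mono intro!: abs_le_square_iff[THEN iffD1])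
  also have "\<dots> \<le> (2 * \<epsilon> * n2 I1 ((wd ^^ 3) f))\<^sup>2" by (rule A(4))
  also have "\<dots> \<le> (2 * \<epsilon> * M)\<^sup>2" using M \<epsilon> by (intro power_mono mult_left_mono mult_nonneg_nonneg n2_nonneg) auto
  finally show "(\<integral>x. (R x)\<^sup>2 \<partial>I1) \<le> (2 * M * \<epsilon>)\<^sup>2" by (simp add: mult.commute mult.left_commute)
qed

end

text \<open>\<open>potential_ok\<close> bounds the second derivative of \<open>W\<close> only from
  below. Under the two restrictions both points lie in a fixed compact interval, where continuity
  bounds it on both sides.\<close>

lemma potential_Lipschitz:
  assumes "potential_ok W"
  obtains \<Lambda> where "\<Lambda> \<ge> 0" "\<And>a b. \<bar>a\<bar> \<le> M \<Longrightarrow> \<bar>b - a\<bar> \<le> 1 \<Longrightarrow> \<bar>deriv W b - deriv W a\<bar> \<le> \<Lambda> * \<bar>b - a\<bar>"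
proof -
  obtain B where B: "\<And>x. x \<in> {-(\<bar>M\<bar> + 1)..\<bar>M\<bar> + 1} \<Longrightarrow> \<bar>(deriv ^^ 2) W x\<bar> \<le> B"
    using continuous_bounded[OF potential_derivs(2)[OF assms], of "{-(\<bar>M\<bar> + 1)..\<bar>M\<bar> + 1}"] by auto
  show ?thesis
  proof (rule that)
    show "B \<ge> 0" using B[of 0] by force
    fix a b assume ab: "\<bar>a\<bar> \<le> M" "\<bar>b - a\<bar> \<le> 1"
    have "norm (deriv W b - deriv W a) \<le> B * norm (b - a)"
    proof (rule field_differentiable_bound)
      show "convex {-(\<bar>M\<bar> + 1)..\<bar>M\<bar> + 1}" by simp
      show "(deriv W has_field_derivative (deriv ^^ 2) W z) (at z within {-(\<bar>M\<bar> + 1)..\<bar>M\<bar> + 1})" for z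
        using potential_derivs(1)[OF assms] by (rule DERIV_subset) simp
      show "norm ((deriv ^^ 2) W z) \<le> B" if "z \<in> {-(\<bar>M\<bar> + 1)..\<bar>M\<bar> + 1}" for z using B[OF that] by simp
    qed (use ab in auto)
    then show "\<bar>deriv W b - deriv W a\<bar> \<le> B * \<bar>b - a\<bar>" by simp
  qed
qed

lemma esssupT_le:
  assumes "AE t in JT T. f t \<le> c" shows "esssupT T f \<le> ereal c"
  unfolding esssupT_def
  using assms unfolding AE_lbon[OF borel_open[OF open_greaterThanLessThan]]
  by (intro Inf_lower) (auto elim: eventually_mono)

lemma sqrt_dominates:
  fixes \<epsilon> c :: real
  assumes \<epsilon>: "0 < \<epsilon>" "\<epsilon> < 1" and c: "0 \<le> c" and small: "\<epsilon> < (1 / (2 * (c + 1)))\<^sup>2"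
  shows "\<epsilon> \<le> sqrt \<epsilon>" "\<epsilon>\<^sup>2 \<le> sqrt \<epsilon>" "c * sqrt \<epsilon> \<le> 1/2"
proof -
  have s: "0 < sqrt \<epsilon>" "sqrt \<epsilon> < 1" using \<epsilon> by auto
  have "sqrt \<epsilon> * sqrt \<epsilon> \<le> sqrt \<epsilon> * 1" using s by (intro mult_left_mono) auto
  then show 1: "\<epsilon> \<le> sqrt \<epsilon>" using \<epsilon> by simp
  have "\<epsilon> * \<epsilon> \<le> \<epsilon> * 1" using \<epsilon> by (intro mult_left_mono) auto
  then show "\<epsilon>\<^sup>2 \<le> sqrt \<epsilon>" using 1 by (simp add: power2_eq_square)
  have "sqrt \<epsilon> < sqrt ((1 / (2 * (c + 1)))\<^sup>2)" using small by (rule real_sqrt_less_mono)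
  then have "sqrt \<epsilon> < 1 / (2 * (c + 1))" using c by simp
  then have "(c + 1) * sqrt \<epsilon> \<le> (c + 1) * (1 / (2 * (c + 1)))" using c by (intro mult_left_mono) auto
  also have "\<dots> = 1/2" using c by simp
  finally show "c * sqrt \<epsilon> \<le> 1/2" using s unfolding distrib_right by linarith
qed

text \<open>Transfers the estimate of the locale \<open>difference\<close> to the two solutions.
  \<open>C\<close> is its constant \<open>C1\<close> written out with \<open>2 M\<close> in place of
  \<open>M\<close>, and \<open>small\<close> is its closing condition, both phrased without
  reference to the locale so that they can be met before a nonlocal solution is given.\<close>

lemma nonlocal_error:
  fixes T \<mu> \<gamma> \<epsilon> M \<Lambda> :: real and u v Ul Vl :: "real \<Rightarrow> real \<Rightarrow> real"
  assumes pos: "T > 0" "\<mu> > 0" "0 < \<epsilon>" "\<epsilon> < 1/2" "M > 0" "\<Lambda> \<ge> 0"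
    and W: "potential_ok W" and ok: "kernel_ok \<phi> \<gamma>" and u0: "L2S u0" and v0: "L2S v0"
    and Ul: "L2Q T Ul" and Vl: "L2Q T Vl"
    and u_eq: "\<And>t. t \<in> {0<..<T} \<Longrightarrow> AE x in I1. u t x = u0 x + cum {0<..<T} (\<lambda>s. Ul s x) t"
    and v_eq: "\<And>t. t \<in> {0<..<T} \<Longrightarrow> AE x in I1. v t x = v0 x + cum {0<..<T} (\<lambda>s. Vl s x) t"
    and H: "\<And>t. t \<in> {0<..<T} \<Longrightarrow> inHk 3 (u t)"
    and v_x: "\<And>t. t \<in> {0<..<T} \<Longrightarrow> is_wderiv (v t) (Ul t)"
    and v_t: "\<And>t. t \<in> {0<..<T} \<Longrightarrow> is_wderiv (\<lambda>x. deriv W (u t x) + \<mu> * Ul t x - \<gamma> * (wd ^^ 2) (u t) x) (Vl t)"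
    and u_bd: "\<And>t. t \<in> {0<..<T} \<Longrightarrow> AE x in I1. \<bar>u t x\<bar> \<le> M"
    and Ul_bd: "\<And>t. t \<in> {0<..<T} \<Longrightarrow> AE x in I1. \<bar>Ul t x\<bar> \<le> M"
    and uxxx: "\<And>t. t \<in> {0<..<T} \<Longrightarrow> n2 I1 ((wd ^^ 3) (u t)) \<le> M"
    and Lip: "\<And>a b. \<bar>a\<bar> \<le> M \<Longrightarrow> \<bar>b - a\<bar> \<le> 1 \<Longrightarrow> \<bar>deriv W b - deriv W a\<bar> \<le> \<Lambda> * \<bar>b - a\<bar>"
    and sol: "nonlocal_sol W \<phi> \<mu> \<epsilon> T u0 v0 ue ve"
  defines "C \<equiv> 2 * (3 / (2 * \<mu>) * (2 * M)\<^sup>2 * T) * exp (2 * (3 / (2 * \<mu>) * (1 + \<Lambda>\<^sup>2)) * T)"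
  defines "\<delta> \<equiv> sqrt C * \<epsilon>"
  assumes small: "2 * \<epsilon>\<^sup>2 * (\<Lambda> + 2 * M) + 2 * \<delta> + sqrt (kernel.Km \<phi> / \<epsilon>) * \<delta> + \<delta> / \<mu> + \<delta> / \<mu> \<le> 1/2"
  shows "AE t in JT T. (nL2 (\<lambda>x. ue t x - u t x))\<^sup>2 \<le> C * \<epsilon>\<^sup>2"
    and "AE t in JT T. (nL2 (\<lambda>x. ve t x - v t x))\<^sup>2 \<le> C * \<epsilon>\<^sup>2"
proof -
  interpret kernel \<phi> \<gamma> by standard (rule ok)
  obtain ut vt k where ut: "L2Q T ut" and vt: "L2Q T vt" and k: "sqi (JT T) k"
    and ue_eq: "AE t in JT T. AE x in I1. ue t x = u0 x + cum {0<..<T} (\<lambda>s. ut s x) t"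
    and ve_eq: "AE t in JT T. AE x in I1. ve t x = v0 x + cum {0<..<T} (\<lambda>s. vt s x) t"
    and ueL: "AE t in JT T. L2S (ue t)"
    and ve_x: "AE t in JT T. is_wderiv (ve t) (ut t)"
    and ve_t: "AE t in JT T. is_wderiv (\<lambda>x. deriv W (ue t x) + \<mu> * ut t x - Leps \<phi> \<epsilon> (ue t) x) (vt t)"
    and utk: "AE t in JT T. AE x in I1. \<bar>ut t x\<bar> \<le> k t"
    by (rule nonlocal_sol_facts[OF sol pos(1) W ok pos(3,4) u0 v0])
  have t_in: "AE t in JT T. t \<in> {0<..<T}" by (simp add: AE_lbon)
  define g h where "g t x = ut t x - Ul t x" and "h t x = vt t x - Vl t x" for t x
  have g: "L2Q T g" and h: "L2Q T h"
    unfolding g_def[abs_def] h_def[abs_def] using L2Q_diff[OF ut Ul] L2Q_diff[OF vt Vl] by auto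
  define p q where "p t x = cum {0<..<T} (\<lambda>s. g s x) t" and "q t x = cum {0<..<T} (\<lambda>s. h s x) t" for t x
  have pL: "L2S (p t)" and qL: "L2S (q t)" if t: "t \<in> {0<..<T}" for t
  proof -
    have "per1 (g s)" "per1 (h s)" for s using g h by (auto simp: L2Q_iff)
    then have "per1 (p t)" "per1 (q t)" by (simp_all add: p_def q_def per1_def)
    moreover have "sqi I1 (p t)" "sqi I1 (q t)"
      unfolding p_def[abs_def] q_def[abs_def] using cum_L2_small(1)[OF pos(1) g, of t] cum_L2_small(1)[OF pos(1) h, of t] t by auto
    ultimately show "L2S (p t)" "L2S (q t)" by (simp_all add: L2S_iff sqi_def)
  qed
  have p_eq: "AE t in JT T. AE x in I1. p t x = ue t x - u t x"
    using t_in ue_eq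
  proof eventually_elim
    case (elim t)
    show ?case using elim(2) u_eq[OF elim(1)] cum_L2Q_diff[OF ut Ul]
      by eventually_elim (simp add: p_def g_def)
  qed
  have q_eq: "AE t in JT T. AE x in I1. q t x = ve t x - v t x"
    using t_in ve_eq
  proof eventually_elim
    case (elim t)
    show ?case using elim(2) v_eq[OF elim(1)] cum_L2Q_diff[OF vt Vl]
      by eventually_elim (simp add: q_def h_def)
  qed
  define R where "R t x = Leps \<phi> \<epsilon> (u t) x - \<gamma> * (wd ^^ 2) (u t) x" for t x
  define Z where "Z t x = (deriv W (ue t x) + \<mu> * ut t x - Leps \<phi> \<epsilon> (ue t) x)
    - (deriv W (u t x) + \<mu> * Ul t x - \<gamma> * (wd ^^ 2) (u t) x)" for t x
  \<comment> \<open>Solving for \<open>N\<close> makes the flux \<open>F\<close> of the locale equal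
    to \<open>Z\<close> everywhere; that \<open>N\<close> is the difference of the nonlinear terms
    holds almost everywhere and is shown in \<open>N_eq\<close>.\<close>
  define N where "N t x = Z t x - \<mu> * g t x + (cv \<epsilon> (p t) x - p t x) / \<epsilon>\<^sup>2 + R t x" for t x
  have R: "R t \<in> borel_measurable borel" "AE x in I1. \<bar>R t x\<bar> \<le> M" "(\<integral>x. (R t x)\<^sup>2 \<partial>I1) \<le> (2 * M * \<epsilon>)\<^sup>2"
    if "t \<in> {0<..<T}" for t
    unfolding R_def[abs_def]
    using consistency_error[OF pos(3,4) H[OF that] uxxx[OF that] less_imp_le[OF pos(5)]] by auto
  have Zh: "AE t in JT T. is_wderiv (Z t) (h t)"
    using t_in ve_t
  proof eventually_elim
    case (elim t)
    have "1 * (deriv W (ue t x) + \<mu> * ut t x - Leps \<phi> \<epsilon> (ue t) x)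
        + (-1) * (deriv W (u t x) + \<mu> * Ul t x - \<gamma> * (wd ^^ 2) (u t) x) = Z t x"
      "1 * vt t x + (-1) * Vl t x = h t x" for x
      by (simp_all add: Z_def h_def)
    with is_wderiv_lin[OF elim(2) v_t[OF elim(1)], of 1 "-1"] show ?case by (simp only:)
  qed
  have qg: "AE t in JT T. is_wderiv (q t) (g t)"
    using t_in ve_x q_eq L2Q_slice[OF g]
  proof eventually_elim
    case (elim t)
    have w: "is_wderiv (\<lambda>x. ve t x - v t x) (\<lambda>x. ut t x - Ul t x)"
      using is_wderiv_lin[OF elim(2) v_x[OF elim(1)], of 1 "-1"] by simp
    show ?case
    proof (rule is_wderiv_cong[OF w qL[OF elim(1)] elim(4)])
      show "AE x in I1. ve t x - v t x = q t x" using elim(3) by eventually_elim simp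
    qed (simp add: g_def)
  qed
  have N_eq: "AE t in JT T. AE x in I1. N t x = deriv W (ue t x) - deriv W (u t x)"
    using t_in ueL p_eq
  proof eventually_elim
    case (elim t)
    have e: "AE x in I1. ue t x = u t x + p t x" using elim(3) by eventually_elim simp
    have "L2S (u t)" using H[OF elim(1)] by (simp add: inHk_def)
    from Leps_add[OF pos(3,4) this pL[OF elim(1)] elim(2) e]
    show ?case
    proof eventually_elim
      case (elim x)
      show ?case unfolding N_def Z_def R_def g_def elim by (simp add: algebra_simps)
    qed
  qed
  have Z_eq: "N t x + \<mu> * g t x - (cv \<epsilon> (p t) x - p t x) / \<epsilon>\<^sup>2 - R t x = Z t x" for t x
    by (simp add: N_def)
  \<comment> \<open>\<open>2 M\<close> is the constant of \<open>consistency_error\<close>, and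
    \<open>k + M\<close> dominates \<open>\<bar>g\<bar>\<close> because \<open>g\<close> is the
    difference of the two time derivatives.\<close>
  interpret D: difference \<phi> \<gamma> T \<mu> \<epsilon> \<Lambda> "2 * M" g h N R "\<lambda>t. k t + M" p q Z
  proof (unfold_locales, unfold p_def[symmetric] q_def[symmetric] Z_eq)
    show "AE t in JT T. R t \<in> borel_measurable borel \<and> (AE x in I1. \<bar>R t x\<bar> \<le> 2 * M) \<and> (\<integral>x. (R t x)\<^sup>2 \<partial>I1) \<le> (2 * M * \<epsilon>)\<^sup>2"
      using t_in
    proof eventually_elim
      case (elim t)
      have "AE x in I1. \<bar>R t x\<bar> \<le> 2 * M" using R(2)[OF elim] by eventually_elim (use pos(5) in simp)
      then show ?case using R[OF elim] by blast
    qed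
    show "AE t in JT T. N t \<in> borel_measurable borel \<and> (AE x in I1. \<bar>p t x\<bar> \<le> 1 \<longrightarrow> \<bar>N t x\<bar> \<le> \<Lambda> * \<bar>p t x\<bar>)"
      using t_in Zh N_eq p_eq L2Q_slice[OF g]
    proof eventually_elim
      case (elim t)
      have [measurable]: "Z t \<in> borel_measurable borel" "g t \<in> borel_measurable borel" "p t \<in> borel_measurable borel" "R t \<in> borel_measurable borel"
        using is_wderiv_L2S(1)[OF elim(2)] elim(5) pL[OF elim(1)] R(1)[OF elim(1)] by (auto simp: L2S_iff)
      have "N t \<in> borel_measurable borel" unfolding N_def[abs_def] by measurable
      moreover have "AE x in I1. \<bar>p t x\<bar> \<le> 1 \<longrightarrow> \<bar>N t x\<bar> \<le> \<Lambda> * \<bar>p t x\<bar>"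
        using elim(3,4) u_bd[OF elim(1)]
      proof eventually_elim
        case (elim x)
        show ?case unfolding elim(1,2) using Lip[OF elim(3)] by blast
      qed
      ultimately show ?case by blast
    qed
    show "AE t in JT T. AE x in I1. \<bar>g t x\<bar> \<le> k t + M"
      using t_in utk
    proof eventually_elim
      case (elim t)
      show ?case using elim(2) Ul_bd[OF elim(1)] by eventually_elim (simp add: g_def)
    qed
    show "sqi (JT T) (\<lambda>t. k t + M)" by (rule sqi_add[OF k sqi_const[OF finite_JT]])
    show "AE t in JT T. is_wderiv (Z t) (h t)" by (rule Zh)
  qed (rule reflexive | use pos g h qg in auto)+
  have C: "D.C1 = C" by (simp add: D.C1_def D.K0_def C_def)
  have est: "(\<integral>x. (p t x)\<^sup>2 \<partial>I1) + (\<integral>x. (q t x)\<^sup>2 \<partial>I1) \<le> C * \<epsilon>\<^sup>2" if "t \<in> {0<..<T}" for t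
    using D.difference_estimate[of t, folded p_def q_def] small that unfolding C D.Bd_def \<delta>_def by simp
  have norm: "(nL2 (\<lambda>x. a x - b x))\<^sup>2 = (\<integral>x. (d x)\<^sup>2 \<partial>I1)"
    if "L2S a" "L2S b" "L2S d" "AE x in I1. d x = a x - b x" for a b d
  proof -
    have [measurable]: "a \<in> borel_measurable borel" "b \<in> borel_measurable borel" "d \<in> borel_measurable borel"
      using that by (auto simp: L2S_iff)
    have "nL2 (\<lambda>x. a x - b x) = n2 I1 (\<lambda>x. a x - b x)" by (rule nL2_eq) measurable
    also have "\<dots> = n2 I1 d" by (rule n2_cong_AE) (use that(4) in \<open>auto elim: eventually_mono\<close>)
    finally show ?thesis by (simp add: n2_sq)
  qed
  have nn: "0 \<le> (\<integral>x. (d x)\<^sup>2 \<partial>I1)" for d :: "real \<Rightarrow> real" by (rule integral_nonneg_AE) auto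
  show "AE t in JT T. (nL2 (\<lambda>x. ue t x - u t x))\<^sup>2 \<le> C * \<epsilon>\<^sup>2"
    using t_in ueL p_eq
  proof eventually_elim
    case (elim t)
    have "L2S (u t)" using H[OF elim(1)] by (simp add: inHk_def)
    then show ?case using norm[OF elim(2) _ pL[OF elim(1)] elim(3)] est[OF elim(1)] nn[of "q t"] by linarith
  qed
  show "AE t in JT T. (nL2 (\<lambda>x. ve t x - v t x))\<^sup>2 \<le> C * \<epsilon>\<^sup>2"
    using t_in ve_x q_eq
  proof eventually_elim
    case (elim t)
    show ?case using norm[OF is_wderiv_L2S(1)[OF elim(2)] is_wderiv_L2S(1)[OF v_x[OF elim(1)]] qL[OF elim(1)] elim(3)] est[OF elim(1)] nn[of "p t"] by linarith
  qed
qed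

theorem theorem3p5:
  fixes u0 v0 :: "real \<Rightarrow> real" and T \<mu> \<gamma> :: real
    and \<phi> W :: "real \<Rightarrow> real" and u v :: "real \<Rightarrow> real \<Rightarrow> real"
  assumes "Hkm 3 u0" and "Hkm 2 v0"
    and "T > 0" and "\<mu> > 0" and "\<gamma> > 0"
    and "kernel_ok \<phi> \<gamma>" and "potential_ok W"
    and "local_sol W \<mu> \<gamma> T u0 v0 u v"
  shows "\<exists>C>0. \<exists>\<epsilon>0>0. \<forall>\<epsilon>. 0 < \<epsilon> \<and> \<epsilon> < \<epsilon>0 \<longrightarrow>
           (\<forall>ue ve. nonlocal_sol W \<phi> \<mu> \<epsilon> T u0 v0 ue ve \<longrightarrow>
              esssupT T (\<lambda>t. (nL2 (\<lambda>x. ue t x - u t x))\<^sup>2)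
              + esssupT T (\<lambda>t. (nL2 (\<lambda>x. ve t x - v t x))\<^sup>2)
              \<le> ereal (C * sqrt \<epsilon>))"
proof -
  have u0: "L2S u0" and v0: "L2S v0" using assms(1,2) by (auto simp: Hkm_def inHk_def)
  interpret kernel \<phi> \<gamma> by standard (rule assms(6))
  obtain M Ul Vl where M: "M > 0" and loc: "L2Q T Ul" "L2Q T Vl"
    "\<And>t. t \<in> {0<..<T} \<Longrightarrow> AE x in I1. u t x = u0 x + cum {0<..<T} (\<lambda>s. Ul s x) t"
    "\<And>t. t \<in> {0<..<T} \<Longrightarrow> AE x in I1. v t x = v0 x + cum {0<..<T} (\<lambda>s. Vl s x) t"
    "\<And>t. t \<in> {0<..<T} \<Longrightarrow> inHk 3 (u t)"
    "\<And>t. t \<in> {0<..<T} \<Longrightarrow> is_wderiv (v t) (Ul t)"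
    "\<And>t. t \<in> {0<..<T} \<Longrightarrow> is_wderiv (\<lambda>x. deriv W (u t x) + \<mu> * Ul t x - \<gamma> * (wd ^^ 2) (u t) x) (Vl t)"
    "\<And>t. t \<in> {0<..<T} \<Longrightarrow> AE x in I1. \<bar>u t x\<bar> \<le> M"
    "\<And>t. t \<in> {0<..<T} \<Longrightarrow> AE x in I1. \<bar>Ul t x\<bar> \<le> M"
    "\<And>t. t \<in> {0<..<T} \<Longrightarrow> n2 I1 ((wd ^^ 3) (u t)) \<le> M"
  proof (rule local_sol_facts[OF assms(8,3,7)], goal_cases)
    case (1 M Ul Vl)
    show ?case by (rule that) (fact 1)+
  qed
  obtain \<Lambda> where \<Lambda>: "\<Lambda> \<ge> 0" and Lip: "\<And>a b. \<bar>a\<bar> \<le> M \<Longrightarrow> \<bar>b - a\<bar> \<le> 1 \<Longrightarrow> \<bar>deriv W b - deriv W a\<bar> \<le> \<Lambda> * \<bar>b - a\<bar>"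
    using potential_Lipschitz[OF assms(7), where M = M] by blast
  define C where "C = 2 * (3 / (2 * \<mu>) * (2 * M)\<^sup>2 * T) * exp (2 * (3 / (2 * \<mu>) * (1 + \<Lambda>\<^sup>2)) * T)"
  have C: "C \<ge> 0" unfolding C_def using assms(3,4) by (intro mult_nonneg_nonneg) auto
  \<comment> \<open>\<open>c\<close> collects the coefficients of the closing condition after
    \<open>\<epsilon>\<close> and \<open>\<epsilon>^2\<close> have been replaced by the larger
    \<open>sqrt \<epsilon>\<close>.\<close>
  define c where "c = 2 * (\<Lambda> + 2 * M) + 2 * sqrt C + sqrt Km * sqrt C + sqrt C / \<mu> + sqrt C / \<mu>"
  have c: "c \<ge> 0" unfolding c_def using \<Lambda> M C Km(1) assms(4) by (intro add_nonneg_nonneg) auto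
  have "esssupT T (\<lambda>t. (nL2 (\<lambda>x. ue t x - u t x))\<^sup>2) + esssupT T (\<lambda>t. (nL2 (\<lambda>x. ve t x - v t x))\<^sup>2)
      \<le> ereal (2 * (C + 1) * sqrt \<epsilon>)"
    if \<epsilon>: "0 < \<epsilon>" "\<epsilon> < min (1/2) ((1 / (2 * (c + 1)))\<^sup>2)" and sol: "nonlocal_sol W \<phi> \<mu> \<epsilon> T u0 v0 ue ve" for \<epsilon> ue ve
  proof -
    \<comment> \<open>\<open>1/2\<close> is the range in which \<open>conv_eps_eq_cv\<close> holds;
      the other bound gives \<open>c sqrt \<epsilon> \<le> 1/2\<close>.\<close>
    have \<epsilon>': "\<epsilon> < 1/2" "\<epsilon> < 1" "\<epsilon> < (1 / (2 * (c + 1)))\<^sup>2" using \<epsilon> by auto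
    note s = sqrt_dominates[OF \<epsilon>(1) \<epsilon>'(2) c \<epsilon>'(3)]
    \<comment> \<open>The convolution term is the one that is genuinely of order
      \<open>sqrt \<epsilon>\<close>.\<close>
    have "sqrt (Km / \<epsilon>) * (sqrt C * \<epsilon>) = sqrt Km * sqrt C * (\<epsilon> / sqrt \<epsilon>)" by (simp add: real_sqrt_divide)
    also have "\<epsilon> / sqrt \<epsilon> = sqrt \<epsilon>" using \<epsilon>(1) by (simp add: real_div_sqrt)
    finally have se: "sqrt (Km / \<epsilon>) * (sqrt C * \<epsilon>) = sqrt Km * sqrt C * sqrt \<epsilon>" .
    have "2 * \<epsilon>\<^sup>2 * (\<Lambda> + 2 * M) = 2 * (\<Lambda> + 2 * M) * \<epsilon>\<^sup>2" by (simp only: mult.commute mult.left_commute)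
    also have "\<dots> \<le> 2 * (\<Lambda> + 2 * M) * sqrt \<epsilon>" using s(2) \<Lambda> M by (intro mult_left_mono) auto
    finally have 1: "2 * \<epsilon>\<^sup>2 * (\<Lambda> + 2 * M) \<le> 2 * (\<Lambda> + 2 * M) * sqrt \<epsilon>" .
    have 2: "sqrt C * \<epsilon> \<le> sqrt C * sqrt \<epsilon>" using s(1) C by (intro mult_left_mono) auto
    have 3: "sqrt C * \<epsilon> / \<mu> \<le> sqrt C / \<mu> * sqrt \<epsilon>" using 2 assms(4) by (simp add: divide_right_mono)
    have "2 * \<epsilon>\<^sup>2 * (\<Lambda> + 2 * M) + 2 * (sqrt C * \<epsilon>) + sqrt (Km / \<epsilon>) * (sqrt C * \<epsilon>) + sqrt C * \<epsilon> / \<mu> + sqrt C * \<epsilon> / \<mu>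
      \<le> 2 * (\<Lambda> + 2 * M) * sqrt \<epsilon> + 2 * (sqrt C * sqrt \<epsilon>) + sqrt Km * sqrt C * sqrt \<epsilon> + sqrt C / \<mu> * sqrt \<epsilon> + sqrt C / \<mu> * sqrt \<epsilon>"
      unfolding se by (rule add_mono[OF add_mono[OF add_mono[OF add_mono[OF 1 mult_left_mono[OF 2]] order_refl] 3] 3]) simp
    also have "\<dots> = c * sqrt \<epsilon>" unfolding c_def by (simp add: distrib_right)
    also note s(3)
    finally have small: "2 * \<epsilon>\<^sup>2 * (\<Lambda> + 2 * M) + 2 * (sqrt C * \<epsilon>) + sqrt (Km / \<epsilon>) * (sqrt C * \<epsilon>) + sqrt C * \<epsilon> / \<mu> + sqrt C * \<epsilon> / \<mu> \<le> 1/2" .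
    have err: "AE t in JT T. (nL2 (\<lambda>x. ue t x - u t x))\<^sup>2 \<le> C * \<epsilon>\<^sup>2" "AE t in JT T. (nL2 (\<lambda>x. ve t x - v t x))\<^sup>2 \<le> C * \<epsilon>\<^sup>2"
      by (rule nonlocal_error[OF assms(3,4) \<epsilon>(1) \<epsilon>'(1) M \<Lambda> assms(7,6) u0 v0 loc Lip sol, folded C_def]; (fact small | assumption))+
    have "esssupT T (\<lambda>t. (nL2 (\<lambda>x. ue t x - u t x))\<^sup>2) + esssupT T (\<lambda>t. (nL2 (\<lambda>x. ve t x - v t x))\<^sup>2) \<le> ereal (C * \<epsilon>\<^sup>2) + ereal (C * \<epsilon>\<^sup>2)"
      by (intro add_mono esssupT_le err)
    also have "\<dots> = ereal (2 * C * \<epsilon>\<^sup>2)" by simp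
    \<comment> \<open>Here \<open>\<epsilon>^2 \<le> sqrt \<epsilon>\<close> enters;
      \<open>C + 1\<close> makes the final constant positive, as only \<open>C \<ge> 0\<close> has
      been recorded.\<close>
    also have "\<dots> \<le> ereal (2 * (C + 1) * sqrt \<epsilon>)"
      unfolding ereal_less_eq using s(2) C by (intro mult_mono) auto
    finally show ?thesis .
  qed
  moreover have "min (1/2) ((1 / (2 * (c + 1)))\<^sup>2) > 0" using c by simp
  moreover have "2 * (C + 1) > 0" using C by simp
  ultimately show ?thesis by blast
qed

end
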